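(* Let $G$ be a finite group, let $\mathbb{C}[G]$ be its complex group algebra, let $\mathcal{H}_{\mathbb{C}[G]}$ be the real vector space of self-adjoint elements of $\mathbb{C}[G]$, and let $\chi_{\mathrm{reg}}$ be the character of the regular representation of $G$, extended linearly to $\mathbb{C}[G]$. Let $d\mu(x)$ be the normalized Lebesgue measure on $\mathcal{H}_{\mathbb{C}[G]}$. Then, as formal power series in the infinitely many variables $t_3,t_4,t_5,\dots$, $$ \log \int_{\mathcal{H}_{\mathbb{C}[G]}} \exp\left(-\frac{1}{2}\chi_{\mathrm{reg}}(x^2)\right) \exp\left(\sum_{j\ge 3} \frac{t_j}{j}\chi_{\mathrm{reg}}(x^j)\right) d\mu(x) = \sum_{\Gamma} \frac{1}{|\mathrm{Aut}_R\, \Gamma|}\,|G|^{\chi(S_\Gamma)-1}\, |\mathrm{Hom}(\pi_1(S_\Gamma),G)| \prod_{j\ge 3} t_j^{v_j(\Gamma)}, $$ where $\Gamma$ runs over all isomorphism classes of (finite, nonempty) connected ribbon graphs all of whose vertices have valence at least $3$, $S_\Gamma$ is the closed oriented surface determined by $\Gamma$, $\chi(S_\Gamma)$ is its Euler characteristic, and $v_j(\Gamma)$ is the number of $j$-valent vertices of $\Gamma$.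
   Context: Self-adjoint elements: the $*$-operation on $\mathbb{C}[G]$ is $x=\sum_{\gamma\in G}x^\gamma\cdot\gamma\mapsto x^*=\sum_{\gamma\in G}\overline{x^\gamma}\cdot\gamma^{-1}$, and $\mathcal{H}_{\mathbb{C}[G]}=\{x\in\mathbb{C}[G] : x^*=x\}$, a real vector space of dimension $|G|$. The map $x\mapsto \frac{1}{|G|}\chi_{\mathrm{reg}}(x^2)$ is a positive definite quadratic form on it (note $\chi_{\mathrm{reg}}(1)=|G|$ and $\chi_{\mathrm{reg}}(\gamma)=0$ for $\gamma\neq 1$). Measure: $dx$ is the Lebesgue measure on $\mathcal{H}_{\mathbb{C}[G]}$ invariant under the Euclidean transformations for this quadratic form, and $$d\mu(x)=\frac{dx}{\int_{\mathcal{H}_{\mathbb{C}[G]}}\exp\left(-\frac12\chi_{\mathrm{reg}}(x^2)\right)dx}.$$ Meaning of the integral: the integral with infinitely many variables $t_j$ is understood as its asymptotic series, a formal power series in $t_3,t_4,\dots$ (with $\deg t_j=j$) in which the coefficient of a monomial $\prod_{j\ge3}t_j^{v_j}$ (finitely many $v_j$ nonzero) is the convergent integral $$\prod_{j\ge 3}\frac{1}{v_j!\,j^{v_j}}\int_{\mathcal{H}_{\mathbb{C}[G]}}\exp\left(-\tfrac12\chi_{\mathrm{reg}}(x^2)\right)\prod_{j\ge3}\chi_{\mathrm{reg}}(x^j)^{v_j}\,d\mu(x).$$ Its constant term is $1$, and $\log$ is the formal logarithm. Ribbon graphs: a ribbon graph is a finite graph (loops and multiple edges allowed) together with a cyclic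 order on the set of half-edges incident to each vertex. Equivalently, it is a graph drawn on a closed oriented surface such that the complement is a disjoint union of open disks (the faces). $S_\Gamma$ denotes this closed oriented surface, so that $\chi(S_\Gamma)=v(\Gamma)-e(\Gamma)+f(\Gamma)$, where $v(\Gamma),e(\Gamma),f(\Gamma)$ are the numbers of vertices, edges and faces. $\mathrm{Aut}_R\,\Gamma$ is the group of automorphisms of the ribbon graph, i.e. permutations of the half-edges compatible with incidence to vertices, with the pairing of half-edges into edges, and with the cyclic orders at the vertices (equivalently, the orientation-preserving automorphisms of the cell decomposition of $S_\Gamma$ determined by $\Gamma$). For each monomial in the $t_j$ only finitely many $\Gamma$ contribute. *)

theory Defs
  imports
    "HOL-Analysis.Analysis"
    "HOL-Algebra.Ring"
    "HOL-Combinatorics.Orbits"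
    "HOL-Library.Poly_Mapping"
begin

section \<open>The complex group algebra\<close>

text \<open>An element \<open>\<Sum>\<gamma>. x \<gamma> \<cdot> \<gamma>\<close> of the group algebra is its coefficient function, which is
  extensional (\<open>undefined\<close> outside the carrier of the group), as the points of a product
  measure \<open>PiM (carrier G) M\<close> are.\<close>

definition group_algebra :: "('g, 'b) monoid_scheme \<Rightarrow> ('g \<Rightarrow> complex) ring" where
  "group_algebra G = \<lparr>carrier = carrier G \<rightarrow>\<^sub>E UNIV,
     mult = (\<lambda>x y. \<lambda>\<gamma>\<in>carrier G. \<Sum>\<delta>\<in>carrier G. x \<delta> * y (inv\<^bsub>G\<^esub> \<delta> \<otimes>\<^bsub>G\<^esub> \<gamma>)),
     one = (\<lambda>\<gamma>\<in>carrier G. if \<gamma> = \<one>\<^bsub>G\<^esub> then 1 else 0),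
     zero = (\<lambda>\<gamma>\<in>carrier G. 0),
     add = (\<lambda>x y. \<lambda>\<gamma>\<in>carrier G. x \<gamma> + y \<gamma>)\<rparr>"

definition group_elt :: "('g, 'b) monoid_scheme \<Rightarrow> 'g \<Rightarrow> 'g \<Rightarrow> complex" where
  "group_elt G \<delta> = (\<lambda>\<gamma>\<in>carrier G. if \<gamma> = \<delta> then 1 else 0)"

text \<open>The trace of left multiplication by \<open>x\<close> on the group algebra, in the basis \<open>G\<close>.\<close>

definition chi_reg :: "('g, 'b) monoid_scheme \<Rightarrow> ('g \<Rightarrow> complex) \<Rightarrow> complex" where
  "chi_reg G x = (\<Sum>\<delta>\<in>carrier G. (x \<otimes>\<^bsub>group_algebra G\<^esub> group_elt G \<delta>) \<delta>)"

lemma chi_reg_eq: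
  assumes "group G" "finite (carrier G)"
  shows "chi_reg G x = of_nat (card (carrier G)) * x \<one>\<^bsub>G\<^esub>"
proof -
  interpret group G by fact
  have "(x \<otimes>\<^bsub>group_algebra G\<^esub> group_elt G \<delta>) \<delta> = x \<one>\<^bsub>G\<^esub>" if d: "\<delta> \<in> carrier G" for \<delta>
  proof -
    have "inv\<^bsub>G\<^esub> \<alpha> \<otimes>\<^bsub>G\<^esub> \<delta> = \<delta> \<longleftrightarrow> \<alpha> = \<one>\<^bsub>G\<^esub>" if "\<alpha> \<in> carrier G" for \<alpha>
      using that d by simp
    then have "(x \<otimes>\<^bsub>group_algebra G\<^esub> group_elt G \<delta>) \<delta> =
        (\<Sum>\<alpha>\<in>carrier G. if \<alpha> = \<one>\<^bsub>G\<^esub> then x \<alpha> else 0)"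
      using d by (auto simp: group_algebra_def group_elt_def intro!: sum.cong)
    then show ?thesis using assms(2) by simp
  qed
  then show ?thesis by (simp add: chi_reg_def)
qed

definition star :: "('g, 'b) monoid_scheme \<Rightarrow> ('g \<Rightarrow> complex) \<Rightarrow> 'g \<Rightarrow> complex" where
  "star G x = (\<lambda>\<gamma>\<in>carrier G. cnj (x (inv\<^bsub>G\<^esub> \<gamma>)))"

definition selfadjoint :: "('g, 'b) monoid_scheme \<Rightarrow> ('g \<Rightarrow> complex) set" where
  "selfadjoint G = {x \<in> carrier (group_algebra G). star G x = x}"


section \<open>The measure on the self-adjoint elements\<close>

text \<open>The map \<open>selfadjoint_of_real\<close> is a linear isometry from the Euclidean space of real-valued
  functions on \<open>G\<close> onto the self-adjoint elements with the quadratic form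
  \<open>x \<mapsto> \<chi>\<^sub>r\<^sub>e\<^sub>g (x\<^sup>2) / |G|\<close>: see \<open>bij_betw_selfadjoint_of_real\<close> and
  \<open>chi_reg_selfadjoint_of_real\<close> below. The Lebesgue measure of the latter Euclidean space is
  therefore the image of the standard one.\<close>

definition selfadjoint_of_real ::
    "('g, 'b) monoid_scheme \<Rightarrow> ('g \<Rightarrow> real) \<Rightarrow> 'g \<Rightarrow> complex" where
  "selfadjoint_of_real G c = (\<lambda>\<gamma>\<in>carrier G.
     Complex ((c \<gamma> + c (inv\<^bsub>G\<^esub> \<gamma>)) / 2) ((c \<gamma> - c (inv\<^bsub>G\<^esub> \<gamma>)) / 2))"

lemma bij_betw_selfadjoint_of_real:
  assumes "group G"
  shows "bij_betw (selfadjoint_of_real G) (carrier G \<rightarrow>\<^sub>E UNIV) (selfadjoint G)"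
proof -
  interpret group G by fact
  show ?thesis
  proof (rule bij_betw_byWitness[where f' = "\<lambda>x. \<lambda>\<gamma>\<in>carrier G. Re (x \<gamma>) + Im (x \<gamma>)"])
    show "\<forall>c\<in>carrier G \<rightarrow>\<^sub>E UNIV. (\<lambda>\<gamma>\<in>carrier G. Re (selfadjoint_of_real G c \<gamma>) + Im (selfadjoint_of_real G c \<gamma>)) = c"
      by (auto simp: selfadjoint_of_real_def fun_eq_iff PiE_def extensional_def field_simps)
    show "selfadjoint_of_real G ` (carrier G \<rightarrow>\<^sub>E UNIV) \<subseteq> selfadjoint G"
      by (auto simp: selfadjoint_def selfadjoint_of_real_def star_def group_algebra_def fun_eq_iff complex_eq_iff field_simps)
    show "(\<lambda>x. \<lambda>\<gamma>\<in>carrier G. Re (x \<gamma>) + Im (x \<gamma>)) ` selfadjoint G \<subseteq> carrier G \<rightarrow>\<^sub>E UNIV"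
      by auto
    show "\<forall>x\<in>selfadjoint G. selfadjoint_of_real G (\<lambda>\<gamma>\<in>carrier G. Re (x \<gamma>) + Im (x \<gamma>)) = x"
    proof
      fix x assume x: "x \<in> selfadjoint G"
      then have *: "x \<in> extensional (carrier G)" and s: "star G x = x"
        by (auto simp: selfadjoint_def group_algebra_def PiE_def)
      have "x (inv\<^bsub>G\<^esub> \<gamma>) = cnj (x \<gamma>)" if "\<gamma> \<in> carrier G" for \<gamma>
        using fun_cong[OF s, of "inv\<^bsub>G\<^esub> \<gamma>"] that by (simp add: star_def)
      then show "selfadjoint_of_real G (\<lambda>\<gamma>\<in>carrier G. Re (x \<gamma>) + Im (x \<gamma>)) = x"
        using * by (auto simp: selfadjoint_of_real_def fun_eq_iff complex_eq_iff extensional_def)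
    qed
  qed
qed

lemma chi_reg_selfadjoint_of_real:
  assumes "group G" "finite (carrier G)" 
  shows "chi_reg G (selfadjoint_of_real G c [^]\<^bsub>group_algebra G\<^esub> (2::nat)) / of_nat (card (carrier G)) =
    of_real (\<Sum>\<gamma>\<in>carrier G. (c \<gamma>)\<^sup>2)"
proof -
  interpret group G by fact
  define x where "x = selfadjoint_of_real G c"
  let ?A = "group_algebra G"
  have x: "x \<in> carrier ?A" by (simp add: x_def selfadjoint_of_real_def group_algebra_def)
  have "\<one>\<^bsub>?A\<^esub> \<otimes>\<^bsub>?A\<^esub> x = x"
  proof
    fix \<gamma>
    show "(\<one>\<^bsub>?A\<^esub> \<otimes>\<^bsub>?A\<^esub> x) \<gamma> = x \<gamma>"
    proof (cases "\<gamma> \<in> carrier G")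
      case True
      then have "(\<one>\<^bsub>?A\<^esub> \<otimes>\<^bsub>?A\<^esub> x) \<gamma> = (\<Sum>\<delta>\<in>carrier G. if \<delta> = \<one>\<^bsub>G\<^esub> then x \<gamma> else 0)"
        by (auto simp: group_algebra_def intro!: sum.cong)
      then show ?thesis using assms(2) by simp
    qed (use x in \<open>auto simp: group_algebra_def PiE_def extensional_def\<close>)
  qed
  then have sq: "x [^]\<^bsub>?A\<^esub> (2::nat) = x \<otimes>\<^bsub>?A\<^esub> x"
    by (simp add: numeral_2_eq_2 nat_pow_def)
  have inv: "bij_betw (\<lambda>\<gamma>. inv\<^bsub>G\<^esub> \<gamma>) (carrier G) (carrier G)"
    by (rule bij_betw_byWitness[where f' = "\<lambda>\<gamma>. inv\<^bsub>G\<^esub> \<gamma>"]) auto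
  have "(x \<otimes>\<^bsub>?A\<^esub> x) \<one>\<^bsub>G\<^esub> = (\<Sum>\<delta>\<in>carrier G. x \<delta> * x (inv\<^bsub>G\<^esub> \<delta>))"
    by (auto simp: group_algebra_def intro!: sum.cong)
  also have "\<dots> = (\<Sum>\<delta>\<in>carrier G. of_real (((c \<delta>)\<^sup>2 + (c (inv\<^bsub>G\<^esub> \<delta>))\<^sup>2) / 2))"
    by (rule sum.cong) (auto simp: x_def selfadjoint_of_real_def complex_eq_iff power2_eq_square field_simps)
  also have "\<dots> = of_real (((\<Sum>\<delta>\<in>carrier G. (c \<delta>)\<^sup>2) + (\<Sum>\<delta>\<in>carrier G. (c (inv\<^bsub>G\<^esub> \<delta>))\<^sup>2)) / 2)"
    by (simp add: sum.distrib flip: sum_divide_distrib)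
  also have "(\<Sum>\<delta>\<in>carrier G. (c (inv\<^bsub>G\<^esub> \<delta>))\<^sup>2) = (\<Sum>\<delta>\<in>carrier G. (c \<delta>)\<^sup>2)"
    by (rule sum.reindex_bij_betw[OF inv])
  finally have "(x \<otimes>\<^bsub>?A\<^esub> x) \<one>\<^bsub>G\<^esub> = of_real (\<Sum>\<delta>\<in>carrier G. (c \<delta>)\<^sup>2)" by simp
  moreover have "card (carrier G) > 0" using assms(2) by (auto simp: card_gt_0_iff)
  ultimately show ?thesis
    unfolding chi_reg_eq[OF assms] sq x_def[symmetric] by simp
qed

lemma measurable_selfadjoint_of_real:
  assumes "group G"
  shows "selfadjoint_of_real G \<in> PiM (carrier G) (\<lambda>_. lborel) \<rightarrow>\<^sub>M
    restrict_space (PiM (carrier G) (\<lambda>_. borel)) (selfadjoint G)"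
proof (rule measurable_restrict_space2)
  interpret group G by fact
  show "selfadjoint_of_real G \<in> space (PiM (carrier G) (\<lambda>_. lborel)) \<rightarrow> selfadjoint G"
    using bij_betw_imp_surj_on[OF bij_betw_selfadjoint_of_real[OF assms]] by (auto simp: space_PiM)
  have c: "(\<lambda>c. c \<gamma>) \<in> borel_measurable (PiM (carrier G) (\<lambda>_. lborel :: real measure))"
    if "\<gamma> \<in> carrier G" for \<gamma>
    using measurable_component_singleton[OF that, of "\<lambda>_. lborel :: real measure"] by simp
  have "(\<lambda>c. Complex ((c \<gamma> + c (inv\<^bsub>G\<^esub> \<gamma>)) / 2) ((c \<gamma> - c (inv\<^bsub>G\<^esub> \<gamma>)) / 2))
      \<in> borel_measurable (PiM (carrier G) (\<lambda>_. lborel))" if "\<gamma> \<in> carrier G" for \<gamma>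
    unfolding Complex_eq using c[OF that] c[OF inv_closed[OF that]] by measurable
  then show "selfadjoint_of_real G \<in> PiM (carrier G) (\<lambda>_. lborel) \<rightarrow>\<^sub>M PiM (carrier G) (\<lambda>_. borel)"
    unfolding selfadjoint_of_real_def by (intro measurable_restrict) auto
qed

definition lebesgue_selfadjoint :: "('g, 'b) monoid_scheme \<Rightarrow> ('g \<Rightarrow> complex) measure" where
  "lebesgue_selfadjoint G =
     distr (PiM (carrier G) (\<lambda>_. lborel))
       (restrict_space (PiM (carrier G) (\<lambda>_. borel)) (selfadjoint G))
       (selfadjoint_of_real G)"

definition gauss_weight :: "('g, 'b) monoid_scheme \<Rightarrow> ('g \<Rightarrow> complex) \<Rightarrow> complex" where
  "gauss_weight G x = exp (- (1/2) * chi_reg G (x [^]\<^bsub>group_algebra G\<^esub> (2::nat)))"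

text \<open>The Gaussian weight is real on self-adjoint elements, so \<open>Re\<close> loses nothing.\<close>

definition normalized_measure :: "('g, 'b) monoid_scheme \<Rightarrow> ('g \<Rightarrow> complex) measure" where
  "normalized_measure G =
     scale_measure (ennreal (1 / Re (LINT x|lebesgue_selfadjoint G. gauss_weight G x)))
       (lebesgue_selfadjoint G)"


section \<open>Formal power series in infinitely many variables\<close>

text \<open>The finitely supported function \<open>v\<close> stands for the monomial \<open>\<Prod>j. t\<^sub>j ^ v j\<close>.\<close>

type_synonym monomial = "nat \<Rightarrow>\<^sub>0 nat"
type_synonym power_series = "monomial \<Rightarrow> complex"

definition series_one :: power_series where
  "series_one v = (if v = 0 then 1 else 0)"

definition series_mult :: "power_series \<Rightarrow> power_series \<Rightarrow> power_series" where
  "series_mult A B v = (\<Sum>(a, b) | a + b = v. A a * B b)"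

lemma finite_splittings: "finite {(a, b). a + b = (v :: monomial)}"
proof -
  let ?F = "{f. \<forall>j. (j \<in> Poly_Mapping.keys v \<longrightarrow> f j \<in> {..Poly_Mapping.lookup v j}) \<and> (j \<notin> Poly_Mapping.keys v \<longrightarrow> f j = 0)}"
  have F: "finite ?F"
  proof (rule finite_subset)
    show "finite {f. \<forall>j. (j \<in> Poly_Mapping.keys v \<longrightarrow> f j \<in> {..Max (Poly_Mapping.lookup v ` Poly_Mapping.keys v)}) \<and> (j \<notin> Poly_Mapping.keys v \<longrightarrow> f j = (0::nat))}"
      by (rule finite_set_of_finite_funs) auto
  qed (auto, meson Max_ge finite_imageI finite_keys imageI le_trans)
  have "finite (Poly_Mapping.lookup -` ?F)"
    by (rule finite_vimageI[OF F]) (simp add: inj_on_def poly_mapping.lookup_inject)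
  moreover have "{(a, b). a + b = v} \<subseteq> (Poly_Mapping.lookup -` ?F) \<times> (Poly_Mapping.lookup -` ?F)"
    by (auto simp: lookup_add in_keys_iff)
  ultimately show ?thesis
    by (meson finite_SigmaI finite_subset)
qed

primrec series_power :: "power_series \<Rightarrow> nat \<Rightarrow> power_series" where
  "series_power A 0 = series_one"
| "series_power A (Suc n) = series_mult A (series_power A n)"

text \<open>\<open>log A = \<Sum>\<^sub>k\<^sub>\<ge>\<^sub>1 (-1)\<^sup>k\<^sup>-\<^sup>1 (A - 1)\<^sup>k / k\<close>, for \<open>A\<close> with constant term 1. In each coefficient
  only finitely many terms of the series are nonzero.\<close>

definition series_log :: "power_series \<Rightarrow> power_series" where
  "series_log A v =
     suminf (\<lambda>k. (-1) ^ k / of_nat (Suc k) *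
       series_power (\<lambda>w. A w - series_one w) (Suc k) v)"

text \<open>The asymptotic series of the integral. Its coefficients vanish at the monomials that contain
  a variable \<open>t\<^sub>j\<close> with \<open>j < 3\<close>.\<close>

definition integral_series :: "('g, 'b) monoid_scheme \<Rightarrow> power_series" where
  "integral_series G v =
     (if Poly_Mapping.keys v \<subseteq> {3..}
      then (\<Prod>j\<in>Poly_Mapping.keys v.
              1 / (fact (Poly_Mapping.lookup v j) * of_nat j ^ Poly_Mapping.lookup v j)) *
           (LINT x|normalized_measure G. gauss_weight G x *
              (\<Prod>j\<in>Poly_Mapping.keys v.
                 chi_reg G (x [^]\<^bsub>group_algebra G\<^esub> j) ^ Poly_Mapping.lookup v j))
      else 0)"


section \<open>Ribbon graphs\<close>

text \<open>\<open>rg_vert h\<close> is the vertex that \<open>h\<close> is incident to, \<open>rg_opp h\<close> the other half of the edge of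
  \<open>h\<close>, and \<open>rg_next h\<close> the successor of \<open>h\<close> in the cyclic order at its vertex. The values of these
  functions outside \<open>rg_halves\<close> are irrelevant.\<close>

record ('v, 'h) ribbon_graph =
  rg_verts :: "'v set"
  rg_halves :: "'h set"
  rg_vert :: "'h \<Rightarrow> 'v"
  rg_opp :: "'h \<Rightarrow> 'h"
  rg_next :: "'h \<Rightarrow> 'h"

definition rg_incident :: "('v, 'h) ribbon_graph \<Rightarrow> 'v \<Rightarrow> 'h set" where
  "rg_incident \<Gamma> v = {h \<in> rg_halves \<Gamma>. rg_vert \<Gamma> h = v}"

definition ribbon_graph :: "('v, 'h) ribbon_graph \<Rightarrow> bool" where
  "ribbon_graph \<Gamma> \<longleftrightarrow>
     finite (rg_verts \<Gamma>) \<and> finite (rg_halves \<Gamma>) \<and>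
     rg_vert \<Gamma> \<in> rg_halves \<Gamma> \<rightarrow> rg_verts \<Gamma> \<and>
     (\<forall>h\<in>rg_halves \<Gamma>. rg_opp \<Gamma> h \<in> rg_halves \<Gamma> \<and> rg_opp \<Gamma> h \<noteq> h \<and> rg_opp \<Gamma> (rg_opp \<Gamma> h) = h) \<and>
     (\<forall>v\<in>rg_verts \<Gamma>. rg_incident \<Gamma> v = {} \<or> cyclic_on (rg_next \<Gamma>) (rg_incident \<Gamma> v))"

definition rg_connected :: "('v, 'h) ribbon_graph \<Rightarrow> bool" where
  "rg_connected \<Gamma> \<longleftrightarrow> rg_verts \<Gamma> \<noteq> {} \<and>
     (\<forall>u\<in>rg_verts \<Gamma>. \<forall>v\<in>rg_verts \<Gamma>.
        (u, v) \<in> {(rg_vert \<Gamma> h, rg_vert \<Gamma> (rg_opp \<Gamma> h)) | h. h \<in> rg_halves \<Gamma>}\<^sup>*)"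

definition rg_valence :: "('v, 'h) ribbon_graph \<Rightarrow> 'v \<Rightarrow> nat" where
  "rg_valence \<Gamma> v = card (rg_incident \<Gamma> v)"

definition rg_num_verts :: "('v, 'h) ribbon_graph \<Rightarrow> nat \<Rightarrow> nat" where
  "rg_num_verts \<Gamma> j = card {v \<in> rg_verts \<Gamma>. rg_valence \<Gamma> v = j}"

definition rg_is_iso ::
    "('v \<Rightarrow> 'w) \<Rightarrow> ('h \<Rightarrow> 'k) \<Rightarrow> ('v, 'h) ribbon_graph \<Rightarrow> ('w, 'k) ribbon_graph \<Rightarrow> bool" where
  "rg_is_iso f g \<Gamma> \<Gamma>' \<longleftrightarrow>
     bij_betw f (rg_verts \<Gamma>) (rg_verts \<Gamma>') \<and> bij_betw g (rg_halves \<Gamma>) (rg_halves \<Gamma>') \<and>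
     (\<forall>h\<in>rg_halves \<Gamma>. rg_vert \<Gamma>' (g h) = f (rg_vert \<Gamma> h) \<and>
        rg_opp \<Gamma>' (g h) = g (rg_opp \<Gamma> h) \<and> rg_next \<Gamma>' (g h) = g (rg_next \<Gamma> h))"

lemma rg_is_iso_comp:
  assumes "rg_is_iso f g \<Gamma> \<Gamma>'" "rg_is_iso f' g' \<Gamma>' \<Gamma>''"
  shows "rg_is_iso (f' \<circ> f) (g' \<circ> g) \<Gamma> \<Gamma>''"
proof -
  have "g h \<in> rg_halves \<Gamma>'" if "h \<in> rg_halves \<Gamma>" for h
    using assms(1) that unfolding rg_is_iso_def by (meson bij_betw_apply)
  moreover have "bij_betw (f' \<circ> f) (rg_verts \<Gamma>) (rg_verts \<Gamma>'')"
      "bij_betw (g' \<circ> g) (rg_halves \<Gamma>) (rg_halves \<Gamma>'')"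
    using assms unfolding rg_is_iso_def by (meson bij_betw_trans)+
  ultimately show ?thesis using assms unfolding rg_is_iso_def by simp
qed

lemma rg_next_in_halves:
  assumes "ribbon_graph \<Gamma>" "h \<in> rg_halves \<Gamma>"
  shows "rg_next \<Gamma> h \<in> rg_halves \<Gamma>"
proof -
  have v: "rg_vert \<Gamma> h \<in> rg_verts \<Gamma>" using assms by (auto simp: ribbon_graph_def)
  have h: "h \<in> rg_incident \<Gamma> (rg_vert \<Gamma> h)" using assms(2) by (simp add: rg_incident_def)
  have "cyclic_on (rg_next \<Gamma>) (rg_incident \<Gamma> (rg_vert \<Gamma> h))"
    using assms(1) v h unfolding ribbon_graph_def by blast
  then have "rg_next \<Gamma> h \<in> rg_incident \<Gamma> (rg_vert \<Gamma> h)" using h by (rule cyclic_on_inI)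
  then show ?thesis by (simp add: rg_incident_def)
qed

lemma rg_is_iso_inv:
  assumes "ribbon_graph \<Gamma>" "rg_is_iso f g \<Gamma> \<Gamma>'"
  shows "rg_is_iso (inv_into (rg_verts \<Gamma>) f) (inv_into (rg_halves \<Gamma>) g) \<Gamma>' \<Gamma>"
proof -
  let ?f = "inv_into (rg_verts \<Gamma>) f" and ?g = "inv_into (rg_halves \<Gamma>) g"
  have f: "bij_betw f (rg_verts \<Gamma>) (rg_verts \<Gamma>')" and g: "bij_betw g (rg_halves \<Gamma>) (rg_halves \<Gamma>')"
    using assms(2) by (auto simp: rg_is_iso_def)
  have "rg_vert \<Gamma> (?g k) = ?f (rg_vert \<Gamma>' k) \<and> rg_opp \<Gamma> (?g k) = ?g (rg_opp \<Gamma>' k) \<and>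
      rg_next \<Gamma> (?g k) = ?g (rg_next \<Gamma>' k)" if k: "k \<in> rg_halves \<Gamma>'" for k
  proof -
    obtain h where h: "h \<in> rg_halves \<Gamma>" "k = g h"
      by (metis bij_betw_imp_surj_on[OF g] imageE k)
    have v: "rg_vert \<Gamma> h \<in> rg_verts \<Gamma>" and o: "rg_opp \<Gamma> h \<in> rg_halves \<Gamma>"
      using assms(1) h(1) by (auto simp: ribbon_graph_def)
    have n: "rg_next \<Gamma> h \<in> rg_halves \<Gamma>"
      using rg_next_in_halves[OF assms(1) h(1)] .
    show ?thesis
      using assms(2) h(1) v o n unfolding h(2)
      by (simp add: rg_is_iso_def bij_betw_inv_into_left[OF f] bij_betw_inv_into_left[OF g])
  qed
  then show ?thesis
    using bij_betw_inv_into[OF f] bij_betw_inv_into[OF g] by (auto simp: rg_is_iso_def)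
qed

definition rg_aut :: "('v, 'h) ribbon_graph \<Rightarrow> ('h \<Rightarrow> 'h) set" where
  "rg_aut \<Gamma> = {g. g permutes rg_halves \<Gamma> \<and> (\<exists>f. rg_is_iso f g \<Gamma> \<Gamma>)}"

text \<open>Every finite ribbon graph is isomorphic to one whose vertices and half-edges are natural
  numbers.\<close>

definition admissible_graphs :: "(nat, nat) ribbon_graph set" where
  "admissible_graphs =
     {\<Gamma>. ribbon_graph \<Gamma> \<and> rg_connected \<Gamma> \<and> (\<forall>v\<in>rg_verts \<Gamma>. rg_valence \<Gamma> v \<ge> 3)}"

definition admissible_iso :: "((nat, nat) ribbon_graph \<times> (nat, nat) ribbon_graph) set" where
  "admissible_iso = {(\<Gamma>, \<Gamma>'). \<Gamma> \<in> admissible_graphs \<and> \<Gamma>' \<in> admissible_graphs \<and>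
     (\<exists>f g. rg_is_iso f g \<Gamma> \<Gamma>')}"

definition admissible_reps :: "(nat, nat) ribbon_graph set" where
  "admissible_reps = (\<lambda>C. SOME \<Gamma>. \<Gamma> \<in> C) ` (admissible_graphs // admissible_iso)"


lemma equiv_admissible_iso: "equiv admissible_graphs admissible_iso"
proof (rule equivI)
  show "admissible_iso \<subseteq> admissible_graphs \<times> admissible_graphs"
    by (auto simp: admissible_iso_def)
  have "rg_is_iso id id \<Gamma> \<Gamma>" for \<Gamma> :: "(nat, nat) ribbon_graph" by (simp add: rg_is_iso_def)
  then show "refl_on admissible_graphs admissible_iso"
    by (auto simp: refl_on_def admissible_iso_def)
  show "sym admissible_iso"
    unfolding sym_def admissible_iso_def admissible_graphs_def by (blast intro: rg_is_iso_inv)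
  show "trans admissible_iso"
    unfolding trans_def admissible_iso_def by (blast intro: rg_is_iso_comp)
qed


lemma admissible_reps_iso_eq:
  assumes "\<Gamma> \<in> admissible_reps" "\<Gamma>' \<in> admissible_reps" "(\<Gamma>, \<Gamma>') \<in> admissible_iso"
  shows "\<Gamma> = \<Gamma>'"
proof -
  have *: "(SOME \<Gamma>. \<Gamma> \<in> C) \<in> C" if "C \<in> admissible_graphs // admissible_iso" for C
    using in_quotient_imp_non_empty[OF equiv_admissible_iso that] by (simp add: some_in_eq)
  obtain C C' where C: "C \<in> admissible_graphs // admissible_iso" "\<Gamma> = (SOME \<Gamma>. \<Gamma> \<in> C)"
    and C': "C' \<in> admissible_graphs // admissible_iso" "\<Gamma>' = (SOME \<Gamma>. \<Gamma> \<in> C')"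
    using assms(1,2) unfolding admissible_reps_def by blast
  have "C = C'"
    using quotient_eqI[OF equiv_admissible_iso C(1) C'(1) _ _ assms(3)] *[OF C(1)] *[OF C'(1)] C(2) C'(2)
    by simp
  then show ?thesis using C C' by simp
qed

lemma admissible_reps_subset: "admissible_reps \<subseteq> admissible_graphs"
proof
  fix \<Gamma> assume "\<Gamma> \<in> admissible_reps"
  then obtain C where C: "C \<in> admissible_graphs // admissible_iso" "\<Gamma> = (SOME \<Gamma>. \<Gamma> \<in> C)"
    unfolding admissible_reps_def by blast
  have "\<Gamma> \<in> C"
    using in_quotient_imp_non_empty[OF equiv_admissible_iso C(1)] by (simp add: some_in_eq C(2))
  then show "\<Gamma> \<in> admissible_graphs"
    using in_quotient_imp_subset[OF equiv_admissible_iso C(1)] by blast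
qed

lemma card_rg_verts:
  assumes "ribbon_graph \<Gamma>" "\<forall>j. rg_num_verts \<Gamma> j = Poly_Mapping.lookup v j"
  shows "card (rg_verts \<Gamma>) = (\<Sum>j\<in>Poly_Mapping.keys v. Poly_Mapping.lookup v j)"
    and "card (rg_halves \<Gamma>) = (\<Sum>j\<in>Poly_Mapping.keys v. j * Poly_Mapping.lookup v j)"
proof -
  have fin: "finite (rg_verts \<Gamma>)" "finite (rg_halves \<Gamma>)"
    and inc: "rg_vert \<Gamma> \<in> rg_halves \<Gamma> \<rightarrow> rg_verts \<Gamma>"
    using assms(1) by (auto simp: ribbon_graph_def)
  have keys: "rg_valence \<Gamma> ` rg_verts \<Gamma> \<subseteq> Poly_Mapping.keys v"
  proof
    fix j assume "j \<in> rg_valence \<Gamma> ` rg_verts \<Gamma>"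
    then have "{u \<in> rg_verts \<Gamma>. rg_valence \<Gamma> u = j} \<noteq> {}" by blast
    then have "rg_num_verts \<Gamma> j \<noteq> 0" using fin(1) by (simp add: rg_num_verts_def)
    then show "j \<in> Poly_Mapping.keys v" using assms(2) by (simp add: in_keys_iff)
  qed
  have "card (rg_verts \<Gamma>) = (\<Sum>u\<in>rg_verts \<Gamma>. 1)" by simp
  also have "\<dots> = (\<Sum>j\<in>Poly_Mapping.keys v. \<Sum>u\<in>{u \<in> rg_verts \<Gamma>. rg_valence \<Gamma> u = j}. 1)"
    by (rule sum.group[symmetric, OF fin(1) _ keys]) simp
  also have "\<dots> = (\<Sum>j\<in>Poly_Mapping.keys v. Poly_Mapping.lookup v j)"
    using assms(2) by (simp add: rg_num_verts_def)
  finally show "card (rg_verts \<Gamma>) = \<dots>" .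
  have "card (rg_halves \<Gamma>) = (\<Sum>h\<in>rg_halves \<Gamma>. 1)" by simp
  also have "\<dots> = (\<Sum>u\<in>rg_verts \<Gamma>. \<Sum>h\<in>{h \<in> rg_halves \<Gamma>. rg_vert \<Gamma> h = u}. 1)"
    by (rule sum.group[symmetric, OF fin(2,1)]) (use inc in blast)
  also have "\<dots> = (\<Sum>u\<in>rg_verts \<Gamma>. rg_valence \<Gamma> u)"
    by (simp add: rg_valence_def rg_incident_def)
  also have "\<dots> = (\<Sum>j\<in>Poly_Mapping.keys v. \<Sum>u\<in>{u \<in> rg_verts \<Gamma>. rg_valence \<Gamma> u = j}. rg_valence \<Gamma> u)"
    by (rule sum.group[symmetric, OF fin(1) _ keys]) simp
  also have "\<dots> = (\<Sum>j\<in>Poly_Mapping.keys v. j * Poly_Mapping.lookup v j)"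
  proof (rule sum.cong[OF refl])
    fix j
    show "(\<Sum>u\<in>{u \<in> rg_verts \<Gamma>. rg_valence \<Gamma> u = j}. rg_valence \<Gamma> u) = j * Poly_Mapping.lookup v j"
      using assms(2)[rule_format, of j, symmetric] by (simp add: rg_num_verts_def)
  qed
  finally show "card (rg_halves \<Gamma>) = \<dots>" .
qed

text \<open>The sum in \<open>ribbon_series\<close> is finite.\<close>

lemma finite_ribbon_series_index:
  "finite {\<Gamma> \<in> admissible_reps. \<forall>j. rg_num_verts \<Gamma> j = Poly_Mapping.lookup v j}" (is "finite ?S")
proof -
  define k where "k = (\<Sum>j\<in>Poly_Mapping.keys v. Poly_Mapping.lookup v j)"
  define n where "n = (\<Sum>j\<in>Poly_Mapping.keys v. j * Poly_Mapping.lookup v j)"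
  define F where "F = (\<lambda>(a, b, c). \<lparr>rg_verts = {..<k}, rg_halves = {..<n}, rg_vert = a, rg_opp = b, rg_next = c\<rparr>) `
    (({..<n} \<rightarrow>\<^sub>E {..<k}) \<times> ({..<n} \<rightarrow>\<^sub>E {..<n}) \<times> ({..<n} \<rightarrow>\<^sub>E {..<n}))"
  have fin: "finite F" unfolding F_def by (intro finite_imageI finite_SigmaI finite_PiE) auto
  have ex: "\<exists>\<Delta>\<in>F. \<exists>f g. rg_is_iso f g \<Gamma> \<Delta>" if \<Gamma>: "\<Gamma> \<in> ?S" for \<Gamma>
  proof -
    have rg: "ribbon_graph \<Gamma>" using \<Gamma> admissible_reps_subset by (auto simp: admissible_graphs_def)
    then have "finite (rg_verts \<Gamma>)" "finite (rg_halves \<Gamma>)" by (auto simp: ribbon_graph_def)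
    moreover have "card (rg_verts \<Gamma>) = k" "card (rg_halves \<Gamma>) = n"
      using card_rg_verts[OF rg] \<Gamma> by (auto simp: k_def n_def)
    ultimately have "\<exists>f. bij_betw f (rg_verts \<Gamma>) {..<k}" "\<exists>g. bij_betw g (rg_halves \<Gamma>) {..<n}"
      by (auto intro!: finite_same_card_bij)
    then obtain f g where f: "bij_betw f (rg_verts \<Gamma>) {..<k}" and g: "bij_betw g (rg_halves \<Gamma>) {..<n}"
      by blast
    let ?i = "inv_into (rg_halves \<Gamma>) g"
    let ?\<Delta> = "\<lparr>rg_verts = {..<k}, rg_halves = {..<n},
      rg_vert = (\<lambda>x\<in>{..<n}. f (rg_vert \<Gamma> (?i x))), rg_opp = (\<lambda>x\<in>{..<n}. g (rg_opp \<Gamma> (?i x))),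
      rg_next = (\<lambda>x\<in>{..<n}. g (rg_next \<Gamma> (?i x)))\<rparr>"
    have v: "rg_vert \<Gamma> h \<in> rg_verts \<Gamma>" "rg_opp \<Gamma> h \<in> rg_halves \<Gamma>" "rg_next \<Gamma> h \<in> rg_halves \<Gamma>"
      if h: "h \<in> rg_halves \<Gamma>" for h
      using rg_next_in_halves[OF rg h] rg h by (auto simp: ribbon_graph_def)
    have i: "?i x \<in> rg_halves \<Gamma>" if "x < n" for x
      using bij_betw_apply[OF bij_betw_inv_into[OF g]] that by simp
    have fk: "f u < k" if "u \<in> rg_verts \<Gamma>" for u using bij_betw_apply[OF f that] by simp
    have gn: "g h < n" if "h \<in> rg_halves \<Gamma>" for h using bij_betw_apply[OF g that] by simp
    have "?\<Delta> \<in> F" unfolding F_def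
      by (rule image_eqI[where x = "(rg_vert ?\<Delta>, rg_opp ?\<Delta>, rg_next ?\<Delta>)"]) (auto simp: v i fk gn)
    moreover have "rg_is_iso f g \<Gamma> ?\<Delta>"
      using f g gn by (simp add: rg_is_iso_def bij_betw_inv_into_left[OF g])
    ultimately show ?thesis by blast
  qed
  then have "\<forall>\<Gamma>\<in>?S. \<exists>\<Delta>. \<Delta> \<in> F \<and> (\<exists>f g. rg_is_iso f g \<Gamma> \<Delta>)" by blast
  from bchoice[OF this] obtain c
    where "\<forall>\<Gamma>\<in>?S. c \<Gamma> \<in> F \<and> (\<exists>f g. rg_is_iso f g \<Gamma> (c \<Gamma>))" ..
  then have c: "c \<Gamma> \<in> F" "\<exists>f g. rg_is_iso f g \<Gamma> (c \<Gamma>)" if "\<Gamma> \<in> ?S" for \<Gamma>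
    using that by blast+
  have "inj_on c ?S"
  proof (rule inj_onI)
    fix \<Gamma> \<Gamma>' assume \<Gamma>: "\<Gamma> \<in> ?S" and \<Gamma>': "\<Gamma>' \<in> ?S" and eq: "c \<Gamma> = c \<Gamma>'"
    have adm: "\<Gamma> \<in> admissible_graphs" "\<Gamma>' \<in> admissible_graphs"
      using \<Gamma> \<Gamma>' admissible_reps_subset by auto
    obtain f g f' g' where "rg_is_iso f g \<Gamma> (c \<Gamma>)" "rg_is_iso f' g' \<Gamma>' (c \<Gamma>)"
      using c(2)[OF \<Gamma>] c(2)[OF \<Gamma>'] unfolding eq by blast
    moreover have "ribbon_graph \<Gamma>'" using adm by (simp add: admissible_graphs_def)
    ultimately have "\<exists>f g. rg_is_iso f g \<Gamma> \<Gamma>'"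
      by (blast intro: rg_is_iso_comp[OF _ rg_is_iso_inv])
    then show "\<Gamma> = \<Gamma>'"
      using admissible_reps_iso_eq[of \<Gamma> \<Gamma>'] \<Gamma> \<Gamma>' adm unfolding admissible_iso_def by blast
  qed
  then show ?thesis by (rule inj_on_finite[OF _ _ fin]) (use c(1) in blast)
qed


section \<open>The surface of a ribbon graph\<close>

text \<open>A face lies along the half-edges \<open>h, rg_face_next h, \<dots>\<close>, each of them traversed from its
  vertex to the vertex of its opposite.\<close>

definition rg_face_next :: "('v, 'h) ribbon_graph \<Rightarrow> 'h \<Rightarrow> 'h" where
  "rg_face_next \<Gamma> h = rg_next \<Gamma> (rg_opp \<Gamma> h)"

definition rg_edges :: "('v, 'h) ribbon_graph \<Rightarrow> 'h set set" where
  "rg_edges \<Gamma> = (\<lambda>h. {h, rg_opp \<Gamma> h}) ` rg_halves \<Gamma>"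

definition rg_faces :: "('v, 'h) ribbon_graph \<Rightarrow> 'h set set" where
  "rg_faces \<Gamma> = orbit (rg_face_next \<Gamma>) ` rg_halves \<Gamma>"

definition rg_euler_char :: "('v, 'h) ribbon_graph \<Rightarrow> int" where
  "rg_euler_char \<Gamma> =
     int (card (rg_verts \<Gamma>)) - int (card (rg_edges \<Gamma>)) + int (card (rg_faces \<Gamma>))"

definition quotient_topology :: "'a topology \<Rightarrow> ('a \<times> 'a) set \<Rightarrow> 'a set topology" where
  "quotient_topology X R = topology (\<lambda>U. U \<subseteq> topspace X // R \<and>
     openin X {x \<in> topspace X. R `` {x} \<in> U})"

lemma openin_quotient_topology:
  "openin (quotient_topology X R) U \<longleftrightarrow>
     U \<subseteq> topspace X // R \<and> openin X {x \<in> topspace X. R `` {x} \<in> U}"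
proof -
  have "istopology (\<lambda>U. U \<subseteq> topspace X // R \<and> openin X {x \<in> topspace X. R `` {x} \<in> U})"
  proof -
    have "openin X {x \<in> topspace X. R `` {x} \<in> S \<inter> T}"
      if "openin X {x \<in> topspace X. R `` {x} \<in> S}" "openin X {x \<in> topspace X. R `` {x} \<in> T}" for S T
      using openin_Int[OF that] by (rule back_subst[where P = "openin X"]) auto
    moreover have "openin X {x \<in> topspace X. R `` {x} \<in> \<Union>K}"
      if "\<forall>U\<in>K. openin X {x \<in> topspace X. R `` {x} \<in> U}" for K
    proof -
      have "{x \<in> topspace X. R `` {x} \<in> \<Union>K} = \<Union> ((\<lambda>U. {x \<in> topspace X. R `` {x} \<in> U}) ` K)"
        by auto
      moreover have "openin X \<dots>" using that by (intro openin_Union) auto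
      ultimately show ?thesis by simp
    qed
    ultimately show ?thesis unfolding istopology_def by blast
  qed
  then show ?thesis unfolding quotient_topology_def by (simp add: topology_inverse')
qed

lemma topspace_quotient_topology: "topspace (quotient_topology X R) = topspace X // R"
proof
  have "{x \<in> topspace X. R `` {x} \<in> topspace X // R} = topspace X" by (auto intro: quotientI)
  then have "openin (quotient_topology X R) (topspace X // R)"
    by (simp add: openin_quotient_topology)
  then show "topspace X // R \<subseteq> topspace (quotient_topology X R)" by (rule openin_subset)
  show "topspace (quotient_topology X R) \<subseteq> topspace X // R"
    using openin_topspace[of "quotient_topology X R"] unfolding openin_quotient_topology by blast
qed

text \<open>One disk is attached to the graph along each face. A disk with \<open>n\<close> boundary edges is cut
  from its centre into \<open>n\<close> triangles, one for each half-edge \<open>h\<close> on its boundary. In the triangle of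
  \<open>h\<close> the point \<open>(0, 0)\<close> is the vertex of \<open>h\<close>, the point \<open>(1, 0)\<close> is the vertex of the opposite
  half-edge, and \<open>(0, 1)\<close> is the centre of the face. The side \<open>r = 0\<close> lies on the edge, whose other
  side belongs to the triangle of the opposite half-edge. The other two sides are shared with the
  neighbouring triangles of the same disk. All gluings reverse the boundary orientation. The graph
  with a single vertex and no edges, which has no triangles, is not covered.\<close>

definition unit_triangle :: "(real \<times> real) set" where
  "unit_triangle = {(s, r). 0 \<le> s \<and> 0 \<le> r \<and> s + r \<le> 1}"

definition rg_triangles :: "('v, 'h) ribbon_graph \<Rightarrow> ('h \<times> real \<times> real) topology" where
  "rg_triangles \<Gamma> = prod_topology (discrete_topology (rg_halves \<Gamma>)) (top_of_set unit_triangle)"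

definition rg_gluing ::
    "('v, 'h) ribbon_graph \<Rightarrow> (('h \<times> real \<times> real) \<times> ('h \<times> real \<times> real)) set" where
  "rg_gluing \<Gamma> =
     {((h, s, 0), (rg_opp \<Gamma> h, 1 - s, 0)) | h s. h \<in> rg_halves \<Gamma> \<and> 0 \<le> s \<and> s \<le> 1} \<union>
     {((h, 1 - r, r), (rg_face_next \<Gamma> h, 0, r)) | h r. h \<in> rg_halves \<Gamma> \<and> 0 \<le> r \<and> r \<le> 1}"

definition rg_surface :: "('v, 'h) ribbon_graph \<Rightarrow> ('h \<times> real \<times> real) set topology" where
  "rg_surface \<Gamma> = quotient_topology (rg_triangles \<Gamma>) ((rg_gluing \<Gamma> \<union> (rg_gluing \<Gamma>)\<inverse>)\<^sup>*)"


section \<open>The fundamental group\<close>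

definition loops_at :: "'a topology \<Rightarrow> 'a \<Rightarrow> (real \<Rightarrow> 'a) set" where
  "loops_at X x\<^sub>0 = {p. pathin X p \<and> p 0 = x\<^sub>0 \<and> p 1 = x\<^sub>0}"

definition loop_homotopy :: "'a topology \<Rightarrow> 'a \<Rightarrow> ((real \<Rightarrow> 'a) \<times> (real \<Rightarrow> 'a)) set" where
  "loop_homotopy X x\<^sub>0 = {(p, q). p \<in> loops_at X x\<^sub>0 \<and> q \<in> loops_at X x\<^sub>0 \<and>
     homotopic_with (\<lambda>r. r 0 = x\<^sub>0 \<and> r 1 = x\<^sub>0) (top_of_set {0..1}) X p q}"

definition loop_concat :: "(real \<Rightarrow> 'a) \<Rightarrow> (real \<Rightarrow> 'a) \<Rightarrow> real \<Rightarrow> 'a" where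
  "loop_concat p q = (\<lambda>t. if t \<le> 1/2 then p (2 * t) else q (2 * t - 1))"

definition fundamental_group :: "'a topology \<Rightarrow> 'a \<Rightarrow> (real \<Rightarrow> 'a) set monoid" where
  "fundamental_group X x\<^sub>0 = \<lparr>carrier = loops_at X x\<^sub>0 // loop_homotopy X x\<^sub>0,
     mult = (\<lambda>A B. loop_homotopy X x\<^sub>0 `` {loop_concat p q | p q. p \<in> A \<and> q \<in> B}),
     one = loop_homotopy X x\<^sub>0 `` {\<lambda>_. x\<^sub>0}\<rparr>"

text \<open>The surface of a connected ribbon graph is path connected, so the base point is immaterial.\<close>

definition rg_pi1 :: "('v, 'h) ribbon_graph \<Rightarrow> (real \<Rightarrow> ('h \<times> real \<times> real) set) set monoid" where
  "rg_pi1 \<Gamma> = fundamental_group (rg_surface \<Gamma>) (SOME x. x \<in> topspace (rg_surface \<Gamma>))"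

text \<open>The library's \<open>hom\<close> does not determine a function outside the carrier. Without the restriction
  to extensional functions, the set would in general be infinite, with \<open>card\<close> equal to 0.\<close>

definition num_homs :: "('a, 'c) monoid_scheme \<Rightarrow> ('g, 'b) monoid_scheme \<Rightarrow> nat" where
  "num_homs P G = card (hom P G \<inter> extensional (carrier P))"

definition ribbon_series :: "('g, 'b) monoid_scheme \<Rightarrow> power_series" where
  "ribbon_series G v =
     (\<Sum>\<Gamma> | \<Gamma> \<in> admissible_reps \<and> (\<forall>j. rg_num_verts \<Gamma> j = Poly_Mapping.lookup v j).
        1 / of_nat (card (rg_aut \<Gamma>)) *
        of_nat (card (carrier G)) powi (rg_euler_char \<Gamma> - 1) * of_nat (num_homs (rg_pi1 \<Gamma>) G))"

end

theory Submission
  imports Defs "HOL-Probability.Distributions"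
begin

text \<open>Both sides are sums over pairs \<open>(\<sigma>, \<alpha>)\<close> of a permutation of the half-edges, whose cycles are the
  vertices, and a pairing of the half-edges into edges. On the left, \<open>\<chi>\<^sub>r\<^sub>e\<^sub>g (x\<^sup>j)\<close> is the sum of
  \<open>\<Prod> x (B (\<sigma> h) (B h)\<^sup>-\<^sup>1)\<close> over all labellings \<open>B\<close> of a \<open>j\<close>-cycle \<open>\<sigma>\<close> by elements of \<open>G\<close>, and in
  Gaussian coordinates the covariance of \<open>x \<gamma>\<close> and \<open>x \<kappa>\<close> is \<open>1 / |G|\<close> if \<open>\<gamma> \<kappa> = 1\<close> and 0 otherwise. By
  Wick's theorem the integral is the exponential generating function of all pairs, where \<open>(\<sigma>, \<alpha>)\<close> has
  the weight \<open>|G|\<^sup>-\<^sup>e\<close> times the number of labellings \<open>B\<close> of the half-edges that satisfy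
  \<open>B (\<sigma> h) (B h)\<^sup>-\<^sup>1 \<cdot> B (\<sigma> \<alpha> h) (B (\<alpha> h))\<^sup>-\<^sup>1 = 1\<close> at each edge. This weight is multiplicative, so the logarithm
  is the generating function of the connected pairs, that is, of ribbon graphs with numbered
  half-edges, and forgetting the numbers divides by the order of the automorphism group.

  It remains to count the labellings. The surface is covered by the open stars of the vertices of
  its triangulation into flags. These stars and their pairwise intersections are simple enough
  for Cech cocycles with values in \<open>G\<close> (flat bundles with a trivialization on each star) to be counted
  in two ways: by holonomy, as \<open>|Hom (\<pi>\<^sub>1 S, G)|\<close> times a power of \<open>|G|\<close>, and combinatorially, as labels
  of the flags, which reduce to the labellings \<open>B\<close> and one free element of \<open>G\<close> per edge.\<close>

section \<open>Paths up to homotopy\<close>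

text \<open>The fundamental group is that of the actual quotient space, so no presentation by
  generators and relations is at hand. Counting trivialized bundles avoids one. The cover has V + E
  + F stars and all but the base star contribute a free element, so the first count is the number of
  homomorphisms times the power V + E + F - 1 of the group order. On the flags the count is the E-th
  power times the number of flat labellings. Cancelling, and dividing by the E-th power that comes
  from the covariances, leaves the exponent V - E + F - 1. Two stars may meet in several pieces;
  therefore a transition function takes a point as argument and is constant along paths. The
  logarithm is handled without an exponential series. If D multiplies each monomial by its degree,
  the number of half-edges, then log Z = C amounts to D Z = (D C) Z, and marking one half-edge and
  splitting off its component gives this equation. The same principle with trivial pairings turns
  the numerical factors of the asymptotic series into a sum over permutations.\<close>

definition path_homotopic :: "'a topology \<Rightarrow> (real \<Rightarrow> 'a) \<Rightarrow> (real \<Rightarrow> 'a) \<Rightarrow> bool" where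
  "path_homotopic X p q \<longleftrightarrow>
     homotopic_with (\<lambda>r. r 0 = p 0 \<and> r 1 = p 1) (top_of_set {0..1}) X p q"

definition is_path :: "'a topology \<Rightarrow> (real \<Rightarrow> 'a) \<Rightarrow> 'a \<Rightarrow> 'a \<Rightarrow> bool" where
  "is_path X p x y \<longleftrightarrow> pathin X p \<and> p 0 = x \<and> p 1 = y"

definition rev_path :: "(real \<Rightarrow> 'a) \<Rightarrow> real \<Rightarrow> 'a" where
  "rev_path p = (\<lambda>t. p (1 - t))"

definition sub_path :: "real \<Rightarrow> real \<Rightarrow> (real \<Rightarrow> 'a) \<Rightarrow> real \<Rightarrow> 'a" where
  "sub_path a b p = (\<lambda>t. p (a + t * (b - a)))"

lemma path_homotopic_imp_eq:
  assumes "path_homotopic X p q"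
  shows "q 0 = p 0" "q 1 = p 1" "pathin X p" "pathin X q"
  using homotopic_with_imp_property[OF assms[unfolded path_homotopic_def]]
    homotopic_with_imp_continuous_maps[OF assms[unfolded path_homotopic_def]]
  by (auto simp: pathin_def)

lemma path_homotopic_refl: "pathin X p \<Longrightarrow> path_homotopic X p p"
  by (simp add: path_homotopic_def pathin_def)

lemma path_homotopic_sym:
  assumes "path_homotopic X p q"
  shows "path_homotopic X q p"
  using homotopic_with_symD[OF assms[unfolded path_homotopic_def]]
  unfolding path_homotopic_def path_homotopic_imp_eq(1,2)[OF assms] .

lemma path_homotopic_trans [trans]:
  assumes "path_homotopic X p q" "path_homotopic X q r"
  shows "path_homotopic X p r"
  using homotopic_with_trans[OF assms(1)[unfolded path_homotopic_def]
      assms(2)[unfolded path_homotopic_def path_homotopic_imp_eq(1,2)[OF assms(1)]]]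
  unfolding path_homotopic_def .

text \<open>The source of all explicit homotopies: in a convex parameter domain two paths with equal
  ends are joined by straight segments, and \<open>f\<close> carries this into the space. The domain
  is \<open>{0..1}\<close> for reparametrizations and the unit square for contractions.\<close>

lemma path_homotopic_convex:
  fixes f :: "'b::real_normed_vector \<Rightarrow> 'a"
  assumes f: "continuous_map (top_of_set D) X f" and D: "convex D"
    and a: "continuous_on {0..1} a" "a ` {0..1} \<subseteq> D"
    and b: "continuous_on {0..1} b" "b ` {0..1} \<subseteq> D"
    and eq: "a 0 = b 0" "a 1 = b 1"
  shows "path_homotopic X (f \<circ> a) (f \<circ> b)"
proof -
  have "homotopic_paths D a b"
  proof (rule homotopic_paths_linear)
    fix t :: real assume "t \<in> {0..1}"
    then show "closed_segment (a t) (b t) \<subseteq> D"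
      using a(2) b(2) by (intro closed_segment_subset D) auto
  qed (use a b eq in \<open>auto simp: path_def pathstart_def pathfinish_def\<close>)
  then have "homotopic_with (\<lambda>r. pathstart r = pathstart a \<and> pathfinish r = pathfinish a)
      (top_of_set {0..1}) (top_of_set D) a b"
    by (simp add: homotopic_paths_def)
  then show ?thesis unfolding path_homotopic_def
    by (rule homotopic_with_compose_continuous_map_left[OF _ f])
      (simp add: pathstart_def pathfinish_def)
qed

lemma pathin_compose_continuous_on:
  assumes "pathin X p" "continuous_on {0..1} a" "a ` {0..1} \<subseteq> {0..1}"
  shows "pathin X (p \<circ> a)"
  using assms unfolding pathin_def
  by (intro continuous_map_compose[of _ "top_of_set {0..1}"]) auto

lemma path_homotopic_reparam:
  assumes "pathin X p" "continuous_on {0..1} a" "a ` {0..1} \<subseteq> {0..1}"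
    "continuous_on {0..1} b" "b ` {0..1} \<subseteq> {0..1}" "a 0 = b 0" "a 1 = b 1"
  shows "path_homotopic X (p \<circ> a) (p \<circ> b)"
  using assms by (intro path_homotopic_convex[where D = "{0..1::real}"]) (auto simp: pathin_def)

text \<open>Two squares are glued along a side. Applied to two homotopies this makes concatenation
  respect homotopy.\<close>

lemma continuous_map_loop_concat:
  fixes h k :: "real \<times> real \<Rightarrow> 'a"
  assumes h: "continuous_map (prod_topology (top_of_set {0..1}) (top_of_set {0..1})) X h"
    and k: "continuous_map (prod_topology (top_of_set {0..1}) (top_of_set {0..1})) X k"
    and eq: "\<And>s. s \<in> {0..1} \<Longrightarrow> h (s, 1) = k (s, 0)"
  shows "continuous_map (prod_topology (top_of_set {0..1}) (top_of_set {0..1})) X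
    (\<lambda>z. if snd z \<le> 1/2 then h (fst z, 2 * snd z) else k (fst z, 2 * snd z - 1))"
proof -
  let ?T = "top_of_set ({0..1} \<times> {0..1::real} :: (real \<times> real) set)"
  have T: "prod_topology (top_of_set {0..1}) (top_of_set {0..1::real}) = ?T"
    by (rule prod_topology_subtopology_eu)
  show ?thesis unfolding T
  proof (rule continuous_map_cases_le)
    have "continuous_map (subtopology ?T {x \<in> topspace ?T. snd x \<le> 1/2}) ?T (\<lambda>z. (fst z, 2 * snd z))"
      unfolding subtopology_subtopology by (auto intro!: continuous_intros)
    from continuous_map_compose[OF this h[unfolded T]]
    show "continuous_map (subtopology ?T {x \<in> topspace ?T. snd x \<le> 1/2}) X (\<lambda>z. h (fst z, 2 * snd z))"
      by (simp add: o_def)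
    have "continuous_map (subtopology ?T {x \<in> topspace ?T. 1/2 \<le> snd x}) ?T (\<lambda>z. (fst z, 2 * snd z - 1))"
      unfolding subtopology_subtopology by (auto intro!: continuous_intros)
    from continuous_map_compose[OF this k[unfolded T]]
    show "continuous_map (subtopology ?T {x \<in> topspace ?T. 1/2 \<le> snd x}) X (\<lambda>z. k (fst z, 2 * snd z - 1))"
      by (simp add: o_def)
  next
    fix z assume "z \<in> topspace ?T" "snd z = 1/2"
    then have "2 * snd z = 1" "fst z \<in> {0..1}" by auto
    then show "h (fst z, 2 * snd z) = k (fst z, 2 * snd z - 1)" using eq[of "fst z"] by (simp only: diff_self)
  qed (auto intro!: continuous_intros)
qed

lemma path_homotopic_concat:
  assumes p: "path_homotopic X p p'" and q: "path_homotopic X q q'" and eq: "p 1 = q 0"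
  shows "path_homotopic X (loop_concat p q) (loop_concat p' q')"
proof -
  obtain h :: "real \<times> real \<Rightarrow> 'a" where h: "continuous_map (prod_topology (top_of_set {0..1}) (top_of_set {0..1})) X h"
      "\<forall>x. h (0, x) = p x" "\<forall>x. h (1, x) = p' x"
      "\<forall>t\<in>{0..1}. h (t, 0) = p 0 \<and> h (t, 1) = p 1"
    using p unfolding path_homotopic_def homotopic_with_def by (elim exE conjE) (rule that; assumption)
  obtain k :: "real \<times> real \<Rightarrow> 'a" where k: "continuous_map (prod_topology (top_of_set {0..1}) (top_of_set {0..1})) X k"
      "\<forall>x. k (0, x) = q x" "\<forall>x. k (1, x) = q' x"
      "\<forall>t\<in>{0..1}. k (t, 0) = q 0 \<and> k (t, 1) = q 1"
    using q unfolding path_homotopic_def homotopic_with_def by (elim exE conjE) (rule that; assumption)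
  show ?thesis
    unfolding path_homotopic_def homotopic_with_def
    by (rule exI[of _ "\<lambda>z. if snd z \<le> 1/2 then h (fst z, 2 * snd z) else k (fst z, 2 * snd z - 1)"])
      (use h k eq continuous_map_loop_concat[OF h(1) k(1)] in \<open>auto simp: loop_concat_def\<close>)
qed

lemma is_path_concat:
  assumes "is_path X p x y" "is_path X q y z"
  shows "is_path X (loop_concat p q) x z"
proof -
  have "path_homotopic X (loop_concat p q) (loop_concat p q)"
    using assms by (intro path_homotopic_concat path_homotopic_refl) (auto simp: is_path_def)
  from path_homotopic_imp_eq(3)[OF this] show ?thesis
    using assms by (auto simp: is_path_def loop_concat_def)
qed

lemma is_path_rev: "is_path X p x y \<Longrightarrow> is_path X (rev_path p) y x"
  using pathin_compose_continuous_on[of X p "\<lambda>t. 1 - t", OF _ continuous_on_op_minus]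
  by (auto simp: is_path_def rev_path_def o_def)

lemma is_path_const: "x \<in> topspace X \<Longrightarrow> is_path X (\<lambda>_. x) x x"
  by (simp add: is_path_def)

lemma is_path_sub:
  assumes "pathin X p" "0 \<le> a" "a \<le> b" "b \<le> 1"
  shows "is_path X (sub_path a b p) (p a) (p b)"
proof -
  have "a + t * (b - a) \<in> {0..1}" if "t \<in> {0..1}" for t
  proof -
    have "t * (b - a) \<le> 1 * (b - a)" "0 \<le> t * (b - a)"
      using that assms by (intro mult_right_mono mult_nonneg_nonneg; simp)+
    then show ?thesis using assms by auto
  qed
  then have "(\<lambda>t. a + t * (b - a)) ` {0..1} \<subseteq> {0..1}" by blast
  then have "pathin X (p \<circ> (\<lambda>t. a + t * (b - a)))"
    by (intro pathin_compose_continuous_on assms continuous_intros)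
  then show ?thesis by (simp add: is_path_def sub_path_def o_def)
qed

lemma sub_path_image:
  assumes "a \<le> b"
  shows "sub_path a b p ` {0..1} \<subseteq> p ` {a..b}"
proof -
  have "a + t * (b - a) \<in> {a..b}" if "t \<in> {0..1}" for t
  proof -
    have "t * (b - a) \<le> 1 * (b - a)" "0 \<le> t * (b - a)"
      using that assms by (intro mult_right_mono mult_nonneg_nonneg; simp)+
    then show ?thesis using assms by auto
  qed
  then show ?thesis unfolding sub_path_def by blast
qed

lemma rev_rev_path [simp]: "rev_path (rev_path p) = p"
  by (simp add: rev_path_def)

lemma rev_path_concat: "p 1 = q 0 \<Longrightarrow> rev_path (loop_concat p q) = loop_concat (rev_path q) (rev_path p)"
proof
  fix t :: real assume "p 1 = q 0"
  then show "rev_path (loop_concat p q) t = loop_concat (rev_path q) (rev_path p) t"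
    by (cases t "1/2 :: real" rule: linorder_cases) (auto simp: rev_path_def loop_concat_def algebra_simps)
qed

lemma continuous_on_if_le:
  fixes f g :: "real \<Rightarrow> real"
  assumes "continuous_on UNIV f" "continuous_on UNIV g" "f a = g a"
  shows "continuous_on {0..1} (\<lambda>t. if t \<le> a then f t else g t)"
proof -
  have "continuous_on {t \<in> {0..1}. t \<le> a} f" "continuous_on {t \<in> {0..1}. a \<le> t} g"
    using assms(1,2) by (auto intro: continuous_on_subset)
  then show ?thesis
    by (intro continuous_on_cases_le[where h = "\<lambda>t. t"]) (use assms(3) in auto)
qed

lemma path_homotopic_assoc:
  assumes "is_path X p x y" "is_path X q y z" "is_path X r z w"
  shows "path_homotopic X (loop_concat (loop_concat p q) r) (loop_concat p (loop_concat q r))"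
proof -
  let ?f = "loop_concat (loop_concat p q) r"
  \<comment> \<open>The reparametrization has slope 1/2, 1, 2 on [0, 1/2], [1/2, 3/4], [3/4, 1].
    Being convex, it is the maximum of its three linear pieces, which makes its continuity
    immediate.\<close>
  let ?b = "\<lambda>t::real. max (t / 2) (max (t - 1/4) (2 * t - 1))"
  have f: "pathin X ?f" using is_path_concat[OF is_path_concat[OF assms(1,2)] assms(3)] by (simp add: is_path_def)
  have "continuous_on {0..1} ?b" by (intro continuous_intros) auto
  then have "path_homotopic X (?f \<circ> id) (?f \<circ> ?b)"
    by (intro path_homotopic_reparam f) (auto simp: le_max_iff_disj)
  moreover have "?f \<circ> ?b = loop_concat p (loop_concat q r)"
  proof
    fix t :: real
    have pq: "p 1 = q 0" and qr: "q 1 = r 0" using assms by (auto simp: is_path_def)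
    consider "t < 1/2" | "t = 1/2" | "1/2 < t" "t < 3/4" | "t = 3/4" | "3/4 < t" by linarith
    then show "(?f \<circ> ?b) t = loop_concat p (loop_concat q r) t"
    proof cases
      case 1
      then have "?b t = t / 2" by simp
      then show ?thesis using 1 by (simp only: o_def) (simp add: loop_concat_def)
    next
      case 2
      then have "?b t = t / 2" by simp
      then show ?thesis using 2 pq by (simp only: o_def) (simp add: loop_concat_def)
    next
      case 3
      then have "?b t = t - 1/4" by simp
      then show ?thesis using 3 by (simp only: o_def) (simp add: loop_concat_def algebra_simps)
    next
      case 4
      then have "?b t = 1/2" by simp
      then show ?thesis using 4 qr by (simp only: o_def) (simp add: loop_concat_def)
    next
      case 5
      then have "?b t = 2 * t - 1" by simp
      then show ?thesis using 5 by (simp only: o_def) (simp add: loop_concat_def algebra_simps)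
    qed
  qed
  ultimately show ?thesis by simp
qed

lemma path_homotopic_const_left:
  assumes "is_path X p x y"
  shows "path_homotopic X (loop_concat (\<lambda>_. x) p) p"
proof -
  let ?b = "\<lambda>t::real. if t \<le> 1/2 then 0 else 2 * t - 1"
  have "path_homotopic X (p \<circ> ?b) (p \<circ> id)"
    using assms by (intro path_homotopic_reparam continuous_on_if_le)
     (auto simp: is_path_def intro!: continuous_intros)
  moreover have "p \<circ> ?b = loop_concat (\<lambda>_. x) p"
    using assms by (auto simp: loop_concat_def is_path_def fun_eq_iff)
  ultimately show ?thesis by simp
qed

lemma path_homotopic_const_right:
  assumes "is_path X p x y"
  shows "path_homotopic X (loop_concat p (\<lambda>_. y)) p"
proof -
  let ?b = "\<lambda>t::real. if t \<le> 1/2 then 2 * t else 1"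
  have "path_homotopic X (p \<circ> ?b) (p \<circ> id)"
    using assms by (intro path_homotopic_reparam continuous_on_if_le)
     (auto simp: is_path_def intro!: continuous_intros)
  moreover have "p \<circ> ?b = loop_concat p (\<lambda>_. y)"
    using assms by (auto simp: loop_concat_def is_path_def fun_eq_iff)
  ultimately show ?thesis by simp
qed

lemma path_homotopic_inverse:
  assumes "is_path X p x y"
  shows "path_homotopic X (loop_concat p (rev_path p)) (\<lambda>_. x)"
proof -
  \<comment> \<open>The path followed by its reverse is \<open>p\<close> composed with a tent
    function, and the tent contracts to 0 inside the parameter interval.\<close>
  let ?b = "\<lambda>t::real. if t \<le> 1/2 then 2 * t else 1 - (2 * t - 1)"
  have "path_homotopic X (p \<circ> ?b) (p \<circ> (\<lambda>_::real. 0))"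
    using assms by (intro path_homotopic_reparam continuous_on_if_le)
     (auto simp: is_path_def intro!: continuous_intros)
  moreover have "p \<circ> ?b = loop_concat p (rev_path p)"
    by (simp add: loop_concat_def rev_path_def fun_eq_iff)
  moreover have "p \<circ> (\<lambda>_::real. 0) = (\<lambda>_. x)" using assms by (simp add: is_path_def fun_eq_iff)
  ultimately show ?thesis by (simp only:)
qed

lemma path_homotopic_sub:
  assumes "pathin X p" "0 \<le> a" "a \<le> b" "b \<le> 1"
  shows "path_homotopic X (loop_concat (sub_path 0 a p) (sub_path a b p)) (sub_path 0 b p)"
proof -
  let ?b = "\<lambda>t::real. if t \<le> 1/2 then 2 * t * a else a + (2 * t - 1) * (b - a)"
  have *: "0 \<le> t * c \<and> t * c \<le> c" if "t \<in> {0..1}" "0 \<le> c" for t c :: real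
    using that by (auto intro: mult_left_le_one_le)
  have "path_homotopic X (p \<circ> ?b) (p \<circ> (\<lambda>t. t * b))"
  proof (intro path_homotopic_reparam continuous_on_if_le)
    show "?b ` {0..1} \<subseteq> {0..1}"
    proof safe
      fix t :: real assume "t \<in> {0..1}"
      then show "?b t \<in> {0..1}" using *[of "2 * t" a] *[of "2 * t - 1" "b - a"] assms by auto
    qed
    show "(\<lambda>t. t * b) ` {0..1} \<subseteq> {0..1}"
    proof safe
      fix t :: real assume "t \<in> {0..1}"
      then show "t * b \<in> {0..1}" using *[of t b] assms by auto
    qed
  qed (use assms in \<open>auto intro!: continuous_intros\<close>)
  moreover have "p \<circ> ?b = loop_concat (sub_path 0 a p) (sub_path a b p)"
    by (auto simp: loop_concat_def sub_path_def)
  moreover have "p \<circ> (\<lambda>t. t * b) = sub_path 0 b p" by (auto simp: sub_path_def)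
  ultimately show ?thesis by simp
qed

lemma path_homotopic_rev:
  assumes "path_homotopic X p q"
  shows "path_homotopic X (rev_path p) (rev_path q)"
proof -
  have "homotopic_with (\<lambda>r. r 0 = p 1 \<and> r 1 = p 0) (top_of_set {0..1}) X (p \<circ> (-) 1) (q \<circ> (-) 1)"
    using assms unfolding path_homotopic_def
    by (rule homotopic_with_compose_continuous_map_right) (auto intro!: continuous_intros)
  then show ?thesis by (simp add: path_homotopic_def rev_path_def o_def)
qed

lemma path_homotopic_cancel:
  assumes a: "is_path X a x y" and m: "is_path X m y z" and d: "is_path X d y w"
  shows "path_homotopic X (loop_concat (loop_concat a m) (loop_concat (rev_path m) d)) (loop_concat a d)"
proof -
  note m' = is_path_rev[OF m]
  note r = path_homotopic_refl is_path_def
  have top: "y \<in> topspace X" using a path_finish_in_topspace by (auto simp: is_path_def)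
  have "path_homotopic X (loop_concat (loop_concat a m) (loop_concat (rev_path m) d))
      (loop_concat a (loop_concat m (loop_concat (rev_path m) d)))"
    by (rule path_homotopic_assoc[OF a m is_path_concat[OF m' d]])
  also have "path_homotopic X \<dots> (loop_concat a (loop_concat (loop_concat m (rev_path m)) d))"
    using a m d m' by (intro path_homotopic_concat path_homotopic_sym[OF path_homotopic_assoc[OF m m' d]])
      (auto simp: r loop_concat_def)
  also have "path_homotopic X \<dots> (loop_concat a (loop_concat (\<lambda>_. y) d))"
    using a m d m' by (intro path_homotopic_concat path_homotopic_inverse[OF m])
      (auto simp: r loop_concat_def rev_path_def)
  also have "path_homotopic X \<dots> (loop_concat a d)"
    using a m d by (intro path_homotopic_concat path_homotopic_const_left[OF d])
      (auto simp: r loop_concat_def)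
  finally show ?thesis .
qed

section \<open>Homotopy classes of loops, and induction along an interval\<close>

lemma loop_homotopy_iff:
  "(p, q) \<in> loop_homotopy X x \<longleftrightarrow> is_path X p x x \<and> path_homotopic X p q"
proof
  assume "(p, q) \<in> loop_homotopy X x"
  then show "is_path X p x x \<and> path_homotopic X p q"
    unfolding loop_homotopy_def loops_at_def is_path_def path_homotopic_def by simp
next
  assume *: "is_path X p x x \<and> path_homotopic X p q"
  then have "q 0 = x" "q 1 = x" "pathin X q"
    using path_homotopic_imp_eq[of X p q] by (simp_all add: is_path_def)
  then show "(p, q) \<in> loop_homotopy X x"
    using * unfolding loop_homotopy_def loops_at_def is_path_def path_homotopic_def by auto
qed

lemma loops_at_iff: "p \<in> loops_at X x \<longleftrightarrow> is_path X p x x"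
  by (simp add: loops_at_def is_path_def)

lemma equiv_loop_homotopy: "equiv (loops_at X x) (loop_homotopy X x)"
proof (rule equivI)
  show "loop_homotopy X x \<subseteq> loops_at X x \<times> loops_at X x" unfolding loop_homotopy_def by blast
  show "refl_on (loops_at X x) (loop_homotopy X x)"
    by (rule refl_onI) (simp add: loop_homotopy_iff loops_at_iff path_homotopic_refl is_path_def)
  show "sym (loop_homotopy X x)"
  proof (rule symI)
    fix p q assume "(p, q) \<in> loop_homotopy X x"
    then show "(q, p) \<in> loop_homotopy X x"
      using path_homotopic_imp_eq[of X p q] by (simp add: loop_homotopy_iff is_path_def path_homotopic_sym)
  qed
  show "trans (loop_homotopy X x)"
  proof (rule transI)
    fix p q r assume "(p, q) \<in> loop_homotopy X x" "(q, r) \<in> loop_homotopy X x"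
    then show "(p, r) \<in> loop_homotopy X x"
      unfolding loop_homotopy_iff using path_homotopic_trans[of X p q r] by blast
  qed
qed

text \<open>Division of the interval into finitely many equal steps shorter than \<delta>. With a
  Lebesgue number for \<delta>, this replaces explicit subdivisions of paths and squares.\<close>

lemma interval_step_induct:
  fixes P :: "real \<Rightarrow> bool"
  assumes "0 < \<delta>" and base: "P l"
    and step: "\<And>a b. l \<le> a \<Longrightarrow> a \<le> b \<Longrightarrow> b \<le> u \<Longrightarrow> b - a < \<delta> \<Longrightarrow> P a \<Longrightarrow> P b"
    and t: "l \<le> t" "t \<le> u"
  shows "P t"
proof -
  obtain n :: nat where n: "(t - l) / \<delta> < real n" using reals_Archimedean2 by blast
  have n0: "n > 0" using n t(1) assms(1) by (cases n) (auto simp: divide_simps split: if_splits)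
  have small: "(t - l) / n < \<delta>" using n n0 assms(1) by (simp add: field_simps)
  have eq: "x + real (Suc k) * e - (x + real k * e) = e" for x e :: real and k
    by (simp add: algebra_simps)
  have "k \<le> n \<Longrightarrow> P (l + real k * ((t - l) / n))" for k
  proof (induction k)
    case (Suc k)
    have le: "real (Suc k) * ((t - l) / n) \<le> t - l"
    proof -
      have "real (Suc k) * ((t - l) / n) \<le> real n * ((t - l) / n)"
        using Suc.prems t(1) by (intro mult_right_mono) auto
      then show ?thesis using n0 by simp
    qed
    show ?case
    proof (rule step)
      show "P (l + real k * ((t - l) / n))" using Suc by simp
      show "l + real (Suc k) * ((t - l) / n) - (l + real k * ((t - l) / n)) < \<delta>"
        using small by (simp only: eq)
      show "l + real (Suc k) * ((t - l) / n) \<le> u" using le t(2) by simp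
      show "l + real k * ((t - l) / n) \<le> l + real (Suc k) * ((t - l) / n)"
        using t(1) by (intro add_left_mono mult_right_mono) auto
    qed (use t(1) in auto)
  qed (use base in simp)
  from this[of n] show ?thesis using n0 by simp
qed

section \<open>Flat bundles and their holonomy\<close>

locale open_cover =
  fixes X :: "'a topology" and I :: "'i set" and U :: "'i \<Rightarrow> 'a set"
  assumes open_U: "i \<in> I \<Longrightarrow> openin X (U i)" and cover: "topspace X \<subseteq> (\<Union>i\<in>I. U i)"
begin

text \<open>The preimages of the charts are traces on \<open>K\<close> of open sets of the ambient
  metric space, so compactness provides a uniform radius. It serves for the interval as well as for
  the square of a homotopy.\<close>

lemma lebesgue_number:
  fixes H :: "'b::metric_space \<Rightarrow> 'a"
  assumes K: "compact K" and H: "continuous_map (top_of_set K) X H"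
  obtains \<delta> where "\<delta> > 0"
    "\<And>z. z \<in> K \<Longrightarrow> \<exists>i\<in>I. \<forall>w\<in>K. dist z w < \<delta> \<longrightarrow> H w \<in> U i"
proof -
  have "\<exists>V. open V \<and> {z \<in> K. H z \<in> U i} = K \<inter> V" if "i \<in> I" for i
    using openin_continuous_map_preimage[OF H open_U[OF that]] by (simp add: openin_open)
  then obtain V where V: "\<And>i. i \<in> I \<Longrightarrow> open (V i)" "\<And>i. i \<in> I \<Longrightarrow> {z \<in> K. H z \<in> U i} = K \<inter> V i"
    by metis
  have "K \<subseteq> \<Union>(V ` I)"
  proof
    fix z assume z: "z \<in> K"
    then have "H z \<in> topspace X" using H by (auto simp: continuous_map_def)
    then obtain i where "i \<in> I" "H z \<in> U i" using cover by blast
    then show "z \<in> \<Union>(V ` I)" using V(2)[of i] z by blast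
  qed
  then obtain \<delta> where \<delta>: "0 < \<delta>" "\<And>z. z \<in> K \<Longrightarrow> \<exists>G \<in> V ` I. ball z \<delta> \<subseteq> G"
    using Heine_Borel_lemma[OF K, of "V ` I"] V(1) by blast
  show thesis
  proof (rule that[OF \<delta>(1)])
    fix z assume "z \<in> K"
    then obtain i where i: "i \<in> I" "ball z \<delta> \<subseteq> V i" using \<delta>(2) by blast
    have "H w \<in> U i" if "w \<in> K" "dist z w < \<delta>" for w
      using V(2)[OF i(1)] i(2) that by auto
    then show "\<exists>i\<in>I. \<forall>w\<in>K. dist z w < \<delta> \<longrightarrow> H w \<in> U i" using i(1) by blast
  qed
qed

text \<open>A property of times propagates along a path once it propagates along every stretch that
  lies in one chart.\<close>

lemma path_induct:
  assumes p: "pathin X p" and base: "P 0"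
    and step: "\<And>a b i. 0 \<le> a \<Longrightarrow> a \<le> b \<Longrightarrow> b \<le> 1 \<Longrightarrow> i \<in> I \<Longrightarrow> p ` {a..b} \<subseteq> U i \<Longrightarrow> P a \<Longrightarrow> P b"
    and t: "0 \<le> t" "t \<le> 1"
  shows "P t"
proof -
  obtain \<delta> where \<delta>: "\<delta> > 0"
      "\<And>z. z \<in> {0..1::real} \<Longrightarrow> \<exists>i\<in>I. \<forall>w\<in>{0..1}. dist z w < \<delta> \<longrightarrow> p w \<in> U i"
    using lebesgue_number[of "{0..1}" p] p by (auto simp: pathin_def)
  show ?thesis
  proof (rule interval_step_induct[where P = P, OF \<delta>(1) base _ t])
    fix a b assume ab: "0 \<le> a" "a \<le> b" "b \<le> 1" "b - a < \<delta>" "P a"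
    then obtain i where i: "i \<in> I" "\<forall>w\<in>{0..1}. dist a w < \<delta> \<longrightarrow> p w \<in> U i" using \<delta>(2)[of a] by auto
    have "p ` {a..b} \<subseteq> U i"
    proof safe
      fix w assume "w \<in> {a..b}"
      then show "p w \<in> U i" using i(2) ab by (auto simp: dist_real_def)
    qed
    then show "P b" using step ab i by blast
  qed
qed

end

locale cech = open_cover X I U + group G
  for X :: "'a topology" and I :: "'i set" and U and G :: "('g, 'b) monoid_scheme" (structure)
begin

text \<open>The transition functions of a flat principal bundle that is trivialized over each \<open>U i\<close>. The last
  condition says that they are locally constant, tested on paths.\<close>

definition cocycle :: "('i \<Rightarrow> 'i \<Rightarrow> 'a \<Rightarrow> 'g) \<Rightarrow> bool" where
  "cocycle g \<longleftrightarrow>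
     (\<forall>i\<in>I. \<forall>j\<in>I. \<forall>x\<in>U i \<inter> U j. g i j x \<in> carrier G) \<and>
     (\<forall>i\<in>I. \<forall>j\<in>I. \<forall>k\<in>I. \<forall>x\<in>U i \<inter> U j \<inter> U k. g i j x \<otimes> g j k x = g i k x) \<and>
     (\<forall>i\<in>I. \<forall>j\<in>I. \<forall>p. pathin X p \<longrightarrow> p ` {0..1} \<subseteq> U i \<inter> U j \<longrightarrow> g i j (p 0) = g i j (p 1))"

lemma
  assumes "cocycle g"
  shows cocycle_closed: "i \<in> I \<Longrightarrow> j \<in> I \<Longrightarrow> x \<in> U i \<Longrightarrow> x \<in> U j \<Longrightarrow> g i j x \<in> carrier G"
    and cocycle_mult: "i \<in> I \<Longrightarrow> j \<in> I \<Longrightarrow> k \<in> I \<Longrightarrow> x \<in> U i \<Longrightarrow> x \<in> U j \<Longrightarrow> x \<in> U k \<Longrightarrow>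
      g i j x \<otimes> g j k x = g i k x"
    and cocycle_path: "i \<in> I \<Longrightarrow> j \<in> I \<Longrightarrow> pathin X p \<Longrightarrow> p ` {0..1} \<subseteq> U i \<inter> U j \<Longrightarrow> g i j (p 0) = g i j (p 1)"
  using assms unfolding cocycle_def by blast+

lemma cocycle_same:
  assumes "cocycle g" "i \<in> I" "x \<in> U i"
  shows "g i i x = \<one>"
  using cocycle_mult[OF assms(1,2,2,2,3,3,3)] cocycle_closed[OF assms(1,2,2,3,3)] by simp

lemma cocycle_sub_path:
  assumes "cocycle g" "i \<in> I" "j \<in> I" "pathin X p" "0 \<le> a" "a \<le> b" "b \<le> 1"
    and "p ` {a..b} \<subseteq> U i" "p ` {a..b} \<subseteq> U j"
  shows "g i j (p a) = g i j (p b)"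
proof -
  note q = is_path_sub[OF assms(4-7)]
  have "sub_path a b p ` {0..1} \<subseteq> U i \<inter> U j"
    using sub_path_image[OF assms(6), of p] assms(8,9) by blast
  from cocycle_path[OF assms(1-3) _ this] q show ?thesis by (simp add: is_path_def)
qed

text \<open>A parallel section along \<open>p\<close> up to the time \<open>b\<close>: \<open>s t i\<close> is its value at \<open>p t\<close> in the chart \<open>U i\<close>.\<close>

definition parallel :: "('i \<Rightarrow> 'i \<Rightarrow> 'a \<Rightarrow> 'g) \<Rightarrow> (real \<Rightarrow> 'a) \<Rightarrow> real \<Rightarrow> (real \<Rightarrow> 'i \<Rightarrow> 'g) \<Rightarrow> bool" where
  "parallel g p b s \<longleftrightarrow>
     (\<forall>t\<in>{0..b}. \<forall>i\<in>I. p t \<in> U i \<longrightarrow> s t i \<in> carrier G) \<and>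
     (\<forall>t\<in>{0..b}. \<forall>i\<in>I. \<forall>j\<in>I. p t \<in> U i \<longrightarrow> p t \<in> U j \<longrightarrow> s t j = s t i \<otimes> g i j (p t)) \<and>
     (\<forall>a c. \<forall>i\<in>I. 0 \<le> a \<longrightarrow> a \<le> c \<longrightarrow> c \<le> b \<longrightarrow> p ` {a..c} \<subseteq> U i \<longrightarrow> s a i = s c i)"

lemma
  assumes "parallel g p b s"
  shows parallel_closed: "0 \<le> t \<Longrightarrow> t \<le> b \<Longrightarrow> i \<in> I \<Longrightarrow> p t \<in> U i \<Longrightarrow> s t i \<in> carrier G"
    and parallel_change: "0 \<le> t \<Longrightarrow> t \<le> b \<Longrightarrow> i \<in> I \<Longrightarrow> j \<in> I \<Longrightarrow> p t \<in> U i \<Longrightarrow> p t \<in> U j \<Longrightarrow>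
      s t j = s t i \<otimes> g i j (p t)"
    and parallel_const: "0 \<le> a \<Longrightarrow> a \<le> c \<Longrightarrow> c \<le> b \<Longrightarrow> i \<in> I \<Longrightarrow> p ` {a..c} \<subseteq> U i \<Longrightarrow> s a i = s c i"
proof -
  note 1 = assms[unfolded parallel_def, THEN conjunct1]
    and 2 = assms[unfolded parallel_def, THEN conjunct2, THEN conjunct1]
    and 3 = assms[unfolded parallel_def, THEN conjunct2, THEN conjunct2]
  show "s t i \<in> carrier G" if "0 \<le> t" "t \<le> b" "i \<in> I" "p t \<in> U i"
    using 1[rule_format, of t i] that by simp
  show "s t j = s t i \<otimes> g i j (p t)" if "0 \<le> t" "t \<le> b" "i \<in> I" "j \<in> I" "p t \<in> U i" "p t \<in> U j"
    by (rule 2[rule_format]) (use that in simp_all)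
  show "s a i = s c i" if "0 \<le> a" "a \<le> c" "c \<le> b" "i \<in> I" "p ` {a..c} \<subseteq> U i"
    using 3 that by blast
qed

text \<open>While the path stays in \<open>U i\<close>, the section has to be constant in that
  chart, so its value in any other chart \<open>j\<close> is forced to be \<open>s a i\<close>
  changed by \<open>g i j\<close>.\<close>

lemma parallel_extend:
  assumes g: "cocycle g" and p: "pathin X p" and s: "parallel g p a s"
    and ab: "0 \<le> a" "a \<le> b" "b \<le> 1" and i: "i \<in> I" "p ` {a..b} \<subseteq> U i"
  shows "parallel g p b (\<lambda>t j. if t \<le> a then s t j else s a i \<otimes> g i j (p t))" (is "parallel g p b ?s")
proof -
  have pa: "p a \<in> U i" using i ab by auto
  have sai: "s a i \<in> carrier G" using parallel_closed[OF s] ab i(1) pa by simp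
  have right: "?s t j = s a i \<otimes> g i j (p t)" "p t \<in> U i" if "a \<le> t" "t \<le> b" "j \<in> I" "p t \<in> U j" for t j
  proof -
    show "p t \<in> U i" using that i(2) by auto
    show "?s t j = s a i \<otimes> g i j (p t)"
    proof (cases "t = a")
      case True
      then show ?thesis using parallel_change[OF s, of a i j] that i(1) pa ab by simp
    qed (use that in auto)
  qed
  have const_right: "?s c j = ?s d j" if "a \<le> c" "c \<le> d" "d \<le> b" "j \<in> I" "p ` {c..d} \<subseteq> U j" for c d j
  proof -
    have "p ` {c..d} \<subseteq> U i" using that i(2) by (auto simp: image_subset_iff)
    then have "g i j (p c) = g i j (p d)"
      using that ab by (intro cocycle_sub_path[OF g i(1) _ p]) auto
    moreover have "p c \<in> U j" "p d \<in> U j" using that by auto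
    ultimately show ?thesis using right(1)[of c j] right(1)[of d j] that by simp
  qed
  show ?thesis unfolding parallel_def
  proof (intro conjI ballI allI impI)
    fix t j assume tj: "t \<in> {0..b}" "j \<in> I" "p t \<in> U j"
    show "?s t j \<in> carrier G"
    proof (cases "t \<le> a")
      case True then show ?thesis using parallel_closed[OF s] tj by simp
    next
      case False
      then have "p t \<in> U i" using right(2)[of t j] tj by simp
      then show ?thesis using False sai cocycle_closed[OF g i(1) tj(2) _ tj(3)] by simp
    qed
  next
    fix t j k assume tj: "t \<in> {0..b}" "j \<in> I" "k \<in> I" "p t \<in> U j" "p t \<in> U k"
    show "?s t k = ?s t j \<otimes> g j k (p t)"
    proof (cases "t \<le> a")
      case True then show ?thesis using parallel_change[OF s, of t j k] tj by simp
    next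
      case False
      then have ti: "p t \<in> U i" using right(2)[of t j] tj by simp
      then show ?thesis using False sai cocycle_closed[OF g] cocycle_mult[OF g i(1) tj(2,3) ti tj(4,5)] tj i(1)
        by (simp add: m_assoc)
    qed
  next
    fix c d j assume cd: "j \<in> I" "0 \<le> c" "c \<le> d" "d \<le> b" "p ` {c..d} \<subseteq> U j"
    consider "d \<le> a" | "a \<le> c" | "c < a" "a < d" by linarith
    then show "?s c j = ?s d j"
    proof cases
      case 1 then show ?thesis using parallel_const[OF s, of c d j] cd by simp
    next
      case 2 then show ?thesis using const_right[of c d j] cd by simp
    next
      \<comment> \<open>The interval straddles the junction \<open>a\<close>, where the old section
        and its extension agree.\<close>
      case 3
      have "?s c j = ?s a j" using parallel_const[OF s, of c a j] 3 cd by (simp add: image_subset_iff)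
      also have "?s a j = ?s d j" using 3 cd by (intro const_right) (auto simp: image_subset_iff)
      finally show ?thesis .
    qed
  qed
qed

lemma parallel_exists:
  assumes g: "cocycle g" and p: "pathin X p" and i: "i0 \<in> I" "p 0 \<in> U i0" and u: "u \<in> carrier G"
  obtains s where "parallel g p 1 s" "s 0 i0 = u"
proof -
  have "\<exists>s. parallel g p 1 s \<and> s 0 i0 = u"
  proof (rule path_induct[where P = "\<lambda>b. \<exists>s. parallel g p b s \<and> s 0 i0 = u" and t = 1, OF p])
    \<comment> \<open>At the single time 0, the value in one chart fixes the values in all
      others.\<close>
    let ?s = "\<lambda>t j. u \<otimes> g i0 j (p 0)"
    have "parallel g p 0 ?s"
      unfolding parallel_def
    proof (intro conjI ballI allI impI)
      fix t j k assume tj: "t \<in> {0..0::real}" "j \<in> I" "k \<in> I" "p t \<in> U j" "p t \<in> U k"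
      then have "t = 0" by simp
      with tj show "?s t k = ?s t j \<otimes> g j k (p t)"
        using u i cocycle_closed[OF g] cocycle_mult[OF g, of i0 j k "p 0"] by (simp add: m_assoc)
    qed (use u i cocycle_closed[OF g] in auto)
    moreover have "?s 0 i0 = u" using cocycle_same[OF g i] u by simp
    ultimately show "\<exists>s. parallel g p 0 s \<and> s 0 i0 = u" by blast
  next
    fix a b i assume ab: "0 \<le> a" "a \<le> b" "b \<le> 1" "i \<in> I" "p ` {a..b} \<subseteq> U i"
      and "\<exists>s. parallel g p a s \<and> s 0 i0 = u"
    then obtain s where s: "parallel g p a s" "s 0 i0 = u" by blast
    show "\<exists>s. parallel g p b s \<and> s 0 i0 = u"
      using parallel_extend[OF g p s(1) ab] s(2) ab(1)
      by (intro exI[of _ "\<lambda>t j. if t \<le> a then s t j else s a i \<otimes> g i j (p t)"]) simp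
  qed simp_all
  then show thesis using that by blast
qed

lemma parallel_unique:
  assumes g: "cocycle g" and p: "pathin X p" and s: "parallel g p 1 s" "parallel g p 1 s'"
    and i: "i0 \<in> I" "p 0 \<in> U i0" "s 0 i0 = s' 0 i0" and t: "0 \<le> t" "t \<le> 1" "j \<in> I" "p t \<in> U j"
  shows "s t j = s' t j"
proof -
  have "\<forall>j\<in>I. p t \<in> U j \<longrightarrow> s t j = s' t j"
  proof (rule path_induct[where P = "\<lambda>t. \<forall>j\<in>I. p t \<in> U j \<longrightarrow> s t j = s' t j", OF p _ _ t(1,2)])
    show "\<forall>j\<in>I. p 0 \<in> U j \<longrightarrow> s 0 j = s' 0 j"
    proof (intro ballI impI)
      fix j assume "j \<in> I" "p 0 \<in> U j"
      then show "s 0 j = s' 0 j"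
        using parallel_change[OF s(1), of 0 i0 j] parallel_change[OF s(2), of 0 i0 j] i by simp
    qed
  next
    fix a b i assume ab: "0 \<le> a" "a \<le> b" "b \<le> 1" "i \<in> I" "p ` {a..b} \<subseteq> U i"
      and IH: "\<forall>j\<in>I. p a \<in> U j \<longrightarrow> s a j = s' a j"
    have pi: "p a \<in> U i" "p b \<in> U i" using ab by auto
    have "s b i = s' b i"
      using parallel_const[OF s(1), of a b i] parallel_const[OF s(2), of a b i] IH ab pi by simp
    show "\<forall>j\<in>I. p b \<in> U j \<longrightarrow> s b j = s' b j"
    proof (intro ballI impI)
      fix j assume "j \<in> I" "p b \<in> U j"
      then show "s b j = s' b j"
        using parallel_change[OF s(1), of b i j] parallel_change[OF s(2), of b i j] ab pi \<open>s b i = s' b i\<close> by simp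
    qed
  qed
  then show ?thesis using t by blast
qed

text \<open>Transition functions act on the right, so left translation preserves parallel sections.
  This makes transport independent of the initial value.\<close>

lemma parallel_scale:
  assumes g: "cocycle g" and s: "parallel g p b s" and u: "u \<in> carrier G"
  shows "parallel g p b (\<lambda>t i. u \<otimes> s t i)"
  unfolding parallel_def
proof (intro conjI ballI allI impI)
  fix t j k assume tj: "t \<in> {0..b}" "j \<in> I" "k \<in> I" "p t \<in> U j" "p t \<in> U k"
  then show "u \<otimes> s t k = u \<otimes> s t j \<otimes> g j k (p t)"
    using u cocycle_closed[OF g] parallel_closed[OF s, of t j] parallel_change[OF s, of t j k]
    by (simp add: m_assoc)
next
  fix c d j assume "j \<in> I" "0 \<le> c" "c \<le> d" "d \<le> b" "p ` {c..d} \<subseteq> U j"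
  then show "u \<otimes> s c j = u \<otimes> s d j" using parallel_const[OF s, of c d j] by simp
qed (use u parallel_closed[OF s] in auto)

text \<open>A parallel section is arbitrary in charts that do not contain the current point, hence
  the choice. By \<open>parallel_unique\<close> the value at time 1 is well defined as soon as
  \<open>p 0\<close> lies in \<open>U i\<close> and \<open>p 1\<close> in
  \<open>U j\<close>.\<close>

definition holonomy :: "('i \<Rightarrow> 'i \<Rightarrow> 'a \<Rightarrow> 'g) \<Rightarrow> (real \<Rightarrow> 'a) \<Rightarrow> 'i \<Rightarrow> 'i \<Rightarrow> 'g" where
  "holonomy g p i j = (SOME s. parallel g p 1 s \<and> s 0 i = \<one>) 1 j"

lemma holonomy_eq:
  assumes g: "cocycle g" and p: "pathin X p" and s: "parallel g p 1 s"
    and i: "i \<in> I" "p 0 \<in> U i" and j: "j \<in> I" "p 1 \<in> U j"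
  shows "s 1 j = s 0 i \<otimes> holonomy g p i j" "holonomy g p i j \<in> carrier G"
proof -
  define s0 where "s0 = (SOME s. parallel g p 1 s \<and> s 0 i = \<one>)"
  have s0: "parallel g p 1 s0" "s0 0 i = \<one>"
    using someI_ex[of "\<lambda>s. parallel g p 1 s \<and> s 0 i = \<one>"] parallel_exists[OF g p i one_closed]
    unfolding s0_def by blast+
  have c: "s 0 i \<in> carrier G" using parallel_closed[OF s] i by simp
  have "s 1 j = s 0 i \<otimes> s0 1 j"
    using parallel_unique[OF g p s parallel_scale[OF g s0(1) c] i _ _ _ j] s0(2) c by simp
  then show "s 1 j = s 0 i \<otimes> holonomy g p i j" by (simp add: holonomy_def s0_def)
  show "holonomy g p i j \<in> carrier G"
    using parallel_closed[OF s0(1), of 1 j] j by (simp add: holonomy_def s0_def)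
qed

lemma holonomy_closed:
  assumes "cocycle g" "pathin X p" "i \<in> I" "p 0 \<in> U i" "j \<in> I" "p 1 \<in> U j"
  shows "holonomy g p i j \<in> carrier G"
  using parallel_exists[OF assms(1-4) one_closed] holonomy_eq(2)[OF assms(1,2) _ assms(3-6)] by blast

text \<open>Inside one chart \<open>k\<close> the section is constant, and only the changes of chart
  at the two ends remain.\<close>

lemma holonomy_local:
  assumes g: "cocycle g" and p: "pathin X p" "p ` {0..1} \<subseteq> U k" and k: "k \<in> I"
    and i: "i \<in> I" "p 0 \<in> U i" and j: "j \<in> I" "p 1 \<in> U j"
  shows "holonomy g p i j = g i k (p 0) \<otimes> g k j (p 1)"
proof -
  have pk: "p t \<in> U k" if "0 \<le> t" "t \<le> 1" for t using p(2) that by auto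
  let ?s = "\<lambda>t j. g k j (p t)"
  have s: "parallel g p 1 ?s" unfolding parallel_def
  proof (intro conjI ballI allI impI)
    fix t i j assume tj: "t \<in> {0..1::real}" "i \<in> I" "j \<in> I" "p t \<in> U i" "p t \<in> U j"
    then show "?s t j = ?s t i \<otimes> g i j (p t)"
      using cocycle_mult[OF g k tj(2,3) pk] by simp
  next
    fix c d i assume "i \<in> I" "0 \<le> c" "c \<le> d" "d \<le> (1::real)" "p ` {c..d} \<subseteq> U i"
    then show "?s c i = ?s d i"
      using p(2) by (intro cocycle_sub_path[OF g k _ p(1)]) (auto simp: image_subset_iff)
  qed (use cocycle_closed[OF g k] pk in auto)
  note h = holonomy_eq[OF g p(1) s i j]
  have "g i k (p 0) \<otimes> g k j (p 1) = g i k (p 0) \<otimes> (g k i (p 0) \<otimes> holonomy g p i j)"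
    using h by simp
  also have "\<dots> = (g i k (p 0) \<otimes> g k i (p 0)) \<otimes> holonomy g p i j"
    using cocycle_closed[OF g] k i pk h(2) by (simp add: m_assoc)
  also have "g i k (p 0) \<otimes> g k i (p 0) = \<one>"
    using cocycle_mult[OF g i(1) k i(1) i(2) _ i(2)] cocycle_same[OF g i] pk by simp
  finally show ?thesis using h(2) by simp
qed

text \<open>A section along the concatenation restricts, after rescaling the time, to sections along
  both halves; its value at time 1/2 is the end of the first transport and the start of the
  second.\<close>

lemma holonomy_concat:
  assumes g: "cocycle g" and p: "is_path X p x y" and q: "is_path X q y z"
    and i: "i \<in> I" "x \<in> U i" and j: "j \<in> I" "y \<in> U j" and k: "k \<in> I" "z \<in> U k"
  shows "holonomy g (loop_concat p q) i k = holonomy g p i j \<otimes> holonomy g q j k"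
proof -
  let ?r = "loop_concat p q"
  have r: "is_path X ?r x z" by (rule is_path_concat[OF p q])
  note P = p[unfolded is_path_def] and Q = q[unfolded is_path_def] and R = r[unfolded is_path_def]
  obtain s where s: "parallel g ?r 1 s" "s 0 i = \<one>"
    using parallel_exists[OF g, of ?r i \<one>] R i by auto
  have rp: "?r (t / 2) = p t" if "t \<le> 1" for t using that by (simp add: loop_concat_def)
  have rq: "?r ((1 + t) / 2) = q t" if "0 \<le> t" for t
    using that P Q by (cases "t = 0") (auto simp: loop_concat_def add_divide_distrib)
  have s1: "parallel g p 1 (\<lambda>t. s (t / 2))" unfolding parallel_def
  proof (intro conjI ballI allI impI)
    fix c d i assume cd: "i \<in> I" "0 \<le> c" "c \<le> d" "d \<le> (1::real)" "p ` {c..d} \<subseteq> U i"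
    have "?r ` {c/2..d/2} \<subseteq> U i"
    proof safe
      fix t assume "t \<in> {c/2..d/2}"
      then show "?r t \<in> U i" using cd rp[of "2 * t"] by (auto simp: image_subset_iff)
    qed
    then show "s (c / 2) i = s (d / 2) i" using cd by (intro parallel_const[OF s(1)]) auto
  next
    fix t i assume "t \<in> {0..1::real}" "i \<in> I" "p t \<in> U i"
    then show "s (t / 2) i \<in> carrier G" using parallel_closed[OF s(1), of "t / 2" i] rp[of t] by simp
  next
    fix t i j assume "t \<in> {0..1::real}" "i \<in> I" "j \<in> I" "p t \<in> U i" "p t \<in> U j"
    then show "s (t / 2) j = s (t / 2) i \<otimes> g i j (p t)"
      using parallel_change[OF s(1), of "t / 2" i j] rp[of t] by simp
  qed
  have s2: "parallel g q 1 (\<lambda>t. s ((1 + t) / 2))" unfolding parallel_def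
  proof (intro conjI ballI allI impI)
    fix c d i assume cd: "i \<in> I" "0 \<le> c" "c \<le> d" "d \<le> (1::real)" "q ` {c..d} \<subseteq> U i"
    have "?r ` {(1+c)/2..(1+d)/2} \<subseteq> U i"
    proof safe
      fix t assume "t \<in> {(1+c)/2..(1+d)/2}"
      then show "?r t \<in> U i" using cd rq[of "2 * t - 1"] by (auto simp: image_subset_iff)
    qed
    then show "s ((1+c) / 2) i = s ((1+d) / 2) i" using cd by (intro parallel_const[OF s(1)]) auto
  next
    fix t i assume "t \<in> {0..1::real}" "i \<in> I" "q t \<in> U i"
    then show "s ((1 + t) / 2) i \<in> carrier G" using parallel_closed[OF s(1), of "(1 + t) / 2" i] rq[of t] by simp
  next
    fix t i j assume "t \<in> {0..1::real}" "i \<in> I" "j \<in> I" "q t \<in> U i" "q t \<in> U j"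
    then show "s ((1 + t) / 2) j = s ((1 + t) / 2) i \<otimes> g i j (q t)"
      using parallel_change[OF s(1), of "(1 + t) / 2" i j] rq[of t] by simp
  qed
  have ends: "?r 0 \<in> U i" "?r 1 \<in> U k" "p 0 \<in> U i" "p 1 \<in> U j" "q 0 \<in> U j" "q 1 \<in> U k"
    using P Q R i j k by auto
  have "s 1 k = holonomy g ?r i k"
    using holonomy_eq[OF g conjunct1[OF R] s(1) i(1) ends(1) k(1) ends(2)] s(2) by simp
  moreover have "s (1/2) j = holonomy g p i j"
    using holonomy_eq[OF g conjunct1[OF P] s1 i(1) ends(3) j(1) ends(4)] s(2) by simp
  moreover have "s 1 k = s (1/2) j \<otimes> holonomy g q j k"
    using holonomy_eq(1)[OF g conjunct1[OF Q] s2 j(1) ends(5) k(1) ends(6)] by simp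
  ultimately show ?thesis by simp
qed

text \<open>A parallel section \<open>s r\<close> is chosen along each path of the homotopy, with no
  regularity in \<open>r\<close>. Stepping through \<open>t\<close>, one shows that
  \<open>s r t j\<close> does not change while \<open>r\<close> varies and \<open>H (r, t)\<close>
  stays in \<open>U j\<close>. At \<open>t = 1\<close> the point is fixed, so the first and the last
  holonomy agree. Rectangles with sides below \<open>\<epsilon>/2\<close> lie in one chart because
  the distance in the square is at most the sum of the coordinate distances.\<close>

lemma holonomy_homotopic:
  assumes g: "cocycle g" and pq: "path_homotopic X p q"
    and i: "i \<in> I" "p 0 \<in> U i" and j: "j \<in> I" "p 1 \<in> U j"
  shows "holonomy g p i j = holonomy g q i j"
proof -
  let ?K = "{0..1} \<times> {0..1::real} :: (real \<times> real) set"
  obtain H :: "real \<times> real \<Rightarrow> 'a" where H0: "continuous_map (prod_topology (top_of_set {0..1}) (top_of_set {0..1})) X H"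
      "\<forall>x. H (0, x) = p x" "\<forall>x. H (1, x) = q x"
      "\<forall>t\<in>{0..1}. H (t, 0) = p 0 \<and> H (t, 1) = p 1"
    using pq unfolding path_homotopic_def homotopic_with_def by (elim exE conjE) (rule that; assumption)
  from H0(1) have H: "continuous_map (top_of_set ?K) X H" by (simp only: prod_topology_subtopology_eu)
  have hpath: "pathin X (\<lambda>t. H (r, t))" if "r \<in> {0..1}" for r
  proof -
    have "continuous_map (top_of_set {0..1}) (top_of_set ?K) (Pair r)"
      using that by (auto intro!: continuous_intros)
    from continuous_map_compose[OF this H] show ?thesis by (simp add: pathin_def o_def)
  qed
  have vpath: "pathin X (\<lambda>r. H (r, t))" if "t \<in> {0..1}" for t
  proof -
    have "continuous_map (top_of_set {0..1}) (top_of_set ?K) (\<lambda>r. (r, t))"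
      using that by (auto intro!: continuous_intros)
    from continuous_map_compose[OF this H] show ?thesis by (simp add: pathin_def o_def)
  qed
  have "\<exists>s. parallel g (\<lambda>t. H (r, t)) 1 s \<and> s 0 i = \<one>" if "r \<in> {0..1}" for r
    using parallel_exists[OF g hpath[OF that] i(1) _ one_closed] i(2) H0(4) that by auto
  then obtain s where s: "\<And>r. r \<in> {0..1} \<Longrightarrow> parallel g (\<lambda>t. H (r, t)) 1 (s r)"
      "\<And>r. r \<in> {0..1} \<Longrightarrow> s r 0 i = \<one>" by metis
  obtain \<epsilon> where \<epsilon>: "\<epsilon> > 0" "\<And>z. z \<in> ?K \<Longrightarrow> \<exists>i\<in>I. \<forall>w\<in>?K. dist z w < \<epsilon> \<longrightarrow> H w \<in> U i"
    by (rule lebesgue_number[OF _ H]) (auto intro: compact_Times)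
  have near: "\<exists>k\<in>I. \<forall>r''\<in>{r..r'}. \<forall>t''\<in>{t..t'}. H (r'', t'') \<in> U k"
    if "0 \<le> r" "r \<le> r'" "r' \<le> 1" "r' - r < \<epsilon>/2" "0 \<le> t" "t \<le> t'" "t' \<le> 1" "t' - t < \<epsilon>/2" for r r' t t'
  proof -
    have "(r, t) \<in> ?K" using \<open>0 \<le> r\<close> \<open>r \<le> r'\<close> \<open>r' \<le> 1\<close> \<open>0 \<le> t\<close> \<open>t \<le> t'\<close> \<open>t' \<le> 1\<close> by simp
    from \<epsilon>(2)[OF this] obtain k where k: "k \<in> I" "\<forall>w\<in>?K. dist (r, t) w < \<epsilon> \<longrightarrow> H w \<in> U k" by blast
    have "H (r'', t'') \<in> U k" if "r'' \<in> {r..r'}" "t'' \<in> {t..t'}" for r'' t''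
    proof -
      have "dist (r, t) (r'', t'') \<le> dist r r'' + dist t t''"
        unfolding dist_prod_def by (simp add: sqrt_sum_squares_le_sum)
      also have "\<dots> < \<epsilon>" using that \<open>r' - r < \<epsilon>/2\<close> \<open>t' - t < \<epsilon>/2\<close> by (auto simp: dist_real_def)
      finally show ?thesis using k(2) that \<open>0 \<le> r\<close> \<open>r' \<le> 1\<close> \<open>0 \<le> t\<close> \<open>t' \<le> 1\<close> by auto
    qed
    then show ?thesis using k(1) by blast
  qed
  let ?Q = "\<lambda>t. \<forall>a c. \<forall>j\<in>I. 0 \<le> a \<longrightarrow> a \<le> c \<longrightarrow> c \<le> 1 \<longrightarrow> (\<forall>r\<in>{a..c}. H (r, t) \<in> U j) \<longrightarrow> s a t j = s c t j"
  have "?Q 1"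
  proof (rule interval_step_induct[where P = ?Q and l = 0 and u = 1 and \<delta> = "\<epsilon>/2"])
    show "?Q 0"
    proof (intro allI ballI impI)
      fix a c j assume ac: "j \<in> I" "0 \<le> a" "a \<le> c" "c \<le> 1" "\<forall>r\<in>{a..c}. H (r, 0) \<in> U j"
      have "s r 0 j = g i j (p 0)" if "r \<in> {a..c}" for r
      proof -
        have r: "r \<in> {0..1}" using that ac by auto
        have "p 0 \<in> U j" using ac H0(4) r that by metis
        then show ?thesis
          using parallel_change[OF s(1)[OF r], of 0 i j] s(2)[OF r] H0(4) r i ac(1) cocycle_closed[OF g i(1) ac(1) i(2)] by auto
      qed
      then show "s a 0 j = s c 0 j" using ac by simp
    qed
  next
    fix t t' :: real assume t: "0 \<le> t" "t \<le> t'" "t' \<le> 1" "t' - t < \<epsilon>/2" and IH: "?Q t"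
    show "?Q t'"
    proof (intro allI ballI impI)
      fix a c j assume ac: "j \<in> I" "0 \<le> a" "a \<le> c" "c \<le> 1" and Hj: "\<forall>r\<in>{a..c}. H (r, t') \<in> U j"
      show "s a t' j = s c t' j"
      proof (rule interval_step_induct[where P = "\<lambda>r. s a t' j = s r t' j" and l = a and u = c and \<delta> = "\<epsilon>/2"])
        \<comment> \<open>In the chart \<open>k\<close> of the small rectangle the values at time
          \<open>t'\<close> equal those at time \<open>t\<close>, which agree for \<open>r\<close>
          and \<open>r'\<close> by \<open>IH\<close>; the change from \<open>k\<close> to
          \<open>j\<close> is constant along the segment from \<open>r\<close> to
          \<open>r'\<close>.\<close>
        fix r r' assume r: "a \<le> r" "r \<le> r'" "r' \<le> c" "r' - r < \<epsilon>/2" and eq: "s a t' j = s r t' j"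
        obtain k where k: "k \<in> I" and Hk: "\<And>x y. x \<in> {r..r'} \<Longrightarrow> y \<in> {t..t'} \<Longrightarrow> H (x, y) \<in> U k"
          using near[of r r' t t'] r t ac by auto
        have up: "s x t k = s x t' k" "s x t' j = s x t' k \<otimes> g k j (H (x, t'))" if x: "x \<in> {r..r'}" for x
        proof -
          have x1: "x \<in> {0..1}" using x r ac by auto
          show "s x t k = s x t' k"
            using t Hk[OF x] by (intro parallel_const[OF s(1)[OF x1] _ _ _ k]) (auto simp: image_subset_iff)
          show "s x t' j = s x t' k \<otimes> g k j (H (x, t'))"
            using t Hk[OF x, of t'] Hj x r ac by (intro parallel_change[OF s(1)[OF x1] _ _ k ac(1)]) auto
        qed
        have "s r t k = s r' t k" using IH[rule_format, OF k, of r r'] Hk r t ac by auto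
        moreover have "g k j (H (r, t')) = g k j (H (r', t'))"
          using r t ac Hk Hj by (intro cocycle_sub_path[OF g k ac(1) vpath[of t']]) (auto simp: image_subset_iff)
        ultimately show "s a t' j = s r' t' j" using eq up[of r] up[of r'] r by auto
      qed (use \<epsilon>(1) ac in auto)
    qed
  qed (use \<epsilon>(1) in auto)
  then have "s 0 1 j = s 1 1 j" using j H0(4) by auto
  moreover have "s r 1 j = holonomy g (\<lambda>t. H (r, t)) i j" if "r \<in> {0..1}" for r
  proof -
    have "H (r, 0) \<in> U i" "H (r, 1) \<in> U j" using i j H0(4) that by auto
    from holonomy_eq[OF g hpath[OF that] s(1)[OF that] i(1) this(1) j(1) this(2)]
    show ?thesis using s(2)[OF that] by simp
  qed
  ultimately show ?thesis using H0(2,3) by simp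
qed

end

section \<open>Cocycles and homomorphisms of the fundamental group\<close>

definition loop_class :: "'a topology \<Rightarrow> 'a \<Rightarrow> (real \<Rightarrow> 'a) \<Rightarrow> (real \<Rightarrow> 'a) set" where
  "loop_class X x p = loop_homotopy X x `` {p}"

lemma loop_class_eq_iff:
  assumes "is_path X p x x" "is_path X q x x"
  shows "loop_class X x p = loop_class X x q \<longleftrightarrow> path_homotopic X p q"
proof -
  have "loop_class X x p = loop_class X x q \<longleftrightarrow> (p, q) \<in> loop_homotopy X x"
    unfolding loop_class_def
    by (rule eq_equiv_class_iff[OF equiv_loop_homotopy]) (simp_all add: loops_at_iff assms)
  then show ?thesis using assms by (simp add: loop_homotopy_iff)
qed

lemma loop_class_in_carrier:
  "is_path X p x x \<Longrightarrow> loop_class X x p \<in> carrier (fundamental_group X x)"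
  by (simp add: fundamental_group_def loop_class_def quotientI loops_at_iff)

lemma in_loop_class: "is_path X p x x \<Longrightarrow> p \<in> loop_class X x p"
  by (simp add: loop_class_def loop_homotopy_iff path_homotopic_refl is_path_def)

lemma loop_class_cases:
  assumes "A \<in> carrier (fundamental_group X x)"
  obtains p where "is_path X p x x" "A = loop_class X x p"
  using assms by (auto simp: fundamental_group_def loop_class_def loops_at_iff elim!: quotientE)

lemma some_in_loop_class:
  assumes "A \<in> carrier (fundamental_group X x)"
  shows "is_path X (SOME p. p \<in> A) x x" "A = loop_class X x (SOME p. p \<in> A)"
proof -
  obtain p where p: "is_path X p x x" "A = loop_class X x p" by (rule loop_class_cases[OF assms])
  have "(SOME p. p \<in> A) \<in> A" using in_loop_class[OF p(1)] p(2) by (metis someI)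
  then have q: "path_homotopic X p (SOME p. p \<in> A)"
    using p by (simp add: loop_class_def loop_homotopy_iff)
  note e = path_homotopic_imp_eq[OF q]
  show r: "is_path X (SOME p. p \<in> A) x x" using e p(1) by (simp add: is_path_def)
  show "A = loop_class X x (SOME p. p \<in> A)"
    using loop_class_eq_iff[OF p(1) r] q p(2) by simp
qed

text \<open>The product of two classes is defined as the image of all concatenations of
  representatives under the homotopy relation, that is, a union of classes. These classes all
  coincide.\<close>

lemma loop_class_mult:
  assumes p: "is_path X p x x" and q: "is_path X q x x"
  shows "loop_class X x p \<otimes>\<^bsub>fundamental_group X x\<^esub> loop_class X x q = loop_class X x (loop_concat p q)"
proof -
  have pq: "is_path X (loop_concat p q) x x" by (rule is_path_concat[OF p q])
  have "loop_class X x (loop_concat p' q') = loop_class X x (loop_concat p q)"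
    if "p' \<in> loop_class X x p" "q' \<in> loop_class X x q" for p' q'
  proof -
    have h: "path_homotopic X p p'" "path_homotopic X q q'"
      using that by (auto simp: loop_class_def loop_homotopy_iff)
    have "path_homotopic X (loop_concat p q) (loop_concat p' q')"
      using p q by (intro path_homotopic_concat h) (simp add: is_path_def)
    moreover have "is_path X (loop_concat p' q') x x"
      using path_homotopic_imp_eq[OF h(1)] path_homotopic_imp_eq[OF h(2)] p q
      by (intro is_path_concat[of _ _ _ x]) (simp_all add: is_path_def)
    ultimately show ?thesis using loop_class_eq_iff[OF pq] by blast
  qed
  then have "loop_homotopy X x `` {loop_concat p' q' | p' q'. p' \<in> loop_class X x p \<and> q' \<in> loop_class X x q}
      = loop_class X x (loop_concat p q)"
    using in_loop_class[OF p] in_loop_class[OF q] unfolding loop_class_def by blast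
  then show ?thesis by (simp add: fundamental_group_def)
qed

section \<open>Comparing paths by a homomorphism of the fundamental group\<close>

locale loop_hom = group G for G :: "('g, 'b) monoid_scheme" (structure) +
  fixes X :: "'a topology" and x0 :: 'a and \<rho>
  assumes hom: "\<rho> \<in> hom (fundamental_group X x0) G"
begin

text \<open>For two reference paths to the same point, this is the transition function between the
  two trivializations that they induce on the flat bundle of \<rho>.\<close>

definition path_diff :: "(real \<Rightarrow> 'a) \<Rightarrow> (real \<Rightarrow> 'a) \<Rightarrow> 'g" where
  "path_diff a b = \<rho> (loop_class X x0 (loop_concat a (rev_path b)))"

lemma path_diff_closed:
  assumes "is_path X a x0 x" "is_path X b x0 x"
  shows "path_diff a b \<in> carrier G"
  using hom loop_class_in_carrier[OF is_path_concat[OF assms(1) is_path_rev[OF assms(2)]]]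
  by (auto simp: hom_def path_diff_def)

lemma path_diff_trans:
  assumes a: "is_path X a x0 x" and b: "is_path X b x0 x" and c: "is_path X c x0 x"
  shows "path_diff a b \<otimes> path_diff b c = path_diff a c"
proof -
  note ab = is_path_concat[OF a is_path_rev[OF b]] and bc = is_path_concat[OF b is_path_rev[OF c]]
    and ac = is_path_concat[OF a is_path_rev[OF c]]
  have "path_homotopic X (loop_concat (loop_concat a (rev_path b)) (loop_concat b (rev_path c)))
      (loop_concat a (rev_path c))"
    using path_homotopic_cancel[OF a is_path_rev[OF b] is_path_rev[OF c]] by simp
  then have "loop_class X x0 (loop_concat (loop_concat a (rev_path b)) (loop_concat b (rev_path c)))
      = loop_class X x0 (loop_concat a (rev_path c))"
    using loop_class_eq_iff[OF is_path_concat[OF ab bc] ac] by simp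
  then show ?thesis
    using hom_mult[OF hom loop_class_in_carrier[OF ab] loop_class_in_carrier[OF bc]]
    by (simp add: path_diff_def loop_class_mult[OF ab bc])
qed

lemma path_diff_homotopic:
  assumes a: "is_path X a x0 x" and b: "is_path X b x0 x"
    and h: "path_homotopic X a a'" "path_homotopic X b b'"
  shows "path_diff a b = path_diff a' b'"
proof -
  have a': "is_path X a' x0 x" and b': "is_path X b' x0 x"
    using path_homotopic_imp_eq[OF h(1)] path_homotopic_imp_eq[OF h(2)] a b by (auto simp: is_path_def)
  have "path_homotopic X (loop_concat a (rev_path b)) (loop_concat a' (rev_path b'))"
    using a b by (intro path_homotopic_concat h path_homotopic_rev) (simp add: is_path_def rev_path_def)
  then show ?thesis
    using loop_class_eq_iff[OF is_path_concat[OF a is_path_rev[OF b]] is_path_concat[OF a' is_path_rev[OF b']]]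
    by (simp add: path_diff_def)
qed

text \<open>Only the multiplicativity of \<rho> is used: the element \<open>path_diff a a\<close> is
  idempotent, and the only idempotent of a group is its unit.\<close>

lemma path_diff_self:
  assumes a: "is_path X a x0 x" and b: "is_path X b x0 x" and h: "path_homotopic X a b"
  shows "path_diff a b = \<one>"
proof -
  have "path_diff a b = path_diff a a"
    using path_diff_homotopic[OF a a path_homotopic_refl h] a by (simp add: is_path_def)
  moreover have "path_diff a a \<otimes> path_diff a a = path_diff a a" by (rule path_diff_trans[OF a a a])
  ultimately show ?thesis using path_diff_closed[OF a a] by simp
qed

text \<open>A common final stretch cancels. This is the source of the local constancy of the
  transition functions built from \<rho>.\<close>

lemma path_diff_extend:
  assumes a: "is_path X a x0 x" and b: "is_path X b x0 x" and m: "is_path X m x y"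
  shows "path_diff (loop_concat a m) (loop_concat b m) = path_diff a b"
proof -
  have eq: "rev_path (loop_concat b m) = loop_concat (rev_path m) (rev_path b)"
    using b m by (intro rev_path_concat) (simp add: is_path_def)
  have "path_homotopic X (loop_concat (loop_concat a m) (rev_path (loop_concat b m))) (loop_concat a (rev_path b))"
    unfolding eq by (rule path_homotopic_cancel[OF a m is_path_rev[OF b]])
  then show ?thesis
    using loop_class_eq_iff[OF is_path_concat[OF is_path_concat[OF a m] is_path_rev[OF is_path_concat[OF b m]]]
        is_path_concat[OF a is_path_rev[OF b]]]
    by (simp add: path_diff_def)
qed

end

text \<open>Homotopies in \<open>U_simply\<close> may leave \<open>U i\<close>, since only classes
  of loops in \<open>X\<close> matter. Intersections of charts may be disconnected; cocycles take
  care of this by their dependence on the point.\<close>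

locale good_cover = cech X I U G
  for X :: "'a topology" and I :: "'i set" and U and G :: "('g, 'b) monoid_scheme" (structure) +
  assumes finite_I: "finite I" and finite_G: "finite (carrier G)"
    and U_nonempty: "i \<in> I \<Longrightarrow> U i \<noteq> {}"
    and U_path: "i \<in> I \<Longrightarrow> x \<in> U i \<Longrightarrow> y \<in> U i \<Longrightarrow> \<exists>p. is_path X p x y \<and> p ` {0..1} \<subseteq> U i"
    and U_simply: "i \<in> I \<Longrightarrow> is_path X p x y \<Longrightarrow> is_path X q x y \<Longrightarrow> p ` {0..1} \<subseteq> U i \<Longrightarrow>
      q ` {0..1} \<subseteq> U i \<Longrightarrow> path_homotopic X p q"
    and path_conn: "x \<in> topspace X \<Longrightarrow> y \<in> topspace X \<Longrightarrow> \<exists>p. is_path X p x y"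
begin

text \<open>Prescribing the values off the overlaps makes equality of cocycles mean equality on the
  overlaps, so that they can be counted.\<close>

definition cocycles :: "('i \<Rightarrow> 'i \<Rightarrow> 'a \<Rightarrow> 'g) set" where
  "cocycles = {g. cocycle g \<and>
     (\<forall>i j x. \<not> (i \<in> I \<and> j \<in> I \<and> x \<in> U i \<and> x \<in> U j) \<longrightarrow> g i j x = undefined)}"

end

text \<open>The reference paths: \<open>C i\<close> leads to the centre \<open>y i\<close> of a
  chart and \<open>Q i x\<close> from there to \<open>x\<close> within the chart. The constant path
  to the base chart makes its transport the unit, so the base chart contributes no free
  element.\<close>

locale based_cover = good_cover X I U G
  for X :: "'a topology" and I :: "'i set" and U and G :: "('g, 'b) monoid_scheme" (structure) +
  fixes x0 i0 and y :: "'i \<Rightarrow> 'a" and C :: "'i \<Rightarrow> real \<Rightarrow> 'a" and Q :: "'i \<Rightarrow> 'a \<Rightarrow> real \<Rightarrow> 'a"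
  assumes i0: "i0 \<in> I" "x0 \<in> U i0" and y: "\<And>i. i \<in> I \<Longrightarrow> y i \<in> U i" and y0: "y i0 = x0"
    and C: "\<And>i. i \<in> I \<Longrightarrow> is_path X (C i) x0 (y i)" and C0: "C i0 = (\<lambda>_. x0)"
    and Q: "\<And>i x. i \<in> I \<Longrightarrow> x \<in> U i \<Longrightarrow> is_path X (Q i x) (y i) x"
      "\<And>i x. i \<in> I \<Longrightarrow> x \<in> U i \<Longrightarrow> Q i x ` {0..1} \<subseteq> U i"
begin

abbreviation "P \<equiv> fundamental_group X x0"

lemma x0: "x0 \<in> topspace X" using i0 open_U openin_subset by blast

definition route :: "'i \<Rightarrow> 'a \<Rightarrow> real \<Rightarrow> 'a" where
  "route i x = loop_concat (C i) (Q i x)"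

lemma route: "i \<in> I \<Longrightarrow> x \<in> U i \<Longrightarrow> is_path X (route i x) x0 x"
  unfolding route_def by (rule is_path_concat[OF C Q(1)])

lemma loop_concat_image:
  assumes "p ` {0..1} \<subseteq> A" "q ` {0..1} \<subseteq> A"
  shows "loop_concat p q ` {0..1} \<subseteq> A"
  using assms by (auto simp: loop_concat_def image_subset_iff)

text \<open>The two paths differ only within \<open>U i\<close>, where \<open>U_simply\<close>
  applies.\<close>

lemma route_move:
  assumes i: "i \<in> I" and m: "is_path X m x x'" "m ` {0..1} \<subseteq> U i"
  shows "path_homotopic X (route i x') (loop_concat (route i x) m)"
proof -
  have xU: "x \<in> U i" "x' \<in> U i" using m by (auto simp: is_path_def image_subset_iff)
  have "path_homotopic X (Q i x') (loop_concat (Q i x) m)"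
    by (rule U_simply[OF i Q(1)[OF i xU(2)] is_path_concat[OF Q(1)[OF i xU(1)] m(1)] Q(2)[OF i xU(2)]
      loop_concat_image[OF Q(2)[OF i xU(1)] m(2)]])
  then have "path_homotopic X (loop_concat (C i) (Q i x')) (loop_concat (C i) (loop_concat (Q i x) m))"
    using C[OF i] Q(1)[OF i xU(2)] by (intro path_homotopic_concat path_homotopic_refl) (auto simp: is_path_def)
  also have "path_homotopic X \<dots> (loop_concat (loop_concat (C i) (Q i x)) m)"
    by (rule path_homotopic_sym[OF path_homotopic_assoc[OF C[OF i] Q(1)[OF i xU(1)] m(1)]])
  finally show ?thesis by (simp add: route_def)
qed

lemma route_base:
  assumes i: "i \<in> I"
  shows "path_homotopic X (route i (y i)) (C i)"
proof -
  have top: "y i \<in> topspace X" using y[OF i] open_U[OF i] openin_subset by blast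
  have "path_homotopic X (Q i (y i)) (\<lambda>_. y i)"
    using y[OF i] by (intro U_simply[OF i Q(1)[OF i y[OF i]] is_path_const[OF top] Q(2)[OF i y[OF i]]]) auto
  then have "path_homotopic X (loop_concat (C i) (Q i (y i))) (loop_concat (C i) (\<lambda>_. y i))"
    using C[OF i] Q(1)[OF i y[OF i]] by (intro path_homotopic_concat path_homotopic_refl) (auto simp: is_path_def)
  also have "path_homotopic X \<dots> (C i)" by (rule path_homotopic_const_right[OF C[OF i]])
  finally show ?thesis by (simp add: route_def)
qed

text \<open>A cocycle amounts to a homomorphism of the fundamental group and one group element for each chart
  other than the base chart, namely the transport along a fixed path to that chart.\<close>

definition hol_data :: "('i \<Rightarrow> 'i \<Rightarrow> 'a \<Rightarrow> 'g) \<Rightarrow> ((real \<Rightarrow> 'a) set \<Rightarrow> 'g) \<times> ('i \<Rightarrow> 'g)" where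
  "hol_data g = (\<lambda>A\<in>carrier P. holonomy g (SOME p. p \<in> A) i0 i0, \<lambda>i\<in>I - {i0}. holonomy g (C i) i0 i)"

lemma holonomy_route:
  assumes g: "cocycle g" and i: "i \<in> I" "x \<in> U i"
  shows "holonomy g (route i x) i0 i = holonomy g (C i) i0 i"
proof -
  have "holonomy g (route i x) i0 i = holonomy g (C i) i0 i \<otimes> holonomy g (Q i x) i i"
    unfolding route_def by (rule holonomy_concat[OF g C[OF i(1)] Q(1)[OF i] i0 i(1) y[OF i(1)] i])
  also have "holonomy g (Q i x) i i = g i i (Q i x 0) \<otimes> g i i (Q i x 1)"
    using Q(1)[OF i] i y[OF i(1)] by (intro holonomy_local[OF g _ Q(2)[OF i]]) (auto simp: is_path_def)
  also have "\<dots> = \<one>"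
    using Q(1)[OF i] i y[OF i(1)] cocycle_same[OF g i(1)] by (auto simp: is_path_def)
  also have "holonomy g (C i) i0 i \<in> carrier G"
    using C[OF i(1)] i0 y[OF i(1)] i by (intro holonomy_closed[OF g]) (auto simp: is_path_def)
  then have "holonomy g (C i) i0 i \<otimes> \<one> = holonomy g (C i) i0 i" by simp
  finally show ?thesis .
qed

lemma holonomy_const:
  assumes g: "cocycle g"
  shows "holonomy g (\<lambda>_. x0) i0 i0 = \<one>"
proof -
  have "(\<lambda>_. x0) ` {0..1::real} \<subseteq> U i0" using i0 by auto
  from holonomy_local[OF g _ this i0(1) i0(1) _ i0(1)] show ?thesis
    using i0 x0 cocycle_same[OF g i0] by simp
qed

lemma holonomy_rev:
  assumes g: "cocycle g" and p: "is_path X p x0 x" and i: "i \<in> I" "x \<in> U i"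
  shows "holonomy g p i0 i \<otimes> holonomy g (rev_path p) i i0 = \<one>"
proof -
  have "holonomy g (loop_concat p (rev_path p)) i0 i0 = holonomy g p i0 i \<otimes> holonomy g (rev_path p) i i0"
    by (rule holonomy_concat[OF g p is_path_rev[OF p] i0 i i0])
  moreover have "holonomy g (loop_concat p (rev_path p)) i0 i0 = holonomy g (\<lambda>_. x0) i0 i0"
    using i0 p by (intro holonomy_homotopic[OF g path_homotopic_inverse[OF p]])
      (auto simp: is_path_def loop_concat_def rev_path_def)
  ultimately show ?thesis using holonomy_const[OF g] by simp
qed

text \<open>Go to \<open>x\<close> through chart \<open>i\<close>, change to chart \<open>j\<close>
  there, and return. The holonomy of this loop is \<open>g i j x\<close> between the transports to
  \<open>i\<close> and back from \<open>j\<close>. Hence loop holonomies and the transports along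
  the \<open>C i\<close> determine the cocycle.\<close>

lemma cocycle_from_holonomy:
  assumes g: "cocycle g" and i: "i \<in> I" "x \<in> U i" and j: "j \<in> I" "x \<in> U j"
  shows "g i j x = inv (holonomy g (C i) i0 i) \<otimes>
    holonomy g (loop_concat (route i x) (rev_path (route j x))) i0 i0 \<otimes> holonomy g (C j) i0 j"
proof -
  let ?c = "\<lambda>i. holonomy g (C i) i0 i"
  let ?R = "rev_path (route j x)"
  have c: "?c k \<in> carrier G" if "k \<in> I" for k
    using C[OF that] i0 y[OF that] that by (intro holonomy_closed[OF g]) (auto simp: is_path_def)
  have gij: "g i j x \<in> carrier G" by (rule cocycle_closed[OF g i(1) j(1) i(2) j(2)])
  have top: "x \<in> topspace X" using i open_U openin_subset by blast
  have jj: "holonomy g ?R j i0 = inv (?c j)"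
  proof -
    have "?c j \<otimes> holonomy g ?R j i0 = \<one>"
      using holonomy_rev[OF g route[OF j] j] holonomy_route[OF g j] by simp
    moreover have "holonomy g ?R j i0 \<in> carrier G"
      using is_path_rev[OF route[OF j]] i0 j by (intro holonomy_closed[OF g]) (auto simp: is_path_def)
    ultimately show ?thesis using inv_equality[of "?c j" "holonomy g ?R j i0"] inv_inv[of "holonomy g ?R j i0"]
        c[OF j(1)] by simp
  qed
  have const: "is_path X (\<lambda>_. x) x x" by (rule is_path_const[OF top])
  \<comment> \<open>A constant path at \<open>x\<close> is inserted so that the change of chart
    appears as a holonomy of its own.\<close>
  have ij: "holonomy g ?R i i0 = g i j x \<otimes> inv (?c j)"
  proof -
    have "holonomy g (loop_concat (\<lambda>_. x) ?R) i i0 = holonomy g (\<lambda>_. x) i j \<otimes> holonomy g ?R j i0"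
      by (rule holonomy_concat[OF g const is_path_rev[OF route[OF j]] i j i0])
    moreover have "holonomy g (\<lambda>_. x) i j = g i j x"
      using holonomy_local[OF g, of "\<lambda>_. x" j i j] i j top gij cocycle_same[OF g j] by auto
    moreover have "holonomy g (loop_concat (\<lambda>_. x) ?R) i i0 = holonomy g ?R i i0"
      using i0 i is_path_rev[OF route[OF j]]
      by (intro holonomy_homotopic[OF g path_homotopic_const_left[OF is_path_rev[OF route[OF j]]]])
        (auto simp: is_path_def loop_concat_def)
    ultimately show ?thesis using jj by simp
  qed
  have "holonomy g (loop_concat (route i x) ?R) i0 i0 = ?c i \<otimes> (g i j x \<otimes> inv (?c j))"
    using holonomy_concat[OF g route[OF i] is_path_rev[OF route[OF j]] i0 i i0] ij holonomy_route[OF g i] by simp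
  then show ?thesis using c[OF i(1)] c[OF j(1)] gij by (simp add: m_assoc inv_solve_left)
qed

lemma hol_data_hom:
  assumes g: "cocycle g"
  shows "hol_data g \<in> (hom P G \<inter> extensional (carrier P)) \<times> ((I - {i0}) \<rightarrow>\<^sub>E carrier G)"
    and "is_path X p x0 x0 \<Longrightarrow> fst (hol_data g) (loop_class X x0 p) = holonomy g p i0 i0"
proof -
  let ?r = "\<lambda>A\<in>carrier P. holonomy g (SOME p. p \<in> A) i0 i0"
  have r: "?r (loop_class X x0 p) = holonomy g p i0 i0" if p: "is_path X p x0 x0" for p
  proof -
    note A = loop_class_in_carrier[OF p]
    have "path_homotopic X p (SOME q. q \<in> loop_class X x0 p)"
      using some_in_loop_class[OF A] loop_class_eq_iff[OF p] by metis
    from holonomy_homotopic[OF g this i0(1) _ i0(1)] show ?thesis using A p i0 by (simp add: is_path_def)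
  qed
  show "is_path X p x0 x0 \<Longrightarrow> fst (hol_data g) (loop_class X x0 p) = holonomy g p i0 i0"
    using r by (simp add: hol_data_def)
  have "?r \<in> hom P G"
  proof (rule homI)
    fix A assume "A \<in> carrier P"
    then obtain p where p: "is_path X p x0 x0" "A = loop_class X x0 p" by (rule loop_class_cases)
    then show "?r A \<in> carrier G"
      using r[OF p(1)] holonomy_closed[OF g, of p i0 i0] i0 by (simp add: is_path_def)
  next
    fix A B assume "A \<in> carrier P" "B \<in> carrier P"
    then obtain p q where p: "is_path X p x0 x0" "A = loop_class X x0 p"
      and q: "is_path X q x0 x0" "B = loop_class X x0 q" by (meson loop_class_cases)
    show "?r (A \<otimes>\<^bsub>P\<^esub> B) = ?r A \<otimes> ?r B"
      unfolding p(2) q(2) loop_class_mult[OF p(1) q(1)] r[OF p(1)] r[OF q(1)] r[OF is_path_concat[OF p(1) q(1)]]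
      by (rule holonomy_concat[OF g p(1) q(1) i0 i0 i0])
  qed
  moreover have "holonomy g (C i) i0 i \<in> carrier G" if "i \<in> I" for i
    using C[OF that] i0 y[OF that] that by (intro holonomy_closed[OF g]) (auto simp: is_path_def)
  ultimately show "hol_data g \<in> (hom P G \<inter> extensional (carrier P)) \<times> ((I - {i0}) \<rightarrow>\<^sub>E carrier G)"
    by (simp add: hol_data_def PiE_iff)
qed

lemma inj_hol_data: "inj_on hol_data cocycles"
proof (rule inj_onI)
  fix g g' assume gs: "g \<in> cocycles" "g' \<in> cocycles" and eq: "hol_data g = hol_data g'"
  have g: "cocycle g" "cocycle g'" using gs by (auto simp: cocycles_def)
  have C_eq: "holonomy g (C i) i0 i = holonomy g' (C i) i0 i" if "i \<in> I" for i
  proof (cases "i = i0")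
    case True then show ?thesis using holonomy_const[OF g(1)] holonomy_const[OF g(2)] C0 by simp
  next
    case False
    have "snd (hol_data g) i = snd (hol_data g') i" using eq by simp
    then show ?thesis using False that by (simp add: hol_data_def)
  qed
  have loop_eq: "holonomy g p i0 i0 = holonomy g' p i0 i0" if "is_path X p x0 x0" for p
    using hol_data_hom(2)[OF g(1) that] hol_data_hom(2)[OF g(2) that] eq by simp
  show "g = g'"
  proof (intro ext)
    fix i j x
    show "g i j x = g' i j x"
    proof (cases "i \<in> I \<and> j \<in> I \<and> x \<in> U i \<and> x \<in> U j")
      case True
      then have ij: "i \<in> I" "x \<in> U i" "j \<in> I" "x \<in> U j" by auto
      show ?thesis
        unfolding cocycle_from_holonomy[OF g(1) ij] cocycle_from_holonomy[OF g(2) ij]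
        using C_eq ij loop_eq[OF is_path_concat[OF route[OF ij(1,2)] is_path_rev[OF route[OF ij(3,4)]]]] by simp
    next
      case False
      then have "g i j x = undefined" "g' i j x = undefined" using gs unfolding cocycles_def by blast+
      then show ?thesis by simp
    qed
  qed
qed

text \<open>The formula of \<open>cocycle_from_holonomy\<close> is read backwards, with \<rho> in
  place of the loop holonomy. What remains is to check that the holonomy of the cocycle so defined
  is the prescribed one, by exhibiting its parallel sections.\<close>

lemma surj_hol_data:
  assumes \<rho>: "\<rho> \<in> hom P G \<inter> extensional (carrier P)" and T: "T \<in> (I - {i0}) \<rightarrow>\<^sub>E carrier G"
  shows "\<exists>g\<in>cocycles. hol_data g = (\<rho>, T)"
proof -
  interpret loop_hom G X x0 \<rho> by unfold_locales (use \<rho> in simp)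
  define T' where "T' = (\<lambda>i. if i = i0 then \<one> else T i)"
  have T': "T' i \<in> carrier G" if "i \<in> I" for i using T that by (auto simp: T'_def)
  define g where "g = (\<lambda>i j x. if i \<in> I \<and> j \<in> I \<and> x \<in> U i \<and> x \<in> U j then
      inv (T' i) \<otimes> (path_diff (route i x) (route j x) \<otimes> T' j) else undefined)"
  have g_eq: "g i j x = inv (T' i) \<otimes> (path_diff (route i x) (route j x) \<otimes> T' j)"
    if "i \<in> I" "j \<in> I" "x \<in> U i" "x \<in> U j" for i j x using that by (simp add: g_def)
  have D: "path_diff (route i x) (route j x) \<in> carrier G" if "i \<in> I" "j \<in> I" "x \<in> U i" "x \<in> U j" for i j x
    using that by (intro path_diff_closed[of _ x] route)
  have glue: "a \<otimes> t \<otimes> (inv t \<otimes> (b \<otimes> u)) = (a \<otimes> b) \<otimes> u"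
    if "a \<in> carrier G" "t \<in> carrier G" "b \<in> carrier G" "u \<in> carrier G" for a t b u
  proof -
    have "t \<otimes> (inv t \<otimes> (b \<otimes> u)) = b \<otimes> u" using that by (simp flip: m_assoc)
    then show ?thesis using that by (simp add: m_assoc)
  qed
  have gcocycle: "cocycle g" unfolding cocycle_def
  proof (intro conjI ballI allI impI)
    fix i j x assume "i \<in> I" "j \<in> I" "x \<in> U i \<inter> U j"
    then show "g i j x \<in> carrier G" using g_eq D T' by simp
  next
    fix i j k x assume ijk: "i \<in> I" "j \<in> I" "k \<in> I" "x \<in> U i \<inter> U j \<inter> U k"
    have t: "path_diff (route i x) (route j x) \<otimes> path_diff (route j x) (route k x) = path_diff (route i x) (route k x)"
      using ijk by (intro path_diff_trans[of _ x] route) auto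
    have "g i j x \<otimes> g j k x = (inv (T' i) \<otimes> path_diff (route i x) (route j x)) \<otimes> T' j \<otimes>
        (inv (T' j) \<otimes> (path_diff (route j x) (route k x) \<otimes> T' k))"
      using ijk g_eq D T' by (simp add: m_assoc)
    also have "\<dots> = (inv (T' i) \<otimes> path_diff (route i x) (route j x)) \<otimes> path_diff (route j x) (route k x) \<otimes> T' k"
      using ijk D T' by (intro glue) auto
    also have "\<dots> = inv (T' i) \<otimes> ((path_diff (route i x) (route j x) \<otimes> path_diff (route j x) (route k x)) \<otimes> T' k)"
      using ijk D T' by (simp add: m_assoc)
    finally show "g i j x \<otimes> g j k x = g i k x" using t g_eq ijk by simp
  next
    \<comment> \<open>Moving the point along \<open>p\<close> inside both charts lengthens both
      reference paths by \<open>p\<close>, and this common stretch cancels.\<close>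
    fix i j p assume ij: "i \<in> I" "j \<in> I" and p: "pathin X p" "p ` {0..1} \<subseteq> U i \<inter> U j"
    have m: "is_path X p (p 0) (p 1)" using p by (simp add: is_path_def)
    have ends: "p 0 \<in> U i" "p 1 \<in> U i" "p 0 \<in> U j" "p 1 \<in> U j" using p(2) by (auto simp: image_subset_iff)
    have "path_diff (route i (p 1)) (route j (p 1)) =
        path_diff (loop_concat (route i (p 0)) p) (loop_concat (route j (p 0)) p)"
      using p(2) ij ends by (intro path_diff_homotopic[of _ "p 1"] route_move[OF _ m] route) auto
    also have "\<dots> = path_diff (route i (p 0)) (route j (p 0))"
      using ij ends by (intro path_diff_extend[OF _ _ m] route)
    finally show "g i j (p 0) = g i j (p 1)" using g_eq ij ends by simp
  qed
  have hol: "holonomy g p i0 j = path_diff p (route j (p 1)) \<otimes> T' j"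
    if p: "pathin X p" "p 0 = x0" and j: "j \<in> I" "p 1 \<in> U j" for p j
  proof -
    \<comment> \<open>The section compares the part of \<open>p\<close> already travelled with the
      reference path into chart \<open>i\<close>. At time 1 it gives the holonomy in closed
      form.\<close>
    define s where "s = (\<lambda>t i. path_diff (sub_path 0 t p) (route i (p t)) \<otimes> T' i)"
    have sp: "is_path X (sub_path 0 t p) x0 (p t)" if "0 \<le> t" "t \<le> 1" for t
      using is_path_sub[OF p(1), of 0 t] that p(2) by simp
    have Ds: "path_diff (sub_path 0 t p) (route i (p t)) \<in> carrier G"
      if "0 \<le> t" "t \<le> 1" "i \<in> I" "p t \<in> U i" for t i
      by (rule path_diff_closed[OF sp route]) (use that in auto)
    have par: "parallel g p 1 s" unfolding parallel_def
    proof (intro conjI ballI allI impI)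
      fix t i assume "t \<in> {0..1::real}" "i \<in> I" "p t \<in> U i"
      then show "s t i \<in> carrier G" using Ds T' by (simp add: s_def)
    next
      fix t i j assume tij: "t \<in> {0..1::real}" "i \<in> I" "j \<in> I" "p t \<in> U i" "p t \<in> U j"
      have "s t i \<otimes> g i j (p t) = path_diff (sub_path 0 t p) (route i (p t)) \<otimes>
          path_diff (route i (p t)) (route j (p t)) \<otimes> T' j"
        unfolding s_def g_eq[OF tij(2-5)]
        by (rule glue) (use tij Ds D T' in auto)
      also have "path_diff (sub_path 0 t p) (route i (p t)) \<otimes> path_diff (route i (p t)) (route j (p t)) =
          path_diff (sub_path 0 t p) (route j (p t))"
        using tij by (intro path_diff_trans[OF sp route route]) auto
      finally show "s t j = s t i \<otimes> g i j (p t)" by (simp add: s_def)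
    next
      fix a c i assume ac: "i \<in> I" "0 \<le> a" "a \<le> c" "c \<le> (1::real)" "p ` {a..c} \<subseteq> U i"
      note m = is_path_sub[OF p(1) ac(2-4)]
      have mU: "sub_path a c p ` {0..1} \<subseteq> U i" using order_trans[OF sub_path_image[OF ac(3)] ac(5)] .
      have U: "p a \<in> U i" "p c \<in> U i" using ac by (auto simp: image_subset_iff)
      have "path_diff (sub_path 0 c p) (route i (p c)) =
          path_diff (loop_concat (sub_path 0 a p) (sub_path a c p)) (loop_concat (route i (p a)) (sub_path a c p))"
        using ac U by (intro path_diff_homotopic[OF sp route] route_move[OF ac(1) m mU]
            path_homotopic_sym[OF path_homotopic_sub[OF p(1)]]) auto
      also have "\<dots> = path_diff (sub_path 0 a p) (route i (p a))"
        using ac U by (intro path_diff_extend[OF sp route m]) auto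
      finally show "s a i = s c i" by (simp add: s_def)
    qed
    have "sub_path 0 0 p = C i0" using C0 p(2) by (simp add: sub_path_def)
    then have "s 0 i0 = path_diff (C i0) (route i0 (y i0))" using p(2) y0 Ds[of 0 i0] i0 by (simp add: s_def T'_def)
    also have "\<dots> = \<one>"
      by (rule path_diff_self[OF C[OF i0(1)] route[OF i0(1) y[OF i0(1)]] path_homotopic_sym[OF route_base[OF i0(1)]]])
    finally have "s 1 j = holonomy g p i0 j"
      using holonomy_eq[OF gcocycle p(1) par i0(1) _ j] p(2) i0(2) by simp
    then show ?thesis by (simp add: s_def sub_path_def)
  qed
  have "hol_data g = (\<rho>, T)"
  proof (rule prod_eqI)
    show "fst (hol_data g) = fst (\<rho>, T)"
    proof (rule ext)
      fix A
      show "fst (hol_data g) A = fst (\<rho>, T) A"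
      proof (cases "A \<in> carrier P")
        case True
        then obtain p where p: "is_path X p x0 x0" "A = loop_class X x0 p" by (rule loop_class_cases)
        have "holonomy g p i0 i0 = path_diff p (route i0 x0)"
          using hol[of p i0] p(1) i0 path_diff_closed[OF p(1) route[OF i0]] by (simp add: T'_def is_path_def)
        also have "\<dots> = path_diff p (C i0)"
          using route_base[OF i0(1)] y0 p(1)
          by (intro path_diff_homotopic[OF p(1) route[OF i0]] path_homotopic_refl) (auto simp: is_path_def)
        also have "\<dots> = \<rho> (loop_class X x0 p)"
        proof -
          have "loop_class X x0 (loop_concat p (\<lambda>_. x0)) = loop_class X x0 p"
            using path_homotopic_const_right[OF p(1)]
            by (simp add: loop_class_eq_iff[OF is_path_concat[OF p(1) is_path_const[OF x0]] p(1)])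
          then show ?thesis by (simp add: path_diff_def C0 rev_path_def)
        qed
        finally show ?thesis using hol_data_hom(2)[OF gcocycle p(1)] p(2) by simp
      next
        case False
        then show ?thesis using \<rho> by (simp add: hol_data_def extensional_def)
      qed
    qed
    show "snd (hol_data g) = snd (\<rho>, T)"
    proof (rule ext)
      fix i
      show "snd (hol_data g) i = snd (\<rho>, T) i"
      proof (cases "i \<in> I - {i0}")
        case True
        then have i: "i \<in> I" by simp
        have Ci: "pathin X (C i)" "C i 0 = x0" "C i 1 = y i" using C[OF i] by (auto simp: is_path_def)
        have "holonomy g (C i) i0 i = path_diff (C i) (route i (y i)) \<otimes> T' i"
          using hol[OF Ci(1,2) i] y[OF i] Ci(3) by simp
        also have "path_diff (C i) (route i (y i)) = \<one>"
          by (rule path_diff_self[OF C[OF i] route[OF i y[OF i]] path_homotopic_sym[OF route_base[OF i]]])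
        finally show ?thesis using T'[OF i] True by (simp add: hol_data_def T'_def)
      next
        case False
        then have "T i = undefined" by (rule PiE_arb[OF T])
        then show ?thesis using False by (auto simp: hol_data_def)
      qed
    qed
  qed
  moreover have "g \<in> cocycles" using gcocycle by (simp add: cocycles_def g_def)
  ultimately show ?thesis by blast
qed

text \<open>The exponent misses the base chart, whose transport is fixed to be the unit.\<close>

lemma card_cocycles: "card cocycles = num_homs P G * card (carrier G) ^ (card I - 1)"
proof -
  have "bij_betw hol_data cocycles ((hom P G \<inter> extensional (carrier P)) \<times> ((I - {i0}) \<rightarrow>\<^sub>E carrier G))"
    unfolding bij_betw_def
  proof (intro conjI inj_hol_data equalityI subsetI)
    fix z assume "z \<in> hol_data ` cocycles"
    then show "z \<in> (hom P G \<inter> extensional (carrier P)) \<times> ((I - {i0}) \<rightarrow>\<^sub>E carrier G)"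
      using hol_data_hom(1) by (auto simp: cocycles_def)
  next
    fix z assume "z \<in> (hom P G \<inter> extensional (carrier P)) \<times> ((I - {i0}) \<rightarrow>\<^sub>E carrier G)"
    then show "z \<in> hol_data ` cocycles" using surj_hol_data[of "fst z" "snd z"] by force
  qed
  then have "card cocycles = card ((hom P G \<inter> extensional (carrier P)) \<times> ((I - {i0}) \<rightarrow>\<^sub>E carrier G))"
    by (rule bij_betw_same_card)
  then show ?thesis
    using finite_I i0 by (simp add: card_cartesian_product card_PiE num_homs_def)
qed

end

lemma (in good_cover) card_cocycles_eq:
  assumes x: "x \<in> topspace X"
  shows "card cocycles = num_homs (fundamental_group X x) G * card (carrier G) ^ (card I - 1)"
proof -
  obtain i0 where i0: "i0 \<in> I" "x \<in> U i0" using cover x by blast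
  define y where "y = (\<lambda>i. if i = i0 then x else SOME z. z \<in> U i)"
  have y: "y i \<in> U i" if "i \<in> I" for i
    using U_nonempty[OF that] i0 by (auto simp: y_def some_in_eq)
  define C where "C = (\<lambda>i. if i = i0 then (\<lambda>_. x) else SOME p. is_path X p x (y i))"
  have C: "is_path X (C i) x (y i)" if "i \<in> I" for i
  proof (cases "i = i0")
    case False
    have "y i \<in> topspace X" using y[OF that] open_U[OF that] openin_subset by blast
    from someI_ex[OF path_conn[OF x this]] False show ?thesis by (simp add: C_def)
  qed (use x in \<open>simp add: C_def y_def is_path_const\<close>)
  define Q where "Q = (\<lambda>i z. SOME p. is_path X p (y i) z \<and> p ` {0..1} \<subseteq> U i)"
  have Q: "is_path X (Q i z) (y i) z" "Q i z ` {0..1} \<subseteq> U i" if "i \<in> I" "z \<in> U i" for i z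
    using someI_ex[OF U_path[OF that(1) y[OF that(1)] that(2)]] unfolding Q_def by blast+
  interpret based_cover X I U G x i0 y C Q
    by unfold_locales (use i0 y C Q in \<open>auto simp: y_def C_def\<close>)
  show ?thesis by (rule card_cocycles)
qed

lemma path_homotopic_eq:
  assumes "pathin X p" "\<And>t. 0 \<le> t \<Longrightarrow> t \<le> 1 \<Longrightarrow> p t = q t"
  shows "path_homotopic X p q"
  unfolding path_homotopic_def
  by (rule homotopic_with_equal) (use assms in \<open>auto simp: pathin_def\<close>)

text \<open>Contracting the path gives a map of the square with \<open>p\<close> on one side. The
  other three sides form a path that depends on the end points alone, so all paths in
  \<open>S\<close> with the same ends become homotopic in \<open>X\<close>.\<close>

lemma path_homotopic_contraction:
  assumes c: "continuous_map (prod_topology (top_of_set {0..1}) (subtopology X S)) X c"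
    and c0: "\<And>x. x \<in> S \<Longrightarrow> c (0, x) = x" and c1: "\<And>x. x \<in> S \<Longrightarrow> c (1, x) = z"
    and p: "is_path X p x y" "p ` {0..1} \<subseteq> S"
  shows "path_homotopic X p (loop_concat (\<lambda>t. c (t, x)) (loop_concat (\<lambda>_. z) (\<lambda>t. c (1 - t, y))))"
proof -
  let ?D = "{0..1} \<times> {0..1::real} :: (real \<times> real) set"
  define f where "f = (\<lambda>w. c (fst w, p (snd w)))"
  have "continuous_map (top_of_set ?D) (subtopology X S) (\<lambda>w. p (snd w))"
  proof -
    have 1: "continuous_map (top_of_set ?D) (top_of_set {0..1}) snd" by (auto intro!: continuous_intros)
    have 2: "continuous_map (top_of_set {0..1}) (subtopology X S) p"
      using p by (auto simp: is_path_def pathin_def continuous_map_in_subtopology)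
    show ?thesis using continuous_map_compose[OF 1 2] by (simp only: o_def)
  qed
  moreover have "continuous_map (top_of_set ?D) (top_of_set {0..1}) fst" by (auto intro!: continuous_intros)
  ultimately have "continuous_map (top_of_set ?D) (prod_topology (top_of_set {0..1}) (subtopology X S))
      (\<lambda>w. (fst w, p (snd w)))"
    by (simp add: continuous_map_pairedI)
  from continuous_map_compose[OF this c] have f: "continuous_map (top_of_set ?D) X f"
    by (simp add: o_def f_def)
  \<comment> \<open>The remaining three sides of the square: along the track of \<open>x\<close>,
    along the collapsed side, and back along the track of \<open>y\<close>.\<close>
  define b where "b = loop_concat (\<lambda>t. (t, 0)) (loop_concat (\<lambda>t. (1, t)) (\<lambda>t. (1 - t, 1 :: real)))"
  have "is_path (top_of_set ?D) (\<lambda>t. (t, 0)) (0, 0) (1, 0)"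
      "is_path (top_of_set ?D) (\<lambda>t. (1, t)) (1, 0) (1, 1)"
      "is_path (top_of_set ?D) (\<lambda>t. (1 - t, 1)) (1, 1) (0, 1)"
    by (auto simp: is_path_def pathin_def intro!: continuous_intros)
  then have "is_path (top_of_set ?D) b (0, 0) (0, 1)"
    unfolding b_def by (intro is_path_concat)
  then have b: "continuous_on {0..1} b" "b ` {0..1} \<subseteq> ?D" "b 0 = (0, 0)" "b 1 = (0, 1)"
    by (simp_all add: is_path_def pathin_def image_subset_iff_funcset)
  have conv: "convex ?D" by (intro convex_Times) auto
  have fb: "path_homotopic X (f \<circ> Pair 0) (f \<circ> b)"
    by (rule path_homotopic_convex[OF f conv _ _ b(1,2)]) (auto simp: b intro!: continuous_intros)
  have pS: "p s \<in> S" if "0 \<le> s" "s \<le> 1" for s using p(2) that by auto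
  have "path_homotopic X p (f \<circ> Pair 0)"
    using p c0[OF pS] by (intro path_homotopic_eq) (simp_all add: f_def is_path_def)
  also note fb
  also have "path_homotopic X (f \<circ> b) (loop_concat (\<lambda>t. c (t, x)) (loop_concat (\<lambda>_. z) (\<lambda>t. c (1 - t, y))))"
  proof (rule path_homotopic_eq)
    show "pathin X (f \<circ> b)" using path_homotopic_imp_eq(4)[OF fb] .
    fix t :: real assume t: "0 \<le> t" "t \<le> 1"
    show "(f \<circ> b) t = loop_concat (\<lambda>t. c (t, x)) (loop_concat (\<lambda>_. z) (\<lambda>t. c (1 - t, y))) t"
      using t p(1) c1[OF pS] by (simp add: f_def b_def loop_concat_def is_path_def)
  qed
  finally show ?thesis .
qed

section \<open>Triangulations into flags\<close>

definition simplex3 :: "(real^3) set" where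
  "simplex3 = {l. (\<forall>k. 0 \<le> l $ k) \<and> (\<Sum>k\<in>UNIV. l $ k) = 1}"

definition segment3 :: "real^3 \<Rightarrow> real^3 \<Rightarrow> real \<Rightarrow> real^3" where
  "segment3 l m t = (1 - t) *\<^sub>R l + t *\<^sub>R m"

lemma segment3_nth: "segment3 l m t $ k = (1 - t) * (l $ k) + t * (m $ k)"
  by (simp add: segment3_def)

lemma segment3_simplex3:
  assumes "l \<in> simplex3" "m \<in> simplex3" "0 \<le> t" "t \<le> 1"
  shows "segment3 l m t \<in> simplex3"
  using assms by (simp add: simplex3_def segment3_nth sum.distrib flip: sum_distrib_left)

lemma segment3_ends [simp]: "segment3 l m 0 = l" "segment3 l m 1 = m"
  by (simp_all add: segment3_def)

lemma segment3_pos: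
  assumes "l \<in> simplex3" "m \<in> simplex3" "0 \<le> t" "t \<le> 1" "l $ k > 0" "m $ k > 0"
  shows "segment3 l m t $ k > 0"
proof (cases "t = 1")
  case False
  then have "0 < (1 - t) * (l $ k)" "0 \<le> t * (m $ k)" using assms by auto
  then show ?thesis by (simp add: segment3_nth)
qed (use assms in simp)

definition bary :: "real^3" where "bary = (\<chi> k. 1/3)"

text \<open>The midpoint of the side opposite to the vertex of type \<open>m\<close>: the place
  where paths cross into the neighbouring triangle.\<close>

definition mid :: "3 \<Rightarrow> real^3" where "mid m = (\<chi> k. if k = m then 0 else 1/2)"

lemma bary: "bary \<in> simplex3" "bary $ k > 0"
  by (auto simp: bary_def simplex3_def)

lemma mid: "mid m \<in> simplex3" "mid m $ m = 0" "k \<noteq> m \<Longrightarrow> mid m $ k > 0"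
proof -
  have "(\<Sum>k\<in>UNIV. mid m $ k) = 1"
    using exhaust_3[of m] by (auto simp: mid_def sum_3)
  then show "mid m \<in> simplex3" by (auto simp: simplex3_def mid_def)
qed (auto simp: mid_def)

lemma axis_simplex3: "axis k 1 \<in> simplex3"
  by (auto simp: simplex3_def axis_def)

text \<open>The space is glued from triangles, whose vertices have the types 1, 2, 3. The triangles \<open>\<phi>\<close> and \<open>\<tau> k \<phi>\<close>
  share the side opposite to their vertex of type \<open>k\<close>. A vertex of type \<open>k\<close> is represented by the set of
  the triangles around it, which are the ones reached without crossing a side opposite to type \<open>k\<close>.\<close>

locale flag_complex =
  fixes X :: "'a topology" and F :: "'f set" and \<tau> :: "3 \<Rightarrow> 'f \<Rightarrow> 'f" and Q :: "'f \<times> (real^3) \<Rightarrow> 'a"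
  assumes finite_F: "finite F" and F_nonempty: "F \<noteq> {}"
    and \<tau>_closed: "\<phi> \<in> F \<Longrightarrow> \<tau> k \<phi> \<in> F" and \<tau>_invol: "\<phi> \<in> F \<Longrightarrow> \<tau> k (\<tau> k \<phi>) = \<phi>"
    and quot: "quotient_map (prod_topology (discrete_topology F) (top_of_set simplex3)) X Q"
    and kernel: "\<phi> \<in> F \<Longrightarrow> \<psi> \<in> F \<Longrightarrow> l \<in> simplex3 \<Longrightarrow> m \<in> simplex3 \<Longrightarrow>
      Q (\<phi>, l) = Q (\<psi>, m) \<longleftrightarrow> l = m \<and> (\<phi>, \<psi>) \<in> {(\<phi>, \<tau> k \<phi>) | \<phi> k. \<phi> \<in> F \<and> l $ k = 0}\<^sup>*"
    and connected: "\<phi> \<in> F \<Longrightarrow> \<psi> \<in> F \<Longrightarrow> (\<phi>, \<psi>) \<in> {(\<phi>, \<tau> k \<phi>) | \<phi> k. \<phi> \<in> F}\<^sup>*"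
begin

section \<open>Cells and their open stars\<close>

definition reach :: "3 set \<Rightarrow> ('f \<times> 'f) set" where
  "reach K = {(\<phi>, \<tau> k \<phi>) | \<phi> k. \<phi> \<in> F \<and> k \<in> K}\<^sup>* \<inter> F \<times> F"

lemma equiv_reach: "equiv F (reach K)"
proof (rule equivI)
  let ?R = "{(\<phi>, \<tau> k \<phi>) | \<phi> k. \<phi> \<in> F \<and> k \<in> K}"
  show "reach K \<subseteq> F \<times> F" by (auto simp: reach_def)
  show "refl_on F (reach K)" by (rule refl_onI) (auto simp: reach_def)
  have "sym ?R"
  proof (rule symI)
    fix a b assume "(a, b) \<in> ?R"
    then obtain k where k: "a \<in> F" "k \<in> K" "b = \<tau> k a" by blast
    then have "b \<in> F" "a = \<tau> k b" using \<tau>_closed \<tau>_invol by auto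
    then show "(b, a) \<in> ?R" using k(2) by blast
  qed
  then have "sym (?R\<^sup>*)" by (rule sym_rtrancl)
  then show "sym (reach K)" unfolding reach_def by (auto simp: sym_def)
  show "trans (reach K)" unfolding reach_def by (auto simp: trans_def intro: rtrancl_trans)
qed

lemma reach_mono: "K \<subseteq> L \<Longrightarrow> reach K \<subseteq> reach L"
  unfolding reach_def by (intro Int_mono rtrancl_mono) auto

lemma reach_step: "\<phi> \<in> F \<Longrightarrow> k \<in> K \<Longrightarrow> (\<phi>, \<tau> k \<phi>) \<in> reach K"
  unfolding reach_def using \<tau>_closed by blast

lemma reach_induct:
  assumes "(\<phi>, \<psi>) \<in> reach K" "P \<phi>" "\<And>\<kappa> k. \<kappa> \<in> F \<Longrightarrow> k \<in> K \<Longrightarrow> P \<kappa> \<Longrightarrow> P (\<tau> k \<kappa>)"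
  shows "P \<psi>"
proof -
  have "(\<phi>, \<psi>) \<in> {(\<phi>, \<tau> k \<phi>) | \<phi> k. \<phi> \<in> F \<and> k \<in> K}\<^sup>*" using assms(1) by (simp add: reach_def)
  then show ?thesis by (induction rule: rtrancl_induct) (use assms(2,3) in auto)
qed

lemma Q_eq_iff:
  assumes "\<phi> \<in> F" "\<psi> \<in> F" "l \<in> simplex3" "m \<in> simplex3"
  shows "Q (\<phi>, l) = Q (\<psi>, m) \<longleftrightarrow> l = m \<and> (\<phi>, \<psi>) \<in> reach {k. l $ k = 0}"
  using kernel[OF assms] assms by (simp add: reach_def)

abbreviation "PR \<equiv> prod_topology (discrete_topology F) (top_of_set simplex3)"

lemma topspace_X: "topspace X = Q ` (F \<times> simplex3)"
  using quotient_imp_surjective_map[OF quot] by simp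

definition orb :: "3 \<Rightarrow> 'f \<Rightarrow> 'f set" where "orb k \<phi> = reach (- {k}) `` {\<phi>}"

definition cells :: "(3 \<times> 'f set) set" where "cells = Sigma UNIV (\<lambda>k. F // reach (- {k}))"

definition open_star :: "3 \<times> 'f set \<Rightarrow> 'a set" where
  "open_star i = Q ` (snd i \<times> {l \<in> simplex3. l $ (fst i) > 0})"

lemma cells_cases:
  assumes "i \<in> cells" obtains k \<phi> where "i = (k, orb k \<phi>)" "\<phi> \<in> F"
  using assms by (auto simp: cells_def orb_def elim!: quotientE)

lemma orb_in_cells: "\<phi> \<in> F \<Longrightarrow> (k, orb k \<phi>) \<in> cells"
  by (simp add: cells_def orb_def quotientI)

lemma orb_eq_iff: "\<phi> \<in> F \<Longrightarrow> \<psi> \<in> F \<Longrightarrow> orb k \<phi> = orb k \<psi> \<longleftrightarrow> (\<phi>, \<psi>) \<in> reach (- {k})"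
  unfolding orb_def by (rule eq_equiv_class_iff[OF equiv_reach])

lemma orb_subset: "orb k \<phi> \<subseteq> F" by (auto simp: orb_def reach_def)

lemma in_orb_iff: "\<phi> \<in> F \<Longrightarrow> \<psi> \<in> F \<Longrightarrow> \<psi> \<in> orb k \<phi> \<longleftrightarrow> orb k \<psi> = orb k \<phi>"
  using orb_eq_iff[of \<phi> \<psi> k] by (auto simp: orb_def)

lemma Q_in_star_iff:
  assumes \<phi>: "\<phi> \<in> F" and l: "l \<in> simplex3" and \<psi>: "\<psi> \<in> F"
  shows "Q (\<phi>, l) \<in> open_star (k, orb k \<psi>) \<longleftrightarrow> orb k \<phi> = orb k \<psi> \<and> l $ k > 0"
proof
  assume "Q (\<phi>, l) \<in> open_star (k, orb k \<psi>)"
  then obtain \<kappa> m where m: "\<kappa> \<in> orb k \<psi>" "m \<in> simplex3" "m $ k > 0" "Q (\<phi>, l) = Q (\<kappa>, m)"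
    by (auto simp: open_star_def)
  have \<kappa>: "\<kappa> \<in> F" using m(1) orb_subset by blast
  have lm: "l = m" "(\<phi>, \<kappa>) \<in> reach {k. l $ k = 0}"
    using Q_eq_iff[OF \<phi> \<kappa> l m(2)] m(4) by auto
  have "{k. l $ k = 0} \<subseteq> - {k}" using lm(1) m(3) by auto
  then have "(\<phi>, \<kappa>) \<in> reach (- {k})" using reach_mono lm(2) by blast
  then show "orb k \<phi> = orb k \<psi> \<and> l $ k > 0"
    using orb_eq_iff[OF \<phi> \<kappa>, of k] in_orb_iff[OF \<psi> \<kappa>, of k] m(1,3) lm(1) by simp
next
  assume "orb k \<phi> = orb k \<psi> \<and> l $ k > 0"
  then show "Q (\<phi>, l) \<in> open_star (k, orb k \<psi>)"
    using in_orb_iff[OF \<psi> \<phi>] l unfolding open_star_def by auto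
qed

lemma star_cases:
  assumes "x \<in> open_star i" "i \<in> cells"
  obtains \<phi> l where "\<phi> \<in> F" "l \<in> simplex3" "x = Q (\<phi>, l)" "i = (fst i, orb (fst i) \<phi>)" "l $ fst i > 0"
proof -
  obtain k \<psi> where i: "i = (k, orb k \<psi>)" "\<psi> \<in> F" using cells_cases[OF assms(2)] .
  obtain \<phi> l where p: "\<phi> \<in> orb k \<psi>" "l \<in> simplex3" "l $ k > 0" "x = Q (\<phi>, l)"
    using assms(1) i by (auto simp: open_star_def)
  have \<phi>: "\<phi> \<in> F" using p(1) orb_subset by blast
  show thesis using that[OF \<phi> p(2,4)] p i in_orb_iff[OF i(2) \<phi>] by simp
qed

text \<open>The set \<open>A \<times> V\<close> is closed under the identifications, so it is the
  full preimage of its image, and the quotient topology makes the image open.\<close>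

lemma preimage_open:
  assumes A: "A \<subseteq> F" and V: "openin (top_of_set simplex3) V"
    and sat: "\<And>\<phi> \<psi> l. \<phi> \<in> A \<Longrightarrow> l \<in> V \<Longrightarrow> (\<phi>, \<psi>) \<in> reach {k. l $ k = 0} \<Longrightarrow> \<psi> \<in> A"
  shows "openin X (Q ` (A \<times> V))" "{z \<in> topspace PR. Q z \<in> Q ` (A \<times> V)} = A \<times> V"
proof -
  have VS: "V \<subseteq> simplex3" using V openin_imp_subset by blast
  show eq: "{z \<in> topspace PR. Q z \<in> Q ` (A \<times> V)} = A \<times> V"
  proof (intro equalityI subsetI)
    fix z assume z: "z \<in> {z \<in> topspace PR. Q z \<in> Q ` (A \<times> V)}"
    obtain \<psi> m where zz: "z = (\<psi>, m)" by (cases z)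
    have F: "\<psi> \<in> F" "m \<in> simplex3" using z zz by auto
    obtain \<phi> l where l: "\<phi> \<in> A" "l \<in> V" "Q (\<phi>, l) = Q (\<psi>, m)" using z zz by auto
    have "l = m" "(\<phi>, \<psi>) \<in> reach {k. l $ k = 0}"
      using Q_eq_iff[of \<phi> \<psi> l m] l A VS F by auto
    then show "z \<in> A \<times> V" using sat[OF l(1,2)] l(2) zz by simp
  next
    fix z assume "z \<in> A \<times> V"
    then show "z \<in> {z \<in> topspace PR. Q z \<in> Q ` (A \<times> V)}" using A VS by auto
  qed
  have "openin PR (A \<times> V)" using A V by (simp add: openin_prod_Times_iff)
  moreover have "Q ` (A \<times> V) \<subseteq> topspace X" using A VS topspace_X by auto
  ultimately show "openin X (Q ` (A \<times> V))"
    using quot[unfolded quotient_map_def, THEN conjunct2, rule_format, of "Q ` (A \<times> V)"] eq by simp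
qed

lemma open_pos: "openin (top_of_set simplex3) {l \<in> simplex3. l $ k > 0}"
proof -
  have "{l \<in> simplex3. l $ k > 0} = simplex3 \<inter> {l. l $ k > 0}" by auto
  then show ?thesis using open_halfspace_component_gt_cart[of 0 k] by (auto simp: openin_open)
qed

lemma star_saturated:
  fixes l :: "real^3"
  assumes \<psi>: "\<psi> \<in> F" and "\<phi> \<in> orb k \<psi>" "l $ k > 0" "(\<phi>, \<kappa>) \<in> reach {k. l $ k = 0}"
  shows "\<kappa> \<in> orb k \<psi>"
proof -
  have "{k. l $ k = 0} \<subseteq> - {k}" using assms(3) by auto
  then have r: "(\<phi>, \<kappa>) \<in> reach (- {k})" using reach_mono assms(4) by blast
  then have F: "\<phi> \<in> F" "\<kappa> \<in> F" by (auto simp: reach_def)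
  then show ?thesis
    using orb_eq_iff[OF F, of k] r in_orb_iff[OF \<psi> F(1), of k] in_orb_iff[OF \<psi> F(2), of k] assms(2) by simp
qed

lemma openin_star: "i \<in> cells \<Longrightarrow> openin X (open_star i)"
proof -
  assume "i \<in> cells"
  then obtain k \<phi> where i: "i = (k, orb k \<phi>)" "\<phi> \<in> F" by (rule cells_cases)
  show ?thesis unfolding open_star_def i fst_conv snd_conv
    by (rule preimage_open(1)[OF orb_subset open_pos]) (use star_saturated[OF i(2)] in blast)
qed

lemma is_path_segment:
  assumes "\<phi> \<in> F" "l \<in> simplex3" "m \<in> simplex3"
  shows "is_path X (\<lambda>t. Q (\<phi>, segment3 l m t)) (Q (\<phi>, l)) (Q (\<phi>, m))"
proof -
  have "continuous_map (top_of_set {0..1}) (top_of_set simplex3) (segment3 l m)"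
    using segment3_simplex3[OF assms(2,3)] by (auto simp: segment3_def intro!: continuous_intros)
  then have "continuous_map (top_of_set {0..1}) PR (\<lambda>t. (\<phi>, segment3 l m t))"
    using assms(1) by (intro continuous_map_pairedI) auto
  from continuous_map_compose[OF this quotient_imp_continuous_map[OF quot]]
  show ?thesis by (simp add: is_path_def pathin_def o_def)
qed

text \<open>In every triangle around the vertex the point moves straight to the vertex. This is
  defined upstairs on flags and coordinates, and has to be pushed down to the quotient together with
  the time parameter.\<close>

lemma star_contraction:
  assumes i: "i \<in> cells"
  obtains c z where "continuous_map (prod_topology (top_of_set {0..1::real}) (subtopology X (open_star i))) X c"
    "\<And>x. x \<in> open_star i \<Longrightarrow> c (0, x) = x" "\<And>x. x \<in> open_star i \<Longrightarrow> c (1, x) = z"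
proof -
  obtain k \<psi> where ik: "i = (k, orb k \<psi>)" and \<psi>: "\<psi> \<in> F" using cells_cases[OF i] .
  let ?V = "{l \<in> simplex3. l $ k > 0}" and ?A = "orb k \<psi>"
  let ?e = "axis k 1 :: real^3"
  have star: "open_star i = Q ` (?A \<times> ?V)" by (simp add: open_star_def ik)
  have pre: "{z \<in> topspace PR. Q z \<in> open_star i} = ?A \<times> ?V" unfolding star
    by (rule preimage_open(2)[OF orb_subset open_pos]) (use star_saturated[OF \<psi>] in blast)
  have q: "quotient_map (subtopology PR (?A \<times> ?V)) (subtopology X (open_star i)) Q"
    by (rule quotient_map_restriction[OF quot pre]) (use openin_star[OF i] in simp)
  let ?T = "prod_topology (top_of_set {0..1::real}) (subtopology PR (?A \<times> ?V))"
  \<comment> \<open>A product with a locally compact Hausdorff factor, here the time interval, keeps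
    a quotient map a quotient map; hence continuity may be tested upstairs.\<close>
  have q2: "quotient_map ?T (prod_topology (top_of_set {0..1}) (subtopology X (open_star i))) (\<lambda>(t, z). (t, Q z))"
  proof (rule quotient_map_prod_right[OF _ _ q])
    show "locally_compact_space (top_of_set {0..1::real})"
      by (intro compact_imp_locally_compact_space) (simp add: compact_space_def)
    show "Hausdorff_space (top_of_set {0..1::real}) \<or> regular_space (top_of_set {0..1::real})"
      by (simp add: Hausdorff_space_subtopology)
  qed
  define h where "h = (\<lambda>(t, (\<phi>, l)). Q (\<phi>, segment3 l ?e t))"
  have PRsub: "subtopology PR (?A \<times> ?V) = prod_topology (discrete_topology ?A) (top_of_set ?V)"
    using orb_subset[of k \<psi>] by (simp add: subtopology_Times subtopology_subtopology inf.absorb2 Collect_conj_eq Int_absorb1)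
  have "continuous_map ?T PR (\<lambda>(t, (\<phi>, l)). (\<phi>, segment3 l ?e t))"
  proof -
    have 1: "continuous_map ?T (discrete_topology F) (\<lambda>w. fst (snd w))"
    proof -
      have "continuous_map ?T (discrete_topology ?A) (fst \<circ> snd)" unfolding PRsub
        by (intro continuous_map_compose[OF continuous_map_snd continuous_map_fst])
      then have "continuous_map ?T (subtopology (discrete_topology F) ?A) (fst \<circ> snd)"
        using orb_subset[of k \<psi>] by (simp add: inf.absorb2)
      then show ?thesis unfolding continuous_map_in_subtopology by (simp add: o_def)
    qed
    have a: "continuous_map ?T (top_of_set {0..1}) fst" by (rule continuous_map_fst)
    have b: "continuous_map ?T (top_of_set ?V) (snd \<circ> snd)" unfolding PRsub
      by (intro continuous_map_compose[OF continuous_map_snd continuous_map_snd])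
    have a': "continuous_map ?T euclideanreal fst" and b': "continuous_map ?T euclidean (\<lambda>w. snd (snd w))"
      using a b by (simp_all add: continuous_map_in_subtopology o_def)
    have ab: "continuous_map ?T (top_of_set ({0..1} \<times> ?V)) (\<lambda>w. (fst w, snd (snd w)))"
    proof -
      have "continuous_map ?T (prod_topology (top_of_set {0..1}) (top_of_set ?V)) (\<lambda>w. (fst w, snd (snd w)))"
        using a b by (intro continuous_map_pairedI) (simp_all add: o_def)
      then show ?thesis by simp
    qed
    have "continuous_map (top_of_set ({0..1} \<times> ?V)) (top_of_set simplex3) (\<lambda>(t, l). segment3 l ?e t)"
      using segment3_simplex3[OF _ axis_simplex3]
      by (auto simp: segment3_def case_prod_unfold intro!: continuous_intros)
    from continuous_map_compose[OF ab this]
    have 2: "continuous_map ?T (top_of_set simplex3) (\<lambda>w. segment3 (snd (snd w)) ?e (fst w))"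
      by (simp add: o_def)
    from continuous_map_pairedI[OF 1 2] show ?thesis by (simp add: case_prod_unfold)
  qed
  from continuous_map_compose[OF this quotient_imp_continuous_map[OF quot]]
  have h: "continuous_map ?T X h" by (simp add: h_def o_def case_prod_unfold)
  \<comment> \<open>Coordinates that vanish stay zero during the motion, so points identified at the
    start remain identified.\<close>
  have hz: "segment3 l ?e t $ m = 0" if "l $ m = 0" "l $ k > 0" for l t m
    using that by (auto simp: segment3_nth axis_def)
  have hx: "h x = h y" if xy: "x \<in> topspace ?T" "y \<in> topspace ?T" "(\<lambda>(t, z). (t, Q z)) x = (\<lambda>(t, z). (t, Q z)) y" for x y
  proof -
    obtain t \<phi> l where x: "x = (t, \<phi>, l)" by (metis prod.exhaust)
    obtain t' \<kappa> m where y: "y = (t', \<kappa>, m)" by (metis prod.exhaust)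
    have tt: "t = t'" "Q (\<phi>, l) = Q (\<kappa>, m)" using xy(3) x y by auto
    have F: "\<phi> \<in> F" "\<kappa> \<in> F" "l \<in> simplex3" "m \<in> simplex3" "l $ k > 0" "0 \<le> t" "t \<le> 1"
      using xy(1,2) x y orb_subset by auto
    have lm: "l = m" "(\<phi>, \<kappa>) \<in> reach {k. l $ k = 0}" using Q_eq_iff[OF F(1-4)] tt(2) by auto
    have "{k. l $ k = 0} \<subseteq> {k. segment3 l ?e t $ k = 0}" using hz[OF _ F(5)] by auto
    then have "(\<phi>, \<kappa>) \<in> reach {k. segment3 l ?e t $ k = 0}" using lm(2) reach_mono by blast
    then have "Q (\<phi>, segment3 l ?e t) = Q (\<kappa>, segment3 l ?e t)"
      using Q_eq_iff[OF F(1,2)] segment3_simplex3[OF F(3) axis_simplex3 F(6,7)] by simp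
    then show "h x = h y" using x y tt lm by (simp add: h_def)
  qed
  obtain c where c: "continuous_map (prod_topology (top_of_set {0..1}) (subtopology X (open_star i))) X c"
      "\<And>x. x \<in> topspace ?T \<Longrightarrow> c ((\<lambda>(t, z). (t, Q z)) x) = h x"
    by (rule quotient_map_lift_exists[OF q2 h], rule hx, assumption+) (rule that; assumption)
  have cQ: "c (t, Q (\<phi>, l)) = Q (\<phi>, segment3 l ?e t)" if "0 \<le> t" "t \<le> 1" "\<phi> \<in> ?A" "l \<in> ?V" for t \<phi> l
    using c(2)[of "(t, \<phi>, l)"] that orb_subset by (auto simp: h_def)
  show thesis
  proof (rule that[OF c(1)])
    fix x assume "x \<in> open_star i"
    then obtain \<phi> l where x: "x = Q (\<phi>, l)" "\<phi> \<in> ?A" "l \<in> ?V" unfolding star by auto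
    show "c (0, x) = x" using cQ[of 0 \<phi> l] x by simp
    have \<phi>: "\<phi> \<in> F" using x(2) orb_subset by blast
    have "{m. ?e $ m = 0} = - {k}" by (auto simp: axis_def)
    then have "Q (\<phi>, ?e) = Q (\<psi>, ?e)"
      using Q_eq_iff[OF \<phi> \<psi> axis_simplex3 axis_simplex3] in_orb_iff[OF \<psi> \<phi>, of k] orb_eq_iff[OF \<phi> \<psi>, of k] x(2) by simp
    then show "c (1, x) = Q (\<psi>, ?e)" using cQ[of 1 \<phi> l] x by simp
  qed
qed

end

section \<open>The open stars form a good cover\<close>

lemma loop_concat_image_subset:
  assumes "p ` {0..1} \<subseteq> A" "q ` {0..1} \<subseteq> A"
  shows "loop_concat p q ` {0..1} \<subseteq> A"
  using assms by (auto simp: loop_concat_def image_subset_iff)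

context flag_complex
begin

lemma segment_in_star:
  assumes "\<phi> \<in> F" "l \<in> simplex3" "m \<in> simplex3" "l $ k > 0" "m $ k > 0"
  shows "(\<lambda>t. Q (\<phi>, segment3 l m t)) ` {0..1} \<subseteq> open_star (k, orb k \<phi>)"
proof safe
  fix t :: real assume "t \<in> {0..1}"
  then show "Q (\<phi>, segment3 l m t) \<in> open_star (k, orb k \<phi>)"
    using assms segment3_simplex3[of l m t] segment3_pos[of l m t k] by (simp add: Q_in_star_iff)
qed

text \<open>Both points are joined to the centre of the star, which is the same point for every
  triangle of the star.\<close>

lemma star_path:
  assumes i: "i \<in> cells" and x: "x \<in> open_star i" and y: "y \<in> open_star i"
  shows "\<exists>p. is_path X p x y \<and> p ` {0..1} \<subseteq> open_star i"
proof -
  obtain \<phi> l where \<phi>: "\<phi> \<in> F" "l \<in> simplex3" "x = Q (\<phi>, l)" "i = (fst i, orb (fst i) \<phi>)" "l $ fst i > 0"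
    using star_cases[OF x i] .
  obtain \<psi> m where \<psi>: "\<psi> \<in> F" "m \<in> simplex3" "y = Q (\<psi>, m)" "i = (fst i, orb (fst i) \<psi>)" "m $ fst i > 0"
    using star_cases[OF y i] .
  let ?k = "fst i"
  let ?e = "axis ?k 1 :: real^3"
  have e: "?e $ ?k > 0" by (simp add: axis_def)
  have "{m. ?e $ m = 0} = - {?k}" by (auto simp: axis_def)
  moreover have "orb ?k \<phi> = orb ?k \<psi>" using \<phi>(4) \<psi>(4) by (metis snd_conv)
  ultimately have eq: "Q (\<phi>, ?e) = Q (\<psi>, ?e)"
    using Q_eq_iff[OF \<phi>(1) \<psi>(1) axis_simplex3 axis_simplex3] orb_eq_iff[OF \<phi>(1) \<psi>(1), of ?k] by simp
  let ?p = "\<lambda>t. Q (\<phi>, segment3 l ?e t)" and ?q = "\<lambda>t. Q (\<psi>, segment3 ?e m t)"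
  have "is_path X ?p x (Q (\<phi>, ?e))" "is_path X ?q (Q (\<phi>, ?e)) y"
    using is_path_segment[OF \<phi>(1,2) axis_simplex3[of ?k]] is_path_segment[OF \<psi>(1) axis_simplex3[of ?k] \<psi>(2)]
      \<phi>(3) \<psi>(3) eq by simp_all
  moreover have "?p ` {0..1} \<subseteq> open_star i"
    using segment_in_star[OF \<phi>(1,2) axis_simplex3 \<phi>(5) e] \<phi>(4) by simp
  moreover have "?q ` {0..1} \<subseteq> open_star i"
    using segment_in_star[OF \<psi>(1) axis_simplex3 \<psi>(2) e \<psi>(5)] \<psi>(4) by simp
  ultimately show ?thesis
    by (intro exI[of _ "loop_concat ?p ?q"] conjI is_path_concat loop_concat_image_subset)
qed

text \<open>A path through a chain of neighbouring triangles, crossing each shared side at its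
  midpoint.\<close>

lemma path_conn_bary:
  assumes "\<phi> \<in> F" "\<psi> \<in> F"
  shows "\<exists>p. is_path X p (Q (\<phi>, bary)) (Q (\<psi>, bary))"
proof -
  have "(\<phi>, \<psi>) \<in> reach UNIV" using connected[OF assms] assms by (simp add: reach_def)
  then show ?thesis
  proof (rule reach_induct)
    show "\<exists>p. is_path X p (Q (\<phi>, bary)) (Q (\<phi>, bary))"
      using is_path_segment[OF assms(1) bary(1) bary(1)] by blast
  next
    fix \<kappa> k assume \<kappa>: "\<kappa> \<in> F" and "\<exists>p. is_path X p (Q (\<phi>, bary)) (Q (\<kappa>, bary))"
    then obtain p where p: "is_path X p (Q (\<phi>, bary)) (Q (\<kappa>, bary))" by blast
    have \<kappa>': "\<tau> k \<kappa> \<in> F" using \<kappa> by (rule \<tau>_closed)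
    have "Q (\<kappa>, mid k) = Q (\<tau> k \<kappa>, mid k)"
      using Q_eq_iff[OF \<kappa> \<kappa>' mid(1) mid(1)] reach_step[OF \<kappa>] mid(2) by simp
    then have "is_path X (\<lambda>t. Q (\<tau> k \<kappa>, segment3 (mid k) bary t)) (Q (\<kappa>, mid k)) (Q (\<tau> k \<kappa>, bary))"
      using is_path_segment[OF \<kappa>' mid(1) bary(1)] by simp
    from is_path_concat[OF p is_path_concat[OF is_path_segment[OF \<kappa> bary(1) mid(1)] this]]
    show "\<exists>p. is_path X p (Q (\<phi>, bary)) (Q (\<tau> k \<kappa>, bary))" by blast
  qed
qed

lemma path_conn_X:
  assumes "x \<in> topspace X" "y \<in> topspace X"
  shows "\<exists>p. is_path X p x y"
proof -
  obtain \<phi> l \<psi> m where \<phi>: "\<phi> \<in> F" "l \<in> simplex3" "x = Q (\<phi>, l)" and \<psi>: "\<psi> \<in> F" "m \<in> simplex3" "y = Q (\<psi>, m)"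
    using assms topspace_X by auto
  obtain p where p: "is_path X p (Q (\<phi>, bary)) (Q (\<psi>, bary))" using path_conn_bary[OF \<phi>(1) \<psi>(1)] by blast
  from is_path_concat[OF is_path_concat[OF is_path_segment[OF \<phi>(1,2) bary(1)] p] is_path_segment[OF \<psi>(1) bary(1) \<psi>(2)]]
  show ?thesis using \<phi> \<psi> by blast
qed

lemma finite_cells: "finite cells"
proof -
  have "finite (F // reach (- {k}))" for k
    by (rule finite_quotient[OF finite_F]) (auto simp: reach_def)
  then show ?thesis by (auto simp: cells_def)
qed

lemma card_cells: "card cells = (\<Sum>k\<in>UNIV. card (F // reach (- {k})))"
proof -
  have "finite (F // reach (- {k}))" for k
    by (rule finite_quotient[OF finite_F]) (auto simp: reach_def)
  then show ?thesis unfolding cells_def by (intro card_SigmaI) auto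
qed

lemma star_nonempty: "i \<in> cells \<Longrightarrow> open_star i \<noteq> {}"
proof -
  assume "i \<in> cells"
  then obtain k \<phi> where i: "i = (k, orb k \<phi>)" "\<phi> \<in> F" by (rule cells_cases)
  then have "Q (\<phi>, bary) \<in> open_star i" by (simp add: Q_in_star_iff bary)
  then show ?thesis by blast
qed

lemma star_covers: "topspace X \<subseteq> (\<Union>i\<in>cells. open_star i)"
proof
  fix x assume "x \<in> topspace X"
  then obtain \<phi> l where \<phi>: "\<phi> \<in> F" "l \<in> simplex3" "x = Q (\<phi>, l)" using topspace_X by auto
  have "\<exists>k. l $ k > 0"
  proof (rule ccontr)
    assume "\<not> (\<exists>k. l $ k > 0)"
    then have "(\<Sum>k\<in>UNIV. l $ k) \<le> 0" by (intro sum_nonpos) (simp add: not_less)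
    then show False using \<phi>(2) by (simp add: simplex3_def)
  qed
  then obtain k where "l $ k > 0" ..
  then have "x \<in> open_star (k, orb k \<phi>)" using \<phi> by (simp add: Q_in_star_iff)
  then show "x \<in> (\<Union>i\<in>cells. open_star i)" using orb_in_cells[OF \<phi>(1)] by blast
qed

lemma star_simply:
  assumes i: "i \<in> cells" and p: "is_path X p x y" "p ` {0..1} \<subseteq> open_star i"
    and q: "is_path X q x y" "q ` {0..1} \<subseteq> open_star i"
  shows "path_homotopic X p q"
proof -
  obtain c z where c: "continuous_map (prod_topology (top_of_set {0..1::real}) (subtopology X (open_star i))) X c"
    "\<And>x. x \<in> open_star i \<Longrightarrow> c (0, x) = x" "\<And>x. x \<in> open_star i \<Longrightarrow> c (1, x) = z"
    by (rule star_contraction[OF i]) (rule that; assumption)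
  have "path_homotopic X r (loop_concat (\<lambda>t. c (t, x)) (loop_concat (\<lambda>_. z) (\<lambda>t. c (1 - t, y))))"
    if "is_path X r x y" "r ` {0..1} \<subseteq> open_star i" for r
    by (rule path_homotopic_contraction[OF c(1) _ _ that]) (use c(2,3) in auto)
  from this[OF p] this[OF q] show ?thesis by (blast intro: path_homotopic_sym path_homotopic_trans)
qed

end

section \<open>Cocycles of the star cover as labels of flags\<close>

locale flag_complex_group = flag_complex X F \<tau> Q + group G
  for X :: "'a topology" and F :: "'f set" and \<tau> Q and G :: "('g, 'b) monoid_scheme" (structure) +
  assumes finite_group: "finite (carrier G)"

sublocale flag_complex_group \<subseteq> good_cover X cells open_star G
proof unfold_locales
  show "path_homotopic X p q"
    if "i \<in> cells" "is_path X p x y" "is_path X q x y" "p ` {0..1} \<subseteq> open_star i" "q ` {0..1} \<subseteq> open_star i"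
    for i p q x y using star_simply that by blast
qed (use openin_star star_covers finite_cells finite_group star_nonempty star_path path_conn_X in auto)

context flag_complex_group
begin

text \<open>The transition functions between the three stars that contain the interior of the triangle \<open>\<phi>\<close>.\<close>

definition flag_labels :: "(3 \<Rightarrow> 3 \<Rightarrow> 'f \<Rightarrow> 'g) set" where
  "flag_labels = {\<gamma>.
     (\<forall>k l. \<forall>\<phi>\<in>F. \<gamma> k l \<phi> \<in> carrier G) \<and>
     (\<forall>k l m. \<forall>\<phi>\<in>F. \<gamma> k l \<phi> \<otimes> \<gamma> l m \<phi> = \<gamma> k m \<phi>) \<and>
     (\<forall>k l m. \<forall>\<phi>\<in>F. m \<noteq> k \<longrightarrow> m \<noteq> l \<longrightarrow> \<gamma> k l (\<tau> m \<phi>) = \<gamma> k l \<phi>) \<and>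
     (\<forall>k l. \<forall>\<phi>. \<phi> \<notin> F \<longrightarrow> \<gamma> k l \<phi> = undefined)}"

definition flag_restrict :: "(3 \<times> 'f set \<Rightarrow> 3 \<times> 'f set \<Rightarrow> 'a \<Rightarrow> 'g) \<Rightarrow> 3 \<Rightarrow> 3 \<Rightarrow> 'f \<Rightarrow> 'g" where
  "flag_restrict g k l \<phi> = (if \<phi> \<in> F then g (k, orb k \<phi>) (l, orb l \<phi>) (Q (\<phi>, bary)) else undefined)"

lemma cocycle_segment:
  assumes g: "cocycle g" and \<phi>: "\<phi> \<in> F" and l: "l \<in> simplex3" "l $ k > 0" "l $ k' > 0"
    and m: "m \<in> simplex3" "m $ k > 0" "m $ k' > 0"
  shows "g (k, orb k \<phi>) (k', orb k' \<phi>) (Q (\<phi>, l)) = g (k, orb k \<phi>) (k', orb k' \<phi>) (Q (\<phi>, m))"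
proof -
  let ?p = "\<lambda>t. Q (\<phi>, segment3 l m t)"
  have p: "pathin X ?p" using is_path_segment[OF \<phi> l(1) m(1)] by (simp add: is_path_def)
  have "?p ` {0..1} \<subseteq> open_star (k, orb k \<phi>) \<inter> open_star (k', orb k' \<phi>)"
    using segment_in_star[OF \<phi> l(1) m(1) l(2) m(2)] segment_in_star[OF \<phi> l(1) m(1) l(3) m(3)] by blast
  from cocycle_path[OF g orb_in_cells[OF \<phi>] orb_in_cells[OF \<phi>] p this] show ?thesis by simp
qed

lemma orb_\<tau>: "\<phi> \<in> F \<Longrightarrow> m \<noteq> k \<Longrightarrow> orb k (\<tau> m \<phi>) = orb k \<phi>"
  using orb_eq_iff[of \<phi> "\<tau> m \<phi>" k] reach_step[of \<phi> m "- {k}"] \<tau>_closed by simp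

lemma bary_in_star: "\<phi> \<in> F \<Longrightarrow> Q (\<phi>, bary) \<in> open_star (k, orb k \<phi>)"
  by (simp add: Q_in_star_iff bary)

text \<open>The side shared by \<open>\<phi>\<close> and \<open>\<tau> m \<phi>\<close> has its
  midpoint in the stars of the types \<open>k\<close> and \<open>l\<close> because both differ from
  \<open>m\<close>. The path from one barycentre to the other through that midpoint stays in both
  stars, so the transition function does not change.\<close>

lemma flag_restrict_in:
  assumes g: "cocycle g"
  shows "flag_restrict g \<in> flag_labels"
proof -
  have "flag_restrict g k l (\<tau> m \<phi>) = flag_restrict g k l \<phi>" if \<phi>: "\<phi> \<in> F" and m: "m \<noteq> k" "m \<noteq> l" for k l m \<phi>
  proof -
    have \<phi>': "\<tau> m \<phi> \<in> F" using \<phi> by (rule \<tau>_closed)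
    have eq: "Q (\<phi>, mid m) = Q (\<tau> m \<phi>, mid m)"
      using Q_eq_iff[OF \<phi> \<phi>' mid(1) mid(1)] reach_step[OF \<phi>] mid(2) by simp
    have "g (k, orb k \<phi>) (l, orb l \<phi>) (Q (\<phi>, bary)) = g (k, orb k \<phi>) (l, orb l \<phi>) (Q (\<phi>, mid m))"
      using m by (intro cocycle_segment[OF g \<phi>] bary mid) auto
    also have "\<dots> = g (k, orb k (\<tau> m \<phi>)) (l, orb l (\<tau> m \<phi>)) (Q (\<tau> m \<phi>, mid m))"
      using orb_\<tau>[OF \<phi> m(1)] orb_\<tau>[OF \<phi> m(2)] eq by simp
    also have "\<dots> = g (k, orb k (\<tau> m \<phi>)) (l, orb l (\<tau> m \<phi>)) (Q (\<tau> m \<phi>, bary))"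
      using m by (intro cocycle_segment[OF g \<phi>'] bary mid) auto
    finally show ?thesis using \<phi> \<phi>' by (simp add: flag_restrict_def)
  qed
  then show ?thesis
    using cocycle_closed[OF g] cocycle_mult[OF g] orb_in_cells bary_in_star
    by (auto simp: flag_labels_def flag_restrict_def)
qed

lemma two_stars_cases:
  assumes "i \<in> cells" "j \<in> cells" "x \<in> open_star i" "x \<in> open_star j"
  obtains \<phi> l where "\<phi> \<in> F" "l \<in> simplex3" "x = Q (\<phi>, l)" "i = (fst i, orb (fst i) \<phi>)" "l $ fst i > 0"
    "j = (fst j, orb (fst j) \<phi>)" "l $ fst j > 0"
proof -
  obtain \<phi> l where \<phi>: "\<phi> \<in> F" "l \<in> simplex3" "x = Q (\<phi>, l)" "i = (fst i, orb (fst i) \<phi>)" "l $ fst i > 0"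
    using star_cases[OF assms(3,1)] .
  obtain k \<psi> where j: "j = (k, orb k \<psi>)" "\<psi> \<in> F" using cells_cases[OF assms(2)] .
  have "orb k \<phi> = orb k \<psi> \<and> l $ k > 0" using Q_in_star_iff[OF \<phi>(1,2) j(2)] assms(4) j \<phi>(3) by simp
  then show thesis using that[OF \<phi>] j by simp
qed

lemma inj_flag_restrict: "inj_on flag_restrict cocycles"
proof (rule inj_onI)
  fix g g' assume gs: "g \<in> cocycles" "g' \<in> cocycles" and eq: "flag_restrict g = flag_restrict g'"
  have g: "cocycle g" "cocycle g'" using gs by (auto simp: cocycles_def)
  show "g = g'"
  proof (intro ext)
    fix i j x
    show "g i j x = g' i j x"
    proof (cases "i \<in> cells \<and> j \<in> cells \<and> x \<in> open_star i \<and> x \<in> open_star j")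
      case True
      then obtain \<phi> l where \<phi>: "\<phi> \<in> F" "l \<in> simplex3" "x = Q (\<phi>, l)" "i = (fst i, orb (fst i) \<phi>)" "l $ fst i > 0"
        "j = (fst j, orb (fst j) \<phi>)" "l $ fst j > 0" using two_stars_cases by metis
      define k where "k = fst i"
      define k' where "k' = fst j"
      have ij: "i = (k, orb k \<phi>)" "j = (k', orb k' \<phi>)" using \<phi>(4,6) by (simp_all add: k_def k'_def)
      have "g i j x = flag_restrict g k k' \<phi>" if "cocycle g" for g
        using cocycle_segment[OF that \<phi>(1,2) _ _ bary(1) bary(2) bary(2), of k k'] \<phi>(5,7)
        by (simp add: flag_restrict_def \<phi>(1,3) ij)
      from this[OF g(1)] this[OF g(2)] show ?thesis using eq by simp
    next
      case False
      then have "g i j x = undefined" "g' i j x = undefined" using gs unfolding cocycles_def by blast+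
      then show ?thesis by simp
    qed
  qed
qed

text \<open>The transition function at a point is read off from any flag that contains it.
  Continuity of a path enters through the openness of the sets on which the label has a given
  value.\<close>

lemma surj_flag_restrict:
  assumes \<gamma>: "\<gamma> \<in> flag_labels"
  shows "\<exists>g\<in>cocycles. flag_restrict g = \<gamma>"
proof -
  have \<gamma>_closed: "\<gamma> k l \<phi> \<in> carrier G" and \<gamma>_mult: "\<gamma> k l \<phi> \<otimes> \<gamma> l m \<phi> = \<gamma> k m \<phi>"
    and \<gamma>_\<tau>: "m \<noteq> k \<Longrightarrow> m \<noteq> l \<Longrightarrow> \<gamma> k l (\<tau> m \<phi>) = \<gamma> k l \<phi>" if "\<phi> \<in> F" for k l m \<phi>
    using \<gamma> that unfolding flag_labels_def by blast+
  have \<gamma>_ext: "\<gamma> k l \<phi> = undefined" if "\<phi> \<notin> F" for k l \<phi>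
    using \<gamma> that unfolding flag_labels_def by blast
  define sel where "sel = (\<lambda>x. SOME \<phi>. \<phi> \<in> F \<and> (\<exists>l\<in>simplex3. x = Q (\<phi>, l)))"
  define g where "g = (\<lambda>i j x. if i \<in> cells \<and> j \<in> cells \<and> x \<in> open_star i \<and> x \<in> open_star j
      then \<gamma> (fst i) (fst j) (sel x) else undefined)"
  \<comment> \<open>Flags containing the same point are connected across sides opposite to types
    with zero coordinate. These types differ from \<open>k\<close> and \<open>k'\<close>, so the
    label is the same and the choice in \<open>sel\<close> does not matter.\<close>
  have sel: "\<gamma> k k' (sel (Q (\<phi>, l))) = \<gamma> k k' \<phi>"
    if \<phi>: "\<phi> \<in> F" "l \<in> simplex3" "l $ k > 0" "l $ k' > 0" for \<phi> l k k'
  proof -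
    have "\<exists>\<psi>. \<psi> \<in> F \<and> (\<exists>m\<in>simplex3. Q (\<phi>, l) = Q (\<psi>, m))" using \<phi> by blast
    from someI_ex[OF this] obtain m where m: "sel (Q (\<phi>, l)) \<in> F" "m \<in> simplex3" "Q (\<phi>, l) = Q (sel (Q (\<phi>, l)), m)"
      unfolding sel_def by blast
    have "(\<phi>, sel (Q (\<phi>, l))) \<in> reach {k. l $ k = 0}"
      using iffD1[OF Q_eq_iff[OF \<phi>(1) m(1) \<phi>(2) m(2)] m(3)] by (rule conjunct2)
    then show ?thesis
    proof (rule reach_induct)
      fix \<kappa> n assume *: "\<kappa> \<in> F" "n \<in> {k. l $ k = 0}" "\<gamma> k k' \<kappa> = \<gamma> k k' \<phi>"
      then have "n \<noteq> k" "n \<noteq> k'" using \<phi>(3,4) by auto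
      with * show "\<gamma> k k' (\<tau> n \<kappa>) = \<gamma> k k' \<phi>" using \<gamma>_\<tau>[of \<kappa> n k k'] by simp
    qed simp
  qed
  have g_eq: "g (k, orb k \<phi>) (k', orb k' \<phi>) (Q (\<phi>, l)) = \<gamma> k k' \<phi>"
    if "\<phi> \<in> F" "l \<in> simplex3" "l $ k > 0" "l $ k' > 0" for \<phi> l k k'
    using that sel[OF that] orb_in_cells by (simp add: g_def Q_in_star_iff)
  have "cocycle g" unfolding cocycle_def
  proof (intro conjI ballI allI impI)
    fix i j x assume "i \<in> cells" "j \<in> cells" "x \<in> open_star i \<inter> open_star j"
    then obtain \<phi> l where "\<phi> \<in> F" "l \<in> simplex3" "x = Q (\<phi>, l)" "i = (fst i, orb (fst i) \<phi>)" "l $ fst i > 0"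
        "j = (fst j, orb (fst j) \<phi>)" "l $ fst j > 0" using two_stars_cases[of i j x] by blast
    then show "g i j x \<in> carrier G" using g_eq \<gamma>_closed by metis
  next
    fix i j k x assume ijk: "i \<in> cells" "j \<in> cells" "k \<in> cells" "x \<in> open_star i \<inter> open_star j \<inter> open_star k"
    then obtain \<phi> l where \<phi>: "\<phi> \<in> F" "l \<in> simplex3" "x = Q (\<phi>, l)" "i = (fst i, orb (fst i) \<phi>)" "l $ fst i > 0"
        "j = (fst j, orb (fst j) \<phi>)" "l $ fst j > 0" using two_stars_cases[of i j x] by blast
    obtain k' \<psi> where k: "k = (k', orb k' \<psi>)" "\<psi> \<in> F" using cells_cases[OF ijk(3)] .
    have k'': "orb k' \<phi> = orb k' \<psi>" "l $ k' > 0" using Q_in_star_iff[OF \<phi>(1,2) k(2)] ijk(4) k \<phi>(3) by auto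
    define a where "a = fst i"
    define b where "b = fst j"
    have ij: "i = (a, orb a \<phi>)" "j = (b, orb b \<phi>)" "k = (k', orb k' \<phi>)" "l $ a > 0" "l $ b > 0"
      using \<phi>(4-7) k k'' by (simp_all add: a_def b_def)
    show "g i j x \<otimes> g j k x = g i k x"
      unfolding ij(1-3) \<phi>(3) using g_eq[OF \<phi>(1,2)] ij(4,5) k''(2) \<gamma>_mult[OF \<phi>(1)] by simp
  next
    fix i j p assume ij: "i \<in> cells" "j \<in> cells" and p: "pathin X p" "p ` {0..1} \<subseteq> open_star i \<inter> open_star j"
    define k where "k = fst i"
    define k' where "k' = fst j"
    have cases: "\<exists>\<phi> l. \<phi> \<in> F \<and> l \<in> simplex3 \<and> p t = Q (\<phi>, l) \<and> i = (k, orb k \<phi>) \<and> j = (k', orb k' \<phi>) \<and> l $ k > 0 \<and> l $ k' > 0"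
      if "t \<in> {0..1}" for t
      using two_stars_cases[OF ij, of "p t"] p(2) that unfolding k_def k'_def by blast
    \<comment> \<open>The flags at the cells \<open>i\<close> and \<open>j\<close> with label
      \<open>v\<close>. Together with the coordinates \<open>V\<close> common to both stars they
      form a saturated set, whose image is open.\<close>
    define A where "A = (\<lambda>v. {\<phi> \<in> F. i = (k, orb k \<phi>) \<and> j = (k', orb k' \<phi>) \<and> \<gamma> k k' \<phi> = v})"
    define V where "V = {l \<in> simplex3. l $ k > 0} \<inter> {l \<in> simplex3. l $ k' > 0}"
    have opn: "openin X (Q ` (A v \<times> V))" for v
    proof (rule preimage_open(1))
      show "openin (top_of_set simplex3) V" unfolding V_def by (intro openin_Int open_pos)
      fix \<phi> \<psi> l assume *: "\<phi> \<in> A v" "l \<in> V" "(\<phi>, \<psi>) \<in> reach {k. l $ k = 0}"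
      from *(3) show "\<psi> \<in> A v"
      proof (rule reach_induct)
        fix \<kappa> n assume "\<kappa> \<in> F" "n \<in> {k. l $ k = 0}" "\<kappa> \<in> A v"
        moreover from this have "n \<noteq> k" "n \<noteq> k'" using *(2) by (auto simp: V_def)
        ultimately show "\<tau> n \<kappa> \<in> A v" using orb_\<tau> \<gamma>_\<tau> \<tau>_closed by (simp add: A_def)
      qed (rule *(1))
    qed (auto simp: A_def)
    have val: "g i j (p t) = v" if pt: "p t \<in> Q ` (A v \<times> V)" for t v
    proof -
      obtain \<phi> l where "\<phi> \<in> A v" "l \<in> V" "p t = Q (\<phi>, l)" using pt by auto
      then show ?thesis using g_eq[of \<phi> l k k'] by (auto simp: A_def V_def)
    qed
    \<comment> \<open>Each value is attained on an open set of times, so the value is locally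
      constant and the connectedness of the interval finishes the argument.\<close>
    have "(\<lambda>t. g i j (p t)) constant_on {0..1::real}"
    proof (rule locally_constant_imp_constant)
      fix a :: real assume a: "a \<in> {0..1}"
      let ?T = "{t \<in> {0..1}. p t \<in> Q ` (A (g i j (p a)) \<times> V)}"
      have "openin (top_of_set {0..1}) ?T"
        using openin_continuous_map_preimage[OF p(1)[unfolded pathin_def] opn] by simp
      moreover have "a \<in> ?T"
      proof -
        obtain \<phi> l where \<phi>: "\<phi> \<in> F" "l \<in> simplex3" "p a = Q (\<phi>, l)" "i = (k, orb k \<phi>)" "j = (k', orb k' \<phi>)"
          "l $ k > 0" "l $ k' > 0" using cases[OF a] by blast
        then have "g i j (p a) = \<gamma> k k' \<phi>" using g_eq[of \<phi> l k k'] by simp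
        then have "\<phi> \<in> A (g i j (p a))" using \<phi> by (simp add: A_def)
        moreover have "l \<in> V" using \<phi> by (simp add: V_def)
        ultimately have "Q (\<phi>, l) \<in> Q ` (A (g i j (p a)) \<times> V)" by blast
        then show ?thesis using a \<phi>(3) by simp
      qed
      moreover have "\<forall>t\<in>?T. g i j (p t) = g i j (p a)" using val by simp
      ultimately show "\<exists>T. openin (top_of_set {0..1}) T \<and> a \<in> T \<and> (\<forall>t\<in>T. g i j (p t) = g i j (p a))" by blast
    qed simp
    then show "g i j (p 0) = g i j (p 1)" unfolding constant_on_def by auto
  qed
  then have "g \<in> cocycles" by (simp add: cocycles_def g_def)
  moreover have "flag_restrict g = \<gamma>"
    using g_eq[OF _ bary(1) bary(2) bary(2)] \<gamma>_ext by (auto simp: flag_restrict_def fun_eq_iff)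
  ultimately show ?thesis by blast
qed

lemma card_flag_labels:
  assumes "x \<in> topspace X"
  shows "card flag_labels = num_homs (fundamental_group X x) G *
    card (carrier G) ^ ((\<Sum>k\<in>UNIV. card (F // reach (- {k}))) - 1)"
proof -
  have "bij_betw flag_restrict cocycles flag_labels"
    unfolding bij_betw_def
  proof (intro conjI inj_flag_restrict equalityI subsetI)
    fix \<gamma> assume "\<gamma> \<in> flag_restrict ` cocycles"
    then show "\<gamma> \<in> flag_labels" using flag_restrict_in by (auto simp: cocycles_def)
  next
    fix \<gamma> assume "\<gamma> \<in> flag_labels"
    then show "\<gamma> \<in> flag_restrict ` cocycles" using surj_flag_restrict by blast
  qed
  then have "card flag_labels = card cocycles" by (metis bij_betw_same_card)
  then show ?thesis using card_cocycles_eq[OF assms] card_cells by simp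
qed

end

section \<open>The surface of a ribbon graph as a flag complex\<close>

lemma compact_simplex3: "compact simplex3"
proof -
  have c1: "closed {l::real^3. \<forall>k. 0 \<le> l $ k}"
    by (intro closed_Collect_all closed_Collect_le continuous_intros)
  have c2: "closed {l::real^3. (\<Sum>k\<in>UNIV. l $ k) = 1}"
    by (intro closed_Collect_eq continuous_intros)
  have "simplex3 = {l. \<forall>k. 0 \<le> l $ k} \<inter> {l. (\<Sum>k\<in>UNIV. l $ k) = 1}"
    by (auto simp: simplex3_def)
  then have "closed simplex3" using closed_Int[OF c1 c2] by (simp only:)
  moreover have "norm l \<le> 1" if "l \<in> simplex3" for l
    using norm_le_l1_cart[of l] that by (simp add: simplex3_def)
  then have "bounded simplex3" by (auto simp: bounded_iff)
  ultimately show ?thesis by (simp add: compact_eq_bounded_closed)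
qed

lemma card_quotient_kernel:
  assumes R: "equiv A R" and f: "\<And>x y. x \<in> A \<Longrightarrow> y \<in> A \<Longrightarrow> (x, y) \<in> R \<longleftrightarrow> f x = f y"
  shows "card (A // R) = card (f ` A)"
proof -
  have sub: "R \<subseteq> A \<times> A" using R by (simp add: equiv_def)
  have cls: "R `` {x} = {y \<in> A. f y = f x}" if "x \<in> A" for x
    using sub f[OF that] that by auto
  have "A // R = (\<lambda>c. {y \<in> A. f y = c}) ` (f ` A)"
    unfolding quotient_def image_image using cls by auto
  moreover have "inj_on (\<lambda>c. {y \<in> A. f y = c}) (f ` A)" by (rule inj_onI) blast
  ultimately show ?thesis by (simp add: card_image)
qed

text \<open>On each pair \<open>{h, op h}\<close> one value is free and the other follows; the
  condition on \<open>c\<close> says that returning to \<open>h\<close> imposes nothing new.\<close>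

lemma (in group) card_twisted_functions:
  assumes H: "finite H" and op: "\<And>h. h \<in> H \<Longrightarrow> op h \<in> H \<and> op h \<noteq> h \<and> op (op h) = h"
    and c: "\<And>h. h \<in> H \<Longrightarrow> c h \<in> carrier G" "\<And>h. h \<in> H \<Longrightarrow> c (op h) \<otimes> c h = \<one>"
  shows "card {A \<in> H \<rightarrow>\<^sub>E carrier G. \<forall>h\<in>H. A (op h) = c h \<otimes> A h} =
    card (carrier G) ^ card ((\<lambda>h. {h, op h}) ` H)"
proof -
  \<comment> \<open>One representative of every pair, on which the function is free.\<close>
  define T where "T = (\<lambda>e. SOME h. h \<in> e) ` (\<lambda>h. {h, op h}) ` H"
  let ?S = "{A \<in> H \<rightarrow>\<^sub>E carrier G. \<forall>h\<in>H. A (op h) = c h \<otimes> A h}"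
  have rep: "(SOME x. x \<in> {h, op h}) \<in> {h, op h}" for h by (rule someI[of _ h]) simp
  have TH: "T \<subseteq> H"
  proof
    fix x assume "x \<in> T"
    then obtain h where h: "h \<in> H" "x = (SOME k. k \<in> {h, op h})" by (auto simp: T_def)
    then have "x \<in> {h, op h}" using rep by metis
    then show "x \<in> H" using op[OF h(1)] h(1) by auto
  qed
  have edge: "{h, op h} = {k, op k}" if "h \<in> H" "k \<in> {h, op h}" for h k using that op by auto
  have one: "op h \<notin> T \<longleftrightarrow> h \<in> T" if h: "h \<in> H" for h
  proof -
    have T_iff: "k \<in> T \<longleftrightarrow> k = (SOME x. x \<in> {k, op k})" if k: "k \<in> H" for k
    proof
      assume "k \<in> T"
      then obtain j where j: "j \<in> H" "k = (SOME x. x \<in> {j, op j})" by (auto simp: T_def)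
      then have "k \<in> {j, op j}" using rep by metis
      then show "k = (SOME x. x \<in> {k, op k})" using edge[OF j(1)] j(2) by metis
    next
      assume eq: "k = (SOME x. x \<in> {k, op k})"
      show "k \<in> T" unfolding T_def using eq k by (intro image_eqI[where x = "{k, op k}"]) auto
    qed
    have "{op h, op (op h)} = {h, op h}" using op[OF h] by auto
    then have "op h \<in> T \<longleftrightarrow> op h = (SOME x. x \<in> {h, op h})" using T_iff[of "op h"] op[OF h] by simp
    moreover have "h \<in> T \<longleftrightarrow> h = (SOME x. x \<in> {h, op h})" by (rule T_iff[OF h])
    ultimately show ?thesis using rep[of h] op[OF h] by auto
  qed
  have "inj_on (\<lambda>e. SOME h. h \<in> e) ((\<lambda>h. {h, op h}) ` H)"
  proof (rule inj_onI)
    fix e e' assume e: "e \<in> (\<lambda>h. {h, op h}) ` H" "e' \<in> (\<lambda>h. {h, op h}) ` H" and eq: "(SOME h. h \<in> e) = (SOME h. h \<in> e')"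
    obtain h h' where h: "h \<in> H" "e = {h, op h}" "h' \<in> H" "e' = {h', op h'}" using e by auto
    have edge': "d = {k, op k}" if "g \<in> H" "d = {g, op g}" "k \<in> d" for d g k
      using edge[of g k] that by simp
    have "(SOME h. h \<in> e) \<in> e" "(SOME h. h \<in> e') \<in> e'" unfolding h(2,4) by (rule rep)+
    then have "e = {SOME h. h \<in> e, op (SOME h. h \<in> e)}" "e' = {SOME h. h \<in> e', op (SOME h. h \<in> e')}"
      using edge'[OF h(1,2)] edge'[OF h(3,4)] by blast+
    then show "e = e'" using eq by metis
  qed
  then have cardT: "card T = card ((\<lambda>h. {h, op h}) ` H)" unfolding T_def by (rule card_image)
  have "bij_betw (\<lambda>A. restrict A T) ?S (T \<rightarrow>\<^sub>E carrier G)"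
  proof (rule bij_betw_byWitness[where f' = "\<lambda>B. \<lambda>h\<in>H. if h \<in> T then B h else c (op h) \<otimes> B (op h)"])
    show "\<forall>A\<in>?S. (\<lambda>h\<in>H. if h \<in> T then restrict A T h else c (op h) \<otimes> restrict A T (op h)) = A"
    proof
      fix A assume A: "A \<in> ?S"
      show "(\<lambda>h\<in>H. if h \<in> T then restrict A T h else c (op h) \<otimes> restrict A T (op h)) = A"
      proof
        fix h
        show "(\<lambda>h\<in>H. if h \<in> T then restrict A T h else c (op h) \<otimes> restrict A T (op h)) h = A h"
        proof (cases "h \<in> H")
          case True
          have eq: "A (op (op h)) = c (op h) \<otimes> A (op h)" using A op[OF True] by blast
          show ?thesis using True one[OF True] op[OF True] eq by auto
        next
          case False
          then show ?thesis using A by (auto simp: PiE_def extensional_def)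
        qed
      qed
    qed
    show "\<forall>B\<in>T \<rightarrow>\<^sub>E carrier G. restrict (\<lambda>h\<in>H. if h \<in> T then B h else c (op h) \<otimes> B (op h)) T = B"
      using TH by (auto simp: fun_eq_iff PiE_def extensional_def)
    show "(\<lambda>A. restrict A T) ` ?S \<subseteq> T \<rightarrow>\<^sub>E carrier G" using TH by (auto simp: PiE_def)
    show "(\<lambda>B. \<lambda>h\<in>H. if h \<in> T then B h else c (op h) \<otimes> B (op h)) ` (T \<rightarrow>\<^sub>E carrier G) \<subseteq> ?S"
    proof (rule image_subsetI)
      fix B assume B: "B \<in> T \<rightarrow>\<^sub>E carrier G"
      let ?A = "\<lambda>h\<in>H. if h \<in> T then B h else c (op h) \<otimes> B (op h)"
      have Bc: "B h \<in> carrier G" if "h \<in> T" for h using B that by auto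
      have Ac: "?A h \<in> carrier G" if h: "h \<in> H" for h
      proof (cases "h \<in> T")
        case False
        then have "op h \<in> T" using one[OF h] by blast
        then show ?thesis using False h op[OF h] c(1)[of "op h"] Bc[of "op h"] by simp
      qed (use h Bc in simp)
      have clo: "?A \<in> H \<rightarrow>\<^sub>E carrier G"
      proof (rule PiE_I)
        fix h assume "h \<in> H" then show "?A h \<in> carrier G" by (rule Ac)
      qed simp
      moreover have "?A (op h) = c h \<otimes> ?A h" if h: "h \<in> H" for h
      proof (cases "h \<in> T")
        case True
        then show ?thesis using h op[OF h] one[OF h] by simp
      next
        case False
        then have oT: "op h \<in> T" using one[OF h] by blast
        have "c h \<otimes> (c (op h) \<otimes> B (op h)) = B (op h)"
          using c(2)[of "op h"] op[OF h] c(1) h Bc[OF oT] by (simp flip: m_assoc)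
        then show ?thesis using False oT h op[OF h] by simp
      qed
      ultimately show "?A \<in> ?S" by blast
    qed
  qed
  then have "card ?S = card (T \<rightarrow>\<^sub>E carrier G)" by (rule bij_betw_same_card)
  also have "\<dots> = card (carrier G) ^ card T" using finite_subset[OF TH H] by (simp add: card_PiE)
  finally show ?thesis using cardT by simp
qed

text \<open>The assumption \<open>incident\<close> rules out isolated vertices: the surface is
  assembled from half-edges and would not see them.\<close>

locale rgraph =
  fixes \<Gamma> :: "('v, 'h) ribbon_graph"
  assumes ribbon: "ribbon_graph \<Gamma>" and conn: "rg_connected \<Gamma>"
    and incident: "v \<in> rg_verts \<Gamma> \<Longrightarrow> rg_incident \<Gamma> v \<noteq> {}"
begin

abbreviation "H \<equiv> rg_halves \<Gamma>"
abbreviation "opp \<equiv> rg_opp \<Gamma>"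
abbreviation "nxt \<equiv> rg_next \<Gamma>"
abbreviation "vert \<equiv> rg_vert \<Gamma>"
abbreviation "face \<equiv> rg_face_next \<Gamma>"

lemma finite_H: "finite H" and finite_V: "finite (rg_verts \<Gamma>)"
  using ribbon by (auto simp: ribbon_graph_def)

lemma opp: "h \<in> H \<Longrightarrow> opp h \<in> H" "h \<in> H \<Longrightarrow> opp h \<noteq> h" "h \<in> H \<Longrightarrow> opp (opp h) = h"
  using ribbon by (auto simp: ribbon_graph_def)

lemma vert: "h \<in> H \<Longrightarrow> vert h \<in> rg_verts \<Gamma>"
  using ribbon by (auto simp: ribbon_graph_def)

lemma cyclic: "h \<in> H \<Longrightarrow> cyclic_on nxt (rg_incident \<Gamma> (vert h))"
  using ribbon vert[of h] incident[of "vert h"] by (auto simp: ribbon_graph_def)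

lemma nxt: "h \<in> H \<Longrightarrow> nxt h \<in> H" "h \<in> H \<Longrightarrow> vert (nxt h) = vert h"
  using cyclic_on_inI[OF cyclic[of h], of h] by (auto simp: rg_incident_def)

lemma nxt_surj: "nxt ` H = H"
proof (intro equalityI subsetI)
  fix h assume h: "h \<in> H"
  then have "h \<in> rg_incident \<Gamma> (vert h)" by (simp add: rg_incident_def)
  then have "h \<in> orbit nxt h" using cyclic[OF h] by (auto simp: cyclic_on_alldef)
  then obtain y where y: "h = nxt y" "y = h \<or> y \<in> orbit nxt h" by cases auto
  have "orbit nxt h \<subseteq> H"
  proof
    fix x assume "x \<in> orbit nxt h" then show "x \<in> H" by induction (use h nxt in auto)
  qed
  then have "y \<in> H" using y(2) h by (elim disjE) (simp, blast)
  with y(1) show "h \<in> nxt ` H" by (rule image_eqI)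
qed (use nxt in auto)

lemma face: "h \<in> H \<Longrightarrow> face h \<in> H" "h \<in> H \<Longrightarrow> face (opp h) = nxt h"
  using opp nxt by (auto simp: rg_face_next_def)

lemma bij_face: "bij_betw face H H"
proof -
  have "opp ` H = H"
  proof (intro equalityI subsetI)
    fix h assume "h \<in> H" then show "h \<in> opp ` H" using opp by (metis imageI)
  qed (use opp in auto)
  then have "face ` H = H" using nxt_surj by (simp add: rg_face_next_def[abs_def] flip: image_image)
  then show ?thesis using finite_H by (simp add: bij_betw_def eq_card_imp_inj_on)
qed

definition face_prev :: "'h \<Rightarrow> 'h" where "face_prev = inv_into H face"

lemma face_prev: "h \<in> H \<Longrightarrow> face_prev h \<in> H" "h \<in> H \<Longrightarrow> face (face_prev h) = h" "h \<in> H \<Longrightarrow> face_prev (face h) = h"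
  using bij_face f_inv_into_f[of h face H] inv_into_into[of h face H] inv_into_f_f[of face H h]
  by (auto simp: face_prev_def bij_betw_def)

lemma orbit_face_self: "h \<in> H \<Longrightarrow> h \<in> orbit face h"
proof -
  assume h: "h \<in> H"
  define p where "p = (\<lambda>x. if x \<in> H then face x else x)"
  have "bij_betw p H H" using bij_face by (rule bij_betw_cong[THEN iffD1, rotated]) (simp add: p_def)
  then have "p permutes H" by (rule bij_imp_permutes) (simp add: p_def)
  then have "permutation p" using finite_H by (auto simp: permutation_permutes)
  then have "h \<in> orbit p h" by (rule permutation_self_in_orbit)
  moreover have "orbit face h = orbit p h"
    by (rule orbit_cong0[OF h]) (use face in \<open>auto simp: p_def\<close>)
  ultimately show ?thesis by simp
qed

lemma orbit_face_face: "h \<in> H \<Longrightarrow> orbit face (face h) = orbit face h"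
proof (intro equalityI subsetI)
  fix x assume h: "h \<in> H"
  show "x \<in> orbit face h" if "x \<in> orbit face (face h)" using orbit_subset[OF that] .
  have hin: "h \<in> orbit face (face h)"
    by (rule orbit_swap[OF orbit_face_self[OF h] orbit.base])
  show "x \<in> orbit face (face h)" if "x \<in> orbit face h" using orbit_trans[OF that hin] .
qed

definition flags :: "('h \<times> bool) set" where "flags = H \<times> UNIV"

text \<open>The flag \<open>(h, b)\<close> is the half of the triangle of \<open>h\<close> at the
  vertex of \<open>h\<close>, or at the other end of the edge if \<open>b\<close> holds. Types 1, 2,
  3 are vertex, edge and face, and \<open>flip k\<close> crosses the side opposite to type
  \<open>k\<close>: for 1 the cut inside the triangle, for 3 the edge itself, for 2 the line from
  the vertex to the centre, into the neighbouring triangle of the same face.\<close>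

definition flip :: "3 \<Rightarrow> 'h \<times> bool \<Rightarrow> 'h \<times> bool" where
  "flip k \<phi> = (if k = 1 then (fst \<phi>, \<not> snd \<phi>)
     else if k = 3 then (opp (fst \<phi>), \<not> snd \<phi>)
     else if snd \<phi> then (face (fst \<phi>), False) else (face_prev (fst \<phi>), True))"

lemma distinct3 [simp]: "(1::3) \<noteq> 2" "(2::3) \<noteq> 1" "(1::3) \<noteq> 3" "(3::3) \<noteq> 1" "(2::3) \<noteq> 3" "(3::3) \<noteq> 2"
  by simp_all

lemma flip_simps:
  "flip 1 (h, b) = (h, \<not> b)" "flip 3 (h, b) = (opp h, \<not> b)"
  "flip 2 (h, True) = (face h, False)" "flip 2 (h, False) = (face_prev h, True)"
  by (simp_all add: flip_def)

lemma flip_closed: "\<phi> \<in> flags \<Longrightarrow> flip k \<phi> \<in> flags"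
  using opp face face_prev by (auto simp: flags_def flip_def)

lemma flip_flip: "\<phi> \<in> flags \<Longrightarrow> flip k (flip k \<phi>) = \<phi>"
  using exhaust_3[of k] opp face face_prev by (auto simp: flags_def flip_def)

text \<open>A triangle is cut into two flags by the line from the centre of the face to the midpoint of
  the edge. The three barycentric coordinates of a flag belong to its vertex, edge and face.\<close>

definition flag_point :: "('h \<times> bool) \<times> (real^3) \<Rightarrow> 'h \<times> real \<times> real" where
  "flag_point z = (fst (fst z), of_bool (snd (fst z)) * (snd z $ 1) + (snd z $ 2) / 2, snd z $ 3)"

abbreviation "glued \<equiv> (rg_gluing \<Gamma> \<union> (rg_gluing \<Gamma>)\<inverse>)\<^sup>*"

definition flag_class :: "('h \<times> bool) \<times> (real^3) \<Rightarrow> ('h \<times> real \<times> real) set" where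
  "flag_class z = glued `` {flag_point z}"

section \<open>The surface as a quotient of the flags\<close>

lemma simplex3_iff: "l \<in> simplex3 \<longleftrightarrow> 0 \<le> l $ 1 \<and> 0 \<le> l $ 2 \<and> 0 \<le> l $ 3 \<and> l $ 1 + l $ 2 + l $ 3 = 1"
  by (auto simp: simplex3_def forall_3 sum_3)

lemma flag_point_image: "flag_point ` (flags \<times> simplex3) = H \<times> unit_triangle"
proof (intro equalityI subsetI)
  fix y assume "y \<in> flag_point ` (flags \<times> simplex3)"
  then show "y \<in> H \<times> unit_triangle"
    by (auto simp: flag_point_def flags_def simplex3_iff unit_triangle_def)
next
  fix y assume "y \<in> H \<times> unit_triangle"
  then obtain h s r where y: "y = (h, s, r)" "h \<in> H" "0 \<le> s" "0 \<le> r" "s + r \<le> 1"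
    by (auto simp: unit_triangle_def)
  show "y \<in> flag_point ` (flags \<times> simplex3)"
  proof (cases "2 * s \<le> 1 - r")
    case True
    show ?thesis
      by (rule image_eqI[of _ _ "((h, False), vector [1 - r - 2 * s, 2 * s, r])"])
        (use y True in \<open>auto simp: flag_point_def flags_def simplex3_iff vector_3\<close>)
  next
    case False
    show ?thesis
      by (rule image_eqI[of _ _ "((h, True), vector [2 * s + r - 1, 2 * (1 - r - s), r])"])
        (use y False in \<open>auto simp: flag_point_def flags_def simplex3_iff vector_3 field_simps\<close>)
  qed
qed

text \<open>A continuous map from a compact space to a Hausdorff space is closed, and a closed
  continuous surjection is a quotient map.\<close>

lemma quotient_map_flag_point:
  "quotient_map (prod_topology (discrete_topology flags) (top_of_set simplex3)) (rg_triangles \<Gamma>) flag_point"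
  (is "quotient_map ?PR _ _")
proof (rule continuous_closed_imp_quotient_map)
  have fl: "continuous_map ?PR (discrete_topology flags) fst" and sn: "continuous_map ?PR (top_of_set simplex3) snd"
    by (rule continuous_map_fst, rule continuous_map_snd)
  have h: "continuous_map ?PR (discrete_topology H) (\<lambda>z. fst (fst z))"
  proof -
    have "fst \<in> flags \<rightarrow> H" by (auto simp: flags_def)
    then show ?thesis using continuous_map_compose[OF fl, of "discrete_topology H" fst] by (simp add: o_def)
  qed
  have b: "continuous_map ?PR euclideanreal (\<lambda>z. of_bool (snd (fst z)))"
    using continuous_map_compose[OF fl, of euclideanreal "\<lambda>\<phi>. of_bool (snd \<phi>)"] by (simp add: o_def)
  have l: "continuous_map ?PR euclideanreal (\<lambda>z. snd z $ k)" for k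
  proof -
    have "continuous_map (top_of_set simplex3) euclideanreal (\<lambda>l. l $ k)" by (auto intro!: continuous_intros)
    from continuous_map_compose[OF sn this] show ?thesis by (simp add: o_def)
  qed
  have s: "continuous_map ?PR euclideanreal (\<lambda>z. of_bool (snd (fst z)) * (snd z $ 1) + (snd z $ 2) / 2)"
    by (intro continuous_map_add continuous_map_real_mult continuous_map_real_divide b l) auto
  have "continuous_map ?PR (prod_topology euclideanreal euclideanreal)
      (\<lambda>z. (of_bool (snd (fst z)) * (snd z $ 1) + (snd z $ 2) / 2, snd z $ 3))"
    by (rule continuous_map_pairedI[OF s l])
  moreover have "prod_topology euclideanreal euclideanreal = (euclidean :: (real \<times> real) topology)"
    using prod_topology_subtopology_eu[of "UNIV::real set" "UNIV :: real set"] by (simp add: subtopology_UNIV)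
  ultimately have t: "continuous_map ?PR (top_of_set unit_triangle)
      (\<lambda>z. (of_bool (snd (fst z)) * (snd z $ 1) + (snd z $ 2) / 2, snd z $ 3))"
    using flag_point_image unfolding continuous_map_in_subtopology by (auto simp: flag_point_def)
  show c: "continuous_map ?PR (rg_triangles \<Gamma>) flag_point"
    using continuous_map_pairedI[OF h t] unfolding rg_triangles_def flag_point_def[abs_def] .
  show "closed_map ?PR (rg_triangles \<Gamma>) flag_point"
  proof (rule T1_Spaces.continuous_imp_closed_map[OF c])
    show "compact_space ?PR"
      using finite_H compact_simplex3
      by (simp add: compact_space_prod_topology compact_space_discrete_topology compact_space_subtopology flags_def)
    show "Hausdorff_space (rg_triangles \<Gamma>)"
      unfolding rg_triangles_def by (simp add: Hausdorff_space_prod_topology Hausdorff_space_subtopology)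
  qed
  show "flag_point ` topspace ?PR = topspace (rg_triangles \<Gamma>)"
    using flag_point_image by (simp add: rg_triangles_def)
qed

lemma quotient_map_flag_class:
  "quotient_map (prod_topology (discrete_topology flags) (top_of_set simplex3)) (rg_surface \<Gamma>) flag_class"
proof -
  have "quotient_map (rg_triangles \<Gamma>) (rg_surface \<Gamma>) (\<lambda>x. glued `` {x})"
    unfolding quotient_map_def rg_surface_def
  proof (intro conjI allI impI)
    show "(\<lambda>x. glued `` {x}) ` topspace (rg_triangles \<Gamma>) = topspace (quotient_topology (rg_triangles \<Gamma>) glued)"
      unfolding topspace_quotient_topology quotient_def by auto
    fix U assume "U \<subseteq> topspace (quotient_topology (rg_triangles \<Gamma>) glued)"
    then show "openin (rg_triangles \<Gamma>) {x. x \<in> topspace (rg_triangles \<Gamma>) \<and> glued `` {x} \<in> U} =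
        openin (quotient_topology (rg_triangles \<Gamma>) glued) U"
      unfolding openin_quotient_topology topspace_quotient_topology by simp
  qed
  from quotient_map_compose[OF quotient_map_flag_point this]
  show ?thesis by (simp add: flag_class_def[abs_def] o_def)
qed

definition across :: "(real^3) \<Rightarrow> (('h \<times> bool) \<times> ('h \<times> bool)) set" where
  "across l = {(\<phi>, flip k \<phi>) | \<phi> k. \<phi> \<in> flags \<and> l $ k = 0}"

lemma glued_flip:
  assumes \<phi>: "\<phi> \<in> flags" and l: "l \<in> simplex3" and k: "l $ k = 0"
  shows "(flag_point (\<phi>, l), flag_point (flip k \<phi>, l)) \<in> glued"
proof -
  obtain h b where hb: "\<phi> = (h, b)" "h \<in> H" using \<phi> by (auto simp: flags_def)
  have l': "0 \<le> l $ 1" "0 \<le> l $ 2" "0 \<le> l $ 3" "l $ 1 = 1 - l $ 2 - l $ 3" using l by (auto simp: simplex3_iff)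
  consider "k = 1" | "k = 2" | "k = 3" using exhaust_3[of k] by blast
  then show ?thesis
  proof cases
    case 1 then show ?thesis using k by (simp add: hb flip_simps flag_point_def)
  next
    case 2
    show ?thesis
    proof (cases b)
      case True
      have "((h, 1 - l $ 3, l $ 3), (face h, 0, l $ 3)) \<in> rg_gluing \<Gamma>"
        using hb l' k 2 by (auto simp: rg_gluing_def)
      then show ?thesis using True k 2 l' by (auto simp: hb flip_simps flag_point_def)
    next
      case False
      have "((face_prev h, 1 - l $ 3, l $ 3), (face (face_prev h), 0, l $ 3)) \<in> rg_gluing \<Gamma>"
        using face_prev(1)[OF hb(2)] l' k 2 by (auto simp: rg_gluing_def simp del: face_prev)
      then have "((h, 0, l $ 3), (face_prev h, 1 - l $ 3, l $ 3)) \<in> (rg_gluing \<Gamma>)\<inverse>"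
        using face_prev(2)[OF hb(2)] by simp
      then show ?thesis using False k 2 l' by (auto simp: hb flip_simps flag_point_def)
    qed
  next
    case 3
    define s where "s = of_bool b * (l $ 1) + l $ 2 / 2"
    have "0 \<le> s" "s \<le> 1" using l' k 3 by (cases b; simp add: s_def)+
    then have "((h, s, 0), (opp h, 1 - s, 0)) \<in> rg_gluing \<Gamma>"
      using hb by (auto simp: rg_gluing_def)
    moreover have "1 - s = of_bool (\<not> b) * (l $ 1) + l $ 2 / 2" using l' k 3 by (auto simp: s_def field_simps)
    ultimately have "((h, s, l $ 3), (opp h, of_bool (\<not> b) * (l $ 1) + l $ 2 / 2, l $ 3)) \<in> rg_gluing \<Gamma>"
      using k 3 by simp
    then show ?thesis using 3 by (auto simp: hb flip_simps flag_point_def s_def)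
  qed
qed

text \<open>An edge gluing happens within one flag for each half of the edge, which forces the case
  distinction at the midpoint.\<close>

lemma gluing_flip:
  assumes "(y, z) \<in> rg_gluing \<Gamma>"
  obtains \<phi> l k where "\<phi> \<in> flags" "l \<in> simplex3" "l $ k = 0" "y = flag_point (\<phi>, l)" "z = flag_point (flip k \<phi>, l)"
proof -
  consider h s where "h \<in> H" "0 \<le> s" "s \<le> 1" "y = (h, s, 0)" "z = (opp h, 1 - s, 0)"
    | h r where "h \<in> H" "0 \<le> r" "r \<le> 1" "y = (h, 1 - r, r)" "z = (face h, 0, r)"
    using assms by (auto simp: rg_gluing_def)
  then show thesis
  proof cases
    case 1
    show thesis
    proof (cases "s \<le> 1/2")
      case True
      show thesis
        by (rule that[of "(h, False)" "vector [1 - 2 * s, 2 * s, 0]" 3])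
          (use 1 True in \<open>auto simp: flags_def simplex3_iff vector_3 flag_point_def flip_simps\<close>)
    next
      case False
      show thesis
        by (rule that[of "(h, True)" "vector [2 * s - 1, 2 - 2 * s, 0]" 3])
          (use 1 False in \<open>auto simp: flags_def simplex3_iff vector_3 flag_point_def flip_simps field_simps\<close>)
    qed
  next
    case 2
    show thesis
      by (rule that[of "(h, True)" "vector [1 - r, 0, r]" 2])
        (use 2 in \<open>auto simp: flags_def simplex3_iff vector_3 flag_point_def flip_simps\<close>)
  qed
qed

lemma vec3_eq_iff: "l = m \<longleftrightarrow> l $ 1 = m $ 1 \<and> l $ 2 = m $ 2 \<and> l $ 3 = m $ 3" for l m :: "real^3"
  by (simp add: vec_eq_iff forall_3)

text \<open>Before the gluing, triangles are disjoint and the two flags of one triangle overlap only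
  on the cut, where the vertex coordinate vanishes.\<close>

lemma flag_point_eq:
  assumes "\<phi> \<in> flags" "\<psi> \<in> flags" "l \<in> simplex3" "m \<in> simplex3" "flag_point (\<phi>, l) = flag_point (\<psi>, m)"
  shows "l = m \<and> (\<phi> = \<psi> \<or> (l $ 1 = 0 \<and> \<psi> = flip 1 \<phi>))"
proof -
  obtain h b h' b' where hb: "\<phi> = (h, b)" "\<psi> = (h', b')" by (metis prod.exhaust)
  have eq: "h = h'" "l $ 3 = m $ 3" "of_bool b * (l $ 1) + l $ 2 / 2 = of_bool b' * (m $ 1) + m $ 2 / 2"
    using assms(5) by (auto simp: hb flag_point_def)
  have lm: "0 \<le> l $ 1" "0 \<le> l $ 2" "l $ 1 + l $ 2 + l $ 3 = 1" "0 \<le> m $ 1" "0 \<le> m $ 2" "m $ 1 + m $ 2 + m $ 3 = 1"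
    using assms(3,4) by (auto simp: simplex3_iff)
  show ?thesis
    by (cases b; cases b') (use eq lm in \<open>auto simp: vec3_eq_iff hb flip_simps\<close>)
qed

lemma glued_imp_across:
  assumes "(flag_point (\<phi>, l), y) \<in> glued" "\<phi> \<in> flags" "l \<in> simplex3"
    "y = flag_point (\<psi>, m)" "\<psi> \<in> flags" "m \<in> simplex3"
  shows "l = m \<and> (\<phi>, \<psi>) \<in> (across l)\<^sup>*"
  using assms(1,4,5,6)
proof (induction arbitrary: \<psi> m rule: rtrancl_induct)
  case base
  have "(\<phi>, flip 1 \<phi>) \<in> across l" if "l $ 1 = 0" unfolding across_def using that assms(2) by blast
  then show ?case using flag_point_eq[OF assms(2) base(2) assms(3) base(3,1)] by blast
next
  case (step y z)
  have "\<exists>\<kappa> n k. \<kappa> \<in> flags \<and> n \<in> simplex3 \<and> n $ k = 0 \<and> y = flag_point (\<kappa>, n) \<and> z = flag_point (flip k \<kappa>, n)"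
  proof (cases "(y, z) \<in> rg_gluing \<Gamma>")
    case True
    then show ?thesis by (elim gluing_flip) blast
  next
    case False
    then have "(z, y) \<in> rg_gluing \<Gamma>" using step(2) by blast
    then obtain \<kappa> n k where \<kappa>: "\<kappa> \<in> flags" "n \<in> simplex3" "n $ k = 0" "z = flag_point (\<kappa>, n)" "y = flag_point (flip k \<kappa>, n)"
      by (rule gluing_flip)
    then show ?thesis using flip_closed[OF \<kappa>(1)] flip_flip[OF \<kappa>(1)]
      by (intro exI[of _ "flip k \<kappa>"] exI[of _ n] exI[of _ k]) simp
  qed
  then obtain \<kappa> n k where \<kappa>: "\<kappa> \<in> flags" "n \<in> simplex3" "n $ k = 0" "y = flag_point (\<kappa>, n)" "z = flag_point (flip k \<kappa>, n)"
    by blast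
  have IH: "l = n" "(\<phi>, \<kappa>) \<in> (across l)\<^sup>*" using step(3)[OF \<kappa>(4,1,2)] by auto
  have fl: "flip k \<kappa> \<in> flags" by (rule flip_closed[OF \<kappa>(1)])
  have "(\<kappa>, flip k \<kappa>) \<in> across l" unfolding across_def using \<kappa> IH(1) by blast
  then have 1: "(\<phi>, flip k \<kappa>) \<in> (across l)\<^sup>*" using IH(2) by (rule rtrancl_into_rtrancl[rotated])
  have "n = m \<and> (flip k \<kappa> = \<psi> \<or> (n $ 1 = 0 \<and> \<psi> = flip 1 (flip k \<kappa>)))"
    using \<kappa>(5) step(4) by (intro flag_point_eq[OF fl step(5) \<kappa>(2) step(6)]) simp
  then show ?case
  proof (elim conjE disjE)
    assume "n = m" "flip k \<kappa> = \<psi>" then show ?thesis using 1 IH(1) by simp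
  next
    assume "n = m" and *: "n $ 1 = 0" "\<psi> = flip 1 (flip k \<kappa>)"
    have "(flip k \<kappa>, \<psi>) \<in> across l" unfolding across_def using * fl IH(1) by blast
    then show ?thesis using 1 IH(1) \<open>n = m\<close> by (simp add: rtrancl_into_rtrancl)
  qed
qed

lemma flag_class_eq_iff:
  assumes \<phi>: "\<phi> \<in> flags" and \<psi>: "\<psi> \<in> flags" and l: "l \<in> simplex3" and m: "m \<in> simplex3"
  shows "flag_class (\<phi>, l) = flag_class (\<psi>, m) \<longleftrightarrow> l = m \<and> (\<phi>, \<psi>) \<in> (across l)\<^sup>*"
proof
  assume "flag_class (\<phi>, l) = flag_class (\<psi>, m)"
  then have "flag_point (\<psi>, m) \<in> glued `` {flag_point (\<phi>, l)}" by (auto simp: flag_class_def)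
  then have "(flag_point (\<phi>, l), flag_point (\<psi>, m)) \<in> glued" by blast
  then show "l = m \<and> (\<phi>, \<psi>) \<in> (across l)\<^sup>*" using glued_imp_across[OF _ \<phi> l refl \<psi> m] by blast
next
  assume *: "l = m \<and> (\<phi>, \<psi>) \<in> (across l)\<^sup>*"
  then have "(\<phi>, \<psi>) \<in> (across l)\<^sup>*" by blast
  then have g: "(flag_point (\<phi>, l), flag_point (\<psi>, l)) \<in> glued"
  proof (induction rule: rtrancl_induct)
    case (step \<kappa> \<mu>)
    then obtain k where "\<kappa> \<in> flags" "l $ k = 0" "\<mu> = flip k \<kappa>" by (auto simp: across_def)
    then have "(flag_point (\<kappa>, l), flag_point (\<mu>, l)) \<in> glued" using glued_flip l by blast
    then show ?case using step(3) by (rule rtrancl_trans[rotated])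
  qed simp
  have "sym glued" by (intro sym_rtrancl sym_Un_converse)
  then have "(flag_point (\<psi>, l), flag_point (\<phi>, l)) \<in> glued" using g by (rule symD)
  then show "flag_class (\<phi>, l) = flag_class (\<psi>, m)"
    using g * unfolding flag_class_def by (auto intro: rtrancl_trans)
qed

section \<open>Connectedness of the flags\<close>

definition linked :: "(('h \<times> bool) \<times> ('h \<times> bool)) set" where
  "linked = {(\<phi>, flip k \<phi>) | \<phi> k. \<phi> \<in> flags}\<^sup>*"

lemma linked_flip: "\<phi> \<in> flags \<Longrightarrow> (\<phi>, flip k \<phi>) \<in> linked"
  unfolding linked_def by blast

lemma linked_trans: "(a, b) \<in> linked \<Longrightarrow> (b, c) \<in> linked \<Longrightarrow> (a, c) \<in> linked"
  unfolding linked_def by (rule rtrancl_trans)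

lemma linked_bool: "h \<in> H \<Longrightarrow> ((h, b), (h, b')) \<in> linked"
  using linked_flip[of "(h, b)" 1] by (cases "b = b'") (auto simp: flags_def flip_simps linked_def)

lemma linked_opp: "h \<in> H \<Longrightarrow> ((h, b), (opp h, b')) \<in> linked"
  using linked_flip[of "(h, b)" 3] linked_bool[OF opp(1), of h "\<not> b" b']
  by (auto simp: flags_def flip_simps intro: linked_trans)

lemma linked_nxt: "h \<in> H \<Longrightarrow> ((h, b), (nxt h, b')) \<in> linked"
proof -
  assume h: "h \<in> H"
  have "((h, b), (opp h, True)) \<in> linked" by (rule linked_opp[OF h])
  moreover have "((opp h, True), (nxt h, False)) \<in> linked"
    using linked_flip[of "(opp h, True)" 2] opp[OF h] face(2)[OF h] by (simp add: flags_def flip_simps)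
  moreover have "((nxt h, False), (nxt h, b')) \<in> linked" by (rule linked_bool[OF nxt(1)[OF h]])
  ultimately show ?thesis by (meson linked_trans)
qed

lemma linked_vertex:
  assumes "h \<in> H" "h' \<in> H" "vert h = vert h'"
  shows "((h, b), (h', b')) \<in> linked"
proof -
  have "h \<in> rg_incident \<Gamma> (vert h)" "h' \<in> rg_incident \<Gamma> (vert h)" using assms by (auto simp: rg_incident_def)
  then have "h' \<in> orbit nxt h" using cyclic[OF assms(1)] by (auto simp: cyclic_on_alldef)
  then have "h' \<in> H \<and> ((h, b), (h', b')) \<in> linked"
  proof (induction arbitrary: b')
    case base
    then show ?case using linked_nxt[OF assms(1)] nxt[OF assms(1)] by simp
  next
    case (step y)
    then show ?case using linked_nxt[of y] nxt[of y] by (meson linked_trans)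
  qed
  then show ?thesis by blast
qed

text \<open>Around a vertex the flags are linked by turning with \<open>nxt\<close>; from vertex to
  vertex they are linked along the edges of a path in the graph.\<close>

lemma all_linked:
  assumes "\<phi> \<in> flags" "\<psi> \<in> flags"
  shows "(\<phi>, \<psi>) \<in> linked"
proof -
  obtain h b h' b' where hb: "\<phi> = (h, b)" "\<psi> = (h', b')" "h \<in> H" "h' \<in> H" using assms by (auto simp: flags_def)
  have "(vert h, vert h') \<in> {(vert h, vert (opp h)) | h. h \<in> H}\<^sup>*"
    using conn vert hb by (auto simp: rg_connected_def)
  then have "\<forall>k\<in>H. vert k = vert h' \<longrightarrow> ((h, b), (k, b')) \<in> linked"
  proof (induction rule: rtrancl_induct)
    case base
    then show ?case using linked_vertex[OF hb(3)] by auto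
  next
    case (step u w)
    then obtain g where g: "g \<in> H" "u = vert g" "w = vert (opp g)" by auto
    show ?case
    proof (intro ballI impI)
      fix k assume k: "k \<in> H" "vert k = w"
      have "((h, b), (g, b')) \<in> linked" using step(3) g by simp
      moreover have "((g, b'), (opp g, b')) \<in> linked" by (rule linked_opp[OF g(1)])
      moreover have "((opp g, b'), (k, b')) \<in> linked" using g k opp by (intro linked_vertex) auto
      ultimately show "((h, b), (k, b')) \<in> linked" by (meson linked_trans)
    qed
  qed
  then show ?thesis using hb by simp
qed

lemma H_nonempty: "H \<noteq> {}"
proof -
  obtain v where "v \<in> rg_verts \<Gamma>" using conn by (auto simp: rg_connected_def)
  then show ?thesis using incident[of v] by (auto simp: rg_incident_def)
qed

sublocale flag_complex "rg_surface \<Gamma>" flags flip flag_class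
proof unfold_locales
  show "finite flags" using finite_H by (simp add: flags_def)
  show "flags \<noteq> {}" using H_nonempty by (simp add: flags_def)
  show "flag_class (\<phi>, l) = flag_class (\<psi>, m) \<longleftrightarrow>
      l = m \<and> (\<phi>, \<psi>) \<in> {(\<phi>, flip k \<phi>) | \<phi> k. \<phi> \<in> flags \<and> l $ k = 0}\<^sup>*"
    if "\<phi> \<in> flags" "\<psi> \<in> flags" "l \<in> simplex3" "m \<in> simplex3" for \<phi> \<psi> l m
    using flag_class_eq_iff[OF that] by (simp add: across_def)
  show "(\<phi>, \<psi>) \<in> {(\<phi>, flip k \<phi>) | \<phi> k. \<phi> \<in> flags}\<^sup>*" if "\<phi> \<in> flags" "\<psi> \<in> flags" for \<phi> \<psi>
    using all_linked[OF that] by (simp add: linked_def)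
qed (use flip_closed flip_flip quotient_map_flag_class in auto)

end

section \<open>Counting the cells of each type\<close>

context rgraph
begin

lemma reach_invariant:
  assumes "(\<phi>, \<psi>) \<in> reach K" "\<And>\<kappa> k. \<kappa> \<in> flags \<Longrightarrow> k \<in> K \<Longrightarrow> f (flip k \<kappa>) = f \<kappa>"
  shows "f \<phi> = f \<psi>"
  by (rule reach_induct[OF assms(1), where P = "\<lambda>\<kappa>. f \<phi> = f \<kappa>"]) (use assms(2) in auto)

lemma reach_trans: "(a, b) \<in> reach K \<Longrightarrow> (b, c) \<in> reach K \<Longrightarrow> (a, c) \<in> reach K"
  using equiv_reach[of K] by (meson equivE transD)

lemma reach_sym: "(a, b) \<in> reach K \<Longrightarrow> (b, a) \<in> reach K"
  using equiv_reach[of K] by (meson equivE symD)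

lemma reach_refl: "h \<in> H \<Longrightarrow> ((h, b), (h, b)) \<in> reach K"
  using equiv_reach[of K] by (auto simp: equiv_def refl_on_def flags_def)

lemma reach_flip1: "h \<in> H \<Longrightarrow> 1 \<in> K \<Longrightarrow> ((h, b), (h, \<not> b)) \<in> reach K"
  using reach_step[of "(h, b)" 1 K] by (simp add: flags_def flip_simps)

lemma reach_flip2: "h \<in> H \<Longrightarrow> 2 \<in> K \<Longrightarrow> ((h, True), (face h, False)) \<in> reach K"
  using reach_step[of "(h, True)" 2 K] by (simp add: flags_def flip_simps)

lemma reach_flip3: "h \<in> H \<Longrightarrow> 3 \<in> K \<Longrightarrow> ((h, b), (opp h, \<not> b)) \<in> reach K"
  using reach_step[of "(h, b)" 3 K] by (simp add: flags_def flip_simps)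

text \<open>The complete invariant is the vertex at the corner of the flag. Two flags at the same
  vertex are connected by turning around it: one step of \<open>nxt\<close> crosses the edge and
  then the line to the centre of the next face. The counts of edges and faces follow the same
  scheme.\<close>

lemma card_reach_1: "card (flags // reach (- {1})) = card (rg_verts \<Gamma>)"
proof -
  define f where "f = (\<lambda>(h, b). if b then vert (opp h) else vert h)"
  have inv: "f (flip k \<phi>) = f \<phi>" if \<phi>k: "\<phi> \<in> flags" "k \<in> - {1}" for \<phi> k
  proof -
    obtain h b where \<phi>: "\<phi> = (h, b)" "h \<in> H" using \<phi>k by (auto simp: flags_def)
    have *: "vert (face g) = vert (opp g)" if "g \<in> H" for g using nxt(2)[OF opp(1)[OF that]] by (simp add: rg_face_next_def)
    from \<phi>k(2) consider "k = 2" | "k = 3" using exhaust_3[of k] by auto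
    then show ?thesis
    proof cases
      case 1
      show ?thesis
      proof (cases b)
        case False
        then show ?thesis using 1 \<phi> *[OF face_prev(1)[OF \<phi>(2)]] face_prev(2)[OF \<phi>(2)] by (simp add: f_def flip_simps)
      qed (use 1 \<phi> * in \<open>simp add: f_def flip_simps\<close>)
    qed (use \<phi> opp in \<open>simp add: f_def flip_simps\<close>)
  qed
  have nx: "((h, False), (nxt h, False)) \<in> reach (- {1})" if "h \<in> H" for h
  proof -
    have "((h, False), (opp h, True)) \<in> reach (- {1})" using reach_flip3[OF that, of "- {1}" False] by simp
    moreover have "((opp h, True), (nxt h, False)) \<in> reach (- {1})"
      using reach_flip2[OF opp(1)[OF that], of "- {1}"] face(2)[OF that] by simp
    ultimately show ?thesis by (rule reach_trans)
  qed
  have vx: "((h, False), (h', False)) \<in> reach (- {1})" if h: "h \<in> H" "h' \<in> H" "vert h = vert h'" for h h'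
  proof -
    have "h' \<in> orbit nxt h" using h cyclic[OF h(1)] by (auto simp: cyclic_on_alldef rg_incident_def)
    then have "h' \<in> H \<and> ((h, False), (h', False)) \<in> reach (- {1})"
    proof (induction)
      case base
      then show ?case using nx[OF h(1)] nxt[OF h(1)] by simp
    next
      case (step y)
      then show ?case using nx[of y] nxt[of y] by (meson reach_trans)
    qed
    then show ?thesis by blast
  qed
  have base: "\<exists>g\<in>H. ((h, b), (g, False)) \<in> reach (- {1})" if "h \<in> H" for h b
    using reach_flip2[OF that, of "- {1}"] face(1)[OF that] reach_refl[OF that] that by (cases b) auto
  have "card (flags // reach (- {1})) = card (f ` flags)"
  proof (rule card_quotient_kernel[OF equiv_reach], rule iffI)
    fix x y assume "(x, y) \<in> reach (- {1})"
    then show "f x = f y" by (rule reach_invariant) (rule inv)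
  next
    fix x y assume xy: "x \<in> flags" "y \<in> flags" "f x = f y"
    obtain g where g: "g \<in> H" "(x, (g, False)) \<in> reach (- {1})" using base xy(1) by (cases x) (auto simp: flags_def)
    obtain g' where g': "g' \<in> H" "(y, (g', False)) \<in> reach (- {1})" using base xy(2) by (cases y) (auto simp: flags_def)
    have "f x = f (g, False)" by (rule reach_invariant[OF g(2) inv])
    moreover have "f y = f (g', False)" by (rule reach_invariant[OF g'(2) inv])
    ultimately have "vert g = vert g'" using xy(3) by (simp add: f_def)
    then show "(x, y) \<in> reach (- {1})" using vx[OF g(1) g'(1)] g(2) reach_sym[OF g'(2)] by (meson reach_trans)
  qed
  also have "f ` flags = rg_verts \<Gamma>"
  proof (intro equalityI subsetI)
    fix v assume "v \<in> f ` flags" then show "v \<in> rg_verts \<Gamma>" using vert opp by (auto simp: f_def flags_def)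
  next
    fix v assume "v \<in> rg_verts \<Gamma>"
    then obtain h where "h \<in> H" "v = vert h" using incident[of v] by (auto simp: rg_incident_def)
    then show "v \<in> f ` flags" by (intro image_eqI[of _ _ "(h, False)"]) (auto simp: f_def flags_def)
  qed
  finally show ?thesis .
qed

lemma card_reach_2: "card (flags // reach (- {2})) = card (rg_edges \<Gamma>)"
proof -
  define f where "f = (\<lambda>\<phi> :: 'h \<times> bool. {fst \<phi>, opp (fst \<phi>)})"
  have inv: "f (flip k \<phi>) = f \<phi>" if "\<phi> \<in> flags" "k \<in> - {2}" for \<phi> k
  proof -
    have "k = 1 \<or> k = 3" using that exhaust_3[of k] by auto
    then show ?thesis using that opp by (auto simp: f_def flip_def flags_def)
  qed
  have "card (flags // reach (- {2})) = card (f ` flags)"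
  proof (rule card_quotient_kernel[OF equiv_reach], rule iffI)
    fix x y assume "(x, y) \<in> reach (- {2})"
    then show "f x = f y" by (rule reach_invariant) (rule inv)
  next
    fix x y assume xy: "x \<in> flags" "y \<in> flags" "f x = f y"
    obtain h b h' b' where hb: "x = (h, b)" "y = (h', b')" "h \<in> H" "h' \<in> H" using xy by (auto simp: flags_def)
    have bb: "((g, c), (g, c')) \<in> reach (- {2})" if "g \<in> H" for g c c'
      using reach_flip1[OF that, of "- {2}" c] reach_refl[OF that] by (cases "c = c'") auto
    have "h' = h \<or> h' = opp h" using xy(3) hb by (auto simp: f_def)
    then show "(x, y) \<in> reach (- {2})"
    proof
      assume "h' = h" then show ?thesis using bb[OF hb(3)] hb by simp
    next
      assume "h' = opp h"
      moreover have "((h, b), (opp h, \<not> b)) \<in> reach (- {2})" using reach_flip3[OF hb(3), of "- {2}" b] by simp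
      ultimately show ?thesis
        using reach_trans[OF _ bb[OF opp(1)[OF hb(3)], of "\<not> b" b']] hb by simp
    qed
  qed
  also have "f ` flags = rg_edges \<Gamma>" by (force simp: f_def flags_def rg_edges_def)
  finally show ?thesis .
qed

lemma card_reach_3: "card (flags // reach (- {3})) = card (rg_faces \<Gamma>)"
proof -
  define f where "f = (\<lambda>\<phi> :: 'h \<times> bool. orbit face (fst \<phi>))"
  have inv: "f (flip k \<phi>) = f \<phi>" if \<phi>k: "\<phi> \<in> flags" "k \<in> - {3}" for \<phi> k
  proof -
    obtain h b where \<phi>: "\<phi> = (h, b)" "h \<in> H" using \<phi>k by (auto simp: flags_def)
    have "k = 1 \<or> k = 2" using \<phi>k(2) exhaust_3[of k] by auto
    moreover have "orbit face (face_prev h) = orbit face h"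
      using orbit_face_face[OF face_prev(1)[OF \<phi>(2)]] face_prev(2)[OF \<phi>(2)] by simp
    ultimately show ?thesis using orbit_face_face[OF \<phi>(2)] \<phi> by (auto simp: f_def flip_def)
  qed
  have "card (flags // reach (- {3})) = card (f ` flags)"
  proof (rule card_quotient_kernel[OF equiv_reach], rule iffI)
    fix x y assume "(x, y) \<in> reach (- {3})"
    then show "f x = f y" by (rule reach_invariant) (rule inv)
  next
    fix x y assume xy: "x \<in> flags" "y \<in> flags" "f x = f y"
    obtain h b h' b' where hb: "x = (h, b)" "y = (h', b')" "h \<in> H" "h' \<in> H" using xy by (auto simp: flags_def)
    have bb: "((g, c), (g, c')) \<in> reach (- {3})" if "g \<in> H" for g c c'
      using reach_flip1[OF that, of "- {3}" c] reach_refl[OF that] by (cases "c = c'") auto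
    have fc: "((g, False), (face g, False)) \<in> reach (- {3})" if "g \<in> H" for g
      by (rule reach_trans[OF bb[OF that]], rule reach_flip2[OF that]) simp
    have "h' \<in> orbit face h" using xy(3) hb orbit_face_self[OF hb(4)] by (simp add: f_def)
    then have "h' \<in> H \<and> ((h, False), (h', False)) \<in> reach (- {3})"
    proof (induction)
      case base
      then show ?case using fc[OF hb(3)] face[OF hb(3)] by simp
    next
      case (step y)
      then show ?case using fc[of y] face[of y] by (meson reach_trans)
    qed
    then show "(x, y) \<in> reach (- {3})" using bb[OF hb(3)] bb[OF hb(4)] hb by (meson reach_trans)
  qed
  also have "f ` flags = rg_faces \<Gamma>" by (force simp: f_def flags_def rg_faces_def)
  finally show ?thesis .
qed

end

text \<open>Read \<open>B h\<close> as the transition from the face of \<open>h\<close> to the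
  vertex of \<open>h\<close>. Then \<open>B (\<sigma> h) \<otimes> inv B h\<close> passes between
  the two faces at the edge by way of one end, and the condition says that passing by way of the
  other end is the inverse. The covariances in Wick's theorem impose the same equation.\<close>

definition flat_labels :: "('g, 'b) monoid_scheme \<Rightarrow> 'h set \<Rightarrow> ('h \<Rightarrow> 'h) \<Rightarrow> ('h \<Rightarrow> 'h) \<Rightarrow> ('h \<Rightarrow> 'g) set" where
  "flat_labels G H \<sigma> \<alpha> = {B \<in> H \<rightarrow>\<^sub>E carrier G. \<forall>h\<in>H.
     (B (\<sigma> h) \<otimes>\<^bsub>G\<^esub> inv\<^bsub>G\<^esub> B h) \<otimes>\<^bsub>G\<^esub> (B (\<sigma> (\<alpha> h)) \<otimes>\<^bsub>G\<^esub> inv\<^bsub>G\<^esub> B (\<alpha> h)) = \<one>\<^bsub>G\<^esub>}"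

section \<open>From labels of flags to labels of half-edges\<close>

locale rgraph_group = rgraph \<Gamma> + group G
  for \<Gamma> :: "('v, 'h) ribbon_graph" and G :: "('g, 'b) monoid_scheme" (structure) +
  assumes finite_carrier: "finite (carrier G)"

sublocale rgraph_group \<subseteq> flag_complex_group "rg_surface \<Gamma>" flags flip flag_class G
  by unfold_locales (rule finite_carrier)

context rgraph_group
begin

definition dart_labels :: "(('h \<Rightarrow> 'g) \<times> ('h \<Rightarrow> 'g)) set" where
  "dart_labels = {(A, B) \<in> (H \<rightarrow>\<^sub>E carrier G) \<times> (H \<rightarrow>\<^sub>E carrier G).
     \<forall>h\<in>H. A (opp h) = (B (nxt h) \<otimes> inv (B h)) \<otimes> A h}"

text \<open>The equation for \<open>A\<close> at \<open>h\<close> and at \<open>opp h\<close>,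
  combined, forces \<open>B\<close> to be flat. For flat \<open>B\<close> the values of
  \<open>A\<close> are free on one half-edge of every edge.\<close>

lemma card_dart_labels:
  "card dart_labels = card (carrier G) ^ card (rg_edges \<Gamma>) * card (flat_labels G H nxt opp)"
proof -
  define c where "c = (\<lambda>B h. B (nxt h) \<otimes> inv (B h))"
  let ?A = "\<lambda>B. {A \<in> H \<rightarrow>\<^sub>E carrier G. \<forall>h\<in>H. A (opp h) = c B h \<otimes> A h}"
  let ?B = "flat_labels G H nxt opp"
  have cc: "c B h \<in> carrier G" if "B \<in> H \<rightarrow>\<^sub>E carrier G" "h \<in> H" for B h
    using that nxt by (auto simp: c_def)
  have flat: "c B (opp h) \<otimes> c B h = \<one>" if B: "B \<in> ?B" and h: "h \<in> H" for B h
  proof -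
    have "c B (opp h) \<otimes> c B (opp (opp h)) = \<one>"
      using B opp(1)[OF h] unfolding flat_labels_def c_def by blast
    then show ?thesis using opp(3)[OF h] by simp
  qed
  have "dart_labels = (\<lambda>(B, A). (A, B)) ` (SIGMA B:?B. ?A B)"
  proof (intro equalityI subsetI)
    fix z assume z: "z \<in> dart_labels"
    obtain A B where AB: "z = (A, B)" by (cases z)
    have A: "A \<in> H \<rightarrow>\<^sub>E carrier G" and B: "B \<in> H \<rightarrow>\<^sub>E carrier G"
      and eq: "\<And>h. h \<in> H \<Longrightarrow> A (opp h) = c B h \<otimes> A h"
      using z by (auto simp: dart_labels_def AB c_def)
    have "c B h \<otimes> c B (opp h) = \<one>" if h: "h \<in> H" for h
    proof -
      have ho: "opp h \<in> H" using opp(1)[OF h] .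
      have Ah: "A (opp h) \<in> carrier G" using A ho by auto
      have "A (opp h) = c B h \<otimes> A h" by (rule eq[OF h])
      also have "A h = c B (opp h) \<otimes> A (opp h)" using eq[OF ho] opp(3)[OF h] by simp
      finally have "\<one> \<otimes> A (opp h) = (c B h \<otimes> c B (opp h)) \<otimes> A (opp h)"
        using cc[OF B] h ho Ah by (simp add: m_assoc)
      then show ?thesis using cc[OF B h] cc[OF B ho] Ah by (metis m_closed one_closed right_cancel)
    qed
    then have "B \<in> ?B" using B unfolding flat_labels_def c_def by blast
    then show "z \<in> (\<lambda>(B, A). (A, B)) ` (SIGMA B:?B. ?A B)" using A eq AB by force
  next
    fix z assume "z \<in> (\<lambda>(B, A). (A, B)) ` (SIGMA B:?B. ?A B)"
    then show "z \<in> dart_labels" by (auto simp: dart_labels_def c_def flat_labels_def)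
  qed
  moreover have "inj_on (\<lambda>(B, A). (A, B)) (SIGMA B:?B. ?A B)" by (auto simp: inj_on_def)
  ultimately have "card dart_labels = card (SIGMA B:?B. ?A B)" by (simp add: card_image)
  also have "\<dots> = (\<Sum>B\<in>?B. card (?A B))"
  proof (rule card_SigmaI)
    have f: "finite (H \<rightarrow>\<^sub>E carrier G)" using finite_H finite_carrier by (intro finite_PiE) auto
    show "finite ?B" by (rule finite_subset[OF _ f]) (auto simp: flat_labels_def)
    show "\<forall>B\<in>?B. finite (?A B)" by (intro ballI finite_subset[OF _ f]) auto
  qed
  also have "\<dots> = (\<Sum>B\<in>?B. card (carrier G) ^ card (rg_edges \<Gamma>))"
  proof (rule sum.cong[OF refl])
    fix B assume B: "B \<in> ?B"
    then have BP: "B \<in> H \<rightarrow>\<^sub>E carrier G" by (simp add: flat_labels_def)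
    show "card (?A B) = card (carrier G) ^ card (rg_edges \<Gamma>)"
      unfolding rg_edges_def using opp cc[OF BP] flat[OF B] by (intro card_twisted_functions[OF finite_H]) auto
  qed
  finally show ?thesis by simp
qed

text \<open>A labelling is determined by a potential on each flag, which vanishes at the face. The pair \<open>(A, B)\<close>
  consists of its values at the edge and at the vertex of the flag \<open>(h, False)\<close>.\<close>

definition to_darts :: "(3 \<Rightarrow> 3 \<Rightarrow> 'h \<times> bool \<Rightarrow> 'g) \<Rightarrow> ('h \<Rightarrow> 'g) \<times> ('h \<Rightarrow> 'g)" where
  "to_darts \<gamma> = (\<lambda>h\<in>H. \<gamma> 3 2 (h, False), \<lambda>h\<in>H. \<gamma> 3 1 (h, False))"

definition potential :: "('h \<Rightarrow> 'g) \<times> ('h \<Rightarrow> 'g) \<Rightarrow> 3 \<Rightarrow> 'h \<times> bool \<Rightarrow> 'g" where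
  "potential AB k \<phi> = (if k = 3 then \<one> else if k = 2 then fst AB (fst \<phi>)
     else if snd \<phi> then snd AB (face (fst \<phi>)) else snd AB (fst \<phi>))"

lemma flag_labelsD:
  assumes "\<gamma> \<in> flag_labels" "\<phi> \<in> flags"
  shows "\<gamma> k l \<phi> \<in> carrier G" "\<gamma> k l \<phi> \<otimes> \<gamma> l m \<phi> = \<gamma> k m \<phi>"
    "m \<noteq> k \<Longrightarrow> m \<noteq> l \<Longrightarrow> \<gamma> k l (flip m \<phi>) = \<gamma> k l \<phi>"
  using assms unfolding flag_labels_def by blast+

lemma flag_labels_potential:
  assumes \<gamma>: "\<gamma> \<in> flag_labels" and \<phi>: "\<phi> \<in> flags"
  shows "\<gamma> k l \<phi> = inv (potential (to_darts \<gamma>) k \<phi>) \<otimes> potential (to_darts \<gamma>) l \<phi>"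
proof -
  note D = flag_labelsD[OF \<gamma>]
  obtain h b where hb: "\<phi> = (h, b)" "h \<in> H" using \<phi> by (auto simp: flags_def)
  have F: "(h, False) \<in> flags" "(h, True) \<in> flags" using hb by (auto simp: flags_def)
  have pot: "\<gamma> 3 k \<phi> = potential (to_darts \<gamma>) k \<phi>" for k
  proof -
    consider "k = 1" | "k = 2" | "k = 3" using exhaust_3[of k] by blast
    then show ?thesis
    proof cases
      case 1
      have "\<gamma> 3 1 (h, True) = \<gamma> 3 1 (face h, False)"
        using D(3)[OF F(2), of 2 3 1] by (simp add: flip_simps)
      then show ?thesis using 1 hb face(1)[OF hb(2)] by (cases b) (simp_all add: potential_def to_darts_def)
    next
      case 2
      have "\<gamma> 3 2 (h, True) = \<gamma> 3 2 (h, False)"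
        using D(3)[OF F(2), of 1 3 2] by (simp add: flip_simps)
      then show ?thesis using 2 hb by (cases b) (simp_all add: potential_def to_darts_def)
    next
      case 3
      have "\<gamma> 3 3 \<phi> \<otimes> \<gamma> 3 3 \<phi> = \<gamma> 3 3 \<phi>" by (rule D(2)[OF \<phi>])
      then have "\<gamma> 3 3 \<phi> = \<one>" using D(1)[OF \<phi>, of 3 3] by simp
      then show ?thesis using 3 by (simp add: potential_def)
    qed
  qed
  have "\<gamma> 3 k \<phi> \<otimes> \<gamma> k l \<phi> = \<gamma> 3 l \<phi>" by (rule D(2)[OF \<phi>])
  then have "\<gamma> k l \<phi> = inv (\<gamma> 3 k \<phi>) \<otimes> \<gamma> 3 l \<phi>" using D(1)[OF \<phi>] by (simp add: inv_solve_left)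
  then show ?thesis by (simp add: pot)
qed

text \<open>The invariance under flips of type 1 and 2 already went into expressing a labelling by
  its potential. The flip across the edge, applied to the transition from vertex to edge, is what
  remains and gives the equation.\<close>

lemma to_darts_in:
  assumes \<gamma>: "\<gamma> \<in> flag_labels"
  shows "to_darts \<gamma> \<in> dart_labels"
proof -
  note D = flag_labelsD[OF \<gamma>]
  let ?A = "fst (to_darts \<gamma>)" and ?B = "snd (to_darts \<gamma>)"
  have AB: "?A h \<in> carrier G" "?B h \<in> carrier G" if "h \<in> H" for h
    using D(1)[of "(h, False)"] that by (auto simp: to_darts_def flags_def)
  have "?A (opp h) = (?B (nxt h) \<otimes> inv (?B h)) \<otimes> ?A h" if h: "h \<in> H" for h
  proof -
    have F: "(h, False) \<in> flags" "(opp h, True) \<in> flags" using h opp by (auto simp: flags_def)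
    have "\<gamma> 1 2 (opp h, True) = \<gamma> 1 2 (h, False)" using D(3)[OF F(1), of 3 1 2] by (simp add: flip_simps)
    then have "inv (?B (nxt h)) \<otimes> ?A (opp h) = inv (?B h) \<otimes> ?A h"
      unfolding flag_labels_potential[OF \<gamma> F(1)] flag_labels_potential[OF \<gamma> F(2)]
      by (simp add: potential_def face(2)[OF h])
    then have "?B (nxt h) \<otimes> (inv (?B (nxt h)) \<otimes> ?A (opp h)) = ?B (nxt h) \<otimes> (inv (?B h) \<otimes> ?A h)" by simp
    then show ?thesis
      using AB(1)[OF h] AB(2)[OF h] AB(1)[OF opp(1)[OF h]] AB(2)[OF nxt(1)[OF h]] by (simp flip: m_assoc)
  qed
  moreover have "?A \<in> H \<rightarrow>\<^sub>E carrier G" "?B \<in> H \<rightarrow>\<^sub>E carrier G"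
    using AB by (auto simp: to_darts_def)
  ultimately show ?thesis unfolding dart_labels_def by (simp add: case_prod_unfold)
qed

lemma bij_to_darts: "bij_betw to_darts flag_labels dart_labels"
  unfolding bij_betw_def
proof (intro conjI equalityI subsetI inj_onI)
  fix \<gamma> \<gamma>' assume *: "\<gamma> \<in> flag_labels" "\<gamma>' \<in> flag_labels" "to_darts \<gamma> = to_darts \<gamma>'"
  show "\<gamma> = \<gamma>'"
  proof (intro ext)
    fix k l \<phi>
    show "\<gamma> k l \<phi> = \<gamma>' k l \<phi>"
    proof (cases "\<phi> \<in> flags")
      case True
      then show ?thesis
        using flag_labels_potential[OF *(1) True] flag_labels_potential[OF *(2) True] *(3) by simp
    next
      case False
      have "\<gamma> k l \<phi> = undefined" using False *(1) unfolding flag_labels_def by blast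
      moreover have "\<gamma>' k l \<phi> = undefined" using False *(2) unfolding flag_labels_def by blast
      ultimately show ?thesis by simp
    qed
  qed
next
  fix z assume "z \<in> to_darts ` flag_labels" then show "z \<in> dart_labels" using to_darts_in by auto
next
  fix z assume z: "z \<in> dart_labels"
  obtain A B where AB: "z = (A, B)" by (cases z)
  have A: "A \<in> H \<rightarrow>\<^sub>E carrier G" and B: "B \<in> H \<rightarrow>\<^sub>E carrier G"
    and eq: "\<And>h. h \<in> H \<Longrightarrow> A (opp h) = (B (nxt h) \<otimes> inv (B h)) \<otimes> A h"
    using z by (auto simp: dart_labels_def AB)
  have Ac: "A h \<in> carrier G" and Bc: "B h \<in> carrier G" if "h \<in> H" for h using A B that by auto
  define u where "u = potential z"
  have uc: "u k \<phi> \<in> carrier G" if "\<phi> \<in> flags" for k \<phi>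
    using that Ac Bc face by (auto simp: u_def potential_def AB flags_def)
  define \<gamma> where "\<gamma> = (\<lambda>k l \<phi>. if \<phi> \<in> flags then inv (u k \<phi>) \<otimes> u l \<phi> else undefined)"
  have key: "inv (B (nxt h)) \<otimes> A (opp h) = inv (B h) \<otimes> A h" if h: "h \<in> H" for h
    unfolding eq[OF h] using Ac[OF h] Bc[OF h] Bc[OF nxt(1)[OF h]] by (simp flip: m_assoc)
  have flip12: "inv (u 1 (flip 3 \<phi>)) \<otimes> u 2 (flip 3 \<phi>) = inv (u 1 \<phi>) \<otimes> u 2 \<phi>" if \<phi>: "\<phi> \<in> flags" for \<phi>
  proof -
    obtain h b where hb: "\<phi> = (h, b)" "h \<in> H" using \<phi> by (auto simp: flags_def)
    show ?thesis
    proof (cases b)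
      case False
      then show ?thesis using key[OF hb(2)] face(2)[OF hb(2)]
        by (simp add: hb flip_simps u_def potential_def AB)
    next
      case True
      have "face h = nxt (opp h)" by (simp add: rg_face_next_def)
      then show ?thesis using key[OF opp(1)[OF hb(2)]] opp(3)[OF hb(2)] True
        by (simp add: hb flip_simps u_def potential_def AB)
    qed
  qed
  have flip21: "inv (u 2 (flip 3 \<phi>)) \<otimes> u 1 (flip 3 \<phi>) = inv (u 2 \<phi>) \<otimes> u 1 \<phi>" if \<phi>: "\<phi> \<in> flags" for \<phi>
  proof -
    have "inv (inv (u 1 (flip 3 \<phi>)) \<otimes> u 2 (flip 3 \<phi>)) = inv (inv (u 1 \<phi>) \<otimes> u 2 \<phi>)" using flip12[OF \<phi>] by simp
    then show ?thesis using uc[OF \<phi>] uc[OF flip_closed[OF \<phi>]] by (simp add: inv_mult_group)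
  qed
  have flip2: "u 1 (flip 2 \<phi>) = u 1 \<phi>" if \<phi>: "\<phi> \<in> flags" for \<phi>
  proof -
    obtain h b where hb: "\<phi> = (h, b)" "h \<in> H" using \<phi> by (auto simp: flags_def)
    then show ?thesis using face_prev(2)[OF hb(2)]
      by (cases b) (simp_all add: flip_simps u_def potential_def AB)
  qed
  have flip1: "u 2 (flip 1 \<phi>) = u 2 \<phi>" for \<phi>
    by (simp add: flip_def u_def potential_def)
  have u3: "u 3 \<phi> = \<one>" for \<phi> by (simp add: u_def potential_def)
  have inv_flip: "\<gamma> k l (flip m \<phi>) = \<gamma> k l \<phi>" if \<phi>: "\<phi> \<in> flags" and m: "m \<noteq> k" "m \<noteq> l" for k l m \<phi>
  proof (cases "k = l")
    case True
    then show ?thesis using \<phi> uc[OF \<phi>] uc[OF flip_closed[OF \<phi>]] flip_closed[OF \<phi>] by (simp add: \<gamma>_def)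
  next
    case False
    \<comment> \<open>With three types, \<open>m\<close> is the one different from \<open>k\<close>
      and \<open>l\<close>. Only the pairs formed by 1 and 2 use the equation between
      \<open>A\<close> and \<open>B\<close>.\<close>
    have "(m = 3 \<and> k = 1 \<and> l = 2) \<or> (m = 3 \<and> k = 2 \<and> l = 1) \<or> (m = 2 \<and> k = 1 \<and> l = 3) \<or>
        (m = 2 \<and> k = 3 \<and> l = 1) \<or> (m = 1 \<and> k = 2 \<and> l = 3) \<or> (m = 1 \<and> k = 3 \<and> l = 2)"
      using m False exhaust_3[of k] exhaust_3[of l] exhaust_3[of m] by metis
    then show ?thesis
      using flip12[OF \<phi>] flip21[OF \<phi>] flip2[OF \<phi>] flip1 u3 flip_closed[OF \<phi>] \<phi> by (elim disjE) (simp_all add: \<gamma>_def)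
  qed
  have "\<gamma> \<in> flag_labels" unfolding flag_labels_def
  proof (intro CollectI conjI allI ballI impI)
    fix k l m \<phi> assume \<phi>: "\<phi> \<in> flags"
    have "u l \<phi> \<otimes> (inv (u l \<phi>) \<otimes> u m \<phi>) = u m \<phi>" using uc[OF \<phi>] by (simp flip: m_assoc)
    then have "inv (u k \<phi>) \<otimes> u l \<phi> \<otimes> (inv (u l \<phi>) \<otimes> u m \<phi>) = inv (u k \<phi>) \<otimes> (u l \<phi> \<otimes> inv (u l \<phi>)) \<otimes> u m \<phi>"
      using uc[OF \<phi>] by (simp add: m_assoc)
    then show "\<gamma> k l \<phi> \<otimes> \<gamma> l m \<phi> = \<gamma> k m \<phi>" using \<phi> uc[OF \<phi>] by (simp add: \<gamma>_def)
  qed (use uc inv_flip in \<open>auto simp: \<gamma>_def\<close>)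
  moreover have "to_darts \<gamma> = z"
  proof -
    have "\<gamma> 3 k (h, False) = u k (h, False)" if "h \<in> H" for k h
      using that uc[of "(h, False)"] u3 by (simp add: \<gamma>_def flags_def)
    then have "to_darts \<gamma> = (\<lambda>h\<in>H. A h, \<lambda>h\<in>H. B h)"
      by (auto simp: to_darts_def u_def potential_def AB)
    then show ?thesis using A B AB by (simp add: extensional_restrict PiE_def)
  qed
  ultimately show "z \<in> to_darts ` flag_labels" by blast
qed

lemma num_homs_rg_pi1:
  "num_homs (rg_pi1 \<Gamma>) G * card (carrier G) ^ (card (rg_verts \<Gamma>) + card (rg_faces \<Gamma>) - 1) =
    card (flat_labels G H nxt opp)"
proof -
  let ?N = "card (carrier G)"
  have N: "?N > 0" using finite_carrier by (auto simp: card_gt_0_iff)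
  have V: "card (rg_verts \<Gamma>) > 0" using conn finite_V by (auto simp: rg_connected_def card_gt_0_iff)
  have "topspace (rg_surface \<Gamma>) \<noteq> {}"
    using topspace_X F_nonempty bary(1) by auto
  then have x: "(SOME x. x \<in> topspace (rg_surface \<Gamma>)) \<in> topspace (rg_surface \<Gamma>)" by (simp add: some_in_eq)
  have "num_homs (rg_pi1 \<Gamma>) G * ?N ^ (card (rg_verts \<Gamma>) + card (rg_edges \<Gamma>) + card (rg_faces \<Gamma>) - 1) = card flag_labels"
    using card_flag_labels[OF x] by (simp add: rg_pi1_def sum_3 card_reach_1 card_reach_2 card_reach_3)
  also have "\<dots> = card dart_labels" by (rule bij_betw_same_card[OF bij_to_darts])
  also have "\<dots> = ?N ^ card (rg_edges \<Gamma>) * card (flat_labels G H nxt opp)" by (rule card_dart_labels)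
  \<comment> \<open>The exponents are truncated differences, so the existence of a vertex is needed
    to split off the edges.\<close>
  also have "card (rg_verts \<Gamma>) + card (rg_edges \<Gamma>) + card (rg_faces \<Gamma>) - 1 =
      card (rg_edges \<Gamma>) + (card (rg_verts \<Gamma>) + card (rg_faces \<Gamma>) - 1)" using V by simp
  finally have "?N ^ card (rg_edges \<Gamma>) * (num_homs (rg_pi1 \<Gamma>) G * ?N ^ (card (rg_verts \<Gamma>) + card (rg_faces \<Gamma>) - 1)) =
      ?N ^ card (rg_edges \<Gamma>) * card (flat_labels G H nxt opp)"
    by (simp add: power_add algebra_simps)
  then show ?thesis using N by simp
qed

lemma ribbon_weight:
  "of_nat (card (carrier G)) powi (rg_euler_char \<Gamma> - 1) * of_nat (num_homs (rg_pi1 \<Gamma>) G) =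
    of_nat (card (flat_labels G H nxt opp)) / (of_nat (card (carrier G)) :: complex) ^ card (rg_edges \<Gamma>)"
proof -
  let ?N = "of_nat (card (carrier G)) :: complex"
  have N: "?N \<noteq> 0" using finite_carrier by auto
  have V: "card (rg_verts \<Gamma>) > 0" using conn finite_V by (auto simp: rg_connected_def card_gt_0_iff)
  have "rg_euler_char \<Gamma> - 1 = int (card (rg_verts \<Gamma>) + card (rg_faces \<Gamma>) - 1) - int (card (rg_edges \<Gamma>))"
    using V by (simp add: rg_euler_char_def of_nat_diff)
  then have "?N powi (rg_euler_char \<Gamma> - 1) = ?N ^ (card (rg_verts \<Gamma>) + card (rg_faces \<Gamma>) - 1) / ?N ^ card (rg_edges \<Gamma>)"
    using N by (simp only: power_int_diff[OF disjI1[OF N]] power_int_of_nat)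
  then show ?thesis
    using arg_cong[OF num_homs_rg_pi1, of "of_nat :: nat \<Rightarrow> complex"] by (simp add: mult.commute)
qed

end

section \<open>The logarithm of a power series\<close>

text \<open>Two gradings are used: the number of factors, which bounds the powers occurring in the
  logarithm, and the weighted degree, which counts half-edges.\<close>

definition mono_size :: "monomial \<Rightarrow> nat" where
  "mono_size v = (\<Sum>j\<in>Poly_Mapping.keys v. Poly_Mapping.lookup v j)"

definition mono_degree :: "monomial \<Rightarrow> nat" where
  "mono_degree v = (\<Sum>j\<in>Poly_Mapping.keys v. j * Poly_Mapping.lookup v j)"

section \<open>Gradings and the ring of power series\<close>

lemma keys_add_monomial: "Poly_Mapping.keys (a + b) = Poly_Mapping.keys a \<union> Poly_Mapping.keys (b :: monomial)"
  by (auto simp: in_keys_iff lookup_add)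

lemma sum_keys_superset:
  assumes "finite S" "Poly_Mapping.keys (v :: monomial) \<subseteq> S"
  shows "(\<Sum>j\<in>Poly_Mapping.keys v. c j * Poly_Mapping.lookup v j) = (\<Sum>j\<in>S. c j * Poly_Mapping.lookup v j)"
  using assms by (intro sum.mono_neutral_left) (auto simp: in_keys_iff)

lemma sum_keys_add:
  "(\<Sum>j\<in>Poly_Mapping.keys (a + b). c j * Poly_Mapping.lookup (a + b) j) =
    (\<Sum>j\<in>Poly_Mapping.keys a. c j * Poly_Mapping.lookup a j) +
    (\<Sum>j\<in>Poly_Mapping.keys b. c j * Poly_Mapping.lookup (b :: monomial) j)" for c :: "nat \<Rightarrow> nat"
proof -
  let ?S = "Poly_Mapping.keys a \<union> Poly_Mapping.keys b"
  have "(\<Sum>j\<in>Poly_Mapping.keys a. c j * Poly_Mapping.lookup a j) = (\<Sum>j\<in>?S. c j * Poly_Mapping.lookup a j)"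
    "(\<Sum>j\<in>Poly_Mapping.keys b. c j * Poly_Mapping.lookup b j) = (\<Sum>j\<in>?S. c j * Poly_Mapping.lookup b j)"
    by (rule sum_keys_superset; auto)+
  then show ?thesis by (simp add: keys_add_monomial lookup_add distrib_left sum.distrib)
qed

lemma mono_size_add: "mono_size (a + b) = mono_size a + mono_size b"
  using sum_keys_add[of "\<lambda>_. 1"] by (simp add: mono_size_def)

lemma mono_degree_add: "mono_degree (a + b) = mono_degree a + mono_degree b"
  using sum_keys_add[of "\<lambda>j. j"] by (simp add: mono_degree_def)

lemma mono_size_eq_0: "mono_size v = 0 \<longleftrightarrow> v = 0"
proof
  assume "mono_size v = 0"
  then have "\<forall>j\<in>Poly_Mapping.keys v. Poly_Mapping.lookup v j = 0" by (simp add: mono_size_def)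
  then have "Poly_Mapping.lookup v j = 0" for j by (cases "j \<in> Poly_Mapping.keys v") (auto simp: in_keys_iff)
  then show "v = 0" by (intro poly_mapping_eqI) simp
qed (simp add: mono_size_def)

lemma series_mult_commute: "series_mult A B = series_mult B A"
proof
  fix v
  have "(\<Sum>z\<in>{(a, b). a + b = v}. A (fst z) * B (snd z)) = (\<Sum>z\<in>{(a, b). a + b = v}. B (fst z) * A (snd z))"
    by (rule sum.reindex_bij_witness[where i = prod.swap and j = prod.swap]) (auto simp: add.commute mult.commute)
  then show "series_mult A B v = series_mult B A v"
    by (simp add: series_mult_def case_prod_unfold)
qed

lemma series_mult_assoc: "series_mult (series_mult A B) C = series_mult A (series_mult B C)"
proof
  fix v
  let ?S = "\<lambda>v. {(a, b). a + b = (v :: monomial)}"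
  have "series_mult (series_mult A B) C v = (\<Sum>z\<in>?S v. \<Sum>w\<in>?S (fst z). A (fst w) * B (snd w) * C (snd z))"
    by (simp add: series_mult_def case_prod_unfold sum_distrib_right)
  also have "\<dots> = (\<Sum>(z, w)\<in>Sigma (?S v) (\<lambda>z. ?S (fst z)). A (fst w) * B (snd w) * C (snd z))"
    by (rule sum.Sigma) (auto simp: finite_splittings)
  also have "\<dots> = (\<Sum>(z, w)\<in>Sigma (?S v) (\<lambda>z. ?S (snd z)). A (fst z) * (B (fst w) * C (snd w)))"
    by (rule sum.reindex_bij_witness[where j = "\<lambda>((x, c), (a, b)). ((a, b + c), (b, c))"
          and i = "\<lambda>((a, y), (b, c)). ((a + b, c), (a, b))"]) (auto simp: algebra_simps)
  also have "\<dots> = (\<Sum>z\<in>?S v. \<Sum>w\<in>?S (snd z). A (fst z) * (B (fst w) * C (snd w)))"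
    by (rule sum.Sigma[symmetric]) (auto simp: finite_splittings)
  also have "\<dots> = series_mult A (series_mult B C) v"
    by (simp add: series_mult_def case_prod_unfold sum_distrib_left)
  finally show "series_mult (series_mult A B) C v = series_mult A (series_mult B C) v" .
qed

lemma series_mult_one: "series_mult series_one A = A"
proof
  fix v
  have "series_mult series_one A v = (\<Sum>z\<in>{(a, b). a + b = v}. if z = (0, v) then A v else 0)"
    unfolding series_mult_def by (rule sum.cong) (auto simp: series_one_def split: if_splits)
  also have "\<dots> = A v" using finite_splittings[of v] by simp
  finally show "series_mult series_one A v = A v" .
qed

lemma series_mult_add_right: "series_mult A (\<lambda>v. B v + C v) v = series_mult A B v + series_mult A C v"
  by (simp add: series_mult_def case_prod_unfold distrib_left sum.distrib)

lemma series_mult_add_left: "series_mult (\<lambda>v. B v + C v) A v = series_mult B A v + series_mult C A v"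
  by (simp add: series_mult_def case_prod_unfold distrib_right sum.distrib)

lemma series_mult_scale_right: "series_mult A (\<lambda>v. c * B v) v = c * series_mult A B v"
  by (simp add: series_mult_def case_prod_unfold sum_distrib_left mult.left_commute)

text \<open>The weighted Euler operator, under which the variable with index \<open>j\<close> has
  weight \<open>j\<close>. On generating functions of graphs it marks a half-edge.\<close>

definition euler_deriv :: "power_series \<Rightarrow> power_series" where
  "euler_deriv A v = of_nat (mono_degree v) * A v"

lemma euler_deriv_mult:
  "euler_deriv (series_mult A B) v = series_mult (euler_deriv A) B v + series_mult A (euler_deriv B) v"
  unfolding series_mult_def euler_deriv_def sum_distrib_left sum.distrib[symmetric]
  by (rule sum.cong) (auto simp: mono_degree_add algebra_simps)

lemma euler_deriv_power:
  "euler_deriv (series_power B (Suc k)) = (\<lambda>v. of_nat (Suc k) * series_mult (series_power B k) (euler_deriv B) v)"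
proof (induction k)
  case 0
  have "series_mult B series_one = B" by (simp add: series_mult_commute[of B] series_mult_one)
  then show ?case by (simp add: series_mult_one)
next
  case (Suc k)
  let ?P = "series_power B" and ?D = "euler_deriv B"
  show ?case
  proof
    fix v
    have "euler_deriv (?P (Suc (Suc k))) v = series_mult ?D (?P (Suc k)) v + series_mult B (euler_deriv (?P (Suc k))) v"
      unfolding series_power.simps(2)[of B "Suc k"] by (rule euler_deriv_mult)
    also have "series_mult B (euler_deriv (?P (Suc k))) v = of_nat (Suc k) * series_mult B (series_mult (?P k) ?D) v"
      unfolding Suc.IH by (rule series_mult_scale_right)
    also have "series_mult B (series_mult (?P k) ?D) = series_mult (?P (Suc k)) ?D"
      by (simp add: series_mult_assoc)
    also have "series_mult ?D (?P (Suc k)) = series_mult (?P (Suc k)) ?D" by (rule series_mult_commute)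
    finally show "euler_deriv (?P (Suc (Suc k))) v = of_nat (Suc (Suc k)) * series_mult (?P (Suc k)) ?D v"
      by (simp add: algebra_simps)
  qed
qed

lemma series_power_eq_0:
  assumes "B 0 = 0" "mono_size v < k"
  shows "series_power B k v = 0"
  using assms(2)
proof (induction k arbitrary: v)
  case (Suc k)
  have "B a * series_power B k b = 0" if "a + b = v" for a b
  proof (cases "a = 0")
    case False
    then have "mono_size b < k" using Suc.prems mono_size_add[of a b] mono_size_eq_0[of a] that by simp
    then show ?thesis using Suc.IH by simp
  qed (use assms(1) in simp)
  then have "(\<Sum>(a, b) | a + b = v. B a * series_power B k b) = 0"
    by (intro sum.neutral) auto
  then show ?case by (simp add: series_mult_def)
qed simp

text \<open>In the coefficient at \<open>v\<close> the unit constant term isolates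
  \<open>A v\<close>; all other terms involve smaller monomials.\<close>

lemma series_mult_cancel:
  assumes Z: "Z 0 = 1" and eq: "series_mult Z A = series_mult Z B"
  shows "A = B"
proof
  fix v show "A v = B v"
  proof (induction "mono_size v" arbitrary: v rule: less_induct)
    case less
    let ?S = "{(a, b). a + b = v}"
    have split: "series_mult Z F v = F v + (\<Sum>(a, b)\<in>?S - {(0, v)}. Z a * F b)" for F
      unfolding series_mult_def using sum.remove[OF finite_splittings, of "(0, v)" v "\<lambda>(a, b). Z a * F b"] Z by simp
    have "(\<Sum>(a, b)\<in>?S - {(0, v)}. Z a * A b) = (\<Sum>(a, b)\<in>?S - {(0, v)}. Z a * B b)"
    proof (rule sum.cong[OF refl])
      fix x assume x: "x \<in> ?S - {(0, v)}"
      obtain a b where ab: "x = (a, b)" by (cases x)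
      have v: "v = a + b" and "\<not> (a = 0 \<and> b = v)" using x by (auto simp: ab)
      then have "a \<noteq> 0" by auto
      then have "mono_size b < mono_size v" using mono_size_add[of a b] mono_size_eq_0[of a] v by simp
      then have "A b = B b" by (rule less)
      then show "(case x of (a, b) \<Rightarrow> Z a * A b) = (case x of (a, b) \<Rightarrow> Z a * B b)" using ab(1) by simp
    qed
    then show ?case using split[of A] split[of B] fun_cong[OF eq, of v] by simp
  qed
qed

lemma series_log_finite:
  assumes "A 0 = 1" "mono_size v \<le> n"
  shows "series_log A v = (\<Sum>k<n. (-1) ^ k / of_nat (Suc k) * series_power (\<lambda>w. A w - series_one w) (Suc k) v)"
  unfolding series_log_def
proof (rule suminf_finite)
  fix k assume "k \<notin> {..<n}"
  then have "series_power (\<lambda>w. A w - series_one w) (Suc k) v = 0"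
    using assms by (intro series_power_eq_0) (auto simp: series_one_def)
  then show "(-1) ^ k / of_nat (Suc k) * series_power (\<lambda>w. A w - series_one w) (Suc k) v = 0" by simp
qed simp

text \<open>With Z = 1 + B the derivative of the logarithm is the alternating geometric series of B
  times D B. Multiplied by 1 + B it telescopes to D B up to a remainder containing a high power of
  B.\<close>

lemma euler_deriv_series_log:
  assumes Z: "Z 0 = 1"
  shows "series_mult Z (euler_deriv (series_log Z)) = euler_deriv Z"
proof
  fix v
  define B where "B = (\<lambda>w. Z w - series_one w)"
  have B0: "B 0 = 0" using Z by (simp add: B_def series_one_def)
  \<comment> \<open>Large enough to truncate the logarithm at every factor of \<open>v\<close> and
    to kill the remainder at \<open>v\<close>.\<close>
  define n where "n = Suc (mono_size v)"
  let ?T = "\<lambda>n v. \<Sum>k<n. (-1) ^ k * series_mult (series_power B k) (euler_deriv B) v"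
  have log: "euler_deriv (series_log Z) b = ?T n b" if "mono_size b \<le> mono_size v" for b
  proof -
    have "euler_deriv (series_log Z) b =
        (\<Sum>k<n. (-1) ^ k / of_nat (Suc k) * euler_deriv (series_power B (Suc k)) b)"
    proof -
      have "mono_size b \<le> n" using that by (simp add: n_def)
      from series_log_finite[where A = Z, OF Z this] show ?thesis
        by (simp add: euler_deriv_def B_def sum_distrib_left mult_ac del: series_power.simps)
    qed
    also have "\<dots> = ?T n b"
      unfolding euler_deriv_power by (rule sum.cong) (simp_all del: of_nat_Suc)
    finally show ?thesis .
  qed
  have "series_mult Z (euler_deriv (series_log Z)) v = series_mult Z (?T n) v"
    unfolding series_mult_def[of Z]
  proof (rule sum.cong[OF refl])
    fix x assume "x \<in> {(a, b). a + b = v}"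
    then obtain a b where x: "x = (a, b)" "a + b = v" by (cases x) simp
    then have "mono_size b \<le> mono_size v" using mono_size_add[of a b] by simp
    from log[OF this]
    show "(case x of (a, b) \<Rightarrow> Z a * euler_deriv (series_log Z) b) = (case x of (a, b) \<Rightarrow> Z a * ?T n b)"
      by (simp only: x prod.case)
  qed
  also have "\<dots> = euler_deriv B v - (-1) ^ n * series_mult (series_power B n) (euler_deriv B) v"
  proof (induction n)
    case 0
    then show ?case by (simp add: series_mult_def series_mult_one[unfolded fun_eq_iff, rule_format, unfolded series_mult_def])
  next
    case (Suc n)
    let ?X = "series_mult (series_power B n) (euler_deriv B)"
    have "Z = (\<lambda>v. series_one v + B v)" by (auto simp: B_def)
    then have "series_mult Z ?X v = ?X v + series_mult B ?X v"
      using series_mult_add_left[of series_one B ?X v] by (simp add: series_mult_one)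
    also have "series_mult B ?X = series_mult (series_power B (Suc n)) (euler_deriv B)"
      by (simp add: series_mult_assoc)
    finally have X: "series_mult Z ?X v = ?X v + series_mult (series_power B (Suc n)) (euler_deriv B) v" .
    have "series_mult Z (?T (Suc n)) v = series_mult Z (?T n) v + (-1) ^ n * series_mult Z ?X v"
      using series_mult_add_right[of Z "?T n" "\<lambda>v. (-1) ^ n * ?X v" v] by (simp add: series_mult_scale_right)
    also have "\<dots> = euler_deriv B v - (-1) ^ Suc n * series_mult (series_power B (Suc n)) (euler_deriv B) v"
      unfolding Suc.IH X by (simp add: algebra_simps)
    finally show ?case .
  qed
  also have "series_mult (series_power B n) (euler_deriv B) v = 0"
  proof -
    have "series_power B n a * euler_deriv B b = 0" if "a + b = v" for a b
      using series_power_eq_0[of B a n, OF B0] mono_size_add[of a b] that by (simp add: n_def)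
    then show ?thesis unfolding series_mult_def by (intro sum.neutral) auto
  qed
  also have "euler_deriv B v = euler_deriv Z v"
    by (cases "v = 0") (auto simp: euler_deriv_def B_def series_one_def mono_degree_def)
  finally show "series_mult Z (euler_deriv (series_log Z)) v = euler_deriv Z v" by simp
qed

lemma series_power_supported:
  assumes "\<And>v. \<not> Poly_Mapping.keys v \<subseteq> S \<Longrightarrow> B v = 0" "\<not> Poly_Mapping.keys v \<subseteq> S"
  shows "series_power B k v = 0"
  using assms(2)
proof (induction k arbitrary: v)
  case 0 then show ?case by (auto simp: series_one_def)
next
  case (Suc k)
  have "B a * series_power B k b = 0" if "a + b = v" for a b
  proof -
    have "\<not> Poly_Mapping.keys a \<subseteq> S \<or> \<not> Poly_Mapping.keys b \<subseteq> S"
      using Suc.prems that keys_add_monomial[of a b] by auto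
    then show ?thesis using assms(1)[of a] Suc.IH[of b] by auto
  qed
  then have "(\<Sum>(a, b) | a + b = v. B a * series_power B k b) = 0"
    by (intro sum.neutral) auto
  then show ?case by (simp add: series_mult_def)
qed

lemma mono_degree_eq_0:
  assumes "Poly_Mapping.keys v \<subseteq> {3..}" "mono_degree v = 0"
  shows "v = 0"
proof -
  have "j * Poly_Mapping.lookup v j = 0" if "j \<in> Poly_Mapping.keys v" for j
    using assms(2) that by (simp add: mono_degree_def)
  moreover have "j \<noteq> 0" if "j \<in> Poly_Mapping.keys v" for j using assms(1) that by auto
  ultimately have "Poly_Mapping.lookup v j = 0" for j
    by (cases "j \<in> Poly_Mapping.keys v") (simp_all add: in_keys_iff)
  then show ?thesis by (intro poly_mapping_eqI) simp
qed

text \<open>The operator D determines a series up to the monomials of degree 0. As the variable with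
  index 0 has weight 0, the support condition is what leaves only the constant term
  undetermined.\<close>

lemma series_log_eqI:
  assumes Z: "Z 0 = 1" and C: "C 0 = 0"
    and supp: "\<And>v. \<not> Poly_Mapping.keys v \<subseteq> {3..} \<Longrightarrow> Z v = 0" "\<And>v. \<not> Poly_Mapping.keys v \<subseteq> {3..} \<Longrightarrow> C v = 0"
    and rec: "\<And>v. of_nat (mono_degree v) * Z v = (\<Sum>(a, b) | a + b = v. of_nat (mono_degree a) * C a * Z b)"
  shows "series_log Z = C"
proof
  fix v
  have "series_mult Z (euler_deriv C) = euler_deriv Z"
    using rec by (simp add: series_mult_commute[of Z] fun_eq_iff series_mult_def euler_deriv_def)
  then have D: "euler_deriv (series_log Z) = euler_deriv C"
    using series_mult_cancel[of Z, OF Z] euler_deriv_series_log[of Z, OF Z] by simp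
  let ?B = "\<lambda>w. Z w - series_one w"
  show "series_log Z v = C v"
  proof (cases "Poly_Mapping.keys v \<subseteq> {3..}")
    case True
    show ?thesis
    proof (cases "v = 0")
      case True
      then show ?thesis using series_log_finite[where A = Z, OF Z, of 0 0] C by (simp add: mono_size_def)
    next
      case False
      then have "mono_degree v \<noteq> 0" using mono_degree_eq_0[OF True] by blast
      then show ?thesis using fun_cong[OF D, of v] by (simp add: euler_deriv_def)
    qed
  next
    case False
    have "series_power ?B k v = 0" for k
      by (rule series_power_supported[OF _ False]) (use supp(1) in \<open>auto simp: series_one_def\<close>)
    then show ?thesis using supp(2)[OF False] by (simp add: series_log_def del: series_power.simps)
  qed
qed

section \<open>Pairs of permutations\<close>

text \<open>For \<open>b = True\<close> these are the pairings of \<open>H\<close>. For \<open>b = False\<close> only the identity remains, so that a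
  connected pair below is a single cycle; this case describes the integrand.\<close>

definition involutions :: "bool \<Rightarrow> 'a set \<Rightarrow> ('a \<Rightarrow> 'a) set" where
  "involutions b H = {\<alpha>. \<alpha> permutes H \<and> (\<forall>h. \<alpha> (\<alpha> h) = h) \<and> (\<forall>h\<in>H. (\<alpha> h \<noteq> h) = b)}"

definition maps :: "bool \<Rightarrow> 'a set \<Rightarrow> (('a \<Rightarrow> 'a) \<times> ('a \<Rightarrow> 'a)) set" where
  "maps b H = {\<sigma>. \<sigma> permutes H} \<times> involutions b H"

definition stable :: "('a \<Rightarrow> 'a) \<times> ('a \<Rightarrow> 'a) \<Rightarrow> 'a set \<Rightarrow> bool" where
  "stable s K \<longleftrightarrow> fst s ` K \<subseteq> K \<and> snd s ` K \<subseteq> K"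

definition conn_maps :: "bool \<Rightarrow> 'a set \<Rightarrow> (('a \<Rightarrow> 'a) \<times> ('a \<Rightarrow> 'a)) set" where
  "conn_maps b H = {s \<in> maps b H. H \<noteq> {} \<and> (\<forall>K\<subseteq>H. K \<noteq> {} \<longrightarrow> stable s K \<longrightarrow> K = H)}"

definition cycle_type :: "'a set \<Rightarrow> ('a \<Rightarrow> 'a) \<Rightarrow> monomial" where
  "cycle_type H \<sigma> = Abs_poly_mapping (\<lambda>j. card {C \<in> orbit \<sigma> ` H. card C = j})"

definition join_maps :: "('a \<Rightarrow> 'a) \<times> ('a \<Rightarrow> 'a) \<Rightarrow> ('a \<Rightarrow> 'a) \<times> ('a \<Rightarrow> 'a) \<Rightarrow> ('a \<Rightarrow> 'a) \<times> ('a \<Rightarrow> 'a)" where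
  "join_maps c r = (fst c \<circ> fst r, snd c \<circ> snd r)"

definition restrict_maps :: "('a \<Rightarrow> 'a) \<times> ('a \<Rightarrow> 'a) \<Rightarrow> 'a set \<Rightarrow> ('a \<Rightarrow> 'a) \<times> ('a \<Rightarrow> 'a)" where
  "restrict_maps s K = (restrict_id (fst s) K, restrict_id (snd s) K)"

text \<open>Only forward steps are taken. On a finite set the complement of a stable set is stable,
  so this is already the orbit under the generated group.\<close>

definition component :: "('a \<Rightarrow> 'a) \<times> ('a \<Rightarrow> 'a) \<Rightarrow> 'a \<Rightarrow> 'a set" where
  "component s h = {k. (h, k) \<in> ({(x, fst s x) | x. True} \<union> {(x, snd s x) | x. True})\<^sup>*}"

section \<open>Cycle types, disjoint unions and components\<close>

lemma lookup_cycle_type: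
  assumes "finite H"
  shows "Poly_Mapping.lookup (cycle_type H \<sigma>) j = card {C \<in> orbit \<sigma> ` H. card C = j}"
proof -
  have "{j. card {C \<in> orbit \<sigma> ` H. card C = j} \<noteq> 0} \<subseteq> card ` orbit \<sigma> ` H"
  proof
    fix j assume "j \<in> {j. card {C \<in> orbit \<sigma> ` H. card C = j} \<noteq> 0}"
    then have "{C \<in> orbit \<sigma> ` H. card C = j} \<noteq> {}" by (metis (lifting) card.empty mem_Collect_eq)
    then show "j \<in> card ` orbit \<sigma> ` H" by blast
  qed
  then have "finite {j. card {C \<in> orbit \<sigma> ` H. card C = j} \<noteq> 0}" using assms finite_subset by blast
  then show ?thesis unfolding cycle_type_def by (simp add: lookup_Abs_poly_mapping)
qed

lemma permutes_orbit:
  assumes "\<sigma> permutes H" "finite H"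
  shows "h \<in> orbit \<sigma> h" "k \<in> orbit \<sigma> h \<Longrightarrow> orbit \<sigma> k = orbit \<sigma> h"
proof -
  show h: "h \<in> orbit \<sigma> h" for h
    by (rule permutation_self_in_orbit) (use assms in \<open>auto simp: permutation_permutes\<close>)
  show "k \<in> orbit \<sigma> h \<Longrightarrow> orbit \<sigma> k = orbit \<sigma> h"
    using cyclic_on_orbit[OF assms] by (rule orbit_cyclic_eq3)
qed

lemma mono_degree_cycle_type:
  assumes \<sigma>: "\<sigma> permutes H" and H: "finite H"
  shows "mono_degree (cycle_type H \<sigma>) = card H"
proof -
  let ?O = "orbit \<sigma> ` H"
  have sub: "C \<subseteq> H" if "C \<in> ?O" for C using that permutes_orbit_subset[OF \<sigma>] by auto
  have fin: "finite ?O" using H by simp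
  have un: "\<Union>?O = H" using sub permutes_orbit(1)[OF \<sigma> H] by blast
  have "card (\<Union>?O) = (\<Sum>C\<in>?O. card C)"
  proof (rule card_Union_disjoint)
    show "pairwise disjnt ?O" unfolding pairwise_def disjnt_def
    proof (intro ballI impI)
      fix C D assume CD: "C \<in> ?O" "D \<in> ?O" "C \<noteq> D"
      show "C \<inter> D = {}"
      proof (rule ccontr)
        assume "C \<inter> D \<noteq> {}"
        then obtain x where "x \<in> C" "x \<in> D" by blast
        then have "orbit \<sigma> x = C" "orbit \<sigma> x = D" using CD(1,2) permutes_orbit(2)[OF \<sigma> H] by auto
        then show False using CD(3) by simp
      qed
    qed
    show "finite C" if "C \<in> ?O" for C using sub[OF that] H finite_subset by blast
  qed
  then have "card H = (\<Sum>C\<in>?O. card C)" using un by simp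
  also have "\<dots> = (\<Sum>j\<in>Poly_Mapping.keys (cycle_type H \<sigma>). \<Sum>C\<in>{C \<in> ?O. card C = j}. card C)"
  proof (rule sum.group[symmetric, OF fin])
    show "card ` ?O \<subseteq> Poly_Mapping.keys (cycle_type H \<sigma>)"
    proof
      fix j assume "j \<in> card ` ?O"
      then have "{C \<in> ?O. card C = j} \<noteq> {}" by blast
      then show "j \<in> Poly_Mapping.keys (cycle_type H \<sigma>)"
        using fin by (simp add: in_keys_iff lookup_cycle_type[OF H])
    qed
  qed simp
  also have "\<dots> = mono_degree (cycle_type H \<sigma>)"
    unfolding mono_degree_def by (rule sum.cong) (simp_all add: lookup_cycle_type[OF H] mult.commute)
  finally show ?thesis by simp
qed

lemma comp_disjoint:
  assumes "p permutes K" "q permutes R" "K \<inter> R = {}"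
  shows "h \<in> K \<Longrightarrow> (p \<circ> q) h = p h" "h \<in> R \<Longrightarrow> (p \<circ> q) h = q h"
proof -
  show "h \<in> K \<Longrightarrow> (p \<circ> q) h = p h" using assms permutes_not_in[OF assms(2)] by (auto simp: disjoint_iff)
  show "h \<in> R \<Longrightarrow> (p \<circ> q) h = q h"
    using assms permutes_not_in[OF assms(1), of "q h"] permutes_in_image[OF assms(2), of h] by (auto simp: disjoint_iff)
qed

lemma cycle_type_join:
  assumes p: "p permutes K" and q: "q permutes R" and KR: "K \<inter> R = {}" and fin: "finite K" "finite R"
  shows "cycle_type (K \<union> R) (p \<circ> q) = cycle_type K p + cycle_type R q"
proof (rule poly_mapping_eqI)
  fix j
  have oK: "orbit (p \<circ> q) h = orbit p h" if "h \<in> K" for h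
    by (rule orbit_cong0[symmetric, OF that]) (use comp_disjoint[OF p q KR] permutes_in_image[OF p] in auto)
  have oR: "orbit (p \<circ> q) h = orbit q h" if "h \<in> R" for h
    by (rule orbit_cong0[symmetric, OF that]) (use comp_disjoint[OF p q KR] permutes_in_image[OF q] in auto)
  have "{C \<in> orbit (p \<circ> q) ` (K \<union> R). card C = j} =
      {C \<in> orbit p ` K. card C = j} \<union> {C \<in> orbit q ` R. card C = j}"
    using oK oR by (auto simp: image_Un)
  moreover have "{C \<in> orbit p ` K. card C = j} \<inter> {C \<in> orbit q ` R. card C = j} = {}"
  proof -
    have "orbit p h \<noteq> orbit q k" if "h \<in> K" "k \<in> R" for h k
      using permutes_orbit_subset[OF p that(1)] permutes_orbit_subset[OF q that(2)] orbit_nonempty[of p h] KR by blast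
    then show ?thesis by blast
  qed
  ultimately show "Poly_Mapping.lookup (cycle_type (K \<union> R) (p \<circ> q)) j =
      Poly_Mapping.lookup (cycle_type K p + cycle_type R q) j"
    using fin by (simp add: lookup_add lookup_cycle_type card_Un_disjoint)
qed

lemma finite_maps: "finite H \<Longrightarrow> finite (maps b H)"
  unfolding maps_def involutions_def
  by (intro finite_SigmaI finite_permutations) (auto intro: finite_subset[OF _ finite_permutations])

lemma mapsD:
  assumes "s \<in> maps b H"
  shows "fst s permutes H" "snd s permutes H" "snd s (snd s h) = h" "h \<in> H \<Longrightarrow> (snd s h \<noteq> h) = b"
  using assms by (auto simp: maps_def involutions_def)

lemma mapsI:
  assumes "fst s permutes H" "snd s permutes H" "\<And>h. snd s (snd s h) = h" "\<And>h. h \<in> H \<Longrightarrow> (snd s h \<noteq> h) = b"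
  shows "s \<in> maps b H"
  using assms by (auto simp: maps_def involutions_def mem_Times_iff)

lemma conn_maps_subset: "s \<in> conn_maps b K \<Longrightarrow> s \<in> maps b K"
  by (simp add: conn_maps_def)

lemma join_maps_in:
  assumes c: "c \<in> maps b K" and r: "r \<in> maps b R" and KR: "K \<inter> R = {}"
  shows "join_maps c r \<in> maps b (K \<union> R)"
proof (rule mapsI)
  note ap = comp_disjoint[OF mapsD(2)[OF c] mapsD(2)[OF r] KR]
  show p: "fst (join_maps c r) permutes (K \<union> R)" "snd (join_maps c r) permutes (K \<union> R)"
    unfolding join_maps_def fst_conv snd_conv
    using mapsD(1,2)[OF c] mapsD(1,2)[OF r] by (auto intro!: permutes_compose intro: permutes_subset)
  have j: "snd (join_maps c r) h = (if h \<in> K then snd c h else snd r h)" for h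
  proof (cases "h \<in> K \<union> R")
    case True
    then show ?thesis using ap KR by (auto simp: join_maps_def)
  next
    case False
    then have "snd (join_maps c r) h = h" "snd r h = h"
      using permutes_not_in[OF p(2)] permutes_not_in[OF mapsD(2)[OF r]] by auto
    then show ?thesis using False by simp
  qed
  show "snd (join_maps c r) (snd (join_maps c r) h) = h" for h
    using j mapsD(3)[OF c] mapsD(3)[OF r] permutes_in_image[OF mapsD(2)[OF c], of h]
      permutes_in_image[OF mapsD(2)[OF r], of h] permutes_not_in[OF mapsD(2)[OF r], of h] KR
    by (auto simp: disjoint_iff)
  show "(snd (join_maps c r) h \<noteq> h) = b" if "h \<in> K \<union> R" for h
    using j that mapsD(4)[OF c] mapsD(4)[OF r] by auto
qed

text \<open>An injection of a finite set into itself is onto; hence nothing enters \<open>K\<close>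
  from outside and the complement is stable too.\<close>

lemma stable_bij:
  assumes "finite H" "K \<subseteq> H" "stable s K" "fst s permutes H" "snd s permutes H"
  shows "bij_betw (fst s) K K" "bij_betw (snd s) K K" "stable s (H - K)"
proof -
  have K: "finite K" using assms finite_subset by blast
  have 1: "fst s ` K = K" "snd s ` K = K"
    using assms(3) endo_inj_surj[OF K _ permutes_inj_on[OF assms(4)]] endo_inj_surj[OF K _ permutes_inj_on[OF assms(5)]]
    by (simp_all add: stable_def)
  then show "bij_betw (fst s) K K" "bij_betw (snd s) K K"
    using permutes_inj_on[OF assms(4)] permutes_inj_on[OF assms(5)] by (auto simp: bij_betw_def)
  have "p ` (H - K) \<subseteq> H - K" if p: "p permutes H" "p ` K = K" for p
  proof -
    have "p ` (H - K) = p ` H - p ` K" by (rule inj_on_image_set_diff[OF permutes_inj_on[OF p(1)]]) (use assms(2) in auto)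
    then show ?thesis using p permutes_image[OF p(1)] by simp
  qed
  then show "stable s (H - K)" using 1 assms(4,5) by (simp add: stable_def)
qed

lemma restrict_maps_in:
  assumes s: "s \<in> maps b H" and H: "finite H" "K \<subseteq> H" and st: "stable s K"
  shows "restrict_maps s K \<in> maps b K"
proof (rule mapsI)
  note B = stable_bij[OF H st mapsD(1,2)[OF s]]
  show "fst (restrict_maps s K) permutes K" "snd (restrict_maps s K) permutes K"
    using B by (auto simp: restrict_maps_def intro: permutes_restrict_id)
  show "snd (restrict_maps s K) (snd (restrict_maps s K) h) = h" for h
    using st mapsD(3)[OF s] by (cases "h \<in> K") (auto simp: restrict_maps_def stable_def image_subset_iff)
  show "(snd (restrict_maps s K) h \<noteq> h) = b" if "h \<in> K" for h
    using that mapsD(4)[OF s] H by (auto simp: restrict_maps_def)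
qed

lemma component_self: "h \<in> component s h"
  by (simp add: component_def)

lemma component_stable: "stable s (component s h)"
  unfolding stable_def component_def by (auto intro: rtrancl_into_rtrancl)

lemma component_least:
  assumes "stable s K" "h \<in> K"
  shows "component s h \<subseteq> K"
proof
  fix k assume "k \<in> component s h"
  then have "(h, k) \<in> ({(x, fst s x) | x. True} \<union> {(x, snd s x) | x. True})\<^sup>*" by (simp add: component_def)
  then show "k \<in> K" by (induction rule: rtrancl_induct) (use assms in \<open>auto simp: stable_def\<close>)
qed

lemma stable_maps: "s \<in> maps b H \<Longrightarrow> stable s H"
  unfolding stable_def using permutes_image[OF mapsD(1)[of s b H]] permutes_image[OF mapsD(2)[of s b H]] by blast

text \<open>A stable part that missed \<open>h\<close> would have a stable complement containing the
  whole component of \<open>h\<close>.\<close>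

lemma restrict_component_conn:
  assumes s: "s \<in> maps b H" and H: "finite H" and h: "h \<in> H"
  shows "restrict_maps s (component s h) \<in> conn_maps b (component s h)"
proof -
  let ?K = "component s h"
  have KH: "?K \<subseteq> H" by (rule component_least[OF stable_maps[OF s] h])
  have "L = ?K" if L: "L \<subseteq> ?K" "L \<noteq> {}" "stable (restrict_maps s ?K) L" for L
  proof -
    have sL: "stable s L"
    proof -
      have "fst (restrict_maps s ?K) x = fst s x" "snd (restrict_maps s ?K) x = snd s x" if "x \<in> L" for x
        using L(1) that by (auto simp: restrict_maps_def)
      then show ?thesis using L(3) by (simp add: stable_def image_subset_iff)
    qed
    have "h \<in> L"
    proof (rule ccontr)
      assume "h \<notin> L"
      have LH: "L \<subseteq> H" using L KH by blast
      have "stable s (H - L)" by (rule stable_bij(3)[OF H LH sL mapsD(1,2)[OF s]])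
      then have "?K \<subseteq> H - L" using \<open>h \<notin> L\<close> h by (intro component_least) auto
      then show False using L by blast
    qed
    then show ?thesis using component_least[OF sL] L(1) by blast
  qed
  then show ?thesis
    using restrict_maps_in[OF s H KH component_stable] component_self[of h s] unfolding conn_maps_def by blast
qed

lemma join_restrict:
  assumes s: "s \<in> maps b H" and H: "finite H" "K \<subseteq> H" and st: "stable s K"
  shows "join_maps (restrict_maps s K) (restrict_maps s (H - K)) = s"
proof -
  note B = stable_bij[OF H st mapsD(1,2)[OF s]]
  have st': "stable s (H - K)" using B(3) .
  have *: "restrict_id p K (restrict_id p (H - K) h) = p h"
    if p: "p permutes H" "p ` (H - K) \<subseteq> H - K" for p h
  proof (cases "h \<in> H - K")
    case True
    then have "p h \<in> H - K" using p(2) by blast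
    then show ?thesis using True by simp
  next
    case False
    then show ?thesis using permutes_not_in[OF p(1), of h] by (cases "h \<in> K") auto
  qed
  show ?thesis using *[OF mapsD(1)[OF s]] *[OF mapsD(2)[OF s]] st'
    by (auto simp: join_maps_def restrict_maps_def prod_eq_iff fun_eq_iff stable_def)
qed

lemma join_apply:
  assumes c: "c \<in> maps b K" and r: "r \<in> maps b R" and KR: "K \<inter> R = {}"
  shows "h \<in> K \<Longrightarrow> fst (join_maps c r) h = fst c h" "h \<in> K \<Longrightarrow> snd (join_maps c r) h = snd c h"
    "h \<in> R \<Longrightarrow> fst (join_maps c r) h = fst r h" "h \<in> R \<Longrightarrow> snd (join_maps c r) h = snd r h"
  using comp_disjoint[OF mapsD(1)[OF c] mapsD(1)[OF r] KR] comp_disjoint[OF mapsD(2)[OF c] mapsD(2)[OF r] KR]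
  by (auto simp: join_maps_def)

lemma restrict_join:
  assumes c: "c \<in> maps b K" and r: "r \<in> maps b R" and KR: "K \<inter> R = {}"
  shows "restrict_maps (join_maps c r) K = c" "restrict_maps (join_maps c r) R = r"
proof -
  note J = join_apply[OF c r KR]
  show "restrict_maps (join_maps c r) K = c"
    using J(1,2) permutes_not_in[OF mapsD(1)[OF c]] permutes_not_in[OF mapsD(2)[OF c]]
    by (auto simp: restrict_maps_def prod_eq_iff fun_eq_iff restrict_id_def)
  show "restrict_maps (join_maps c r) R = r"
    using J(3,4) permutes_not_in[OF mapsD(1)[OF r]] permutes_not_in[OF mapsD(2)[OF r]]
    by (auto simp: restrict_maps_def prod_eq_iff fun_eq_iff restrict_id_def)
qed

lemma component_join:
  assumes c: "c \<in> conn_maps b K" and r: "r \<in> maps b R" and KR: "K \<inter> R = {}" and h: "h \<in> K"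
  shows "component (join_maps c r) h = K"
proof -
  note cm = conn_maps_subset[OF c]
  note J = join_apply[OF cm r KR]
  let ?s = "join_maps c r"
  have stK: "stable ?s K" using stable_maps[OF cm] J(1,2) by (auto simp: stable_def)
  have sub: "component ?s h \<subseteq> K" by (rule component_least[OF stK h])
  have "stable c (component ?s h)"
    using component_stable[of ?s h] sub J(1,2) unfolding stable_def image_subset_iff by (metis subsetD)
  then show ?thesis using c sub component_self[of h ?s] unfolding conn_maps_def by blast
qed

text \<open>A structure on \<open>H\<close> is a connected structure on the component of \<open>h\<close> and an arbitrary one on
  the rest: this is the combinatorial form of the equation \<open>Z' = C' Z\<close>.\<close>

lemma bij_join_maps:
  assumes H: "finite H" and h: "h \<in> H"
  shows "bij_betw (\<lambda>(K, c, r). join_maps c r)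
    (SIGMA K:{K. K \<subseteq> H \<and> h \<in> K}. conn_maps b K \<times> maps b (H - K)) (maps b H)"
proof (rule bij_betw_byWitness[where f' = "\<lambda>s. (component s h, restrict_maps s (component s h), restrict_maps s (H - component s h))"])
  let ?D = "SIGMA K:{K. K \<subseteq> H \<and> h \<in> K}. conn_maps b K \<times> maps b (H - K)"
  show "\<forall>z\<in>?D. (\<lambda>s. (component s h, restrict_maps s (component s h), restrict_maps s (H - component s h)))
      ((\<lambda>(K, c, r). join_maps c r) z) = z"
  proof
    fix z assume "z \<in> ?D"
    then obtain K c r where z: "z = (K, c, r)" "K \<subseteq> H" "h \<in> K" "c \<in> conn_maps b K" "r \<in> maps b (H - K)" by auto
    have d: "K \<inter> (H - K) = {}" by blast
    show "(\<lambda>s. (component s h, restrict_maps s (component s h), restrict_maps s (H - component s h)))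
      ((\<lambda>(K, c, r). join_maps c r) z) = z"
      using component_join[OF z(4,5) d z(3)] restrict_join[OF conn_maps_subset[OF z(4)] z(5) d] z(1) by simp
  qed
  show "\<forall>s\<in>maps b H. (\<lambda>(K, c, r). join_maps c r) (component s h, restrict_maps s (component s h),
      restrict_maps s (H - component s h)) = s"
    using join_restrict[OF _ H component_least[OF stable_maps h] component_stable] by simp
  show "(\<lambda>(K, c, r). join_maps c r) ` ?D \<subseteq> maps b H"
  proof (rule image_subsetI)
    fix z assume "z \<in> ?D"
    then obtain K c r where z: "z = (K, c, r)" "K \<subseteq> H" "h \<in> K" "c \<in> conn_maps b K" "r \<in> maps b (H - K)" by auto
    have "K \<union> (H - K) = H" using z(2) by blast
    then show "(\<lambda>(K, c, r). join_maps c r) z \<in> maps b H"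
      using join_maps_in[OF conn_maps_subset[OF z(4)] z(5)] z(1) by auto
  qed
  show "(\<lambda>s. (component s h, restrict_maps s (component s h), restrict_maps s (H - component s h))) ` maps b H \<subseteq> ?D"
  proof (rule image_subsetI)
    fix s assume s: "s \<in> maps b H"
    have sub: "component s h \<subseteq> H" by (rule component_least[OF stable_maps[OF s] h])
    have "restrict_maps s (H - component s h) \<in> maps b (H - component s h)"
      by (rule restrict_maps_in[OF s H _ stable_bij(3)[OF H sub component_stable mapsD(1,2)[OF s]]]) blast
    then show "(component s h, restrict_maps s (component s h), restrict_maps s (H - component s h)) \<in> ?D"
      using restrict_component_conn[OF s H h] sub component_self[of h s] by blast
  qed
qed

lemma sum_maps_decompose:
  assumes H: "finite H" and h: "h \<in> H"
  shows "(\<Sum>s\<in>maps b H. f s) = (\<Sum>K\<in>{K. K \<subseteq> H \<and> h \<in> K}. \<Sum>c\<in>conn_maps b K. \<Sum>r\<in>maps b (H - K). f (join_maps c r))"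
proof -
  have fc: "finite (conn_maps b K)" if "K \<subseteq> H" for K
    using finite_maps[of K b] finite_subset[OF that H] by (auto simp: conn_maps_def)
  have fr: "finite (maps b (H - K))" for K using H by (simp add: finite_maps)
  have fK: "finite {K. K \<subseteq> H \<and> h \<in> K}" using H by simp
  have "(\<Sum>s\<in>maps b H. f s) = (\<Sum>(K, c, r)\<in>(SIGMA K:{K. K \<subseteq> H \<and> h \<in> K}. conn_maps b K \<times> maps b (H - K)). f (join_maps c r))"
    using sum.reindex_bij_betw[OF bij_join_maps[OF H h, of b], of f] by (simp add: case_prod_unfold)
  also have "\<dots> = (\<Sum>K\<in>{K. K \<subseteq> H \<and> h \<in> K}. \<Sum>(c, r)\<in>conn_maps b K \<times> maps b (H - K). f (join_maps c r))"
    using fc fr fK by (subst sum.Sigma) auto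
  also have "\<dots> = (\<Sum>K\<in>{K. K \<subseteq> H \<and> h \<in> K}. \<Sum>c\<in>conn_maps b K. \<Sum>r\<in>maps b (H - K). f (join_maps c r))"
    by (simp add: sum.cartesian_product)
  finally show ?thesis .
qed

section \<open>Transport of structure along bijections\<close>

definition relabel :: "'a set \<Rightarrow> ('a \<Rightarrow> 'c) \<Rightarrow> ('a \<Rightarrow> 'a) \<times> ('a \<Rightarrow> 'a) \<Rightarrow> ('c \<Rightarrow> 'c) \<times> ('c \<Rightarrow> 'c)" where
  "relabel A f s = (map_permutation A f (fst s), map_permutation A f (snd s))"

lemma relabel_in:
  assumes f: "bij_betw f A B" and s: "s \<in> maps b A"
  shows "relabel A f s \<in> maps b B"
proof (rule mapsI)
  have inj: "inj_on f A" and B: "B = f ` A" using f by (auto simp: bij_betw_def)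
  note ap = map_permutation_apply[OF inj]
  show p: "fst (relabel A f s) permutes B" "snd (relabel A f s) permutes B"
    using map_permutation_permutes[OF f] mapsD(1,2)[OF s] by (auto simp: relabel_def)
  show "(snd (relabel A f s) h \<noteq> h) = b" if "h \<in> B" for h
  proof -
    obtain a where a: "a \<in> A" "h = f a" using \<open>h \<in> B\<close> B by auto
    have "snd s a \<in> A" using a permutes_in_image[OF mapsD(2)[OF s]] by simp
    then show ?thesis using a ap[OF a(1)] mapsD(4)[OF s a(1)] inj by (auto simp: relabel_def inj_on_eq_iff)
  qed
  show "snd (relabel A f s) (snd (relabel A f s) h) = h" for h
  proof (cases "h \<in> B")
    case True
    then obtain a where a: "a \<in> A" "h = f a" using B by auto
    have "snd s a \<in> A" using a permutes_in_image[OF mapsD(2)[OF s]] by simp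
    then show ?thesis using a ap mapsD(3)[OF s] by (simp add: relabel_def)
  next
    case False
    then show ?thesis using permutes_not_in[OF p(2)] by simp
  qed
qed

lemma relabel_inverse:
  assumes f: "bij_betw f A B" and s: "s \<in> maps b A"
  shows "relabel B (inv_into A f) (relabel A f s) = s"
  using map_permutation_compose_inv[OF f mapsD(1)[OF s], of "inv_into A f"]
    map_permutation_compose_inv[OF f mapsD(2)[OF s], of "inv_into A f"] f
  by (auto simp: relabel_def bij_betw_inv_into_left prod_eq_iff)

lemma relabel_apply:
  assumes "inj_on f A" "a \<in> A"
  shows "fst (relabel A f s) (f a) = f (fst s a)" "snd (relabel A f s) (f a) = f (snd s a)"
  using assms by (auto simp: relabel_def map_permutation_apply)

lemma stable_relabel:
  assumes f: "bij_betw f A B" and s: "s \<in> maps b A" and L: "L \<subseteq> A"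
  shows "stable (relabel A f s) (f ` L) \<longleftrightarrow> stable s L"
proof -
  have inj: "inj_on f A" using f by (simp add: bij_betw_def)
  have sA: "fst s a \<in> A" "snd s a \<in> A" if "a \<in> A" for a
    using that permutes_in_image[OF mapsD(1)[OF s]] permutes_in_image[OF mapsD(2)[OF s]] by auto
  have mem: "f x \<in> f ` L \<longleftrightarrow> x \<in> L" if "x \<in> A" for x using inj_on_image_mem_iff[OF inj that L] .
  have "fst (relabel A f s) (f a) \<in> f ` L \<longleftrightarrow> fst s a \<in> L" "snd (relabel A f s) (f a) \<in> f ` L \<longleftrightarrow> snd s a \<in> L"
    if "a \<in> L" for a
  proof -
    have "a \<in> A" using that L by blast
    from relabel_apply[OF inj this, of s] mem[OF sA(1)[OF this]] mem[OF sA(2)[OF this]]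
    show "fst (relabel A f s) (f a) \<in> f ` L \<longleftrightarrow> fst s a \<in> L" "snd (relabel A f s) (f a) \<in> f ` L \<longleftrightarrow> snd s a \<in> L"
      by simp_all
  qed
  then show ?thesis unfolding stable_def image_subset_iff by simp
qed

lemma relabel_conn:
  assumes f: "bij_betw f A B" and s: "s \<in> conn_maps b A"
  shows "relabel A f s \<in> conn_maps b B"
proof -
  note sm = conn_maps_subset[OF s]
  have B: "B = f ` A" using f by (auto simp: bij_betw_def)
  have "K = B" if K: "K \<subseteq> B" "K \<noteq> {}" "stable (relabel A f s) K" for K
  proof -
    obtain L where L: "L \<subseteq> A" "K = f ` L" using K(1) B by (metis subset_imageE)
    have "stable s L" using stable_relabel[OF f sm L(1)] K(3) L(2) by simp
    then have "L = A" using s L K(2) unfolding conn_maps_def by blast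
    then show ?thesis using L(2) B by simp
  qed
  moreover have "B \<noteq> {}" using s B by (auto simp: conn_maps_def)
  ultimately show ?thesis using relabel_in[OF f sm] unfolding conn_maps_def by blast
qed

lemma bij_relabel:
  assumes f: "bij_betw f A B"
  shows "bij_betw (relabel A f) (maps b A) (maps b B)" "bij_betw (relabel A f) (conn_maps b A) (conn_maps b B)"
proof -
  let ?g = "inv_into A f"
  have g: "bij_betw ?g B A" using f by (rule bij_betw_inv_into)
  have inverse: "relabel A f (relabel B ?g s) = s" if "s \<in> maps b B" for s
  proof -
    have "map_permutation A f (map_permutation B ?g p) = p" if p: "p permutes B" for p
    proof
      fix x
      show "map_permutation A f (map_permutation B ?g p) x = p x"
      proof (cases "x \<in> B")
        case True
        have "?g x \<in> A" "f (?g x) = x" "f (?g (p x)) = p x"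
          using True permutes_in_image[OF p, of x] f bij_betw_apply[OF g True] bij_betw_inv_into_right[OF f] by auto
        then show ?thesis
          using map_permutation_apply[of f A "?g x" "map_permutation B ?g p"] map_permutation_apply[of ?g B x p]
            True f g by (simp add: bij_betw_def)
      next
        case False
        then show ?thesis
          using permutes_not_in[OF map_permutation_permutes[OF f map_permutation_permutes[OF g p]]] permutes_not_in[OF p] by simp
      qed
    qed
    then show ?thesis using mapsD(1,2)[OF that] by (simp add: relabel_def)
  qed
  show "bij_betw (relabel A f) (maps b A) (maps b B)"
    by (rule bij_betw_byWitness[where f' = "relabel B ?g"])
      (use relabel_inverse[OF f] inverse relabel_in[OF f] relabel_in[OF g] in auto)
  show "bij_betw (relabel A f) (conn_maps b A) (conn_maps b B)"
    by (rule bij_betw_byWitness[where f' = "relabel B ?g"])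
      (use relabel_inverse[OF f conn_maps_subset] inverse[OF conn_maps_subset] relabel_conn[OF f] relabel_conn[OF g] in auto)
qed

lemma cycle_type_relabel:
  assumes f: "bij_betw f A B" and \<sigma>: "\<sigma> permutes A" and A: "finite A"
  shows "cycle_type B (map_permutation A f \<sigma>) = cycle_type A \<sigma>"
proof (rule poly_mapping_eqI)
  fix j
  have inj: "inj_on f A" and B: "B = f ` A" using f by (auto simp: bij_betw_def)
  have orb: "orbit (map_permutation A f \<sigma>) (f a) = f ` orbit \<sigma> a" if a: "a \<in> A" for a
  proof -
    have it: "(map_permutation A f \<sigma> ^^ n) (f a) = f ((\<sigma> ^^ n) a) \<and> (\<sigma> ^^ n) a \<in> A" for n
      by (induction n) (use a map_permutation_apply[OF inj] permutes_in_image[OF \<sigma>] in auto)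
    show ?thesis unfolding orbit_altdef using it by auto
  qed
  have sub: "orbit \<sigma> a \<subseteq> A" if "a \<in> A" for a using permutes_orbit_subset[OF \<sigma> that] .
  have "{C \<in> orbit (map_permutation A f \<sigma>) ` B. card C = j} = (`) f ` {C \<in> orbit \<sigma> ` A. card C = j}"
  proof -
    have "card (f ` orbit \<sigma> a) = card (orbit \<sigma> a)" if "a \<in> A" for a
      by (rule card_image[OF inj_on_subset[OF inj sub[OF that]]])
    then show ?thesis using orb unfolding B by (auto simp: image_iff)
  qed
  moreover have "inj_on ((`) f) {C \<in> orbit \<sigma> ` A. card C = j}"
    by (rule inj_on_subset[OF inj_on_image_Pow[OF inj]]) (use sub in auto)
  ultimately have "card {C \<in> orbit (map_permutation A f \<sigma>) ` B. card C = j} = card {C \<in> orbit \<sigma> ` A. card C = j}"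
    by (simp add: card_image)
  then show "Poly_Mapping.lookup (cycle_type B (map_permutation A f \<sigma>)) j = Poly_Mapping.lookup (cycle_type A \<sigma>) j"
    using A B by (simp add: lookup_cycle_type)
qed

lemma card_subsets_containing:
  assumes "finite H" "h \<in> H" "k \<ge> 1"
  shows "card {K. K \<subseteq> H \<and> h \<in> K \<and> card K = k} = (card H - 1) choose (k - 1)"
proof -
  have "bij_betw (insert h) {L. L \<subseteq> H - {h} \<and> card L = k - 1} {K. K \<subseteq> H \<and> h \<in> K \<and> card K = k}"
  proof (rule bij_betw_byWitness[where f' = "\<lambda>K. K - {h}"])
    show "insert h ` {L. L \<subseteq> H - {h} \<and> card L = k - 1} \<subseteq> {K. K \<subseteq> H \<and> h \<in> K \<and> card K = k}"
    proof (rule image_subsetI)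
      fix L assume L: "L \<in> {L. L \<subseteq> H - {h} \<and> card L = k - 1}"
      then have "finite L" "h \<notin> L" using assms(1) finite_subset by auto
      then show "insert h L \<in> {K. K \<subseteq> H \<and> h \<in> K \<and> card K = k}" using L assms by auto
    qed
  qed (use assms in \<open>auto simp: insert_absorb\<close>)
  then have "card {K. K \<subseteq> H \<and> h \<in> K \<and> card K = k} = card {L. L \<subseteq> H - {h} \<and> card L = k - 1}"
    by (rule bij_betw_same_card[symmetric])
  also have "\<dots> = card (H - {h}) choose (k - 1)" using assms by (intro n_subsets) auto
  finally show ?thesis using assms by simp
qed

section \<open>The exponential formula\<close>

text \<open>What the exponential formula requires of a weight: it depends only on the isomorphism
  type and is multiplicative on disjoint unions.\<close>

locale map_weight =
  fixes b :: bool and w :: "nat set \<Rightarrow> (nat \<Rightarrow> nat) \<times> (nat \<Rightarrow> nat) \<Rightarrow> complex"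
  assumes w_empty: "s \<in> maps b {} \<Longrightarrow> w {} s = 1"
    and w_join: "finite K \<Longrightarrow> finite R \<Longrightarrow> K \<inter> R = {} \<Longrightarrow> c \<in> maps b K \<Longrightarrow> r \<in> maps b R \<Longrightarrow>
      w (K \<union> R) (join_maps c r) = w K c * w R r"
    and w_relabel: "finite A \<Longrightarrow> bij_betw f A B \<Longrightarrow> s \<in> maps b A \<Longrightarrow> w B (relabel A f s) = w A s"
begin

definition total :: "nat set \<Rightarrow> power_series" where
  "total H v = (\<Sum>s\<in>maps b H. if cycle_type H (fst s) = v then w H s else 0)"

definition conn_total :: "nat set \<Rightarrow> power_series" where
  "conn_total H v = (\<Sum>s\<in>conn_maps b H. if cycle_type H (fst s) = v then w H s else 0)"

text \<open>A cycle type has as degree the size of the underlying set, so the monomial itself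
  records the size and the exponential generating function needs no further variable.\<close>

definition egf :: power_series where
  "egf v = total {..<mono_degree v} v / fact (mono_degree v)"

definition conn_egf :: power_series where
  "conn_egf v = conn_total {..<mono_degree v} v / fact (mono_degree v)"

lemma total_relabel:
  assumes A: "finite A" and f: "bij_betw f A B"
  shows "total B v = total A v" "conn_total B v = conn_total A v"
proof -
  have eq: "(if cycle_type B (fst (relabel A f s)) = v then w B (relabel A f s) else 0) =
      (if cycle_type A (fst s) = v then w A s else 0)" if "s \<in> maps b A" for s
    using cycle_type_relabel[OF f mapsD(1)[OF that] A] w_relabel[OF A f that] by (simp add: relabel_def)
  have "total B v = (\<Sum>s\<in>maps b A. if cycle_type B (fst (relabel A f s)) = v then w B (relabel A f s) else 0)"
    unfolding total_def by (rule sum.reindex_bij_betw[OF bij_relabel(1)[OF f], symmetric])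
  also have "\<dots> = total A v" unfolding total_def by (rule sum.cong[OF refl eq])
  finally show "total B v = total A v" .
  have "conn_total B v = (\<Sum>s\<in>conn_maps b A. if cycle_type B (fst (relabel A f s)) = v then w B (relabel A f s) else 0)"
    unfolding conn_total_def by (rule sum.reindex_bij_betw[OF bij_relabel(2)[OF f], symmetric])
  also have "\<dots> = conn_total A v" unfolding conn_total_def by (rule sum.cong[OF refl eq[OF conn_maps_subset]])
  finally show "conn_total B v = conn_total A v" .
qed

lemma total_card:
  assumes "finite A"
  shows "total A v = total {..<card A} v" "conn_total A v = conn_total {..<card A} v"
proof -
  obtain f where "bij_betw f {..<card A} A" using ex_bij_betw_nat_finite[OF assms] by (auto simp: atLeast0LessThan)
  then show "total A v = total {..<card A} v" "conn_total A v = conn_total {..<card A} v"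
    using total_relabel[of "{..<card A}" f A] by simp_all
qed

lemma total_degree:
  assumes "finite A" "card A \<noteq> mono_degree v"
  shows "total A v = 0" "conn_total A v = 0"
proof -
  have "cycle_type A (fst s) \<noteq> v" if "s \<in> maps b A" for s
    using mono_degree_cycle_type[OF mapsD(1)[OF that] assms(1)] assms(2) by auto
  then show "total A v = 0" "conn_total A v = 0"
    unfolding total_def conn_total_def by (auto intro!: sum.neutral dest: conn_maps_subset)
qed

lemma total_decompose:
  assumes H: "finite H" and h: "h \<in> H"
  shows "total H v = (\<Sum>K\<in>{K. K \<subseteq> H \<and> h \<in> K}. \<Sum>(a, b)\<in>{(a, b). a + b = v}. conn_total K a * total (H - K) b)"
proof -
  let ?S = "{(a, b). a + b = v}"
  have "total H v = (\<Sum>K\<in>{K. K \<subseteq> H \<and> h \<in> K}. \<Sum>c\<in>conn_maps b K. \<Sum>r\<in>maps b (H - K).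
      if cycle_type H (fst (join_maps c r)) = v then w H (join_maps c r) else 0)"
    unfolding total_def by (rule sum_maps_decompose[OF H h])
  also have "\<dots> = (\<Sum>K\<in>{K. K \<subseteq> H \<and> h \<in> K}. \<Sum>(a, b)\<in>?S. conn_total K a * total (H - K) b)"
  proof (rule sum.cong[OF refl])
    fix K assume "K \<in> {K. K \<subseteq> H \<and> h \<in> K}"
    then have K: "K \<subseteq> H" "finite K" "K \<inter> (H - K) = {}" "K \<union> (H - K) = H" using H finite_subset by auto
    have fR: "finite (H - K)" using H by simp
    let ?c = "\<lambda>c. cycle_type K (fst c)" and ?r = "\<lambda>r. cycle_type (H - K) (fst r)"
    have "(\<Sum>(a, d)\<in>?S. conn_total K a * total (H - K) d) =
        (\<Sum>z\<in>?S. \<Sum>c\<in>conn_maps b K. \<Sum>r\<in>maps b (H - K).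
          (if ?c c = fst z then w K c else 0) * (if ?r r = snd z then w (H - K) r else 0))"
      by (simp add: conn_total_def total_def case_prod_unfold sum_product)
    also have "\<dots> = (\<Sum>c\<in>conn_maps b K. \<Sum>r\<in>maps b (H - K). \<Sum>z\<in>?S.
          (if ?c c = fst z then w K c else 0) * (if ?r r = snd z then w (H - K) r else 0))"
      by (subst sum.swap, intro sum.cong refl sum.swap)
    also have "\<dots> = (\<Sum>c\<in>conn_maps b K. \<Sum>r\<in>maps b (H - K).
      if cycle_type H (fst (join_maps c r)) = v then w H (join_maps c r) else 0)"
    proof (intro sum.cong refl)
      fix c r assume c: "c \<in> conn_maps b K" and r: "r \<in> maps b (H - K)"
      note cm = conn_maps_subset[OF c]
      have ty: "cycle_type H (fst (join_maps c r)) = ?c c + ?r r"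
        using cycle_type_join[OF mapsD(1)[OF cm] mapsD(1)[OF r] K(3,2) fR] K(4) by (simp add: join_maps_def)
      have ww: "w H (join_maps c r) = w K c * w (H - K) r" using w_join[OF K(2) fR K(3) cm r] K(4) by simp
      have "(\<Sum>z\<in>?S. (if ?c c = fst z then w K c else 0) * (if ?r r = snd z then w (H - K) r else 0)) =
          (\<Sum>z\<in>?S. if z = (?c c, ?r r) then w K c * w (H - K) r else 0)"
        by (rule sum.cong) auto
      also have "\<dots> = (if (?c c, ?r r) \<in> ?S then w K c * w (H - K) r else 0)"
        using finite_splittings[of v] by (simp only: sum.delta)
      finally show "(\<Sum>z\<in>?S. (if ?c c = fst z then w K c else 0) * (if ?r r = snd z then w (H - K) r else 0)) =
          (if cycle_type H (fst (join_maps c r)) = v then w H (join_maps c r) else 0)"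
        by (simp add: ty ww)
    qed
    finally show "(\<Sum>c\<in>conn_maps b K. \<Sum>r\<in>maps b (H - K).
        if cycle_type H (fst (join_maps c r)) = v then w H (join_maps c r) else 0) =
        (\<Sum>(a, b)\<in>?S. conn_total K a * total (H - K) b)" by simp
  qed
  finally show ?thesis .
qed

text \<open>The point 0 is marked and its component split off. A component of size \<open>k\<close>
  can be chosen in \<open>(n - 1) choose (k - 1)\<close> ways, so the factorials match after one
  factor \<open>n\<close> and one factor \<open>k\<close>, the weights of the Euler
  operator.\<close>

theorem egf_recursion:
  "of_nat (mono_degree v) * egf v = (\<Sum>(a, b) | a + b = v. of_nat (mono_degree a) * conn_egf a * egf b)"
proof (cases "mono_degree v = 0")
  case True
  have "mono_degree a = 0" if "a + b = v" for a b using mono_degree_add[of a b] True that by simp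
  then have "(\<Sum>(a, b) | a + b = v. of_nat (mono_degree a) * conn_egf a * egf b) = 0"
    by (intro sum.neutral) auto
  then show ?thesis using True by simp
next
  case False
  define n where "n = mono_degree v"
  let ?H = "{..<n}" and ?S = "{(a, b). a + b = v}"
  have n: "n > 0" using False by (simp add: n_def)
  have "total ?H v = (\<Sum>K\<in>{K. K \<subseteq> ?H \<and> 0 \<in> K}. \<Sum>(a, b)\<in>?S. conn_total K a * total (?H - K) b)"
    using n by (intro total_decompose) auto
  also have "\<dots> = (\<Sum>(a, b)\<in>?S. \<Sum>K\<in>{K. K \<subseteq> ?H \<and> 0 \<in> K}. conn_total K a * total (?H - K) b)"
    unfolding case_prod_unfold by (rule sum.swap)
  also have "\<dots> = (\<Sum>(a, b)\<in>?S. of_nat (mono_degree a) * conn_egf a * egf b * fact (n - 1))"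
  proof (rule sum.cong[OF refl])
    fix z assume z: "z \<in> ?S"
    obtain a d where ad: "z = (a, d)" by (cases z)
    have deg: "n = mono_degree a + mono_degree d" using z mono_degree_add[of a d] by (simp add: ad n_def)
    let ?k = "mono_degree a"
    let ?T = "conn_total {..<?k} a * total {..<mono_degree d} d"
    have val: "conn_total K a * total (?H - K) d = (if card K = ?k then ?T else 0)"
      if "K \<in> {K. K \<subseteq> ?H \<and> 0 \<in> K}" for K
    proof -
      have K: "finite K" "finite (?H - K)" "card (?H - K) = n - card K" "K \<subseteq> ?H"
        using that finite_subset[of K ?H] by (auto simp: card_Diff_subset)
      show ?thesis
      proof (cases "card K = ?k")
        case True
        then show ?thesis using total_card(2)[OF K(1), of a] total_card(1)[OF K(2), of d] K(3) deg by simp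
      qed (use total_degree(2)[OF K(1), of a] in simp)
    qed
    have "(\<Sum>K\<in>{K. K \<subseteq> ?H \<and> 0 \<in> K}. conn_total K a * total (?H - K) d) =
        (\<Sum>K\<in>{K. K \<subseteq> ?H \<and> 0 \<in> K}. if card K = ?k then ?T else 0)"
      by (rule sum.cong[OF refl val])
    also have "\<dots> = of_nat (card {K. K \<subseteq> ?H \<and> 0 \<in> K \<and> card K = ?k}) * ?T"
    proof -
      have "finite {K. K \<subseteq> ?H \<and> 0 \<in> K}" by simp
      then have "(\<Sum>K\<in>{K. K \<subseteq> ?H \<and> 0 \<in> K}. if card K = ?k then ?T else 0) =
          (\<Sum>K\<in>{K \<in> {K. K \<subseteq> ?H \<and> 0 \<in> K}. card K = ?k}. ?T)"
        by (rule sum.inter_filter[symmetric])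
      moreover have "{K \<in> {K. K \<subseteq> ?H \<and> 0 \<in> K}. card K = ?k} = {K. K \<subseteq> ?H \<and> 0 \<in> K \<and> card K = ?k}" by blast
      ultimately show ?thesis by simp
    qed
    also have "\<dots> = of_nat ?k * conn_egf a * egf d * fact (n - 1)"
    proof (cases "?k = 0")
      case True
      then show ?thesis by (simp add: conn_total_def conn_maps_def)
    next
      case False
      then have k: "?k \<ge> 1" by simp
      have "card {K. K \<subseteq> ?H \<and> 0 \<in> K \<and> card K = ?k} = (n - 1) choose (?k - 1)"
        using card_subsets_containing[of ?H 0 ?k] n k by simp
      \<comment> \<open>The binomial coefficient supplies the factorials of both parts; the missing
        factor of \<open>fact ?k\<close> is the weight of \<open>a\<close>.\<close>
      moreover have "(of_nat ((n - 1) choose (?k - 1)) :: complex) = fact (n - 1) / (fact (?k - 1) * fact (mono_degree d))"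
      proof -
        have "n - 1 - (?k - 1) = mono_degree d" "?k - 1 \<le> n - 1" using k deg by auto
        then show ?thesis using binomial_fact[of "?k - 1" "n - 1", where 'a = complex] by simp
      qed
      moreover have "(fact ?k :: complex) = of_nat ?k * fact (?k - 1)" using k by (simp add: fact_reduce)
      ultimately show ?thesis using k by (simp add: conn_egf_def egf_def)
    qed
    finally show "(case z of (a, b) \<Rightarrow> \<Sum>K\<in>{K. K \<subseteq> ?H \<and> 0 \<in> K}. conn_total K a * total (?H - K) b) =
        (case z of (a, b) \<Rightarrow> of_nat (mono_degree a) * conn_egf a * egf b * fact (n - 1))"
      by (simp add: ad)
  qed
  also have "\<dots> = (\<Sum>(a, b)\<in>?S. of_nat (mono_degree a) * conn_egf a * egf b) * fact (n - 1)"
    by (simp add: case_prod_unfold sum_distrib_right)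
  finally have tot: "total ?H v = \<dots>" .
  have "(fact n :: complex) = of_nat n * fact (n - 1)" using n by (simp add: fact_reduce)
  then have "of_nat n * egf v = total ?H v / fact (n - 1)" using n by (simp add: egf_def n_def)
  then show ?thesis using tot by (simp add: n_def)
qed

lemma egf_0: "egf 0 = 1"
proof -
  have "maps b ({} :: nat set) = {(id, id)}" by (auto simp: maps_def involutions_def)
  moreover have "cycle_type ({} :: nat set) id = 0"
    by (rule poly_mapping_eqI) (simp add: lookup_cycle_type)
  ultimately show ?thesis using w_empty[of "(id, id)"] by (simp add: egf_def total_def mono_degree_def)
qed

lemma conn_egf_0: "conn_egf 0 = 0"
  by (simp add: conn_egf_def conn_total_def mono_degree_def conn_maps_def)

end

section \<open>Permutations without pairings: cycles and the integrand\<close>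

lemma involutions_False: "involutions False H = {id}"
proof (intro equalityI subsetI)
  fix \<alpha> assume \<alpha>: "\<alpha> \<in> involutions False H"
  have "\<alpha> h = h" for h
    using \<alpha> permutes_not_in[of \<alpha> H h] by (cases "h \<in> H") (auto simp: involutions_def)
  then show "\<alpha> \<in> {id}" by auto
qed (auto simp: involutions_def)

lemma card_maps_False: "finite H \<Longrightarrow> card (maps False H) = fact (card H)"
  by (simp add: maps_def involutions_False card_cartesian_product card_permutations)

text \<open>The number of cyclic orders is derived from the decomposition itself: sorted by the size
  \<open>k\<close> of the cycle through 0, the permutations of \<open>n\<close> points contribute (n
  - 1)! for each \<open>k\<close> below \<open>n\<close>, and the difference to n! is the number of
  full cycles.\<close>

lemma card_conn_maps_False:
  assumes "finite K" "K \<noteq> {}"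
  shows "card (conn_maps False (K :: nat set)) = fact (card K - 1)"
proof -
  define c :: "nat \<Rightarrow> nat" where "c = (\<lambda>n. card (conn_maps False {..<n}))"
  have c: "card (conn_maps False K) = c (card K)" if fK: "finite K" for K :: "nat set"
  proof -
    obtain f where "bij_betw f {..<card K} K" using ex_bij_betw_nat_finite[OF fK] by (auto simp: atLeast0LessThan)
    from bij_betw_same_card[OF bij_relabel(2)[OF this]] show ?thesis by (simp add: c_def)
  qed
  have cn: "c n = fact (n - 1)" if "n > 0" for n using that
  proof (induction n rule: less_induct)
    case (less n)
    let ?H = "{..<n}"
    let ?S = "{K. K \<subseteq> ?H \<and> 0 \<in> K}"
    let ?f = "\<lambda>k. c k * fact (n - k)"
    have cK: "1 \<le> card K \<and> card K \<le> n" if "K \<in> ?S" for K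
      using that card_mono[of ?H K] finite_subset[of K ?H] by (auto simp: Suc_le_eq card_gt_0_iff)
    have "fact n = (\<Sum>s\<in>maps False ?H. 1)" using card_maps_False[of ?H] by simp
    also have "\<dots> = (\<Sum>K\<in>?S. \<Sum>c\<in>conn_maps False K. \<Sum>r\<in>maps False (?H - K). 1)"
      using less.prems by (intro sum_maps_decompose) auto
    also have "\<dots> = (\<Sum>K\<in>?S. ?f (card K))"
    proof (rule sum.cong[OF refl])
      fix K assume "K \<in> ?S"
      then have "finite K" "K \<subseteq> ?H" using finite_subset[of K ?H] by auto
      then show "(\<Sum>c\<in>conn_maps False K. \<Sum>r\<in>maps False (?H - K). 1) = ?f (card K)"
        using c[of K] card_maps_False[of "?H - K"] by (simp add: card_Diff_subset)
    qed
    also have "\<dots> = (\<Sum>k\<in>{1..n}. \<Sum>K\<in>{K \<in> ?S. card K = k}. ?f (card K))"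
      by (rule sum.group[symmetric]) (use cK in auto)
    \<comment> \<open>By induction a cycle of length \<open>k < n\<close> and the rest give (n - 1)!
      whatever \<open>k\<close> is; the term \<open>k = n\<close> is the unknown.\<close>
    also have "\<dots> = (\<Sum>k\<in>{1..n}. (if k = n then c n else fact (n - 1)))"
    proof (rule sum.cong[OF refl])
      fix k assume k: "k \<in> {1..n}"
      have "{K \<in> ?S. card K = k} = {K. K \<subseteq> ?H \<and> 0 \<in> K \<and> card K = k}" by blast
      then have "(\<Sum>K\<in>{K \<in> ?S. card K = k}. ?f (card K)) = ((n - 1) choose (k - 1)) * ?f k"
        using card_subsets_containing[of ?H 0 k] k less.prems by simp
      also have "\<dots> = (if k = n then c n else fact (n - 1))"
      proof (cases "k = n")
        case False
        then have "c k = fact (k - 1)" using less.IH[of k] k by simp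
        moreover have "fact (k - 1) * fact (n - 1 - (k - 1)) * ((n - 1) choose (k - 1)) = (fact (n - 1) :: nat)"
          using k by (intro binomial_fact_lemma) auto
        moreover have "n - 1 - (k - 1) = n - k" using k by auto
        ultimately show ?thesis using False by (simp add: mult_ac)
      qed (use less.prems in simp)
      finally show "(\<Sum>K\<in>{K \<in> ?S. card K = k}. ?f (card K)) = (if k = n then c n else fact (n - 1))" .
    qed
    also have "\<dots> = c n + (\<Sum>k\<in>{1..n} - {n}. fact (n - 1))"
      using less.prems by (subst sum.remove[of _ n]) auto
    also have "(\<Sum>k\<in>{1..n} - {n}. fact (n - 1)) = (n - 1) * fact (n - 1)" using less.prems by simp
    finally have 1: "fact n = c n + (n - 1) * fact (n - 1)" .
    have 2: "fact n = n * (fact (n - 1) :: nat)" using fact_reduce[OF less.prems, where 'a = nat] by (simp only: of_nat_id)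
    have 3: "n * fact (n - 1) = fact (n - 1) + (n - 1) * (fact (n - 1) :: nat)"
      using mult_Suc[of "n - 1" "fact (n - 1)"] unfolding Suc_diff_1[OF less.prems] .
    show ?case using trans[OF 1[symmetric] trans[OF 2 3]] by (rule add_right_imp_eq)
  qed
  have "card K > 0" using assms by (simp add: card_gt_0_iff)
  then show ?thesis by (rule trans[OF c[OF assms(1)] cn])
qed

lemma conn_maps_False_cyclic:
  assumes s: "s \<in> conn_maps False K" and K: "finite K" and h: "h \<in> K"
  shows "orbit (fst s) h = K" "snd s = id"
proof -
  note sm = conn_maps_subset[OF s]
  have "snd s \<in> involutions False K" using sm unfolding maps_def mem_Times_iff by (rule conjunct2)
  then show id: "snd s = id" unfolding involutions_False by (rule singletonD)
  have "orbit (fst s) h \<subseteq> K" by (rule permutes_orbit_subset[OF mapsD(1)[OF sm] h])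
  moreover have "orbit (fst s) h \<noteq> {}" by (rule orbit_nonempty)
  moreover have "stable s (orbit (fst s) h)" unfolding stable_def id by (auto intro: orbit.step)
  ultimately show "orbit (fst s) h = K" using s unfolding conn_maps_def by blast
qed

lemma cycle_type_conn_False:
  assumes s: "s \<in> conn_maps False K" and K: "finite K"
  shows "cycle_type K (fst s) = Poly_Mapping.single (card K) (Suc 0)"
proof (rule poly_mapping_eqI)
  fix j
  have "K \<noteq> {}" using s by (simp add: conn_maps_def)
  then have "orbit (fst s) ` K = {K}" using conn_maps_False_cyclic(1)[OF s K] by auto
  then have "{C \<in> orbit (fst s) ` K. card C = j} = (if card K = j then {K} else {})" by auto
  then show "Poly_Mapping.lookup (cycle_type K (fst s)) j = Poly_Mapping.lookup (Poly_Mapping.single (card K) (Suc 0)) j"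
    using K by (simp add: lookup_cycle_type lookup_single when_def)
qed

lemma mono_degree_single: "mono_degree (Poly_Mapping.single j (Suc 0)) = j"
  by (simp add: mono_degree_def)

text \<open>A connected structure is a cycle, and (j - 1)! cycles out of j! give the factor 1 / j.
  The right-hand side is the coefficient of the exponential of the sum of the terms x_j t_j / j; it
  is identified by showing that it obeys \<open>egf_recursion\<close>.\<close>

lemma egf_permutations:
  assumes "map_weight False w" and x: "\<And>K s. finite K \<Longrightarrow> s \<in> conn_maps False K \<Longrightarrow> w K s = x (card K)"
    and v: "Poly_Mapping.keys v \<subseteq> {3..}"
  shows "map_weight.egf False w v =
    (\<Prod>j\<in>Poly_Mapping.keys v. x j ^ Poly_Mapping.lookup v j / (fact (Poly_Mapping.lookup v j) * of_nat j ^ Poly_Mapping.lookup v j))"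
proof -
  interpret map_weight False w by fact
  have cs: "conn_egf (Poly_Mapping.single j (Suc 0)) = x j / of_nat j" if j: "j \<ge> 1" for j
  proof -
    have "conn_total {..<j} (Poly_Mapping.single j (Suc 0)) = (\<Sum>s\<in>conn_maps False {..<j}. x j)"
      unfolding conn_total_def by (rule sum.cong) (use cycle_type_conn_False[of _ "{..<j}"] x[of "{..<j}"] in auto)
    also have "\<dots> = fact (j - 1) * x j" using card_conn_maps_False[of "{..<j}"] j by (simp add: lessThan_empty_iff)
    finally show ?thesis using j by (simp add: conn_egf_def mono_degree_single fact_reduce)
  qed
  have c0: "conn_egf a = 0" if "\<And>j. j \<ge> 1 \<Longrightarrow> a \<noteq> Poly_Mapping.single j (Suc 0)" for a
  proof -
    have "cycle_type K (fst s) \<noteq> a" if "s \<in> conn_maps False K" "finite K" for K s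
    proof -
      have "K \<noteq> {}" using that by (simp add: conn_maps_def)
      then have "card K \<ge> 1" using that by (simp add: Suc_le_eq card_gt_0_iff)
      then show ?thesis using cycle_type_conn_False[OF that] \<open>\<And>j. j \<ge> 1 \<Longrightarrow> a \<noteq> Poly_Mapping.single j (Suc 0)\<close>[of "card K"] by simp
    qed
    then have "conn_total {..<mono_degree a} a = 0" unfolding conn_total_def by (intro sum.neutral) auto
    then show ?thesis by (simp add: conn_egf_def)
  qed
  define t where "t = (\<lambda>j m. x j ^ m / (fact m * of_nat j ^ m))"
  define q where "q = (\<lambda>v. \<Prod>j\<in>Poly_Mapping.keys v. t j (Poly_Mapping.lookup v j))"
  have q_super: "q v = (\<Prod>j\<in>S. t j (Poly_Mapping.lookup v j))" if "finite S" "Poly_Mapping.keys v \<subseteq> S" for v S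
    unfolding q_def using that by (intro prod.mono_neutral_left) (auto simp: in_keys_iff t_def)
  have "egf v = q v" using v
  proof (induction "mono_size v" arbitrary: v rule: less_induct)
    case less
    let ?K = "Poly_Mapping.keys v" and ?e = "\<lambda>j. Poly_Mapping.single j (Suc 0)"
    show ?case
    proof (cases "v = 0")
      case True
      then show ?thesis using egf_0 by (simp add: q_def)
    next
      case False
      have add: "?e j + (v - ?e j) = v" if "j \<in> ?K" for j
        using that by (intro poly_mapping_eqI) (auto simp: lookup_add lookup_minus lookup_single when_def in_keys_iff)
      have lk: "Poly_Mapping.lookup (v - ?e j) i = (if i = j then Poly_Mapping.lookup v j - 1 else Poly_Mapping.lookup v i)" for i j
        by (simp add: lookup_minus lookup_single when_def)
      \<comment> \<open>Lowering the exponent of one variable acts on the product as a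
        multiplication. Summed over \<open>j\<close>, this is the recursion.\<close>
      have q_step: "x j * q (v - ?e j) = of_nat (j * Poly_Mapping.lookup v j) * q v" if j: "j \<in> ?K" for j
      proof -
        have sub: "Poly_Mapping.keys (v - ?e j) \<subseteq> ?K" by (auto simp: in_keys_iff lk split: if_splits)
        have j0: "j \<noteq> 0" using j less.prems by auto
        obtain m where m: "Poly_Mapping.lookup v j = Suc m" using j by (cases "Poly_Mapping.lookup v j") (auto simp: in_keys_iff)
        let ?P = "\<Prod>i\<in>?K - {j}. t i (Poly_Mapping.lookup v i)"
        have "q v = t j (Suc m) * ?P" using prod.remove[of ?K j "\<lambda>i. t i (Poly_Mapping.lookup v i)"] j m by (simp add: q_def)
        moreover have "q (v - ?e j) = t j m * ?P"
          using q_super[OF _ sub] prod.remove[of ?K j "\<lambda>i. t i (Poly_Mapping.lookup (v - ?e j) i)"] j m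
          by (simp add: lk)
        moreover have "x j * t j m = of_nat (j * Suc m) * t j (Suc m)"
        proof -
          have "of_nat (Suc m) \<noteq> (0 :: complex)" "of_nat j \<noteq> (0 :: complex)" using j0 by (simp_all del: of_nat_Suc)
          then show ?thesis by (simp add: t_def divide_simps del: of_nat_Suc) (simp add: algebra_simps)
        qed
        ultimately show ?thesis using m by (simp add: mult.assoc[symmetric])
      qed
      have "of_nat (mono_degree v) * egf v = (\<Sum>(a, b) | a + b = v. of_nat (mono_degree a) * conn_egf a * egf b)"
        by (rule egf_recursion)
      \<comment> \<open>Connected structures have a single cycle, so only splittings whose first
        part is one variable survive.\<close>
      also have "\<dots> = (\<Sum>(a, b)\<in>(\<lambda>j. (?e j, v - ?e j)) ` ?K. of_nat (mono_degree a) * conn_egf a * egf b)"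
      proof (rule sum.mono_neutral_right)
        show "finite {(a, b). a + b = v}" by (rule finite_splittings)
        show "(\<lambda>j. (?e j, v - ?e j)) ` ?K \<subseteq> {(a, b). a + b = v}" using add by auto
        show "\<forall>z\<in>{(a, b). a + b = v} - (\<lambda>j. (?e j, v - ?e j)) ` ?K. (case z of (a, b) \<Rightarrow> of_nat (mono_degree a) * conn_egf a * egf b) = 0"
        proof
          fix z assume z: "z \<in> {(a, b). a + b = v} - (\<lambda>j. (?e j, v - ?e j)) ` ?K"
          obtain a b where ab: "z = (a, b)" by (cases z)
          have "conn_egf a = 0"
          proof (rule c0, rule notI)
            fix j :: nat assume "j \<ge> 1" and a: "a = ?e j"
            have "v = ?e j + b" using z ab a by auto
            then have "j \<in> ?K" "b = v - ?e j" by (auto simp: in_keys_iff lookup_add lookup_single)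
            then show False using z ab a by auto
          qed
          then show "(case z of (a, b) \<Rightarrow> of_nat (mono_degree a) * conn_egf a * egf b) = 0" by (simp add: ab)
        qed
      qed
      also have "\<dots> = (\<Sum>j\<in>?K. of_nat j * conn_egf (?e j) * egf (v - ?e j))"
      proof (subst sum.reindex)
        show "inj_on (\<lambda>j. (?e j, v - ?e j)) ?K"
          by (rule inj_onI) (metis mono_degree_single prod.inject)
      qed (simp add: mono_degree_single)
      also have "\<dots> = (\<Sum>j\<in>?K. of_nat (j * Poly_Mapping.lookup v j) * q v)"
      proof (rule sum.cong[OF refl])
        fix j assume j: "j \<in> ?K"
        then have j1: "j \<ge> 1" using less.prems by auto
        have "mono_size (v - ?e j) < mono_size v"
          using mono_size_add[of "?e j" "v - ?e j"] add[OF j] by (simp add: mono_size_def)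
        moreover have "Poly_Mapping.keys (v - ?e j) \<subseteq> {3..}"
          using less.prems by (auto simp: in_keys_iff lk subset_iff split: if_splits)
        ultimately have "egf (v - ?e j) = q (v - ?e j)" by (rule less.hyps)
        then show "of_nat j * conn_egf (?e j) * egf (v - ?e j) = of_nat (j * Poly_Mapping.lookup v j) * q v"
          using cs[OF j1] j1 q_step[OF j] by simp
      qed
      also have "\<dots> = of_nat (mono_degree v) * q v"
        by (simp add: mono_degree_def sum_distrib_right)
      finally have "of_nat (mono_degree v) * egf v = of_nat (mono_degree v) * q v" .
      moreover have "mono_degree v \<noteq> 0" using mono_degree_eq_0[OF less.prems] False by blast
      ultimately show ?thesis by simp
    qed
  qed
  then show ?thesis by (simp add: q_def t_def)
qed

text \<open>The factor of a half-edge sees the labels at \<open>\<sigma> h\<close>,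
  \<open>h\<close>, \<open>\<sigma> (\<alpha> h)\<close> and \<open>\<alpha> h\<close>, in this
  order. The integrand uses the first two; the edge condition uses all four.\<close>

definition local_weight :: "('g \<Rightarrow> 'g \<Rightarrow> 'g \<Rightarrow> 'g \<Rightarrow> complex) \<Rightarrow> 'g set \<Rightarrow> 'a set \<Rightarrow> ('a \<Rightarrow> 'a) \<times> ('a \<Rightarrow> 'a) \<Rightarrow> complex" where
  "local_weight \<phi> \<Gamma> H s = (\<Sum>B\<in>H \<rightarrow>\<^sub>E \<Gamma>. \<Prod>h\<in>H. \<phi> (B (fst s h)) (B h) (B (fst s (snd s h))) (B (snd s h)))"

lemma bij_betw_restrict_PiE:
  assumes f: "bij_betw f A B"
  shows "bij_betw (\<lambda>L. \<lambda>a\<in>A. L (f a)) (B \<rightarrow>\<^sub>E \<Gamma>) (A \<rightarrow>\<^sub>E \<Gamma>)"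
proof -
  have inj: "inj_on f A" and B: "B = f ` A" using f by (auto simp: bij_betw_def)
  let ?g = "inv_into A f"
  show ?thesis
  proof (rule bij_betw_byWitness[where f' = "\<lambda>L. \<lambda>c\<in>B. L (?g c)"])
    show "\<forall>L\<in>B \<rightarrow>\<^sub>E \<Gamma>. (\<lambda>c\<in>B. (\<lambda>a\<in>A. L (f a)) (?g c)) = L"
      using f by (auto simp: fun_eq_iff PiE_def extensional_def bij_betw_inv_into_right B inv_into_into f_inv_into_f)
    show "\<forall>L\<in>A \<rightarrow>\<^sub>E \<Gamma>. (\<lambda>a\<in>A. (\<lambda>c\<in>B. L (?g c)) (f a)) = L"
      using inj by (auto simp: fun_eq_iff PiE_def extensional_def B)
    show "(\<lambda>L. \<lambda>a\<in>A. L (f a)) ` (B \<rightarrow>\<^sub>E \<Gamma>) \<subseteq> A \<rightarrow>\<^sub>E \<Gamma>" by (auto simp: B)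
    show "(\<lambda>L. \<lambda>c\<in>B. L (?g c)) ` (A \<rightarrow>\<^sub>E \<Gamma>) \<subseteq> B \<rightarrow>\<^sub>E \<Gamma>"
      using inv_into_into[of _ f A] by (auto simp: B PiE_def Pi_def)
  qed
qed

lemma local_weight_relabel:
  assumes f: "bij_betw f A B" and s: "s \<in> maps b A"
  shows "local_weight \<phi> \<Gamma> B (relabel A f s) = local_weight \<phi> \<Gamma> A s"
proof -
  have inj: "inj_on f A" and B: "B = f ` A" using f by (auto simp: bij_betw_def)
  have sA: "fst s a \<in> A" "snd s a \<in> A" if "a \<in> A" for a
    using that permutes_in_image[OF mapsD(1)[OF s]] permutes_in_image[OF mapsD(2)[OF s]] by auto
  from sum.reindex_bij_betw[OF bij_betw_restrict_PiE[OF f], of "\<lambda>L. \<Prod>h\<in>A. \<phi> (L (fst s h)) (L h) (L (fst s (snd s h))) (L (snd s h))"]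
  have "local_weight \<phi> \<Gamma> A s = (\<Sum>L\<in>B \<rightarrow>\<^sub>E \<Gamma>. \<Prod>h\<in>A. \<phi> (L (f (fst s h))) (L (f h)) (L (f (fst s (snd s h)))) (L (f (snd s h))))"
    unfolding local_weight_def using sA by simp
  also have "\<dots> = local_weight \<phi> \<Gamma> B (relabel A f s)"
    unfolding local_weight_def
  proof (rule sum.cong[OF refl])
    fix L
    show "(\<Prod>h\<in>A. \<phi> (L (f (fst s h))) (L (f h)) (L (f (fst s (snd s h)))) (L (f (snd s h)))) =
        (\<Prod>h\<in>B. \<phi> (L (fst (relabel A f s) h)) (L h) (L (fst (relabel A f s) (snd (relabel A f s) h))) (L (snd (relabel A f s) h)))"
      unfolding prod.reindex_bij_betw[OF f, symmetric]
      by (rule prod.cong) (simp_all add: relabel_apply[OF inj] sA)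
  qed
  finally show ?thesis by simp
qed

text \<open>A labelling of the union is a pair of labellings, and each factor involves labels of its
  own part only.\<close>

lemma local_weight_join:
  assumes fin: "finite K" "finite R" "finite \<Gamma>" and KR: "K \<inter> R = {}" and c: "c \<in> maps b K" and r: "r \<in> maps b R"
  shows "local_weight \<phi> \<Gamma> (K \<union> R) (join_maps c r) = local_weight \<phi> \<Gamma> K c * local_weight \<phi> \<Gamma> R r"
proof -
  let ?s = "join_maps c r"
  note J = join_apply[OF c r KR]
  have cK: "fst c a \<in> K" "snd c a \<in> K" if "a \<in> K" for a
    using that permutes_in_image[OF mapsD(1)[OF c]] permutes_in_image[OF mapsD(2)[OF c]] by auto
  have rR: "fst r a \<in> R" "snd r a \<in> R" if "a \<in> R" for a
    using that permutes_in_image[OF mapsD(1)[OF r]] permutes_in_image[OF mapsD(2)[OF r]] by auto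
  let ?p = "\<lambda>s L h. \<phi> (L (fst s h)) (L h) (L (fst s (snd s h))) (L (snd s h))"
  have "local_weight \<phi> \<Gamma> (K \<union> R) ?s =
      (\<Sum>(L, M)\<in>(K \<rightarrow>\<^sub>E \<Gamma>) \<times> (R \<rightarrow>\<^sub>E \<Gamma>). (\<Prod>h\<in>K. ?p c L h) * (\<Prod>h\<in>R. ?p r M h))"
    unfolding local_weight_def
  proof (rule sum.reindex_bij_witness[where j = "\<lambda>L. (restrict L K, restrict L R)" and i = "\<lambda>(L, M). \<lambda>h\<in>K \<union> R. if h \<in> K then L h else M h"])
    fix L assume L: "L \<in> K \<union> R \<rightarrow>\<^sub>E \<Gamma>"
    show "(case (restrict L K, restrict L R) of (L, M) \<Rightarrow> \<lambda>h\<in>K \<union> R. if h \<in> K then L h else M h) = L"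
      using L by (auto simp: fun_eq_iff PiE_def extensional_def)
    show "(restrict L K, restrict L R) \<in> (K \<rightarrow>\<^sub>E \<Gamma>) \<times> (R \<rightarrow>\<^sub>E \<Gamma>)" using L by auto
    have "(\<Prod>h\<in>K \<union> R. ?p ?s L h) = (\<Prod>h\<in>K. ?p ?s L h) * (\<Prod>h\<in>R. ?p ?s L h)"
      using fin KR by (intro prod.union_disjoint)
    also have "(\<Prod>h\<in>K. ?p ?s L h) = (\<Prod>h\<in>K. ?p c (restrict L K) h)"
      by (rule prod.cong) (simp_all add: J cK)
    also have "(\<Prod>h\<in>R. ?p ?s L h) = (\<Prod>h\<in>R. ?p r (restrict L R) h)"
      by (rule prod.cong) (simp_all add: J rR)
    finally show "(case (restrict L K, restrict L R) of (L, M) \<Rightarrow> (\<Prod>h\<in>K. ?p c L h) * (\<Prod>h\<in>R. ?p r M h)) = (\<Prod>h\<in>K \<union> R. ?p ?s L h)"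
      by simp
  next
    fix z assume "z \<in> (K \<rightarrow>\<^sub>E \<Gamma>) \<times> (R \<rightarrow>\<^sub>E \<Gamma>)"
    then obtain L M where z: "z = (L, M)" "L \<in> K \<rightarrow>\<^sub>E \<Gamma>" "M \<in> R \<rightarrow>\<^sub>E \<Gamma>" by auto
    have nK: "h \<notin> K" if "h \<in> R" for h using that KR by blast
    show "(case z of (L, M) \<Rightarrow> \<lambda>h\<in>K \<union> R. if h \<in> K then L h else M h) \<in> K \<union> R \<rightarrow>\<^sub>E \<Gamma>" using z by auto
    show "(restrict (case z of (L, M) \<Rightarrow> \<lambda>h\<in>K \<union> R. if h \<in> K then L h else M h) K,
        restrict (case z of (L, M) \<Rightarrow> \<lambda>h\<in>K \<union> R. if h \<in> K then L h else M h) R) = z"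
      using z nK by (auto simp: fun_eq_iff PiE_def extensional_def)
  qed
  then show ?thesis by (simp add: local_weight_def sum_product sum.cartesian_product)
qed

lemma map_weight_local: "finite \<Gamma> \<Longrightarrow> map_weight b (local_weight \<phi> \<Gamma>)"
proof (unfold_locales, goal_cases)
  case (1 s) then show ?case by (simp add: local_weight_def)
next
  case (2 K R c r) then show ?case by (intro local_weight_join)
next
  case (3 A f B s) then show ?case by (intro local_weight_relabel)
qed

lemma sum_PiE_insert:
  assumes "h \<notin> H"
  shows "(\<Sum>p\<in>insert h H \<rightarrow>\<^sub>E \<Gamma>. f p) = (\<Sum>\<gamma>\<in>\<Gamma>. \<Sum>p\<in>H \<rightarrow>\<^sub>E \<Gamma>. f (p(h := \<gamma>)))"
  unfolding PiE_insert_eq using sum.reindex[OF inj_combinator[OF assms, of "\<lambda>_. \<Gamma>"], of f]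
  by (simp add: sum.cartesian_product case_prod_unfold)

section \<open>Gaussian integrals\<close>

text \<open>The moments of the centred normal law with variance \<open>1 / N\<close>.\<close>

definition moment :: "real \<Rightarrow> nat \<Rightarrow> real" where
  "moment N k = (if even k then fact k / ((2 * N) ^ (k div 2) * fact (k div 2)) else 0)"

lemma moment_0: "moment N 0 = 1" "moment N (Suc 0) = 0"
  by (simp_all add: moment_def)

text \<open>Wick's theorem in one variable: one of the factors has \<open>Suc k\<close> possible
  partners, each contributing the variance.\<close>

lemma moment_Suc_Suc:
  assumes "N > 0"
  shows "moment N (Suc (Suc k)) = real (Suc k) / N * moment N k"
proof (cases "even k")
  case True
  then obtain m where m: "k = 2 * m" by (elim evenE)
  have "(fact (Suc (Suc (2 * m))) :: real) = 2 * real (Suc m) * real (Suc (2 * m)) * fact (2 * m)"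
    by (simp add: algebra_simps)
  moreover have "(fact (Suc m) :: real) = real (Suc m) * fact m" by simp
  moreover have "real (Suc m) \<noteq> 0" by simp
  ultimately show ?thesis using assms
    by (simp add: moment_def m del: fact_Suc of_nat_Suc)
qed (simp add: moment_def)

lemma gaussian_moment:
  assumes N: "N > 0"
  shows "has_bochner_integral lborel (\<lambda>t. complex_of_real (exp (- N * t\<^sup>2 / 2)) * of_real t ^ k)
    (of_real (sqrt (2 * pi / N) * moment N k))"
proof -
  let ?\<sigma> = "1 / sqrt N"
  have \<sigma>: "0 < ?\<sigma>" "?\<sigma>\<^sup>2 = 1 / N" using N by (simp_all add: power_divide)
  have "has_bochner_integral lborel (\<lambda>x. normal_density 0 ?\<sigma> x * x ^ k) (moment N k)"
  proof (cases "even k")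
    case True
    then obtain m where "k = 2 * m" by (elim evenE)
    then show ?thesis using normal_moment_even[OF \<sigma>(1), of 0 m] \<sigma>(2) by (simp add: moment_def)
  next
    case False
    then obtain m where "k = 2 * m + 1" by (elim oddE)
    then show ?thesis using normal_moment_odd[OF \<sigma>(1), of 0 m] by (simp add: moment_def)
  qed
  from has_bochner_integral_mult_right[OF this, of "sqrt (2 * pi / N)"]
  have "has_bochner_integral lborel (\<lambda>x. sqrt (2 * pi / N) * (normal_density 0 ?\<sigma> x * x ^ k)) (sqrt (2 * pi / N) * moment N k)"
    by simp
  from has_bochner_integral_of_real[OF this, where 'a = complex]
  have "has_bochner_integral lborel (\<lambda>x. complex_of_real (sqrt (2 * pi / N) * (normal_density 0 ?\<sigma> x * x ^ k)))
    (of_real (sqrt (2 * pi / N) * moment N k))" .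
  moreover have "sqrt (2 * pi / N) * normal_density 0 ?\<sigma> x = exp (- N * x\<^sup>2 / 2)" for x
    using N unfolding normal_density_def \<sigma>(2) by (simp add: mult.commute)
  then have "complex_of_real (sqrt (2 * pi / N) * (normal_density 0 ?\<sigma> x * x ^ k)) =
      complex_of_real (exp (- N * x\<^sup>2 / 2)) * of_real x ^ k" for x
    by (simp only: mult.assoc[symmetric] of_real_mult of_real_power)
  ultimately show ?thesis by (simp only:)
qed

definition gauss_density :: "real \<Rightarrow> 'c set \<Rightarrow> ('c \<Rightarrow> real) \<Rightarrow> complex" where
  "gauss_density N \<Gamma> c = (\<Prod>\<gamma>\<in>\<Gamma>. of_real (exp (- N * (c \<gamma>)\<^sup>2 / 2)))"

text \<open>The normalized mean of the monomial that contains the coordinate \<open>p h\<close> once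
  for each \<open>h\<close>. The coordinates are independent, and their exponents are the fibre
  sizes of \<open>p\<close>.\<close>

definition gauss_mean :: "real \<Rightarrow> 'c set \<Rightarrow> ('h \<Rightarrow> 'c) \<Rightarrow> 'h set \<Rightarrow> real" where
  "gauss_mean N \<Gamma> p H = (\<Prod>\<gamma>\<in>\<Gamma>. moment N (card {h \<in> H. p h = \<gamma>}))"

lemma gaussian_monomial:
  assumes N: "N > 0" and \<Gamma>: "finite \<Gamma>" and H: "finite H" and p: "p ` H \<subseteq> \<Gamma>"
  shows "has_bochner_integral (\<Pi>\<^sub>M \<gamma>\<in>\<Gamma>. lborel) (\<lambda>c. gauss_density N \<Gamma> c * (\<Prod>h\<in>H. of_real (c (p h))))
    (of_real (sqrt (2 * pi / N) ^ card \<Gamma> * gauss_mean N \<Gamma> p H))"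
proof -
  interpret product_sigma_finite "\<lambda>_ :: 'a. lborel :: real measure" by standard
  let ?f = "\<lambda>\<gamma> t. complex_of_real (exp (- N * t\<^sup>2 / 2)) * of_real t ^ card {h \<in> H. p h = \<gamma>}"
  note m = gaussian_moment[OF N]
  have "(\<Prod>h\<in>H. complex_of_real (c (p h))) = (\<Prod>\<gamma>\<in>\<Gamma>. of_real (c \<gamma>) ^ card {h \<in> H. p h = \<gamma>})" for c
    using prod.group[OF H \<Gamma> p, of "\<lambda>h. complex_of_real (c (p h))"] by simp
  then have eq: "gauss_density N \<Gamma> c * (\<Prod>h\<in>H. of_real (c (p h))) = (\<Prod>\<gamma>\<in>\<Gamma>. ?f \<gamma> (c \<gamma>))" for c
    by (simp add: gauss_density_def prod.distrib)
  have int: "integrable lborel (?f \<gamma>)" for \<gamma> using m by (rule integrable.intros)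
  have "integrable (\<Pi>\<^sub>M \<gamma>\<in>\<Gamma>. lborel) (\<lambda>c. \<Prod>\<gamma>\<in>\<Gamma>. ?f \<gamma> (c \<gamma>))"
    by (rule product_integrable_prod[OF \<Gamma> int])
  moreover have "(LINT c|(\<Pi>\<^sub>M \<gamma>\<in>\<Gamma>. lborel). (\<Prod>\<gamma>\<in>\<Gamma>. ?f \<gamma> (c \<gamma>))) = (\<Prod>\<gamma>\<in>\<Gamma>. integral\<^sup>L lborel (?f \<gamma>))"
    by (rule product_integral_prod[OF \<Gamma> int])
  moreover have "(\<Prod>\<gamma>\<in>\<Gamma>. integral\<^sup>L lborel (?f \<gamma>)) = of_real (sqrt (2 * pi / N) ^ card \<Gamma> * gauss_mean N \<Gamma> p H)"
    using has_bochner_integral_integral_eq[OF m] by (simp add: gauss_mean_def prod.distrib)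
  ultimately show ?thesis unfolding eq has_bochner_integral_iff by simp
qed

text \<open>Only the coordinate \<open>p h\<close> changes its exponent. The factor that the
  recursion of the moments produces is the number of the other factors in the same coordinate, and
  is read as a sum over the partner of \<open>h\<close>.\<close>

lemma gauss_mean_insert:
  assumes N: "N > 0" and \<Gamma>: "finite \<Gamma>" and H: "finite H" and h: "h \<notin> H" and p: "p ` insert h H \<subseteq> \<Gamma>"
  shows "gauss_mean N \<Gamma> p (insert h H) = (\<Sum>k | k \<in> H \<and> p k = p h. gauss_mean N \<Gamma> p (H - {k}) / N)"
proof -
  let ?c = "\<lambda>H \<gamma>. card {k \<in> H. p k = \<gamma>}"
  let ?M = "\<lambda>K. \<Prod>\<gamma>\<in>\<Gamma> - {p h}. moment N (?c K \<gamma>)"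
  have split: "gauss_mean N \<Gamma> p K = moment N (?c K (p h)) * ?M K" for K
    unfolding gauss_mean_def using prod.remove[OF \<Gamma>, of "p h" "\<lambda>\<gamma>. moment N (?c K \<gamma>)"] p by simp
  have M: "?M (insert h H) = ?M H"
  proof (rule prod.cong[OF refl])
    fix \<gamma> assume "\<gamma> \<in> \<Gamma> - {p h}"
    then have "{k \<in> insert h H. p k = \<gamma>} = {k \<in> H. p k = \<gamma>}" by auto
    then show "moment N (?c (insert h H) \<gamma>) = moment N (?c H \<gamma>)" by simp
  qed
  have "{k \<in> insert h H. p k = p h} = insert h {k \<in> H. p k = p h}" by auto
  then have ch: "?c (insert h H) (p h) = Suc (?c H (p h))" using H h by simp
  have mean: "gauss_mean N \<Gamma> p (H - {k}) = moment N (?c H (p h) - 1) * ?M H" if k: "k \<in> {k. k \<in> H \<and> p k = p h}" for k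
  proof -
    have "?M (H - {k}) = ?M H"
    proof (rule prod.cong[OF refl])
      fix \<gamma> assume "\<gamma> \<in> \<Gamma> - {p h}"
      then have "{k' \<in> H - {k}. p k' = \<gamma>} = {k \<in> H. p k = \<gamma>}" using k by auto
      then show "moment N (?c (H - {k}) \<gamma>) = moment N (?c H \<gamma>)" by simp
    qed
    moreover have "{k' \<in> H - {k}. p k' = p h} = {k \<in> H. p k = p h} - {k}" by auto
    then have "?c (H - {k}) (p h) = ?c H (p h) - 1" using k by simp
    ultimately show ?thesis using split[of "H - {k}"] by simp
  qed
  have "(\<Sum>k | k \<in> H \<and> p k = p h. gauss_mean N \<Gamma> p (H - {k}) / N) =
      real (?c H (p h)) * (moment N (?c H (p h) - 1) * ?M H / N)"
    by (simp add: mean)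
  also have "\<dots> = moment N (Suc (?c H (p h))) * ?M H"
    using moment_Suc_Suc[OF N] moment_0(2) by (cases "?c H (p h)") simp_all
  finally show ?thesis unfolding split[of "insert h H"] ch M by simp
qed

definition linear_mean :: "real \<Rightarrow> 'c set \<Rightarrow> ('h \<Rightarrow> 'c \<Rightarrow> complex) \<Rightarrow> 'h set \<Rightarrow> complex" where
  "linear_mean N \<Gamma> a H = (\<Sum>p\<in>H \<rightarrow>\<^sub>E \<Gamma>. (\<Prod>h\<in>H. a h (p h)) * of_real (gauss_mean N \<Gamma> p H))"

lemma gaussian_linear_forms:
  assumes N: "N > 0" and \<Gamma>: "finite \<Gamma>" and H: "finite H"
  shows "has_bochner_integral (\<Pi>\<^sub>M \<gamma>\<in>\<Gamma>. lborel) (\<lambda>c. gauss_density N \<Gamma> c * (\<Prod>h\<in>H. \<Sum>\<gamma>\<in>\<Gamma>. a h \<gamma> * of_real (c \<gamma>)))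
    (of_real (sqrt (2 * pi / N) ^ card \<Gamma>) * linear_mean N \<Gamma> a H)"
proof -
  have "gauss_density N \<Gamma> c * (\<Prod>h\<in>H. \<Sum>\<gamma>\<in>\<Gamma>. a h \<gamma> * of_real (c \<gamma>)) =
      (\<Sum>p\<in>H \<rightarrow>\<^sub>E \<Gamma>. (\<Prod>h\<in>H. a h (p h)) * (gauss_density N \<Gamma> c * (\<Prod>h\<in>H. of_real (c (p h)))))" for c
    using H \<Gamma> by (simp add: prod_sum_PiE sum_distrib_left prod.distrib mult_ac)
  moreover have "of_real (sqrt (2 * pi / N) ^ card \<Gamma>) * linear_mean N \<Gamma> a H =
      (\<Sum>p\<in>H \<rightarrow>\<^sub>E \<Gamma>. (\<Prod>h\<in>H. a h (p h)) * of_real (sqrt (2 * pi / N) ^ card \<Gamma> * gauss_mean N \<Gamma> p H))"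
    by (simp add: linear_mean_def sum_distrib_left mult_ac)
  moreover have "has_bochner_integral (\<Pi>\<^sub>M \<gamma>\<in>\<Gamma>. lborel)
      (\<lambda>c. \<Sum>p\<in>H \<rightarrow>\<^sub>E \<Gamma>. (\<Prod>h\<in>H. a h (p h)) * (gauss_density N \<Gamma> c * (\<Prod>h\<in>H. of_real (c (p h)))))
      (\<Sum>p\<in>H \<rightarrow>\<^sub>E \<Gamma>. (\<Prod>h\<in>H. a h (p h)) * of_real (sqrt (2 * pi / N) ^ card \<Gamma> * gauss_mean N \<Gamma> p H))"
    by (intro has_bochner_integral_sum has_bochner_integral_mult_right gaussian_monomial N \<Gamma> H) auto
  ultimately show ?thesis by simp
qed

text \<open>The pairing rule for coordinates extends to linear forms by multilinearity; summing over
  the common coordinate of \<open>h\<close> and its partner \<open>k\<close> produces the covariance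
  of the two forms.\<close>

lemma linear_mean_insert:
  assumes N: "N > 0" and \<Gamma>: "finite \<Gamma>" and H: "finite H" and h: "h \<notin> H"
  shows "linear_mean N \<Gamma> a (insert h H) =
    (\<Sum>k\<in>H. (\<Sum>\<gamma>\<in>\<Gamma>. a h \<gamma> * a k \<gamma>) / of_real N * linear_mean N \<Gamma> a (H - {k}))"
proof -
  have mean_cong: "gauss_mean N \<Gamma> p K = gauss_mean N \<Gamma> q K" if "\<And>h. h \<in> K \<Longrightarrow> p h = q h" for p q and K :: "'b set"
  proof -
    have "{h \<in> K. p h = \<gamma>} = {h \<in> K. q h = \<gamma>}" for \<gamma> using that by auto
    then show ?thesis by (simp add: gauss_mean_def)
  qed
  have "linear_mean N \<Gamma> a (insert h H) = (\<Sum>\<gamma>\<in>\<Gamma>. \<Sum>p\<in>H \<rightarrow>\<^sub>E \<Gamma>.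
      \<Sum>k\<in>H. if p k = \<gamma> then a h \<gamma> * (\<Prod>h\<in>H. a h (p h)) * of_real (gauss_mean N \<Gamma> p (H - {k}) / N) else 0)"
    unfolding linear_mean_def sum_PiE_insert[OF h]
  proof (intro sum.cong refl)
    fix \<gamma> p assume g: "\<gamma> \<in> \<Gamma>" and p: "p \<in> H \<rightarrow>\<^sub>E \<Gamma>"
    let ?p = "p(h := \<gamma>)"
    have "(\<Prod>h\<in>H. a h (?p h)) = (\<Prod>h\<in>H. a h (p h))" using h by (intro prod.cong) auto
    then have 1: "(\<Prod>h\<in>insert h H. a h (?p h)) = a h \<gamma> * (\<Prod>h\<in>H. a h (p h))" using H h by simp
    have "gauss_mean N \<Gamma> ?p (insert h H) = (\<Sum>k | k \<in> H \<and> ?p k = ?p h. gauss_mean N \<Gamma> ?p (H - {k}) / N)"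
      using g p by (intro gauss_mean_insert N \<Gamma> H h) auto
    also have "{k. k \<in> H \<and> ?p k = ?p h} = {k \<in> H. p k = \<gamma>}" using h by auto
    also have "(\<Sum>k\<in>{k \<in> H. p k = \<gamma>}. gauss_mean N \<Gamma> ?p (H - {k}) / N) = (\<Sum>k\<in>{k \<in> H. p k = \<gamma>}. gauss_mean N \<Gamma> p (H - {k}) / N)"
      using h by (intro sum.cong refl arg_cong[where f = "\<lambda>x. x / N"] mean_cong) auto
    also have "\<dots> = (\<Sum>k\<in>H. if p k = \<gamma> then gauss_mean N \<Gamma> p (H - {k}) / N else 0)"
      by (rule sum.inter_filter[OF H])
    finally have 2: "of_real (gauss_mean N \<Gamma> ?p (insert h H)) =
        (\<Sum>k\<in>H. if p k = \<gamma> then of_real (gauss_mean N \<Gamma> p (H - {k}) / N) else (0 :: complex))"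
      by (simp only: of_real_sum if_distrib[of of_real] of_real_0)
    show "(\<Prod>h\<in>insert h H. a h (?p h)) * of_real (gauss_mean N \<Gamma> ?p (insert h H)) =
        (\<Sum>k\<in>H. if p k = \<gamma> then a h \<gamma> * (\<Prod>h\<in>H. a h (p h)) * of_real (gauss_mean N \<Gamma> p (H - {k}) / N) else 0)"
      unfolding 1 2 sum_distrib_left by (rule sum.cong) auto
  qed
  also have "\<dots> = (\<Sum>p\<in>H \<rightarrow>\<^sub>E \<Gamma>. \<Sum>k\<in>H. \<Sum>\<gamma>\<in>\<Gamma>. if p k = \<gamma> then a h \<gamma> * (\<Prod>h\<in>H. a h (p h)) * of_real (gauss_mean N \<Gamma> p (H - {k}) / N) else 0)"
    by (subst sum.swap) (intro sum.cong refl sum.swap)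
  also have "\<dots> = (\<Sum>p\<in>H \<rightarrow>\<^sub>E \<Gamma>. \<Sum>k\<in>H. a h (p k) * (\<Prod>h\<in>H. a h (p h)) * of_real (gauss_mean N \<Gamma> p (H - {k}) / N))"
    using \<Gamma> by (intro sum.cong refl) (auto simp: sum.delta' PiE_def Pi_def)
  also have "\<dots> = (\<Sum>k\<in>H. \<Sum>p\<in>H \<rightarrow>\<^sub>E \<Gamma>. a h (p k) * (\<Prod>h\<in>H. a h (p h)) * of_real (gauss_mean N \<Gamma> p (H - {k}) / N))"
    by (rule sum.swap)
  also have "\<dots> = (\<Sum>k\<in>H. (\<Sum>\<gamma>\<in>\<Gamma>. a h \<gamma> * a k \<gamma>) / of_real N * linear_mean N \<Gamma> a (H - {k}))"
  proof (rule sum.cong[OF refl])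
    fix k assume k: "k \<in> H"
    let ?K = "H - {k}"
    have "(\<Sum>p\<in>H \<rightarrow>\<^sub>E \<Gamma>. a h (p k) * (\<Prod>h\<in>H. a h (p h)) * of_real (gauss_mean N \<Gamma> p ?K / N)) =
        (\<Sum>p\<in>insert k ?K \<rightarrow>\<^sub>E \<Gamma>. a h (p k) * (a k (p k) * (\<Prod>h\<in>?K. a h (p h))) * of_real (gauss_mean N \<Gamma> p ?K / N))"
      using k by (simp add: insert_absorb prod.remove[OF H k, of "\<lambda>x. a x (_ x)"])
    also have "\<dots> = (\<Sum>\<gamma>\<in>\<Gamma>. \<Sum>p\<in>?K \<rightarrow>\<^sub>E \<Gamma>. a h \<gamma> * (a k \<gamma> * (\<Prod>h\<in>?K. a h (p h))) * of_real (gauss_mean N \<Gamma> p ?K / N))"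
    proof (subst sum_PiE_insert, simp, intro sum.cong refl)
      fix \<gamma> p
      have "(\<Prod>h\<in>?K. a h ((p(k := \<gamma>)) h)) = (\<Prod>h\<in>?K. a h (p h))" by (rule prod.cong) auto
      moreover have "gauss_mean N \<Gamma> (p(k := \<gamma>)) ?K = gauss_mean N \<Gamma> p ?K" by (rule mean_cong) auto
      ultimately show "a h ((p(k := \<gamma>)) k) * (a k ((p(k := \<gamma>)) k) * (\<Prod>h\<in>?K. a h ((p(k := \<gamma>)) h))) * of_real (gauss_mean N \<Gamma> (p(k := \<gamma>)) ?K / N) =
          a h \<gamma> * (a k \<gamma> * (\<Prod>h\<in>?K. a h (p h))) * of_real (gauss_mean N \<Gamma> p ?K / N)" by simp
    qed
    also have "\<dots> = (\<Sum>\<gamma>\<in>\<Gamma>. a h \<gamma> * a k \<gamma>) / of_real N * linear_mean N \<Gamma> a ?K"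
      by (simp add: linear_mean_def sum_product sum_divide_distrib mult_ac)
    finally show "(\<Sum>p\<in>H \<rightarrow>\<^sub>E \<Gamma>. a h (p k) * (\<Prod>h\<in>H. a h (p h)) * of_real (gauss_mean N \<Gamma> p ?K / N)) = \<dots>" .
  qed
  finally show ?thesis .
qed

text \<open>A pairing of the larger set is a partner \<open>k\<close> for \<open>h\<close> and a
  pairing of the rest. The latter fixes \<open>h\<close> and \<open>k\<close>, so composing it with
  their transposition adds exactly this edge.\<close>

lemma bij_insert_pair:
  assumes "h \<notin> H"
  shows "bij_betw (\<lambda>(k, \<alpha>). Transposition.transpose h k \<circ> \<alpha>) (SIGMA k:H. involutions True (H - {k})) (involutions True (insert h H))"
proof (rule bij_betw_byWitness[where f' = "\<lambda>\<alpha>. (\<alpha> h, Transposition.transpose h (\<alpha> h) \<circ> \<alpha>)"])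
  have fixed: "\<alpha> h = h" "\<alpha> k = k" if "\<alpha> \<in> involutions True (H - {k})" for \<alpha> k
    using that assms permutes_not_in[of \<alpha> "H - {k}"] by (auto simp: involutions_def)
  have mem: "\<alpha> x \<in> H - {k} \<longleftrightarrow> x \<in> H - {k}" if "\<alpha> \<in> involutions True (H - {k})" for \<alpha> k x
    using that permutes_in_image[of \<alpha> "H - {k}" x] by (auto simp: involutions_def)
  show "\<forall>z\<in>SIGMA k:H. involutions True (H - {k}). ((case z of (k, \<alpha>) \<Rightarrow> Transposition.transpose h k \<circ> \<alpha>) h,
      Transposition.transpose h ((case z of (k, \<alpha>) \<Rightarrow> Transposition.transpose h k \<circ> \<alpha>) h) \<circ> (case z of (k, \<alpha>) \<Rightarrow> Transposition.transpose h k \<circ> \<alpha>)) = z"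
  proof
    fix z assume z: "z \<in> (SIGMA k:H. involutions True (H - {k}))"
    obtain k \<alpha> where k: "z = (k, \<alpha>)" "\<alpha> h = h" using z fixed(1) by (cases z) auto
    then show "((case z of (k, \<alpha>) \<Rightarrow> Transposition.transpose h k \<circ> \<alpha>) h,
        Transposition.transpose h ((case z of (k, \<alpha>) \<Rightarrow> Transposition.transpose h k \<circ> \<alpha>) h) \<circ> (case z of (k, \<alpha>) \<Rightarrow> Transposition.transpose h k \<circ> \<alpha>)) = z"
      by (simp add: fun_eq_iff)
  qed
  show "\<forall>\<alpha>\<in>involutions True (insert h H). (case (\<alpha> h, Transposition.transpose h (\<alpha> h) \<circ> \<alpha>) of (k, \<alpha>) \<Rightarrow> Transposition.transpose h k \<circ> \<alpha>) = \<alpha>"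
    by (auto simp: o_def Transposition.transpose_involutory)
  show "(\<lambda>(k, \<alpha>). Transposition.transpose h k \<circ> \<alpha>) ` (SIGMA k:H. involutions True (H - {k})) \<subseteq> involutions True (insert h H)"
  proof
    fix \<beta> assume "\<beta> \<in> (\<lambda>(k, \<alpha>). Transposition.transpose h k \<circ> \<alpha>) ` (SIGMA k:H. involutions True (H - {k}))"
    then obtain k \<alpha> where k: "k \<in> H" and \<alpha>: "\<alpha> \<in> involutions True (H - {k})" and \<beta>: "\<beta> = Transposition.transpose h k \<circ> \<alpha>" by auto
    have hk: "h \<noteq> k" using k assms by auto
    have perm: "\<beta> permutes insert h H" unfolding \<beta>
      using \<alpha> k by (intro permutes_compose permutes_swap_id) (auto simp: involutions_def intro: permutes_subset)
    have val: "\<beta> x = (if x = h then k else if x = k then h else \<alpha> x)" for x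
    proof (cases "x \<in> H - {k}")
      case True
      then have "\<alpha> x \<in> H - {k}" using mem[OF \<alpha>] by simp
      then show ?thesis using True assms hk by (auto simp: \<beta> Transposition.transpose_def)
    next
      case False
      then have "\<alpha> x = x" using \<alpha> permutes_not_in[of \<alpha> "H - {k}" x] by (simp add: involutions_def)
      then show ?thesis by (simp add: \<beta> Transposition.transpose_def)
    qed
    have inv: "\<alpha> (\<alpha> x) = x" "x \<in> H - {k} \<Longrightarrow> \<alpha> x \<noteq> x" for x using \<alpha> by (auto simp: involutions_def)
    have "\<alpha> x \<noteq> h" "\<alpha> x \<noteq> k" if "x \<noteq> h" "x \<noteq> k" for x using fixed[OF \<alpha>] inv(1) that by metis+
    then have "\<beta> (\<beta> x) = x" for x using inv(1) hk by (simp add: val)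
    moreover have "\<beta> x \<noteq> x" if "x \<in> insert h H" for x using that inv(2) hk by (auto simp: val)
    ultimately show "\<beta> \<in> involutions True (insert h H)" using perm by (simp add: involutions_def)
  qed
  show "(\<lambda>\<alpha>. (\<alpha> h, Transposition.transpose h (\<alpha> h) \<circ> \<alpha>)) ` involutions True (insert h H) \<subseteq> (SIGMA k:H. involutions True (H - {k}))"
  proof
    fix z assume "z \<in> (\<lambda>\<alpha>. (\<alpha> h, Transposition.transpose h (\<alpha> h) \<circ> \<alpha>)) ` involutions True (insert h H)"
    then obtain \<alpha> where \<alpha>: "\<alpha> \<in> involutions True (insert h H)" and z: "z = (\<alpha> h, Transposition.transpose h (\<alpha> h) \<circ> \<alpha>)" by auto
    let ?k = "\<alpha> h" and ?\<beta> = "Transposition.transpose h (\<alpha> h) \<circ> \<alpha>"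
    have perm: "\<alpha> permutes insert h H" and inv: "\<alpha> (\<alpha> x) = x" "x \<in> insert h H \<Longrightarrow> \<alpha> x \<noteq> x" for x
      using \<alpha> by (auto simp: involutions_def)
    have k: "?k \<in> H" using permutes_in_image[OF perm, of h] inv(2)[of h] by auto
    have ne: "\<alpha> x \<noteq> h" "\<alpha> x \<noteq> ?k" if "x \<noteq> h" "x \<noteq> ?k" for x using inv(1) that by metis+
    have val: "?\<beta> x = (if x = h \<or> x = ?k then x else \<alpha> x)" for x
      using ne[of x] inv(1)[of h] by (auto simp: Transposition.transpose_def)
    have "?\<beta> (?\<beta> x) = x" for x using ne[of x] inv(1)[of x] unfolding val by auto
    moreover have "?\<beta> x = x" if "x \<notin> H - {?k}" for x using that permutes_not_in[OF perm, of x] unfolding val by auto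
    ultimately have "?\<beta> permutes (H - {?k})" unfolding permutes_def by metis
    moreover have "?\<beta> x \<noteq> x" if "x \<in> H - {?k}" for x using that inv(2)[of x] assms unfolding val by auto
    ultimately have "?\<beta> \<in> involutions True (H - {?k})" using \<open>\<And>x. ?\<beta> (?\<beta> x) = x\<close> by (simp add: involutions_def)
    then show "z \<in> (SIGMA k:H. involutions True (H - {k}))" using k z by simp
  qed
qed

text \<open>The product runs over half-edges, so every edge contributes
  \<open>q h k * q k h\<close>. This spares the choice of one half-edge per edge and fits weights
  that are local at half-edges.\<close>

definition matching_sum :: "('h \<Rightarrow> 'h \<Rightarrow> complex) \<Rightarrow> 'h set \<Rightarrow> complex" where
  "matching_sum q H = (\<Sum>\<alpha>\<in>involutions True H. \<Prod>h\<in>H. q h (\<alpha> h))"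

lemma matching_sum_empty:
  fixes q :: "'h \<Rightarrow> 'h \<Rightarrow> complex"
  shows "matching_sum q {} = 1"
proof -
  have "involutions True ({} :: 'h set) = {id}" by (auto simp: involutions_def)
  then show ?thesis unfolding matching_sum_def by simp
qed

lemma finite_involutions: "finite H \<Longrightarrow> finite (involutions b H)"
  unfolding involutions_def by (auto intro: finite_subset[OF _ finite_permutations])

lemma matching_sum_insert:
  assumes H: "finite H" and h: "h \<notin> H"
  shows "matching_sum q (insert h H) = (\<Sum>k\<in>H. q h k * q k h * matching_sum q (H - {k}))"
proof -
  have "matching_sum q (insert h H) = (\<Sum>(k, \<alpha>)\<in>(SIGMA k:H. involutions True (H - {k})). \<Prod>x\<in>insert h H. q x ((Transposition.transpose h k \<circ> \<alpha>) x))"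
    unfolding matching_sum_def
    by (subst sum.reindex_bij_betw[OF bij_insert_pair[OF h], symmetric]) (simp add: case_prod_unfold)
  also have "\<dots> = (\<Sum>k\<in>H. \<Sum>\<alpha>\<in>involutions True (H - {k}). \<Prod>x\<in>insert h H. q x ((Transposition.transpose h k \<circ> \<alpha>) x))"
    using H by (subst sum.Sigma) (auto intro: finite_involutions)
  also have "\<dots> = (\<Sum>k\<in>H. \<Sum>\<alpha>\<in>involutions True (H - {k}). q h k * q k h * (\<Prod>x\<in>H - {k}. q x (\<alpha> x)))"
  proof (intro sum.cong refl)
    fix k \<alpha> assume k: "k \<in> H" and \<alpha>: "\<alpha> \<in> involutions True (H - {k})"
    have hk: "h \<noteq> k" using k h by auto
    have perm: "\<alpha> permutes (H - {k})" using \<alpha> by (simp add: involutions_def)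
    let ?\<beta> = "Transposition.transpose h k \<circ> \<alpha>"
    have \<beta>: "?\<beta> h = k" "?\<beta> k = h" using permutes_not_in[OF perm] h by (simp_all add: Transposition.transpose_def)
    have "(\<Prod>x\<in>H - {k}. q x (?\<beta> x)) = (\<Prod>x\<in>H - {k}. q x (\<alpha> x))"
    proof (rule prod.cong[OF refl])
      fix x assume "x \<in> H - {k}"
      then have "\<alpha> x \<in> H - {k}" using permutes_in_image[OF perm] by simp
      then have "Transposition.transpose h k (\<alpha> x) = \<alpha> x" using h by (auto simp: Transposition.transpose_def)
      then show "q x (?\<beta> x) = q x (\<alpha> x)" by simp
    qed
    moreover have "(\<Prod>x\<in>insert h H. q x (?\<beta> x)) = q h (?\<beta> h) * (\<Prod>x\<in>H. q x (?\<beta> x))" using H h by (rule prod.insert)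
    moreover have "(\<Prod>x\<in>H. q x (?\<beta> x)) = q k (?\<beta> k) * (\<Prod>x\<in>H - {k}. q x (?\<beta> x))" using H k by (rule prod.remove)
    ultimately show "(\<Prod>x\<in>insert h H. q x (?\<beta> x)) = q h k * q k h * (\<Prod>x\<in>H - {k}. q x (\<alpha> x))"
      unfolding \<beta> by simp
  qed
  also have "\<dots> = (\<Sum>k\<in>H. q h k * q k h * matching_sum q (H - {k}))"
    by (simp add: matching_sum_def sum_distrib_left)
  finally show ?thesis .
qed

text \<open>Both sides obey the same recursion on the partner of one element.\<close>

theorem wick:
  assumes N: "N > 0" and \<Gamma>: "finite \<Gamma>" and H: "finite H"
    and q: "\<And>h k. h \<in> H \<Longrightarrow> k \<in> H \<Longrightarrow> (\<Sum>\<gamma>\<in>\<Gamma>. a h \<gamma> * a k \<gamma>) / of_real N = q h k * q k h"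
  shows "linear_mean N \<Gamma> a H = matching_sum q H"
  using H q
proof (induction "card H" arbitrary: H rule: less_induct)
  case less
  show ?case
  proof (cases "H = {}")
    case True
    then show ?thesis by (simp add: matching_sum_empty linear_mean_def gauss_mean_def moment_0)
  next
    case False
    then obtain h where h: "h \<in> H" by blast
    let ?K = "H - {h}"
    have K: "finite ?K" "h \<notin> ?K" "insert h ?K = H" using less.prems(1) h by auto
    have "linear_mean N \<Gamma> a (insert h ?K) = (\<Sum>k\<in>?K. (\<Sum>\<gamma>\<in>\<Gamma>. a h \<gamma> * a k \<gamma>) / of_real N * linear_mean N \<Gamma> a (?K - {k}))"
      by (rule linear_mean_insert[OF N \<Gamma> K(1,2)])
    also have "\<dots> = (\<Sum>k\<in>?K. q h k * q k h * matching_sum q (?K - {k}))"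
    proof (rule sum.cong[OF refl])
      fix k assume k: "k \<in> ?K"
      have "card (?K - {k}) < card H" using less.prems(1) h by (intro psubset_card_mono) auto
      then have "linear_mean N \<Gamma> a (?K - {k}) = matching_sum q (?K - {k})"
        using less.prems by (intro less.hyps) auto
      then show "(\<Sum>\<gamma>\<in>\<Gamma>. a h \<gamma> * a k \<gamma>) / of_real N * linear_mean N \<Gamma> a (?K - {k}) =
          q h k * q k h * matching_sum q (?K - {k})"
        using less.prems(2)[of h k] h k by simp
    qed
    also have "\<dots> = matching_sum q (insert h ?K)" by (rule matching_sum_insert[OF K(1,2), symmetric])
    finally show ?thesis unfolding K(3) .
  qed
qed

section \<open>The integral over the group algebra\<close>

locale finite_group = group G for G :: "('g, 'b) monoid_scheme" (structure) +
  assumes finite_carrier: "finite (carrier G)"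
begin

abbreviation (input) "\<Gamma> \<equiv> carrier G"
abbreviation (input) "A \<equiv> group_algebra G"
abbreviation (input) "N \<equiv> card (carrier G)"

lemma order_pos: "N > 0"
  using finite_carrier by (auto simp: card_gt_0_iff)

lemma pow_Suc:
  assumes "\<alpha> \<in> \<Gamma>" "\<beta> \<in> \<Gamma>"
  shows "(x [^]\<^bsub>A\<^esub> Suc n) (\<alpha> \<otimes> inv \<beta>) = (\<Sum>\<mu>\<in>\<Gamma>. (x [^]\<^bsub>A\<^esub> n) (\<alpha> \<otimes> inv \<mu>) * x (\<mu> \<otimes> inv \<beta>))"
proof -
  have bij: "bij_betw (\<lambda>\<mu>. \<alpha> \<otimes> inv \<mu>) \<Gamma> \<Gamma>"
    by (rule bij_betw_byWitness[where f' = "\<lambda>\<delta>. inv \<delta> \<otimes> \<alpha>"]) (use assms in \<open>auto simp: inv_mult_group m_assoc[symmetric] m_assoc\<close>)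
  have "inv (\<alpha> \<otimes> inv \<mu>) \<otimes> (\<alpha> \<otimes> inv \<beta>) = \<mu> \<otimes> inv \<beta>" if "\<mu> \<in> \<Gamma>" for \<mu>
  proof -
    have "inv (\<alpha> \<otimes> inv \<mu>) \<otimes> (\<alpha> \<otimes> inv \<beta>) = \<mu> \<otimes> (inv \<alpha> \<otimes> \<alpha>) \<otimes> inv \<beta>"
      using assms that by (simp only: inv_mult_group inv_closed inv_inv m_assoc m_closed)
    then show ?thesis using assms that by simp
  qed
  moreover have "(x [^]\<^bsub>A\<^esub> Suc n) (\<alpha> \<otimes> inv \<beta>) = (\<Sum>\<delta>\<in>\<Gamma>. (x [^]\<^bsub>A\<^esub> n) \<delta> * x (inv \<delta> \<otimes> (\<alpha> \<otimes> inv \<beta>)))"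
    using assms by (simp add: nat_pow_def group_algebra_def)
  ultimately show ?thesis using sum.reindex_bij_betw[OF bij, of "\<lambda>\<delta>. (x [^]\<^bsub>A\<^esub> n) \<delta> * x (inv \<delta> \<otimes> (\<alpha> \<otimes> inv \<beta>))"] by simp
qed

lemma one_apply:
  assumes "\<alpha> \<in> \<Gamma>" "\<beta> \<in> \<Gamma>"
  shows "\<one>\<^bsub>A\<^esub> (\<alpha> \<otimes> inv \<beta>) = (if \<alpha> = \<beta> then 1 else 0)"
proof -
  have "\<alpha> \<otimes> inv \<beta> = \<one> \<longleftrightarrow> \<alpha> = \<beta>" using assms inv_solve_right'[of \<one> \<alpha> \<beta>] by auto
  then show ?thesis using assms by (simp add: group_algebra_def)
qed

text \<open>The power multiplies by \<open>x\<close> on the right, whereas a walk is extended at its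
  end, on the left. The induction passes from one side to the other.\<close>

lemma pow_Suc2:
  assumes "\<alpha> \<in> \<Gamma>" "\<beta> \<in> \<Gamma>"
  shows "(x [^]\<^bsub>A\<^esub> Suc n) (\<alpha> \<otimes> inv \<beta>) = (\<Sum>\<mu>\<in>\<Gamma>. x (\<alpha> \<otimes> inv \<mu>) * (x [^]\<^bsub>A\<^esub> n) (\<mu> \<otimes> inv \<beta>))"
  using assms
proof (induction n arbitrary: \<beta>)
  case 0
  have "(\<Sum>\<mu>\<in>\<Gamma>. (if \<alpha> = \<mu> then 1 else 0) * x (\<mu> \<otimes> inv \<beta>)) = (\<Sum>\<mu>\<in>\<Gamma>. if \<alpha> = \<mu> then x (\<mu> \<otimes> inv \<beta>) else 0)"
    by (rule sum.cong) auto
  moreover have "(\<Sum>\<mu>\<in>\<Gamma>. x (\<alpha> \<otimes> inv \<mu>) * (if \<mu> = \<beta> then 1 else 0)) = (\<Sum>\<mu>\<in>\<Gamma>. if \<mu> = \<beta> then x (\<alpha> \<otimes> inv \<mu>) else 0)"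
    by (rule sum.cong) auto
  ultimately show ?case using 0 finite_carrier unfolding pow_Suc[OF 0] by (simp add: one_apply)
next
  case (Suc n)
  have "(x [^]\<^bsub>A\<^esub> Suc (Suc n)) (\<alpha> \<otimes> inv \<beta>) =
      (\<Sum>\<mu>\<in>\<Gamma>. \<Sum>\<nu>\<in>\<Gamma>. x (\<alpha> \<otimes> inv \<nu>) * (x [^]\<^bsub>A\<^esub> n) (\<nu> \<otimes> inv \<mu>) * x (\<mu> \<otimes> inv \<beta>))"
    unfolding pow_Suc[OF Suc.prems, of x "Suc n"]
    by (intro sum.cong refl) (simp only: Suc.IH[OF Suc.prems(1)] sum_distrib_right)
  also have "\<dots> = (\<Sum>\<nu>\<in>\<Gamma>. \<Sum>\<mu>\<in>\<Gamma>. x (\<alpha> \<otimes> inv \<nu>) * (x [^]\<^bsub>A\<^esub> n) (\<nu> \<otimes> inv \<mu>) * x (\<mu> \<otimes> inv \<beta>))"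
    by (rule sum.swap)
  also have "\<dots> = (\<Sum>\<nu>\<in>\<Gamma>. x (\<alpha> \<otimes> inv \<nu>) * (x [^]\<^bsub>A\<^esub> Suc n) (\<nu> \<otimes> inv \<beta>))"
    by (intro sum.cong refl) (simp only: pow_Suc[OF _ Suc.prems(2)] sum_distrib_left mult.assoc)
  finally show ?case .
qed

text \<open>\<open>x\<^sup>n\<close> corresponds to the \<open>n\<close>-th power of the matrix \<open>(x (\<alpha> \<beta>\<^sup>-\<^sup>1))\<close>, whose entries are sums over walks.\<close>

lemma walk_sum:
  "(\<Sum>B\<in>{..<Suc n} \<rightarrow>\<^sub>E \<Gamma>. f (B 0) (B n) * (\<Prod>i<n. x (B (Suc i) \<otimes> inv (B i)))) =
    (\<Sum>\<beta>\<in>\<Gamma>. \<Sum>\<alpha>\<in>\<Gamma>. f \<beta> \<alpha> * (x [^]\<^bsub>A\<^esub> n) (\<alpha> \<otimes> inv \<beta>))"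
proof (induction n arbitrary: f)
  case 0
  have "(\<Sum>B\<in>{..<Suc 0} \<rightarrow>\<^sub>E \<Gamma>. f (B 0) (B 0)) = (\<Sum>\<beta>\<in>\<Gamma>. f \<beta> \<beta>)"
    unfolding lessThan_Suc lessThan_0 by (subst sum_PiE_insert) simp_all
  also have "\<dots> = (\<Sum>\<beta>\<in>\<Gamma>. \<Sum>\<alpha>\<in>\<Gamma>. f \<beta> \<alpha> * (x [^]\<^bsub>A\<^esub> (0::nat)) (\<alpha> \<otimes> inv \<beta>))"
  proof (rule sum.cong[OF refl])
    fix \<beta> assume \<beta>: "\<beta> \<in> \<Gamma>"
    then have "(\<Sum>\<alpha>\<in>\<Gamma>. f \<beta> \<alpha> * (x [^]\<^bsub>A\<^esub> (0::nat)) (\<alpha> \<otimes> inv \<beta>)) = (\<Sum>\<alpha>\<in>\<Gamma>. if \<alpha> = \<beta> then f \<beta> \<alpha> else 0)"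
      by (intro sum.cong) (auto simp: one_apply)
    then show "f \<beta> \<beta> = (\<Sum>\<alpha>\<in>\<Gamma>. f \<beta> \<alpha> * (x [^]\<^bsub>A\<^esub> (0::nat)) (\<alpha> \<otimes> inv \<beta>))" using \<beta> finite_carrier by simp
  qed
  finally show ?case by simp
next
  case (Suc n)
  let ?P = "\<lambda>B. \<Prod>i<n. x (B (Suc i) \<otimes> inv (B i))"
  have "(\<Sum>B\<in>{..<Suc (Suc n)} \<rightarrow>\<^sub>E \<Gamma>. f (B 0) (B (Suc n)) * (\<Prod>i<Suc n. x (B (Suc i) \<otimes> inv (B i)))) =
      (\<Sum>\<alpha>\<in>\<Gamma>. \<Sum>B\<in>{..<Suc n} \<rightarrow>\<^sub>E \<Gamma>. f (B 0) \<alpha> * x (\<alpha> \<otimes> inv (B n)) * ?P B)"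
    unfolding lessThan_Suc[of "Suc n"] by (subst sum_PiE_insert) (simp_all add: lessThan_Suc mult_ac)
  also have "\<dots> = (\<Sum>B\<in>{..<Suc n} \<rightarrow>\<^sub>E \<Gamma>. (\<Sum>\<alpha>\<in>\<Gamma>. f (B 0) \<alpha> * x (\<alpha> \<otimes> inv (B n))) * ?P B)"
    by (subst sum.swap) (simp only: sum_distrib_right)
  also have "\<dots> = (\<Sum>\<beta>\<in>\<Gamma>. \<Sum>\<mu>\<in>\<Gamma>. (\<Sum>\<alpha>\<in>\<Gamma>. f \<beta> \<alpha> * x (\<alpha> \<otimes> inv \<mu>)) * (x [^]\<^bsub>A\<^esub> n) (\<mu> \<otimes> inv \<beta>))"
    by (rule Suc.IH[of "\<lambda>\<beta> \<mu>. \<Sum>\<alpha>\<in>\<Gamma>. f \<beta> \<alpha> * x (\<alpha> \<otimes> inv \<mu>)"])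
  also have "\<dots> = (\<Sum>\<beta>\<in>\<Gamma>. \<Sum>\<alpha>\<in>\<Gamma>. \<Sum>\<mu>\<in>\<Gamma>. f \<beta> \<alpha> * (x (\<alpha> \<otimes> inv \<mu>) * (x [^]\<^bsub>A\<^esub> n) (\<mu> \<otimes> inv \<beta>)))"
    unfolding sum_distrib_right mult.assoc by (intro sum.cong refl sum.swap)
  also have "\<dots> = (\<Sum>\<beta>\<in>\<Gamma>. \<Sum>\<alpha>\<in>\<Gamma>. f \<beta> \<alpha> * (x [^]\<^bsub>A\<^esub> Suc n) (\<alpha> \<otimes> inv \<beta>))"
    by (intro sum.cong refl) (simp only: pow_Suc2 sum_distrib_left)
  finally show ?case .
qed

text \<open>The trace of the matrix power is a sum over closed walks; the separate factor is the
  step that closes the walk.\<close>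

lemma chi_reg_pow:
  "chi_reg G (x [^]\<^bsub>A\<^esub> Suc n) =
    (\<Sum>B\<in>{..<Suc n} \<rightarrow>\<^sub>E \<Gamma>. x (B 0 \<otimes> inv (B n)) * (\<Prod>i<n. x (B (Suc i) \<otimes> inv (B i))))"
proof -
  have "(\<Sum>B\<in>{..<Suc n} \<rightarrow>\<^sub>E \<Gamma>. x (B 0 \<otimes> inv (B n)) * (\<Prod>i<n. x (B (Suc i) \<otimes> inv (B i)))) =
      (\<Sum>\<beta>\<in>\<Gamma>. \<Sum>\<alpha>\<in>\<Gamma>. x (\<beta> \<otimes> inv \<alpha>) * (x [^]\<^bsub>A\<^esub> n) (\<alpha> \<otimes> inv \<beta>))"
    by (rule walk_sum)
  also have "\<dots> = (\<Sum>\<beta>\<in>\<Gamma>. (x [^]\<^bsub>A\<^esub> Suc n) (\<beta> \<otimes> inv \<beta>))"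
    by (intro sum.cong refl) (simp only: pow_Suc2)
  also have "\<dots> = of_nat N * (x [^]\<^bsub>A\<^esub> Suc n) \<one>" by simp
  finally show ?thesis using chi_reg_eq[OF is_group finite_carrier, of "x [^]\<^bsub>A\<^esub> Suc n"] by simp
qed

text \<open>Numbering the cycle by the iterates of a point turns its labellings into closed
  walks.\<close>

lemma local_weight_cyclic:
  assumes s: "s \<in> conn_maps False K" and K: "finite K"
  shows "local_weight (\<lambda>a b _ _. x (a \<otimes> inv b)) \<Gamma> K s = chi_reg G (x [^]\<^bsub>A\<^esub> card K)"
proof -
  obtain h where h: "h \<in> K" using s by (auto simp: conn_maps_def)
  let ?\<sigma> = "fst s" and ?e = "\<lambda>i. (fst s ^^ i) h"
  have orb: "orbit ?\<sigma> h = K" by (rule conn_maps_False_cyclic(1)[OF s K h])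
  obtain n where n: "funpow_dist1 ?\<sigma> h h = Suc n" by blast
  have hh: "h \<in> orbit ?\<sigma> h" using orb h by simp
  have e: "bij_betw ?e {..<Suc n} K"
    using inj_on_funpow_dist1[OF hh] orbit_conv_funpow_dist1[OF hh] unfolding n orb
    by (simp add: bij_betw_def atLeast0LessThan)
  then have cK: "card K = Suc n" using bij_betw_same_card by fastforce
  have last: "?e (Suc n) = h" using funpow_dist1_prop[OF hh] unfolding n .
  have "local_weight (\<lambda>a b _ _. x (a \<otimes> inv b)) \<Gamma> K s = (\<Sum>L\<in>K \<rightarrow>\<^sub>E \<Gamma>. \<Prod>i<Suc n. x (L (?e (Suc i)) \<otimes> inv (L (?e i))))"
    unfolding local_weight_def by (subst prod.reindex_bij_betw[OF e, symmetric]) simp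
  also have "\<dots> = (\<Sum>L\<in>K \<rightarrow>\<^sub>E \<Gamma>. x ((\<lambda>i\<in>{..<Suc n}. L (?e i)) 0 \<otimes> inv ((\<lambda>i\<in>{..<Suc n}. L (?e i)) n)) *
      (\<Prod>i<n. x ((\<lambda>i\<in>{..<Suc n}. L (?e i)) (Suc i) \<otimes> inv ((\<lambda>i\<in>{..<Suc n}. L (?e i)) i))))"
    using last by (intro sum.cong refl) (simp add: mult.commute)
  also have "\<dots> = chi_reg G (x [^]\<^bsub>A\<^esub> Suc n)"
    unfolding chi_reg_pow
    using sum.reindex_bij_betw[OF bij_betw_restrict_PiE[OF e, of \<Gamma>], of "\<lambda>B. x (B 0 \<otimes> inv (B n)) * (\<Prod>i<n. x (B (Suc i) \<otimes> inv (B i)))"] .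
  finally show ?thesis by (simp add: cK)
qed

section \<open>Reduction to independent Gaussian coordinates\<close>

lemma measurable_coefficient:
  assumes "\<gamma> \<in> \<Gamma>"
  shows "(\<lambda>x. x \<gamma>) \<in> borel_measurable (restrict_space (\<Pi>\<^sub>M \<gamma>\<in>\<Gamma>. (borel :: complex measure)) S)"
  by (rule measurable_restrict_space1[OF measurable_component_singleton[OF assms]])

lemma measurable_chi_reg:
  assumes "n \<ge> (1 :: nat)"
  shows "(\<lambda>x. chi_reg G (x [^]\<^bsub>A\<^esub> n)) \<in> borel_measurable (restrict_space (\<Pi>\<^sub>M \<gamma>\<in>\<Gamma>. (borel :: complex measure)) S)"
proof -
  obtain m where m: "n = Suc m" using assms by (cases n) auto
  show ?thesis unfolding m chi_reg_pow
    by (intro borel_measurable_sum borel_measurable_times borel_measurable_prod measurable_coefficient)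
      (auto simp: PiE_def Pi_def)
qed

definition gauss_norm :: real where
  "gauss_norm = sqrt (2 * pi / N) ^ N"

lemma gauss_norm_pos: "gauss_norm > 0"
  using order_pos by (simp add: gauss_norm_def)

lemma gauss_weight_selfadjoint_of_real:
  "gauss_weight G (selfadjoint_of_real G c) = gauss_density N \<Gamma> c"
proof -
  let ?q = "chi_reg G (selfadjoint_of_real G c [^]\<^bsub>A\<^esub> (2::nat))"
  have "?q / of_nat N = of_real (\<Sum>\<gamma>\<in>\<Gamma>. (c \<gamma>)\<^sup>2)" by (rule chi_reg_selfadjoint_of_real[OF is_group finite_carrier])
  then have "?q = of_nat N * of_real (\<Sum>\<gamma>\<in>\<Gamma>. (c \<gamma>)\<^sup>2)" using order_pos by (simp add: field_simps)
  then have "- (1/2) * ?q = (\<Sum>\<gamma>\<in>\<Gamma>. of_real (- real N * (c \<gamma>)\<^sup>2 / 2))"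
    by (simp add: sum_distrib_left sum_negf sum_divide_distrib)
  then have "exp (- (1/2) * ?q) = (\<Prod>\<gamma>\<in>\<Gamma>. exp (of_real (- real N * (c \<gamma>)\<^sup>2 / 2)))"
    using finite_carrier by (simp only: exp_sum)
  then show ?thesis unfolding gauss_weight_def gauss_density_def by (simp only: exp_of_real)
qed

text \<open>A row of the matrix of \<open>selfadjoint_of_real\<close>, with real and imaginary part
  combined. For \<gamma> equal to its inverse the two entries fall together and add up to 1.\<close>

definition real_coeff :: "'g \<Rightarrow> 'g \<Rightarrow> complex" where
  "real_coeff \<gamma> \<delta> = (if \<delta> = \<gamma> then (1 + \<i>) / 2 else 0) + (if \<delta> = inv \<gamma> then (1 - \<i>) / 2 else 0)"

lemma selfadjoint_of_real_eq:
  assumes "\<gamma> \<in> \<Gamma>"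
  shows "selfadjoint_of_real G c \<gamma> = (\<Sum>\<delta>\<in>\<Gamma>. real_coeff \<gamma> \<delta> * of_real (c \<delta>))"
proof -
  have "(\<Sum>\<delta>\<in>\<Gamma>. real_coeff \<gamma> \<delta> * of_real (c \<delta>)) =
      (\<Sum>\<delta>\<in>\<Gamma>. (if \<delta> = \<gamma> then (1 + \<i>) / 2 * of_real (c \<delta>) else 0) + (if \<delta> = inv \<gamma> then (1 - \<i>) / 2 * of_real (c \<delta>) else 0))"
    by (rule sum.cong) (auto simp: real_coeff_def distrib_right)
  also have "\<dots> = (1 + \<i>) / 2 * of_real (c \<gamma>) + (1 - \<i>) / 2 * of_real (c (inv \<gamma>))"
    using assms finite_carrier by (simp add: sum.distrib)
  finally show ?thesis using assms
    by (simp add: selfadjoint_of_real_def complex_eq_iff field_simps)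
qed

text \<open>The product is bilinear, without conjugation. The squares of (1 + i) / 2 and (1 - i) / 2
  cancel and the two mixed products give 1/2 each, so the coefficient at \<gamma> correlates with
  the one at the inverse of \<gamma>.\<close>

lemma real_coeff_product:
  assumes "\<gamma> \<in> \<Gamma>" "\<kappa> \<in> \<Gamma>"
  shows "(\<Sum>\<delta>\<in>\<Gamma>. real_coeff \<gamma> \<delta> * real_coeff \<kappa> \<delta>) = (if \<gamma> \<otimes> \<kappa> = \<one> then 1 else 0)"
proof -
  let ?u = "(1 + \<i>) / 2" and ?v = "(1 - \<i>) / 2"
  have "(\<Sum>\<delta>\<in>\<Gamma>. real_coeff \<gamma> \<delta> * real_coeff \<kappa> \<delta>) =
      (\<Sum>\<delta>\<in>\<Gamma>. (if \<delta> = \<gamma> then ?u * real_coeff \<kappa> \<delta> else 0) + (if \<delta> = inv \<gamma> then ?v * real_coeff \<kappa> \<delta> else 0))"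
    by (rule sum.cong) (auto simp: real_coeff_def[of \<gamma>] distrib_right)
  also have "\<dots> = ?u * real_coeff \<kappa> \<gamma> + ?v * real_coeff \<kappa> (inv \<gamma>)"
    using assms finite_carrier by (simp add: sum.distrib)
  also have "\<dots> = (if \<gamma> = inv \<kappa> then 1 else 0)"
  proof -
    have "inv \<gamma> = inv \<kappa> \<longleftrightarrow> \<gamma> = \<kappa>" "inv \<gamma> = \<kappa> \<longleftrightarrow> \<gamma> = inv \<kappa>" using assms by auto
    then show ?thesis by (auto simp: real_coeff_def complex_eq_iff)
  qed
  also have "\<gamma> = inv \<kappa> \<longleftrightarrow> \<gamma> \<otimes> \<kappa> = \<one>" using assms inv_equality[of \<gamma> \<kappa>] by auto
  finally show ?thesis .
qed

text \<open>Each of the two half-edges of an edge contributes a square root of the variance \<open>1 / |G|\<close>.\<close>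

definition edge_weight :: "'g \<Rightarrow> 'g \<Rightarrow> 'g \<Rightarrow> 'g \<Rightarrow> complex" where
  "edge_weight a b c d = (if (a \<otimes> inv b) \<otimes> (c \<otimes> inv d) = \<one> then 1 / of_real (sqrt (real N)) else 0)"

lemma gaussian_walks:
  assumes H: "finite H" and \<sigma>: "\<sigma> permutes H" and B: "B \<in> H \<rightarrow>\<^sub>E \<Gamma>"
  shows "has_bochner_integral (\<Pi>\<^sub>M \<gamma>\<in>\<Gamma>. lborel)
    (\<lambda>c. gauss_density N \<Gamma> c * (\<Prod>h\<in>H. selfadjoint_of_real G c (B (\<sigma> h) \<otimes> inv (B h))))
    (of_real gauss_norm * (\<Sum>\<alpha>\<in>involutions True H. \<Prod>h\<in>H. edge_weight (B (\<sigma> h)) (B h) (B (\<sigma> (\<alpha> h))) (B (\<alpha> h))))"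
proof -
  let ?g = "\<lambda>h. B (\<sigma> h) \<otimes> inv (B h)"
  let ?q = "\<lambda>h k. edge_weight (B (\<sigma> h)) (B h) (B (\<sigma> k)) (B k)"
  have BG: "B h \<in> \<Gamma>" "B (\<sigma> h) \<in> \<Gamma>" if "h \<in> H" for h
    using B that permutes_in_image[OF \<sigma>] by auto
  have g: "?g h \<in> \<Gamma>" if "h \<in> H" for h using BG[OF that] by simp
  have "linear_mean N \<Gamma> (\<lambda>h. real_coeff (?g h)) H = matching_sum ?q H"
  proof (rule wick)
    fix h k assume hk: "h \<in> H" "k \<in> H"
    \<comment> \<open>In a group, one-sided inverses are two-sided, so both half-edges of an edge
      impose the same condition.\<close>
    have sym: "?g h \<otimes> ?g k = \<one> \<longleftrightarrow> ?g k \<otimes> ?g h = \<one>"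
      using inv_comm[OF _ g[OF hk(1)] g[OF hk(2)]] inv_comm[OF _ g[OF hk(2)] g[OF hk(1)]] by blast
    have r: "(1 / of_real (sqrt (real N)) :: complex) * (1 / of_real (sqrt (real N))) = 1 / of_real (real N)"
      by (simp flip: of_real_mult)
    show "(\<Sum>\<gamma>\<in>\<Gamma>. real_coeff (?g h) \<gamma> * real_coeff (?g k) \<gamma>) / of_real (real N) = ?q h k * ?q k h"
      unfolding real_coeff_product[OF g[OF hk(1)] g[OF hk(2)]] edge_weight_def sym using r by simp
  qed (use order_pos finite_carrier H in auto)
  then have val: "of_real (sqrt (2 * pi / N) ^ card \<Gamma>) * linear_mean N \<Gamma> (\<lambda>h. real_coeff (?g h)) H =
      of_real gauss_norm * (\<Sum>\<alpha>\<in>involutions True H. \<Prod>h\<in>H. ?q h (\<alpha> h))"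
    by (simp add: matching_sum_def gauss_norm_def)
  have fn: "(\<Prod>h\<in>H. selfadjoint_of_real G c (?g h)) = (\<Prod>h\<in>H. \<Sum>\<gamma>\<in>\<Gamma>. real_coeff (?g h) \<gamma> * of_real (c \<gamma>))" for c
    by (rule prod.cong[OF refl selfadjoint_of_real_eq[OF g]])
  show ?thesis unfolding fn val[symmetric]
    by (rule gaussian_linear_forms) (use order_pos finite_carrier H in auto)
qed

lemma integral_lebesgue_selfadjoint:
  fixes F :: "('g \<Rightarrow> complex) \<Rightarrow> complex"
  assumes "F \<in> borel_measurable (restrict_space (\<Pi>\<^sub>M \<gamma>\<in>\<Gamma>. borel) (selfadjoint G))"
  shows "(LINT x|lebesgue_selfadjoint G. F x) = (LINT c|(\<Pi>\<^sub>M \<gamma>\<in>\<Gamma>. lborel). F (selfadjoint_of_real G c))"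
  unfolding lebesgue_selfadjoint_def by (rule integral_distr[OF measurable_selfadjoint_of_real[OF is_group] assms])

lemma measurable_gauss_weight:
  "gauss_weight G \<in> borel_measurable (restrict_space (\<Pi>\<^sub>M \<gamma>\<in>\<Gamma>. borel) (selfadjoint G))"
proof -
  have "(\<lambda>x. exp (- (1/2) * chi_reg G (x [^]\<^bsub>A\<^esub> (2::nat)))) \<in> borel_measurable (restrict_space (\<Pi>\<^sub>M \<gamma>\<in>\<Gamma>. borel) (selfadjoint G))"
    using measurable_chi_reg[of 2] by measurable
  then show ?thesis unfolding gauss_weight_def[abs_def] .
qed

lemma integral_gauss_weight: "(LINT x|lebesgue_selfadjoint G. gauss_weight G x) = of_real gauss_norm"
proof -
  have "has_bochner_integral (\<Pi>\<^sub>M \<gamma>\<in>\<Gamma>. lborel) (\<lambda>c. gauss_density N \<Gamma> c * (\<Prod>h\<in>{}. of_real (c (id h))))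
      (of_real (sqrt (2 * pi / N) ^ card \<Gamma> * gauss_mean N \<Gamma> id {}))"
    using order_pos finite_carrier by (intro gaussian_monomial) auto
  then have "has_bochner_integral (\<Pi>\<^sub>M \<gamma>\<in>\<Gamma>. lborel) (gauss_density N \<Gamma>) (of_real gauss_norm)"
    by (simp add: gauss_mean_def moment_0 gauss_norm_def)
  then show ?thesis
    unfolding integral_lebesgue_selfadjoint[OF measurable_gauss_weight] gauss_weight_selfadjoint_of_real
    by (rule has_bochner_integral_integral_eq)
qed

lemma integral_normalized_measure:
  fixes F :: "('g \<Rightarrow> complex) \<Rightarrow> complex"
  assumes F: "F \<in> borel_measurable (restrict_space (\<Pi>\<^sub>M \<gamma>\<in>\<Gamma>. borel) (selfadjoint G))"
  shows "(LINT x|normalized_measure G. F x) =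
    (LINT c|(\<Pi>\<^sub>M \<gamma>\<in>\<Gamma>. lborel). F (selfadjoint_of_real G c)) / of_real gauss_norm"
proof -
  let ?M = "lebesgue_selfadjoint G"
  have "normalized_measure G = density ?M (\<lambda>_. ennreal (1 / gauss_norm))"
    unfolding normalized_measure_def integral_gauss_weight
    by (rule measure_eqI) (auto simp: emeasure_density_const)
  moreover have "F \<in> borel_measurable ?M" using F by (simp add: lebesgue_selfadjoint_def)
  ultimately have "(LINT x|normalized_measure G. F x) = (LINT x|?M. (1 / gauss_norm) *\<^sub>R F x)"
    using gauss_norm_pos by (simp add: integral_density)
  also have "\<dots> = (LINT x|?M. F x) / of_real gauss_norm"
    by (simp add: scaleR_conv_of_real)
  finally show ?thesis unfolding integral_lebesgue_selfadjoint[OF F] .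
qed

lemma integral_series_eq:
  assumes v: "Poly_Mapping.keys v \<subseteq> {3..}"
  shows "integral_series G v = map_weight.egf True (local_weight edge_weight \<Gamma>) v"
proof -
  let ?n = "mono_degree v"
  let ?H = "{..<?n}" and ?L = "Poly_Mapping.lookup v" and ?V = "Poly_Mapping.keys v"
  let ?M = "\<Pi>\<^sub>M \<gamma>\<in>\<Gamma>. (lborel :: real measure)"
  let ?w = "\<lambda>x. local_weight (\<lambda>a b _ _. x (a \<otimes> inv b)) \<Gamma> :: nat set \<Rightarrow> _"
  let ?P = "{\<sigma>. \<sigma> permutes ?H}"
  interpret E: map_weight True "local_weight edge_weight \<Gamma>" by (rule map_weight_local[OF finite_carrier])
  let ?F = "\<lambda>x. gauss_weight G x * (\<Prod>j\<in>?V. chi_reg G (x [^]\<^bsub>A\<^esub> j) ^ ?L j)"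
  let ?c = "\<Prod>j\<in>?V. 1 / (fact (?L j) * of_nat j ^ ?L j) :: complex"
  have F: "?F \<in> borel_measurable (restrict_space (\<Pi>\<^sub>M \<gamma>\<in>\<Gamma>. borel) (selfadjoint G))"
    by (intro borel_measurable_times borel_measurable_prod borel_measurable_power measurable_chi_reg measurable_gauss_weight)
      (use v in auto)
  \<comment> \<open>Here the factors of the asymptotic series are absorbed: they count the
    permutations with cycle type \<open>v\<close> among all permutations of the numbered
    half-edges.\<close>
  have egf: "?c * (\<Prod>j\<in>?V. chi_reg G (x [^]\<^bsub>A\<^esub> j) ^ ?L j) = map_weight.egf False (?w x) v" for x
    by (subst egf_permutations[OF map_weight_local[OF finite_carrier] local_weight_cyclic v])
      (simp_all add: prod.distrib[symmetric])
  have maps_False: "(\<Sum>s\<in>maps False ?H. f s) = (\<Sum>\<sigma>\<in>?P. f (\<sigma>, id))" for f :: "_ \<Rightarrow> complex"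
    unfolding maps_def involutions_False sum.cartesian_product' by simp
  let ?p = "\<lambda>x \<sigma> B. \<Prod>h\<in>?H. x (B (\<sigma> h) \<otimes> inv (B h))"
  let ?e = "\<lambda>\<sigma> B. \<Sum>\<alpha>\<in>involutions True ?H. \<Prod>h\<in>?H. edge_weight (B (\<sigma> h)) (B h) (B (\<sigma> (\<alpha> h))) (B (\<alpha> h))"
  have "map_weight.egf False (?w x) v =
      (\<Sum>\<sigma>\<in>{\<sigma> \<in> ?P. cycle_type ?H \<sigma> = v}. \<Sum>B\<in>?H \<rightarrow>\<^sub>E \<Gamma>. ?p x \<sigma> B) / fact ?n" for x
  proof -
    interpret W: map_weight False "?w x" by (rule map_weight_local[OF finite_carrier])
    show ?thesis unfolding W.egf_def W.total_def maps_False
      by (simp add: sum.inter_filter[symmetric] finite_permutations local_weight_def)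
  qed
  then have "?c * ?F (selfadjoint_of_real G c) = (\<Sum>\<sigma>\<in>{\<sigma> \<in> ?P. cycle_type ?H \<sigma> = v}. \<Sum>B\<in>?H \<rightarrow>\<^sub>E \<Gamma>.
      gauss_density N \<Gamma> c * ?p (selfadjoint_of_real G c) \<sigma> B) / fact ?n" for c
    using egf[of "selfadjoint_of_real G c"]
    by (simp add: gauss_weight_selfadjoint_of_real sum_distrib_left[symmetric] mult.left_commute)
  moreover have "has_bochner_integral ?M (\<lambda>c. (\<Sum>\<sigma>\<in>{\<sigma> \<in> ?P. cycle_type ?H \<sigma> = v}. \<Sum>B\<in>?H \<rightarrow>\<^sub>E \<Gamma>.
      gauss_density N \<Gamma> c * ?p (selfadjoint_of_real G c) \<sigma> B) / fact ?n)
      ((\<Sum>\<sigma>\<in>{\<sigma> \<in> ?P. cycle_type ?H \<sigma> = v}. \<Sum>B\<in>?H \<rightarrow>\<^sub>E \<Gamma>. of_real gauss_norm * ?e \<sigma> B) / fact ?n)"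
    by (intro has_bochner_integral_divide_zero has_bochner_integral_sum gaussian_walks) auto
  ultimately have "(LINT c|?M. ?c * ?F (selfadjoint_of_real G c)) =
      (\<Sum>\<sigma>\<in>{\<sigma> \<in> ?P. cycle_type ?H \<sigma> = v}. \<Sum>B\<in>?H \<rightarrow>\<^sub>E \<Gamma>. of_real gauss_norm * ?e \<sigma> B) / fact ?n"
    by (simp only: has_bochner_integral_integral_eq)
  also have "\<dots> = of_real gauss_norm * E.egf v"
  proof -
    have "E.total ?H v = (\<Sum>\<sigma>\<in>?P. \<Sum>\<alpha>\<in>involutions True ?H. if cycle_type ?H \<sigma> = v then local_weight edge_weight \<Gamma> ?H (\<sigma>, \<alpha>) else 0)"
      unfolding E.total_def maps_def sum.cartesian_product by (rule sum.cong) auto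
    also have "\<dots> = (\<Sum>\<sigma>\<in>{\<sigma> \<in> ?P. cycle_type ?H \<sigma> = v}. \<Sum>\<alpha>\<in>involutions True ?H. local_weight edge_weight \<Gamma> ?H (\<sigma>, \<alpha>))"
      by (subst sum.inter_filter) (auto simp: finite_permutations intro!: sum.cong)
    also have "\<dots> = (\<Sum>\<sigma>\<in>{\<sigma> \<in> ?P. cycle_type ?H \<sigma> = v}. \<Sum>B\<in>?H \<rightarrow>\<^sub>E \<Gamma>. ?e \<sigma> B)"
      unfolding local_weight_def fst_conv snd_conv by (intro sum.cong refl sum.swap)
    finally show ?thesis by (simp add: E.egf_def sum_distrib_left)
  qed
  finally have "?c * (LINT c|?M. ?F (selfadjoint_of_real G c)) = of_real gauss_norm * E.egf v" by simp
  then have "?c * ((LINT c|?M. ?F (selfadjoint_of_real G c)) / of_real gauss_norm) = E.egf v"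
    using gauss_norm_pos by simp
  then show ?thesis unfolding integral_series_def integral_normalized_measure[OF F] using v by simp
qed

end

section \<open>Ribbon graphs and pairs of permutations\<close>

definition isos :: "'a set \<Rightarrow> ('a \<Rightarrow> 'a) \<times> ('a \<Rightarrow> 'a) \<Rightarrow> 'c set \<Rightarrow> ('c \<Rightarrow> 'c) \<times> ('c \<Rightarrow> 'c) \<Rightarrow> ('a \<Rightarrow> 'c) set" where
  "isos H s K t = {\<beta> \<in> H \<rightarrow>\<^sub>E K. bij_betw \<beta> H K \<and>
     (\<forall>h\<in>H. fst t (\<beta> h) = \<beta> (fst s h) \<and> snd t (\<beta> h) = \<beta> (snd s h))}"

definition autos :: "'a set \<Rightarrow> ('a \<Rightarrow> 'a) \<times> ('a \<Rightarrow> 'a) \<Rightarrow> ('a \<Rightarrow> 'a) set" where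
  "autos H s = {g. g permutes H \<and> (\<forall>h\<in>H. fst s (g h) = g (fst s h) \<and> snd s (g h) = g (snd s h))}"

lemma isos_relabel:
  assumes \<beta>: "bij_betw \<beta> H K" "\<beta> \<in> H \<rightarrow>\<^sub>E K" and s: "s \<in> maps b H" and t: "t \<in> maps b K"
  shows "\<beta> \<in> isos H s K t \<longleftrightarrow> relabel H \<beta> s = t"
proof
  have inj: "inj_on \<beta> H" and K: "K = \<beta> ` H" using \<beta> by (auto simp: bij_betw_def)
  note ap = relabel_apply[OF inj]
  show "\<beta> \<in> isos H s K t" if "relabel H \<beta> s = t"
    using \<beta> ap[of _ s] that by (auto simp: isos_def)
  assume \<beta>': "\<beta> \<in> isos H s K t"
  have r: "relabel H \<beta> s \<in> maps b K" by (rule relabel_in[OF \<beta>(1) s])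
  have "fst (relabel H \<beta> s) x = fst t x" "snd (relabel H \<beta> s) x = snd t x" for x
  proof -
    have "fst (relabel H \<beta> s) x = fst t x \<and> snd (relabel H \<beta> s) x = snd t x"
    proof (cases "x \<in> K")
      case True
      then obtain h where "h \<in> H" "x = \<beta> h" using K by auto
      then show ?thesis using \<beta>' ap[of h s] by (simp add: isos_def)
    next
      case False
      then show ?thesis
        using permutes_not_in[OF mapsD(1)[OF r]] permutes_not_in[OF mapsD(2)[OF r]]
          permutes_not_in[OF mapsD(1)[OF t]] permutes_not_in[OF mapsD(2)[OF t]] by simp
    qed
    then show "fst (relabel H \<beta> s) x = fst t x" "snd (relabel H \<beta> s) x = snd t x" by simp_all
  qed
  then show "relabel H \<beta> s = t" by (simp add: prod_eq_iff fun_eq_iff)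
qed

text \<open>The automorphisms act freely and transitively on the isomorphisms: each is a fixed
  \<beta> preceded by one automorphism.\<close>

lemma card_isos:
  assumes \<beta>: "\<beta> \<in> isos H s K t" and s: "\<And>h. h \<in> H \<Longrightarrow> fst s h \<in> H" "\<And>h. h \<in> H \<Longrightarrow> snd s h \<in> H"
  shows "card (isos H s K t) = card (autos H s)"
proof -
  have b: "bij_betw \<beta> H K" using \<beta> by (simp add: isos_def)
  let ?i = "inv_into H \<beta>"
  have i: "\<And>k. k \<in> K \<Longrightarrow> ?i k \<in> H" "\<And>k. k \<in> K \<Longrightarrow> \<beta> (?i k) = k" "\<And>h. h \<in> H \<Longrightarrow> ?i (\<beta> h) = h"
    using bij_betw_apply[OF bij_betw_inv_into[OF b]] bij_betw_inv_into_right[OF b] bij_betw_inv_into_left[OF b] by auto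
  have \<beta>s: "\<And>h. h \<in> H \<Longrightarrow> fst t (\<beta> h) = \<beta> (fst s h)" "\<And>h. h \<in> H \<Longrightarrow> snd t (\<beta> h) = \<beta> (snd s h)" "\<And>h. h \<in> H \<Longrightarrow> \<beta> h \<in> K"
    using \<beta> by (auto simp: isos_def)
  have "bij_betw (\<lambda>g. restrict (\<beta> \<circ> g) H) (autos H s) (isos H s K t)"
  proof (rule bij_betw_byWitness[where f' = "\<lambda>\<gamma> h. if h \<in> H then ?i (\<gamma> h) else h"])
    show "\<forall>g\<in>autos H s. (\<lambda>h. if h \<in> H then ?i (restrict (\<beta> \<circ> g) H h) else h) = g"
    proof
      fix g assume "g \<in> autos H s"
      then have g: "g permutes H" by (simp add: autos_def)
      show "(\<lambda>h. if h \<in> H then ?i (restrict (\<beta> \<circ> g) H h) else h) = g"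
        using i(3) permutes_in_image[OF g] permutes_not_in[OF g] by (auto simp: fun_eq_iff)
    qed
    show "\<forall>\<gamma>\<in>isos H s K t. restrict (\<beta> \<circ> (\<lambda>h. if h \<in> H then ?i (\<gamma> h) else h)) H = \<gamma>"
    proof
      fix \<gamma> assume "\<gamma> \<in> isos H s K t"
      then have "\<gamma> \<in> H \<rightarrow>\<^sub>E K" by (simp add: isos_def)
      then show "restrict (\<beta> \<circ> (\<lambda>h. if h \<in> H then ?i (\<gamma> h) else h)) H = \<gamma>"
        using i(2) by (auto simp: fun_eq_iff PiE_def extensional_def Pi_def)
    qed
    show "(\<lambda>g. restrict (\<beta> \<circ> g) H) ` autos H s \<subseteq> isos H s K t"
    proof (rule image_subsetI)
      fix g assume g: "g \<in> autos H s"
      then have p: "g permutes H" by (simp add: autos_def)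
      have gH: "g h \<in> H" if "h \<in> H" for h using that permutes_in_image[OF p] by simp
      have "bij_betw (\<beta> \<circ> g) H K" using permutes_imp_bij[OF p] b by (rule bij_betw_trans)
      then have "bij_betw (restrict (\<beta> \<circ> g) H) H K" by (rule bij_betw_cong[THEN iffD1, rotated]) simp
      then show "restrict (\<beta> \<circ> g) H \<in> isos H s K t" using g gH \<beta>s s by (auto simp: isos_def autos_def)
    qed
    show "(\<lambda>\<gamma> h. if h \<in> H then ?i (\<gamma> h) else h) ` isos H s K t \<subseteq> autos H s"
    proof (rule image_subsetI)
      fix \<gamma> assume \<gamma>: "\<gamma> \<in> isos H s K t"
      let ?g = "\<lambda>h. if h \<in> H then ?i (\<gamma> h) else h"
      have bg: "bij_betw \<gamma> H K" and \<gamma>K: "\<And>h. h \<in> H \<Longrightarrow> \<gamma> h \<in> K"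
        and \<gamma>s: "\<And>h. h \<in> H \<Longrightarrow> fst t (\<gamma> h) = \<gamma> (fst s h)" "\<And>h. h \<in> H \<Longrightarrow> snd t (\<gamma> h) = \<gamma> (snd s h)"
        using \<gamma> by (auto simp: isos_def)
      have "bij_betw (?i \<circ> \<gamma>) H H" using bg bij_betw_inv_into[OF b] by (rule bij_betw_trans)
      then have "bij_betw ?g H H" by (rule bij_betw_cong[THEN iffD1, rotated]) simp
      then have p: "?g permutes H" by (rule bij_imp_permutes) simp
      have "fst s (?i (\<gamma> h)) = ?i (\<gamma> (fst s h))" "snd s (?i (\<gamma> h)) = ?i (\<gamma> (snd s h))" if h: "h \<in> H" for h
      proof -
        let ?k = "?i (\<gamma> h)"
        have k: "?k \<in> H" "\<beta> ?k = \<gamma> h" using i \<gamma>K[OF h] by auto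
        have "\<beta> (fst s ?k) = \<gamma> (fst s h)" "\<beta> (snd s ?k) = \<gamma> (snd s h)" using \<beta>s[OF k(1)] \<gamma>s[OF h] k(2) by simp_all
        then show "fst s ?k = ?i (\<gamma> (fst s h))" "snd s ?k = ?i (\<gamma> (snd s h))"
          using i(3)[OF s(1)[OF k(1)]] i(3)[OF s(2)[OF k(1)]] by simp_all
      qed
      then show "?g \<in> autos H s" using p s by (simp add: autos_def)
    qed
  qed
  then show ?thesis by (rule bij_betw_same_card[symmetric])
qed

text \<open>The case of trivial structures, for which isomorphisms are bijections and automorphisms
  are permutations.\<close>

lemma card_bijections:
  assumes H: "finite H" and K: "finite K" "card H = card K"
  shows "card {\<beta> \<in> H \<rightarrow>\<^sub>E K. bij_betw \<beta> H K} = fact (card H)"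
proof -
  obtain \<beta>0 where "bij_betw \<beta>0 H K" using finite_same_card_bij[OF H K] by blast
  then have "bij_betw (restrict \<beta>0 H) H K" by (rule bij_betw_cong[THEN iffD1, rotated]) simp
  then have "restrict \<beta>0 H \<in> isos H (id, id) K (id, id)"
    using bij_betw_apply[of \<beta>0 H K] \<open>bij_betw \<beta>0 H K\<close> by (auto simp: isos_def)
  from card_isos[OF this] have "card (isos H (id, id) K (id, id)) = card (autos H (id, id))" by simp
  moreover have "isos H (id, id) K (id, id) = {\<beta> \<in> H \<rightarrow>\<^sub>E K. bij_betw \<beta> H K}" by (simp add: isos_def)
  moreover have "autos H (id, id) = {g. g permutes H}" by (simp add: autos_def)
  ultimately show ?thesis using card_permutations[OF refl H] by simp
qed

text \<open>Every bijection carries \<open>s\<close> to exactly one pair on \<open>K\<close>, which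
  is again connected and has the same cycle type; so the bijections are sorted by the pair they
  produce.\<close>

lemma sum_card_isos:
  assumes s: "s \<in> conn_maps b H" and H: "finite H" and K: "finite K" "card H = card K"
  shows "(\<Sum>t\<in>{t \<in> conn_maps b K. cycle_type K (fst t) = cycle_type H (fst s)}. card (isos H s K t)) = fact (card H)"
proof -
  note sm = conn_maps_subset[OF s]
  let ?B = "{\<beta> \<in> H \<rightarrow>\<^sub>E K. bij_betw \<beta> H K}"
  let ?S = "{t \<in> conn_maps b K. cycle_type K (fst t) = cycle_type H (fst s)}"
  have fB: "finite ?B" using finite_PiE[of H "\<lambda>_. K"] H K by simp
  have fS: "finite ?S" using finite_maps[OF K(1), of b] by (auto intro: finite_subset[OF _ finite_maps[OF K(1)]] dest: conn_maps_subset)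
  have im: "(\<lambda>\<beta>. relabel H \<beta> s) ` ?B \<subseteq> ?S"
  proof (rule image_subsetI)
    fix \<beta> assume "\<beta> \<in> ?B"
    then have b: "bij_betw \<beta> H K" by simp
    have "cycle_type K (fst (relabel H \<beta> s)) = cycle_type H (fst s)"
      using cycle_type_relabel[OF b mapsD(1)[OF sm] H] by (simp add: relabel_def)
    then show "relabel H \<beta> s \<in> ?S" using relabel_conn[OF b s] by simp
  qed
  have "(\<Sum>t\<in>?S. card (isos H s K t)) = (\<Sum>t\<in>?S. \<Sum>\<beta>\<in>{\<beta> \<in> ?B. relabel H \<beta> s = t}. 1)"
  proof (rule sum.cong[OF refl])
    fix t assume "t \<in> ?S"
    then have tm: "t \<in> maps b K" by (simp add: conn_maps_subset)
    have "isos H s K t = {\<beta> \<in> ?B. relabel H \<beta> s = t}"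
      using isos_relabel[OF _ _ sm tm] by (auto simp: isos_def)
    then show "card (isos H s K t) = (\<Sum>\<beta>\<in>{\<beta> \<in> ?B. relabel H \<beta> s = t}. 1)" by simp
  qed
  also have "\<dots> = (\<Sum>\<beta>\<in>?B. 1)" by (rule sum.group[OF fB fS im])
  also have "\<dots> = fact (card H)" using card_bijections[OF H K] by simp
  finally show ?thesis .
qed

text \<open>The identity outside the half-edges replaces the irrelevant values, so that both
  components become permutations.\<close>

definition rg_maps :: "('v, 'h) ribbon_graph \<Rightarrow> ('h \<Rightarrow> 'h) \<times> ('h \<Rightarrow> 'h)" where
  "rg_maps \<Gamma> = (restrict_id (rg_next \<Gamma>) (rg_halves \<Gamma>), restrict_id (rg_opp \<Gamma>) (rg_halves \<Gamma>))"

lemma rg_maps_apply: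
  "h \<in> rg_halves \<Gamma> \<Longrightarrow> fst (rg_maps \<Gamma>) h = rg_next \<Gamma> h" "h \<in> rg_halves \<Gamma> \<Longrightarrow> snd (rg_maps \<Gamma>) h = rg_opp \<Gamma> h"
  by (simp_all add: rg_maps_def)

context rgraph
begin

lemma incident_vert: "h \<in> H \<Longrightarrow> rg_incident \<Gamma> (vert h) = orbit nxt h"
  using cyclic[of h] by (auto simp: cyclic_on_alldef rg_incident_def)

lemma vert_eq_iff: "h \<in> H \<Longrightarrow> k \<in> H \<Longrightarrow> vert h = vert k \<longleftrightarrow> k \<in> orbit nxt h"
  by (subst incident_vert[symmetric]) (auto simp: rg_incident_def)

lemma vert_image: "vert ` H = rg_verts \<Gamma>"
  using vert incident by (force simp: rg_incident_def)

lemma rg_maps_in: "rg_maps \<Gamma> \<in> maps True H"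
proof (rule mapsI)
  have "bij_betw nxt H H" using nxt_surj finite_H by (simp add: bij_betw_def eq_card_imp_inj_on)
  then show "fst (rg_maps \<Gamma>) permutes H" by (simp add: rg_maps_def permutes_restrict_id)
  have "bij_betw opp H H" by (rule bij_betw_byWitness[where f' = opp]) (use opp in auto)
  then show "snd (rg_maps \<Gamma>) permutes H" by (simp add: rg_maps_def permutes_restrict_id)
  show "snd (rg_maps \<Gamma>) (snd (rg_maps \<Gamma>) h) = h" for h using opp by (cases "h \<in> H") (simp_all add: rg_maps_def)
  show "(snd (rg_maps \<Gamma>) h \<noteq> h) = True" if "h \<in> H" for h using that opp by (simp add: rg_maps_def)
qed

text \<open>Connectedness of the graph is a statement about vertices. A stable set contains all
  half-edges at a vertex as soon as it contains one, and passes on along edges.\<close>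

lemma rg_maps_conn: "rg_maps \<Gamma> \<in> conn_maps True H"
proof -
  have "K = H" if K: "K \<subseteq> H" "K \<noteq> {}" "stable (rg_maps \<Gamma>) K" for K
  proof -
    have st: "nxt k \<in> K" "opp k \<in> K" if "k \<in> K" for k
    proof -
      have "k \<in> H" using that K(1) by blast
      then show "nxt k \<in> K" "opp k \<in> K"
        using K(3) that rg_maps_apply[of k \<Gamma>] by (auto simp: stable_def image_subset_iff)
    qed
    have inc: "rg_incident \<Gamma> (vert k) \<subseteq> K" if "k \<in> K" for k
    proof
      fix x assume "x \<in> rg_incident \<Gamma> (vert k)"
      then have "x \<in> orbit nxt k" using incident_vert[of k] that K(1) by auto
      then show "x \<in> K" by induction (use st that in auto)
    qed
    obtain a where a: "a \<in> K" using K(2) by blast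
    have "x \<in> K" if x: "x \<in> H" for x
    proof -
      have "(vert a, vert x) \<in> {(vert h, vert (opp h)) | h. h \<in> H}\<^sup>*"
        using conn vert a x K(1) unfolding rg_connected_def by blast
      then have "rg_incident \<Gamma> (vert x) \<subseteq> K"
      proof (induction rule: rtrancl_induct)
        case base show ?case by (rule inc[OF a])
      next
        case (step u w)
        then obtain h where h: "h \<in> H" "u = vert h" "w = vert (opp h)" by auto
        then have "h \<in> K" using step.IH by (auto simp: rg_incident_def)
        then show ?case using inc[OF st(2)] h(3) by simp
      qed
      then show ?thesis using x by (auto simp: rg_incident_def)
    qed
    then show ?thesis using K(1) by blast
  qed
  moreover have "H \<noteq> {}" using conn vert_image by (auto simp: rg_connected_def)
  ultimately show ?thesis using rg_maps_in by (auto simp: conn_maps_def)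
qed

lemma cycle_type_rg_maps: "Poly_Mapping.lookup (cycle_type H (fst (rg_maps \<Gamma>))) j = rg_num_verts \<Gamma> j"
proof -
  have o: "orbit (fst (rg_maps \<Gamma>)) h = rg_incident \<Gamma> (vert h)" if "h \<in> H" for h
    unfolding incident_vert[OF that]
    by (rule orbit_cong0[OF that]) (use nxt rg_maps_apply(1)[of _ \<Gamma>] in auto)
  have "orbit (fst (rg_maps \<Gamma>)) ` H = rg_incident \<Gamma> ` rg_verts \<Gamma>"
    using o by (auto simp: vert_image[symmetric] image_image)
  then have "{C \<in> orbit (fst (rg_maps \<Gamma>)) ` H. card C = j} = rg_incident \<Gamma> ` {v \<in> rg_verts \<Gamma>. rg_valence \<Gamma> v = j}"
    by (auto simp: rg_valence_def)
  moreover have "inj_on (rg_incident \<Gamma>) {v \<in> rg_verts \<Gamma>. rg_valence \<Gamma> v = j}"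
  proof (rule inj_onI)
    fix u v assume "u \<in> {v \<in> rg_verts \<Gamma>. rg_valence \<Gamma> v = j}" and eq: "rg_incident \<Gamma> u = rg_incident \<Gamma> v"
    then obtain h where "h \<in> rg_incident \<Gamma> u" using incident by blast
    then show "u = v" using eq by (auto simp: rg_incident_def)
  qed
  ultimately show ?thesis using finite_H by (simp add: lookup_cycle_type rg_num_verts_def card_image)
qed

lemma card_halves: "card H = 2 * card (rg_edges \<Gamma>)"
proof -
  have "card H = (\<Sum>e\<in>rg_edges \<Gamma>. \<Sum>h\<in>{h \<in> H. {h, opp h} = e}. 1)"
    using sum.group[of H "rg_edges \<Gamma>" "\<lambda>h. {h, opp h}" "\<lambda>_. 1 :: nat"] finite_H by (simp add: rg_edges_def)
  also have "\<dots> = (\<Sum>e\<in>rg_edges \<Gamma>. 2)"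
  proof (rule sum.cong[OF refl])
    fix e assume "e \<in> rg_edges \<Gamma>"
    then obtain k where k: "k \<in> H" "e = {k, opp k}" by (auto simp: rg_edges_def)
    have "{h \<in> H. {h, opp h} = e} = {k, opp k}" using k opp[OF k(1)] by (auto simp: doubleton_eq_iff)
    then show "(\<Sum>h\<in>{h \<in> H. {h, opp h} = e}. 1) = (2 :: nat)" using opp(2)[OF k(1)] by simp
  qed
  finally show ?thesis by simp
qed

end

text \<open>The vertices carry no information beyond the half-edges, since none of them is isolated.\<close>

lemma rg_is_iso_of_halves:
  assumes \<Gamma>: "rgraph \<Gamma>" and \<Delta>: "rgraph \<Delta>" and g: "bij_betw g (rg_halves \<Gamma>) (rg_halves \<Delta>)"
    and comm: "\<And>h. h \<in> rg_halves \<Gamma> \<Longrightarrow> rg_next \<Delta> (g h) = g (rg_next \<Gamma> h)"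
      "\<And>h. h \<in> rg_halves \<Gamma> \<Longrightarrow> rg_opp \<Delta> (g h) = g (rg_opp \<Gamma> h)"
  shows "\<exists>f. rg_is_iso f g \<Gamma> \<Delta>"
proof -
  interpret A: rgraph \<Gamma> by fact
  interpret B: rgraph \<Delta> by fact
  have inj: "inj_on g A.H" and im: "g ` A.H = B.H" using g by (auto simp: bij_betw_def)
  have gB: "g h \<in> B.H" if "h \<in> A.H" for h using that im by blast
  have same: "B.vert (g h) = B.vert (g k) \<longleftrightarrow> A.vert h = A.vert k" if h: "h \<in> A.H" and k: "k \<in> A.H" for h k
  proof -
    have it: "(B.nxt ^^ n) (g h) = g ((A.nxt ^^ n) h) \<and> (A.nxt ^^ n) h \<in> A.H" for n
      by (induction n) (use h comm(1) A.nxt(1) in auto)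
    then have o: "orbit B.nxt (g h) = g ` orbit A.nxt h" unfolding orbit_altdef by auto
    have sub: "orbit A.nxt h \<subseteq> A.H" unfolding orbit_altdef using it by auto
    show ?thesis unfolding B.vert_eq_iff[OF gB[OF h] gB[OF k]] A.vert_eq_iff[OF h k] o
      by (rule inj_on_image_mem_iff[OF inj k sub])
  qed
  \<comment> \<open>The image of a vertex is found from any of its half-edges; \<open>same\<close>
    makes the choice immaterial.\<close>
  define f where "f = (\<lambda>v. B.vert (g (SOME h. h \<in> A.H \<and> A.vert h = v)))"
  have f: "f (A.vert h) = B.vert (g h)" if h: "h \<in> A.H" for h
  proof -
    have "\<exists>k. k \<in> A.H \<and> A.vert k = A.vert h" using h by blast
    from someI_ex[OF this] show ?thesis unfolding f_def using same[OF _ h] by blast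
  qed
  have "f ` rg_verts \<Gamma> = rg_verts \<Delta>"
  proof -
    have "f ` A.vert ` A.H = B.vert ` g ` A.H" unfolding image_image by (rule image_cong[OF refl f])
    then show ?thesis unfolding im A.vert_image B.vert_image .
  qed
  moreover have "inj_on f (rg_verts \<Gamma>)"
    unfolding A.vert_image[symmetric] by (rule inj_onI) (use f same in auto)
  ultimately have "rg_is_iso f g \<Gamma> \<Delta>" using g f comm by (simp add: rg_is_iso_def bij_betw_def)
  then show ?thesis by blast
qed

lemma (in rgraph) rg_aut_eq: "rg_aut \<Gamma> = autos H (rg_maps \<Gamma>)"
proof (intro equalityI subsetI)
  fix g assume "g \<in> rg_aut \<Gamma>"
  then obtain f where g: "g permutes H" and iso: "rg_is_iso f g \<Gamma> \<Gamma>" by (auto simp: rg_aut_def)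
  have "g h \<in> H" if "h \<in> H" for h using that permutes_in_image[OF g] by simp
  then show "g \<in> autos H (rg_maps \<Gamma>)" using g iso by (simp add: autos_def rg_is_iso_def rg_maps_apply)
next
  fix g assume g: "g \<in> autos H (rg_maps \<Gamma>)"
  then have p: "g permutes H" by (simp add: autos_def)
  have gH: "g h \<in> H" if "h \<in> H" for h using that permutes_in_image[OF p] by simp
  have "\<exists>f. rg_is_iso f g \<Gamma> \<Gamma>"
    by (rule rg_is_iso_of_halves[OF _ _ permutes_imp_bij[OF p]])
      (use g gH in \<open>auto simp: autos_def rg_maps_apply intro: rgraph_axioms\<close>)
  then show "g \<in> rg_aut \<Gamma>" using p by (simp add: rg_aut_def)
qed

text \<open>A vertex of valence at least 3 has an incident half-edge.\<close>

lemma admissible_rgraph: "\<Gamma> \<in> admissible_graphs \<Longrightarrow> rgraph \<Gamma>"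
  by unfold_locales (force simp: admissible_graphs_def rg_valence_def)+

text \<open>A cycle of the first permutation is encoded as a vertex by its least element.\<close>

definition rg_of_maps :: "nat set \<Rightarrow> (nat \<Rightarrow> nat) \<times> (nat \<Rightarrow> nat) \<Rightarrow> (nat, nat) ribbon_graph" where
  "rg_of_maps K t = \<lparr>rg_verts = (\<lambda>h. Min (orbit (fst t) h)) ` K, rg_halves = K,
     rg_vert = (\<lambda>h. Min (orbit (fst t) h)), rg_opp = snd t, rg_next = fst t\<rparr>"

lemma rg_of_maps_admissible:
  assumes K: "finite K" and t: "t \<in> conn_maps True K" and keys: "Poly_Mapping.keys (cycle_type K (fst t)) \<subseteq> {3..}"
  shows "rg_of_maps K t \<in> admissible_graphs"
proof -
  let ?\<Gamma> = "rg_of_maps K t" and ?v = "\<lambda>h. Min (orbit (fst t) h)"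
  note tm = conn_maps_subset[OF t]
  note o = permutes_orbit[OF mapsD(1)[OF tm] K]
  have tK: "fst t h \<in> K" "snd t h \<in> K" if "h \<in> K" for h
    using that permutes_in_image[OF mapsD(1)[OF tm]] permutes_in_image[OF mapsD(2)[OF tm]] by auto
  have sub: "orbit (fst t) h \<subseteq> K" if "h \<in> K" for h using permutes_orbit_subset[OF mapsD(1)[OF tm] that] .
  have min: "?v h \<in> orbit (fst t) h" if "h \<in> K" for h
    using sub[OF that] K o(1)[of h] finite_subset by (intro Min_in) auto
  have inc: "rg_incident ?\<Gamma> (?v h) = orbit (fst t) h" if h: "h \<in> K" for h
  proof (intro equalityI subsetI)
    fix k assume "k \<in> rg_incident ?\<Gamma> (?v h)"
    then have k: "k \<in> K" "?v k = ?v h" by (auto simp: rg_incident_def rg_of_maps_def)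
    have "orbit (fst t) k = orbit (fst t) (?v k)" by (rule o(2)[OF min[OF k(1)], symmetric])
    also have "\<dots> = orbit (fst t) h" unfolding k(2) by (rule o(2)[OF min[OF h]])
    finally show "k \<in> orbit (fst t) h" using o(1)[of k] by (simp only:)
  next
    fix k assume "k \<in> orbit (fst t) h"
    then show "k \<in> rg_incident ?\<Gamma> (?v h)" using o(2)[of k h] sub[OF h] by (auto simp: rg_incident_def rg_of_maps_def)
  qed
  have cyc: "cyclic_on (fst t) (orbit (fst t) h)" for h by (rule cyclic_on_orbit[OF mapsD(1)[OF tm] K])
  have "ribbon_graph ?\<Gamma>"
    unfolding ribbon_graph_def
  proof (intro conjI ballI)
    fix v assume "v \<in> rg_verts ?\<Gamma>"
    then obtain h where "h \<in> K" "v = ?v h" by (auto simp: rg_of_maps_def)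
    then show "rg_incident ?\<Gamma> v = {} \<or> cyclic_on (rg_next ?\<Gamma>) (rg_incident ?\<Gamma> v)"
      using inc cyc by (simp add: rg_of_maps_def)
  qed (use K tK mapsD(3,4)[OF tm] in \<open>auto simp: rg_of_maps_def\<close>)
  moreover have "rg_connected ?\<Gamma>"
    unfolding rg_connected_def
  proof (intro conjI ballI)
    show "rg_verts ?\<Gamma> \<noteq> {}" using t by (simp add: rg_of_maps_def conn_maps_def)
    fix u v assume "u \<in> rg_verts ?\<Gamma>" "v \<in> rg_verts ?\<Gamma>"
    then obtain a b where ab: "a \<in> K" "b \<in> K" "u = ?v a" "v = ?v b" by (auto simp: rg_of_maps_def)
    let ?R = "{(rg_vert ?\<Gamma> h, rg_vert ?\<Gamma> (rg_opp ?\<Gamma> h)) | h. h \<in> rg_halves ?\<Gamma>}"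
    \<comment> \<open>The half-edges at vertices that can be reached from \<open>a\<close>. They
      form a stable set, so connectedness of the pair makes it everything.\<close>
    let ?L = "{k \<in> K. (?v a, ?v k) \<in> ?R\<^sup>*}"
    have "stable t ?L" unfolding stable_def
    proof (intro conjI image_subsetI)
      fix k assume k: "k \<in> ?L"
      have "?v (fst t k) = ?v k" using o(2)[OF orbit.base[of "fst t" k]] by simp
      then show "fst t k \<in> ?L" using k tK by simp
      have "(?v k, ?v (snd t k)) \<in> ?R" using k by (auto simp: rg_of_maps_def)
      then show "snd t k \<in> ?L" using k tK by (auto intro: rtrancl_into_rtrancl)
    qed
    moreover have "?L \<noteq> {}" using ab(1) by blast
    moreover have "L = K" if "L \<subseteq> K" "L \<noteq> {}" "stable t L" for L using t that unfolding conn_maps_def by blast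
    ultimately have "?L = K" by (metis (no_types, lifting) mem_Collect_eq subsetI)
    then have "b \<in> ?L" using ab(2) by (simp only:)
    then show "(u, v) \<in> ?R\<^sup>*" unfolding ab(3,4) by (simp only: mem_Collect_eq)
  qed
  moreover have "rg_valence ?\<Gamma> v \<ge> 3" if v: "v \<in> rg_verts ?\<Gamma>" for v
  proof -
    obtain h where h: "h \<in> K" "v = ?v h" using v by (auto simp: rg_of_maps_def)
    have val: "rg_valence ?\<Gamma> v = card (orbit (fst t) h)" using inc[OF h(1)] h(2) by (simp add: rg_valence_def)
    have "finite {C \<in> orbit (fst t) ` K. card C = card (orbit (fst t) h)}" using K by simp
    moreover have "orbit (fst t) h \<in> {C \<in> orbit (fst t) ` K. card C = card (orbit (fst t) h)}" using h by simp
    ultimately have "card {C \<in> orbit (fst t) ` K. card C = card (orbit (fst t) h)} \<noteq> 0" by (metis card_0_eq empty_iff)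
    then have "card (orbit (fst t) h) \<in> Poly_Mapping.keys (cycle_type K (fst t))"
      by (simp add: in_keys_iff lookup_cycle_type[OF K])
    then show ?thesis using keys val by auto
  qed
  ultimately show ?thesis by (simp add: admissible_graphs_def)
qed

text \<open>The graph built from \<open>t\<close> is isomorphic to the representative of its class,
  and the half-edge part of such an isomorphism numbers the representative.\<close>

lemma rg_of_maps_represented:
  assumes K: "finite (K :: nat set)" and t: "t \<in> conn_maps True K" and keys: "Poly_Mapping.keys (cycle_type K (fst t)) \<subseteq> {3..}"
  obtains \<Gamma> where "\<Gamma> \<in> admissible_reps" "isos (rg_halves \<Gamma>) (rg_maps \<Gamma>) K t \<noteq> {}"
proof -
  let ?\<Delta> = "rg_of_maps K t"
  let ?C = "admissible_iso `` {?\<Delta>}"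
  have \<Delta>: "?\<Delta> \<in> admissible_graphs" by (rule rg_of_maps_admissible[OF assms])
  have C: "?C \<in> admissible_graphs // admissible_iso" using \<Delta> by (rule quotientI)
  define \<Gamma> where "\<Gamma> = (SOME \<Gamma>. \<Gamma> \<in> ?C)"
  have "\<Gamma> \<in> ?C" unfolding \<Gamma>_def some_in_eq by (rule in_quotient_imp_non_empty[OF equiv_admissible_iso C])
  then obtain f g where \<Gamma>: "\<Gamma> \<in> admissible_graphs" and fg: "rg_is_iso f g ?\<Delta> \<Gamma>" by (auto simp: admissible_iso_def)
  have rep: "\<Gamma> \<in> admissible_reps" unfolding admissible_reps_def using C \<Gamma>_def by blast
  interpret rgraph \<Gamma> by (rule admissible_rgraph[OF \<Gamma>])
  have "ribbon_graph ?\<Delta>" using \<Delta> by (simp add: admissible_graphs_def)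
  from rg_is_iso_inv[OF this fg] obtain f' g' where iso: "rg_is_iso f' g' \<Gamma> ?\<Delta>" by blast
  have hK: "rg_halves ?\<Delta> = K" by (simp add: rg_of_maps_def)
  have g': "bij_betw g' H K" using iso by (simp add: rg_is_iso_def hK)
  then have "bij_betw (restrict g' H) H K" by (rule bij_betw_cong[THEN iffD1, rotated]) simp
  moreover have "restrict g' H \<in> H \<rightarrow>\<^sub>E K" using bij_betw_apply[OF g'] by auto
  moreover have "fst t (g' h) = g' (nxt h)" "snd t (g' h) = g' (opp h)" if "h \<in> H" for h
    using iso that by (auto simp: rg_is_iso_def rg_of_maps_def)
  ultimately have "restrict g' H \<in> isos H (rg_maps \<Gamma>) K t"
    using nxt opp by (simp add: isos_def rg_maps_apply)
  then show ?thesis using that rep by blast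
qed

text \<open>Two numberings with the same result compose to an isomorphism of graphs, and isomorphic
  representatives are equal.\<close>

lemma isos_unique:
  assumes \<Gamma>: "\<Gamma> \<in> admissible_reps" "isos (rg_halves \<Gamma>) (rg_maps \<Gamma>) K t \<noteq> {}"
    and \<Delta>: "\<Delta> \<in> admissible_reps" "isos (rg_halves \<Delta>) (rg_maps \<Delta>) K t \<noteq> {}"
  shows "\<Gamma> = \<Delta>"
proof -
  have adm: "\<Gamma> \<in> admissible_graphs" "\<Delta> \<in> admissible_graphs" using \<Gamma>(1) \<Delta>(1) admissible_reps_subset by auto
  interpret A: rgraph \<Gamma> by (rule admissible_rgraph[OF adm(1)])
  interpret B: rgraph \<Delta> by (rule admissible_rgraph[OF adm(2)])
  obtain \<beta> \<gamma> where \<beta>: "\<beta> \<in> isos A.H (rg_maps \<Gamma>) K t" and \<gamma>: "\<gamma> \<in> isos B.H (rg_maps \<Delta>) K t"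
    using \<Gamma>(2) \<Delta>(2) by blast
  let ?i = "inv_into B.H \<gamma>"
  have bb: "bij_betw \<beta> A.H K" and bg: "bij_betw \<gamma> B.H K" using \<beta> \<gamma> by (auto simp: isos_def)
  have i: "\<And>k. k \<in> K \<Longrightarrow> ?i k \<in> B.H" "\<And>k. k \<in> K \<Longrightarrow> \<gamma> (?i k) = k" "\<And>h. h \<in> B.H \<Longrightarrow> ?i (\<gamma> h) = h"
    using bij_betw_apply[OF bij_betw_inv_into[OF bg]] bij_betw_inv_into_right[OF bg] bij_betw_inv_into_left[OF bg] by auto
  have "\<exists>f. rg_is_iso f (?i \<circ> \<beta>) \<Gamma> \<Delta>"
  proof (rule rg_is_iso_of_halves[OF A.rgraph_axioms B.rgraph_axioms])
    show "bij_betw (?i \<circ> \<beta>) A.H B.H" using bb bij_betw_inv_into[OF bg] by (rule bij_betw_trans)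
    fix h assume h: "h \<in> A.H"
    let ?k = "?i (\<beta> h)"
    have k: "?k \<in> B.H" "\<gamma> ?k = \<beta> h" using i bij_betw_apply[OF bb h] by auto
    have "\<gamma> (B.nxt ?k) = \<beta> (A.nxt h)" "\<gamma> (B.opp ?k) = \<beta> (A.opp h)"
      using \<beta> \<gamma> h k unfolding isos_def by (auto simp: rg_maps_apply)
    then show "B.nxt ((?i \<circ> \<beta>) h) = (?i \<circ> \<beta>) (A.nxt h)" "B.opp ((?i \<circ> \<beta>) h) = (?i \<circ> \<beta>) (A.opp h)"
      using i(3)[OF B.nxt(1)[OF k(1)]] i(3)[OF B.opp(1)[OF k(1)]] by simp_all
  qed
  then have "(\<Gamma>, \<Delta>) \<in> admissible_iso" using adm by (auto simp: admissible_iso_def)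
  then show ?thesis by (rule admissible_reps_iso_eq[OF \<Gamma>(1) \<Delta>(1)])
qed

text \<open>The product of edge weights vanishes unless the labelling is flat. Otherwise each
  half-edge contributes the inverse square root of the group order, hence each edge the inverse of
  the order.\<close>

lemma (in finite_group) local_weight_rg_maps:
  assumes "rgraph \<Delta>"
  shows "local_weight edge_weight (carrier G) (rg_halves \<Delta>) (rg_maps \<Delta>) =
    of_nat N powi (rg_euler_char \<Delta> - 1) * of_nat (num_homs (rg_pi1 \<Delta>) G)"
proof -
  interpret R: rgraph \<Delta> by fact
  interpret RG: rgraph_group \<Delta> G by unfold_locales (rule finite_carrier)
  let ?r = "1 / complex_of_real (sqrt (real N))"
  have prod_if: "(\<Prod>h\<in>S. if P h then c else 0) = (if \<forall>h\<in>S. P h then c ^ card S else 0)"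
    if "finite S" for S :: "'c set" and P and c :: complex
    using that by (induction S rule: finite_induct) auto
  have p: "(\<Prod>h\<in>R.H. edge_weight (B (fst (rg_maps \<Delta>) h)) (B h) (B (fst (rg_maps \<Delta>) (snd (rg_maps \<Delta>) h))) (B (snd (rg_maps \<Delta>) h))) =
      (if B \<in> flat_labels G R.H R.nxt R.opp then ?r ^ card R.H else 0)" if "B \<in> R.H \<rightarrow>\<^sub>E carrier G" for B
    unfolding edge_weight_def prod_if[OF R.finite_H] using that R.opp(1)
    by (auto simp: flat_labels_def rg_maps_apply)
  have "local_weight edge_weight (carrier G) R.H (rg_maps \<Delta>) =
      (\<Sum>B\<in>R.H \<rightarrow>\<^sub>E carrier G. if B \<in> flat_labels G R.H R.nxt R.opp then ?r ^ card R.H else 0)"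
    unfolding local_weight_def by (rule sum.cong[OF refl p])
  also have "\<dots> = (\<Sum>B\<in>{B \<in> R.H \<rightarrow>\<^sub>E carrier G. B \<in> flat_labels G R.H R.nxt R.opp}. ?r ^ card R.H)"
    using R.finite_H finite_carrier by (intro sum.inter_filter[symmetric] finite_PiE) auto
  also have "{B \<in> R.H \<rightarrow>\<^sub>E carrier G. B \<in> flat_labels G R.H R.nxt R.opp} = flat_labels G R.H R.nxt R.opp"
    by (auto simp: flat_labels_def)
  also have "?r ^ card R.H = 1 / of_nat N ^ card (rg_edges \<Delta>)"
  proof -
    have "complex_of_real (sqrt (real N)) ^ 2 = of_nat N" by (simp flip: of_real_power)
    then show ?thesis by (simp add: R.card_halves power_mult power_divide)
  qed
  finally show ?thesis using RG.ribbon_weight by simp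
qed

lemma ribbon_series_unsupported:
  assumes "\<not> Poly_Mapping.keys v \<subseteq> {3..}"
  shows "ribbon_series G v = 0"
proof -
  obtain j where "j \<in> Poly_Mapping.keys v" "j \<notin> {3..}" using assms by blast
  then have j: "Poly_Mapping.lookup v j \<noteq> 0" "j < 3" by (auto simp: in_keys_iff)
  have none: "rg_num_verts \<Gamma> j = 0" if "\<Gamma> \<in> admissible_reps" for \<Gamma>
  proof -
    have "\<Gamma> \<in> admissible_graphs" using that admissible_reps_subset by blast
    then have "{u \<in> rg_verts \<Gamma>. rg_valence \<Gamma> u = j} = {}" using j(2) by (fastforce simp: admissible_graphs_def)
    then show ?thesis unfolding rg_num_verts_def by (simp only: card.empty)
  qed
  have "\<not> (\<forall>j. rg_num_verts \<Gamma> j = Poly_Mapping.lookup v j)" if "\<Gamma> \<in> admissible_reps" for \<Gamma>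
    using none[OF that] j(1) by metis
  then have "{\<Gamma> \<in> admissible_reps. \<forall>j. rg_num_verts \<Gamma> j = Poly_Mapping.lookup v j} = {}" by blast
  then show ?thesis unfolding ribbon_series_def by (simp only: sum.empty)
qed

text \<open>Each numbering of the half-edges of a graph gives one connected pair, and each connected pair \<open>t\<close>
  arises from a single graph, as often as the graph has automorphisms.\<close>

lemma (in finite_group) ribbon_series_eq:
  assumes keys: "Poly_Mapping.keys v \<subseteq> {3..}"
  shows "ribbon_series G v = map_weight.conn_egf True (local_weight edge_weight (carrier G)) v"
proof -
  let ?w = "local_weight edge_weight (carrier G) :: nat set \<Rightarrow> _"
  interpret E: map_weight True ?w by (rule map_weight_local[OF finite_carrier])
  define n where "n = mono_degree v"
  let ?K = "{..<n}"
  let ?I = "{\<Gamma> \<in> admissible_reps. \<forall>j. rg_num_verts \<Gamma> j = Poly_Mapping.lookup v j}"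
  let ?S = "{t \<in> conn_maps True ?K. cycle_type ?K (fst t) = v}"
  let ?iso = "\<lambda>\<Gamma> t. isos (rg_halves \<Gamma>) (rg_maps \<Gamma>) ?K t"
  let ?X = "\<lambda>\<Gamma>. of_nat N powi (rg_euler_char \<Gamma> - 1) * of_nat (num_homs (rg_pi1 \<Gamma>) G) :: complex"
  have fS: "finite ?S" by (rule finite_subset[OF _ finite_maps[of ?K True]]) (auto dest: conn_maps_subset)
  have rg: "rgraph \<Gamma>" if "\<Gamma> \<in> ?I" for \<Gamma> using that admissible_reps_subset admissible_rgraph by blast
  have type: "cycle_type (rg_halves \<Gamma>) (fst (rg_maps \<Gamma>)) = v" if "\<Gamma> \<in> ?I" for \<Gamma>
    using that rgraph.cycle_type_rg_maps[OF rg[OF that]] by (intro poly_mapping_eqI) simp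
  have count: "(\<Sum>t\<in>?S. card (?iso \<Gamma> t)) = fact n" if \<Gamma>: "\<Gamma> \<in> ?I" for \<Gamma>
  proof -
    interpret R: rgraph \<Gamma> by (rule rg[OF \<Gamma>])
    have "card R.H = n" using mono_degree_cycle_type[OF mapsD(1)[OF R.rg_maps_in] R.finite_H] type[OF \<Gamma>] by (simp add: n_def)
    then show ?thesis using sum_card_isos[OF R.rg_maps_conn R.finite_H, of ?K] type[OF \<Gamma>] by simp
  qed
  \<comment> \<open>If \<open>t\<close> is a numbering of the graph, the isomorphisms are as many as
    the automorphisms and cancel them; the weight is invariant under relabelling.\<close>
  have summand: "?X \<Gamma> / of_nat (card (rg_aut \<Gamma>)) * of_nat (card (?iso \<Gamma> t)) = (if ?iso \<Gamma> t \<noteq> {} then ?w ?K t else 0)"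
    if \<Gamma>: "\<Gamma> \<in> ?I" and t: "t \<in> ?S" for \<Gamma> t
  proof (cases "?iso \<Gamma> t = {}")
    case False
    then obtain \<beta> where \<beta>: "\<beta> \<in> ?iso \<Gamma> t" by blast
    interpret R: rgraph \<Gamma> by (rule rg[OF \<Gamma>])
    have b: "bij_betw \<beta> R.H ?K" "\<beta> \<in> R.H \<rightarrow>\<^sub>E ?K" using \<beta> by (auto simp: isos_def)
    have tm: "t \<in> maps True ?K" using t conn_maps_subset by blast
    have "relabel R.H \<beta> (rg_maps \<Gamma>) = t" using isos_relabel[OF b R.rg_maps_in tm] \<beta> by simp
    then have "?w ?K t = ?X \<Gamma>"
      using local_weight_relabel[OF b(1) R.rg_maps_in, of edge_weight "carrier G"] local_weight_rg_maps[OF rg[OF \<Gamma>]] by simp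
    moreover have "card (?iso \<Gamma> t) = card (rg_aut \<Gamma>)"
      unfolding R.rg_aut_eq by (rule card_isos[OF \<beta>]) (simp_all add: rg_maps_apply R.nxt R.opp)
    moreover have "finite (?iso \<Gamma> t)"
      using R.finite_H by (intro finite_subset[OF _ finite_PiE[of R.H "\<lambda>_. ?K"]]) (auto simp: isos_def)
    then have "card (?iso \<Gamma> t) \<noteq> 0" using False by simp
    ultimately show ?thesis using False by simp
  qed simp
  \<comment> \<open>Exactly one representative underlies \<open>t\<close>, and the cycle type of
    \<open>t\<close> places it in the index set.\<close>
  have unique: "(\<Sum>\<Gamma>\<in>?I. if ?iso \<Gamma> t \<noteq> {} then ?w ?K t else 0) = ?w ?K t" if t: "t \<in> ?S" for t
  proof -
    have tc: "t \<in> conn_maps True ?K" and tv: "cycle_type ?K (fst t) = v" using t by auto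
    have "finite ?K" by simp
    then obtain \<Gamma> where \<Gamma>: "\<Gamma> \<in> admissible_reps" "?iso \<Gamma> t \<noteq> {}"
      by (rule rg_of_maps_represented[OF _ tc, unfolded tv, OF _ keys])
    interpret R: rgraph \<Gamma> using \<Gamma>(1) admissible_reps_subset admissible_rgraph by blast
    obtain \<beta> where \<beta>: "\<beta> \<in> ?iso \<Gamma> t" using \<Gamma>(2) by blast
    have b: "bij_betw \<beta> R.H ?K" "\<beta> \<in> R.H \<rightarrow>\<^sub>E ?K" using \<beta> by (auto simp: isos_def)
    have "relabel R.H \<beta> (rg_maps \<Gamma>) = t" using isos_relabel[OF b R.rg_maps_in conn_maps_subset[OF tc]] \<beta> by simp
    then have "cycle_type R.H (fst (rg_maps \<Gamma>)) = v"
      using cycle_type_relabel[OF b(1) mapsD(1)[OF R.rg_maps_in] R.finite_H] tv by (auto simp: relabel_def)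
    then have \<Gamma>I: "\<Gamma> \<in> ?I" using \<Gamma>(1) R.cycle_type_rg_maps by simp
    have "(\<Sum>\<Gamma>\<in>?I. if ?iso \<Gamma> t \<noteq> {} then ?w ?K t else 0) = (\<Sum>\<Gamma>\<in>{\<Gamma> \<in> ?I. ?iso \<Gamma> t \<noteq> {}}. ?w ?K t)"
      by (rule sum.inter_filter[OF finite_ribbon_series_index, symmetric])
    also have "{\<Gamma> \<in> ?I. ?iso \<Gamma> t \<noteq> {}} = {\<Gamma>}"
      using \<Gamma>I \<Gamma> isos_unique[OF _ _ \<Gamma>] by blast
    finally show ?thesis by simp
  qed
  \<comment> \<open>The factor \<open>fact n\<close> is spread over the pairs \<open>t\<close> by
    \<open>count\<close>; exchanging the two sums then counts pairs instead of graphs.\<close>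
  have "fact n * ribbon_series G v = (\<Sum>\<Gamma>\<in>?I. ?X \<Gamma> / of_nat (card (rg_aut \<Gamma>)) * of_nat (\<Sum>t\<in>?S. card (?iso \<Gamma> t)))"
    unfolding ribbon_series_def sum_distrib_left
  proof (rule sum.cong[OF refl])
    fix \<Gamma> assume "\<Gamma> \<in> ?I"
    from count[OF this] show "fact n * (1 / of_nat (card (rg_aut \<Gamma>)) * of_nat N powi (rg_euler_char \<Gamma> - 1) * of_nat (num_homs (rg_pi1 \<Gamma>) G)) =
        ?X \<Gamma> / of_nat (card (rg_aut \<Gamma>)) * of_nat (\<Sum>t\<in>?S. card (?iso \<Gamma> t))"
      by (simp only: of_nat_fact) simp
  qed
  also have "\<dots> = (\<Sum>\<Gamma>\<in>?I. \<Sum>t\<in>?S. if ?iso \<Gamma> t \<noteq> {} then ?w ?K t else 0)"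
    unfolding of_nat_sum sum_distrib_left by (intro sum.cong refl summand)
  also have "\<dots> = (\<Sum>t\<in>?S. \<Sum>\<Gamma>\<in>?I. if ?iso \<Gamma> t \<noteq> {} then ?w ?K t else 0)" by (rule sum.swap)
  also have "\<dots> = (\<Sum>t\<in>?S. ?w ?K t)" by (rule sum.cong[OF refl unique])
  also have "\<dots> = E.conn_total ?K v"
    unfolding E.conn_total_def
    by (rule sum.inter_filter) (rule finite_subset[OF _ finite_maps[of ?K True]], auto dest: conn_maps_subset)
  finally have "fact n * ribbon_series G v = fact n * E.conn_egf v" by (simp add: E.conn_egf_def n_def)
  then show ?thesis by simp
qed

theorem theorem2p1:
  fixes G :: "('g, 'b) monoid_scheme"
  assumes "group G" and "finite (carrier G)"
  shows "series_log (integral_series G) = ribbon_series G"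
proof -
  interpret group G by fact
  interpret finite_group G by unfold_locales fact
  interpret E: map_weight True "local_weight edge_weight (carrier G)" by (rule map_weight_local[OF finite_carrier])
  have Z0: "integral_series G v = 0" if "\<not> Poly_Mapping.keys v \<subseteq> {3..}" for v
    using that by (simp add: integral_series_def)
  show ?thesis
  proof (rule series_log_eqI)
    show "integral_series G 0 = 1" using integral_series_eq[of 0] E.egf_0 by simp
    show "ribbon_series G 0 = 0" using ribbon_series_eq[of 0] E.conn_egf_0 by simp
    show "integral_series G v = 0" if "\<not> Poly_Mapping.keys v \<subseteq> {3..}" for v using that by (rule Z0)
    show "ribbon_series G v = 0" if "\<not> Poly_Mapping.keys v \<subseteq> {3..}" for v using that by (rule ribbon_series_unsupported)
    show "of_nat (mono_degree v) * integral_series G v =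
        (\<Sum>(a, b) | a + b = v. of_nat (mono_degree a) * ribbon_series G a * integral_series G b)" for v
    \<comment> \<open>The identification with the generating functions holds for monomials in the
      variables from index 3 on. Such a monomial splits only into monomials of the same kind, while
      any other has a part on which one of the factors vanishes.\<close>
    proof (cases "Poly_Mapping.keys v \<subseteq> {3..}")
      case True
      have "(\<Sum>(a, b) | a + b = v. of_nat (mono_degree a) * ribbon_series G a * integral_series G b) =
          (\<Sum>(a, b) | a + b = v. of_nat (mono_degree a) * E.conn_egf a * E.egf b)"
      proof (rule sum.cong[OF refl])
        fix z assume z: "z \<in> {(a, b). a + b = v}"
        obtain a b where ab: "z = (a, b)" by (cases z)
        then have "Poly_Mapping.keys a \<subseteq> {3..}" "Poly_Mapping.keys b \<subseteq> {3..}" using z True keys_add_monomial[of a b] by auto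
        then show "(case z of (a, b) \<Rightarrow> of_nat (mono_degree a) * ribbon_series G a * integral_series G b) =
            (case z of (a, b) \<Rightarrow> of_nat (mono_degree a) * E.conn_egf a * E.egf b)"
          by (simp add: ab integral_series_eq ribbon_series_eq)
      qed
      then show ?thesis using E.egf_recursion[of v] integral_series_eq[OF True] by simp
    next
      case False
      have "(\<Sum>(a, b) | a + b = v. of_nat (mono_degree a) * ribbon_series G a * integral_series G b) = 0"
      proof (intro sum.neutral ballI)
        fix z assume z: "z \<in> {(a, b). a + b = v}"
        obtain a b where ab: "z = (a, b)" by (cases z)
        then have "\<not> Poly_Mapping.keys a \<subseteq> {3..} \<or> \<not> Poly_Mapping.keys b \<subseteq> {3..}"
          using z False keys_add_monomial[of a b] by auto
        then show "(case z of (a, b) \<Rightarrow> of_nat (mono_degree a) * ribbon_series G a * integral_series G b) = 0"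
          using Z0 ribbon_series_unsupported[of _ G] by (auto simp: ab)
      qed
      then show ?thesis using Z0[OF False] by simp
    qed
  qed
qed

end
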